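(* Suppose that $f(X_1,\dots,X_d)\in L^p$ and $\tilde f(X_1,\dots,X_{\tilde d})\in L^p$ for every $p<\infty$, and that $\mu>0$. Then, for both choices of sign $\pm$, as $x\to\infty$, the limits $$\frac{\tilde U_{N_\pm(x)}}{x^{\tilde d/d}}\longrightarrow\frac{\tilde\mu}{\tilde d!}\Bigl(\frac{d!}{\mu}\Bigr)^{\tilde d/d}\ \text{a.s.}\qquad\text{and}\qquad\frac{\tilde U_{N_\pm(x)}-\bigl(\frac{d!}{\mu}\bigr)^{\tilde d/d}\frac{\tilde\mu}{\tilde d!}x^{\tilde d/d}}{x^{\tilde d/d-1/(2d)}}\ \overset{\mathrm d}{\longrightarrow}\ N(0,\gamma^2)$$ hold with convergence of all moments and absolute moments (i.e., every moment of positive integer order and every absolute moment of positive real order of the left-hand side converges to the corresponding moment of the limit), where $$\gamma^2:=\Bigl(\frac{d!}{\mu}\Bigr)^{(2\tilde d-1)/d}\operatorname{Var}\Bigl(\tilde Z_1-\frac{(d-1)!\,\tilde\mu}{(\tilde d-1)!\,\mu}Z_1\Bigr).$$ In particular, as $x\to\infty$, $$\mathbb E\tilde U_{N_\pm(x)}\sim\frac{\tilde\mu}{\tilde d!}\Bigl(\frac{d!}{\mu}\Bigr)^{\tilde d/d}x^{\tilde d/d},\qquad\operatorname{Var}\tilde U_{N_\pm(x)}\sim\gamma^2x^{(2\tilde d-1)/d}.$$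
   Context: $X,X_1,X_2,\dots$ is an i.i.d. sequence of random variables with values in an arbitrary measurable space $(S,\mathcal S)$; $d,\tilde d\ge1$ are fixed integers (possibly different), and $f:S^d\to\mathbb R$, $\tilde f:S^{\tilde d}\to\mathbb R$ are measurable (no symmetry assumed). For $n\ge0$, $$U_n:=\sum_{1\le i_1<\dots<i_d\le n}f(X_{i_1},\dots,X_{i_d}),\qquad \tilde U_n:=\sum_{1\le i_1<\dots<i_{\tilde d}\le n}\tilde f(X_{i_1},\dots,X_{i_{\tilde d}}),$$ $\mu:=\mathbb Ef(X_1,\dots,X_d)$, $\tilde\mu:=\mathbb E\tilde f(X_1,\dots,X_{\tilde d})$. For $x>0$, $N_-(x):=\sup\{n\ge0:U_n\le x\}$ and $N_+(x):=\inf\{n\ge0:U_n>x\}$ (a.s. finite here). Let $f_i(x):=\mathbb Ef(X_1,\dots,X_{i-1},x,X_{i+1},\dots,X_d)-\mu$ for $1\le i\le d$ and $\tilde f_i(x):=\mathbb E\tilde f(X_1,\dots,X_{i-1},x,X_{i+1},\dots,X_{\tilde d})-\tilde\mu$ for $1\le i\le\tilde d$. Let $(W_1,\dots,W_d,\tilde W_1,\dots,\tilde W_{\tilde d})$ be a continuous centered Gaussian process on $[0,\infty)$, starting at $0$, with stationary independent increments and covariances $\operatorname{Cov}(W_i(s),W_j(t))=\operatorname{Cov}(f_i(X),f_j(X))\min(s,t)$, $\operatorname{Cov}(\tilde W_i(s),\tilde W_j(t))=\operatorname{Cov}(\tilde f_i(X),\tilde f_j(X))\min(s,t)$, $\operatorname{Cov}(W_i(s),\tilde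 W_j(t))=\operatorname{Cov}(f_i(X),\tilde f_j(X))\min(s,t)$. With $\psi_{j;d}(s,t):=\frac{1}{(j-1)!\,(d-j)!}s^{j-1}(t-s)^{d-j}$, set $$Z_1:=\sum_{j=1}^d\int_0^1\psi_{j;d}(s,1)\,\mathrm dW_j(s),\qquad\tilde Z_1:=\sum_{j=1}^{\tilde d}\int_0^1\psi_{j;\tilde d}(s,1)\,\mathrm d\tilde W_j(s).$$ $N(0,0)$ is the point mass at $0$. The notation $a(x)\sim c\,b(x)$, with $c$ a constant and $b(x)>0$, means $a(x)/b(x)\to c$ (also when $c=0$). *)

theory Defs
  imports "HOL-Probability.Probability"
begin

section \<open>U-statistics, their projections and first/last passage times\<close>

text \<open>
  A \<open>d\<close>-tuple is an extensional function on \<open>{1..d}\<close>, so \<open>f : S\<^sup>d \<rightarrow> \<real>\<close> is measurable on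
  \<open>PiM {1..d} (\<lambda>_. S)\<close>. The i.i.d. sequence is \<open>X :: nat \<Rightarrow> 'a \<Rightarrow> 's\<close>; \<open>X 0\<close> plays the role of the generic
  variable \<open>X\<close>, and \<open>X 1, X 2, \<dots>\<close> are the variables entering the U-statistics.
\<close>

definition U_stat :: "nat \<Rightarrow> ((nat \<Rightarrow> 's) \<Rightarrow> real) \<Rightarrow> (nat \<Rightarrow> 'a \<Rightarrow> 's) \<Rightarrow> nat \<Rightarrow> 'a \<Rightarrow> real" where
  "U_stat d f X n \<omega> =
     (\<Sum>i\<in>{i \<in> {1..d} \<rightarrow>\<^sub>E {1..n}. strict_mono_on {1..d} i}. f (\<lambda>k\<in>{1..d}. X (i k) \<omega>))"

definition kernel_mean ::
  "'a measure \<Rightarrow> (nat \<Rightarrow> 'a \<Rightarrow> 's) \<Rightarrow> nat \<Rightarrow> ((nat \<Rightarrow> 's) \<Rightarrow> real) \<Rightarrow> real" where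
  "kernel_mean M X d f = (\<integral>\<omega>. f (\<lambda>k\<in>{1..d}. X k \<omega>) \<partial>M)"

definition kernel_proj ::
  "'a measure \<Rightarrow> (nat \<Rightarrow> 'a \<Rightarrow> 's) \<Rightarrow> nat \<Rightarrow> ((nat \<Rightarrow> 's) \<Rightarrow> real) \<Rightarrow> nat \<Rightarrow> 's \<Rightarrow> real" where
  "kernel_proj M X d f i x =
     (\<integral>\<omega>. f (\<lambda>k\<in>{1..d}. if k = i then x else X k \<omega>) \<partial>M) - kernel_mean M X d f"

text \<open>
  Passage times take values in \<open>enat\<close>, so that suprema of unbounded sets and infima of empty sets
  are \<open>\<infinity>\<close>. A process stopped at time \<open>\<infinity>\<close> is given the value \<open>0\<close>.
\<close>

definition N_minus :: "(nat \<Rightarrow> 'a \<Rightarrow> real) \<Rightarrow> real \<Rightarrow> 'a \<Rightarrow> enat" where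
  "N_minus U x \<omega> = Sup {enat n | n. U n \<omega> \<le> x}"

definition N_plus :: "(nat \<Rightarrow> 'a \<Rightarrow> real) \<Rightarrow> real \<Rightarrow> 'a \<Rightarrow> enat" where
  "N_plus U x \<omega> = Inf {enat n | n. U n \<omega> > x}"

definition stopped :: "(nat \<Rightarrow> 'a \<Rightarrow> real) \<Rightarrow> ('a \<Rightarrow> enat) \<Rightarrow> 'a \<Rightarrow> real" where
  "stopped U T \<omega> = (case T \<omega> of enat n \<Rightarrow> U n \<omega> | \<infinity> \<Rightarrow> 0)"


section \<open>Covariance, normal laws, modes of convergence\<close>

definition cov :: "'a measure \<Rightarrow> ('a \<Rightarrow> real) \<Rightarrow> ('a \<Rightarrow> real) \<Rightarrow> real" where
  "cov M Y Z = (\<integral>\<omega>. (Y \<omega> - (\<integral>\<omega>'. Y \<omega>' \<partial>M)) * (Z \<omega> - (\<integral>\<omega>'. Z \<omega>' \<partial>M)) \<partial>M)"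

text \<open>The second parameter is the variance; variance \<open>0\<close> gives a point mass.\<close>

definition normal_law :: "real \<Rightarrow> real \<Rightarrow> real measure" where
  "normal_law m v =
     (if v = 0 then return borel m else density lborel (\<lambda>x. ennreal (normal_density m (sqrt v) x)))"

text \<open>
  Convergence in distribution along an arbitrary filter. For \<open>F = sequentially\<close> the second
  conjunct is the library's \<open>weak_conv_m\<close>.
\<close>

definition conv_in_distr ::
  "'a measure \<Rightarrow> ('i \<Rightarrow> 'a \<Rightarrow> real) \<Rightarrow> 'i filter \<Rightarrow> real measure \<Rightarrow> bool" where
  "conv_in_distr M Y F \<nu> \<longleftrightarrow>
     (\<forall>\<^sub>F x in F. Y x \<in> borel_measurable M) \<and>
     (\<forall>z. isCont (cdf \<nu>) z \<longrightarrow> ((\<lambda>x. cdf (distr M borel (Y x)) z) \<longlongrightarrow> cdf \<nu> z) F)"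

text \<open>
  Integrability is demanded explicitly, since the Bochner integral of a non-integrable function
  is \<open>0\<close>.
\<close>

definition moments_converge ::
  "'a measure \<Rightarrow> ('i \<Rightarrow> 'a \<Rightarrow> real) \<Rightarrow> 'i filter \<Rightarrow> real measure \<Rightarrow> bool" where
  "moments_converge M Y F \<nu> \<longleftrightarrow>
     (\<forall>k::nat. k \<ge> 1 \<longrightarrow>
        integrable \<nu> (\<lambda>z. z ^ k) \<and>
        (\<forall>\<^sub>F x in F. integrable M (\<lambda>\<omega>. Y x \<omega> ^ k)) \<and>
        ((\<lambda>x. \<integral>\<omega>. Y x \<omega> ^ k \<partial>M) \<longlongrightarrow> (\<integral>z. z ^ k \<partial>\<nu>)) F) \<and>
     (\<forall>r::real. r > 0 \<longrightarrow>
        integrable \<nu> (\<lambda>z. \<bar>z\<bar> powr r) \<and>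
        (\<forall>\<^sub>F x in F. integrable M (\<lambda>\<omega>. \<bar>Y x \<omega>\<bar> powr r)) \<and>
        ((\<lambda>x. \<integral>\<omega>. \<bar>Y x \<omega>\<bar> powr r \<partial>M) \<longlongrightarrow> (\<integral>z. \<bar>z\<bar> powr r \<partial>\<nu>)) F)"


section \<open>Gaussian processes and Wiener integrals\<close>

text \<open>A family is Gaussian if all its finite linear combinations are (possibly degenerate) normal.\<close>

definition gaussian_family :: "'b measure \<Rightarrow> 'i set \<Rightarrow> ('i \<Rightarrow> 'b \<Rightarrow> real) \<Rightarrow> bool" where
  "gaussian_family P I Y \<longleftrightarrow>
     (\<forall>i\<in>I. Y i \<in> borel_measurable P) \<and>
     (\<forall>J (c :: 'i \<Rightarrow> real). finite J \<and> J \<subseteq> I \<longrightarrow>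
        (\<exists>m v. v \<ge> 0 \<and> distr P borel (\<lambda>\<omega>. \<Sum>i\<in>J. c i * Y i \<omega>) = normal_law m v))"

text \<open>
  \<open>V k t\<close> is the \<open>k\<close>-th coordinate at time \<open>t\<close> of a process with values in \<open>\<real>\<^sup>K\<close>; independence and
  stationarity concern the increments of the whole vector.
\<close>

definition independent_increments ::
  "'b measure \<Rightarrow> 'k set \<Rightarrow> ('k \<Rightarrow> real \<Rightarrow> 'b \<Rightarrow> real) \<Rightarrow> bool" where
  "independent_increments P K V \<longleftrightarrow>
     (\<forall>n (t :: nat \<Rightarrow> real). 0 \<le> t 0 \<and> (\<forall>m<n. t m \<le> t (Suc m)) \<longrightarrow>
        prob_space.indep_vars P (\<lambda>_. PiM K (\<lambda>_. borel))
          (\<lambda>m \<omega>. \<lambda>k\<in>K. V k (t (Suc m)) \<omega> - V k (t m) \<omega>) {..<n})"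

definition stationary_increments ::
  "'b measure \<Rightarrow> 'k set \<Rightarrow> ('k \<Rightarrow> real \<Rightarrow> 'b \<Rightarrow> real) \<Rightarrow> bool" where
  "stationary_increments P K V \<longleftrightarrow>
     (\<forall>s\<ge>0. \<forall>h\<ge>0.
        distr P (PiM K (\<lambda>_. borel)) (\<lambda>\<omega>. \<lambda>k\<in>K. V k (s + h) \<omega> - V k s \<omega>) =
        distr P (PiM K (\<lambda>_. borel)) (\<lambda>\<omega>. \<lambda>k\<in>K. V k h \<omega> - V k 0 \<omega>))"

definition centered_gaussian_process ::
  "'b measure \<Rightarrow> 'k set \<Rightarrow> ('k \<Rightarrow> real \<Rightarrow> 'b \<Rightarrow> real) \<Rightarrow> bool" where
  "centered_gaussian_process P K V \<longleftrightarrow>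
     gaussian_family P (K \<times> {0..}) (\<lambda>(k, t). V k t) \<and>
     (\<forall>k\<in>K. \<forall>t\<ge>0. (\<integral>\<omega>. V k t \<omega> \<partial>P) = 0)"

definition continuous_paths_from_0 ::
  "'b measure \<Rightarrow> 'k set \<Rightarrow> ('k \<Rightarrow> real \<Rightarrow> 'b \<Rightarrow> real) \<Rightarrow> bool" where
  "continuous_paths_from_0 P K V \<longleftrightarrow>
     (\<forall>k\<in>K. \<forall>\<omega>\<in>space P. V k 0 \<omega> = 0 \<and> continuous_on {0..} (\<lambda>t. V k t \<omega>))"

text \<open>
  A list of triples \<open>(c, u, v)\<close> represents the step function with value \<open>c\<close> added on each \<open>{u<..v}\<close>;
  the intervals may overlap.
\<close>

definition step_fun :: "(real \<times> real \<times> real) list \<Rightarrow> real \<Rightarrow> real" where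
  "step_fun \<phi> s = (\<Sum>(c, u, v)\<leftarrow>\<phi>. c * indicator {u<..v} s)"

definition step_integral ::
  "(real \<Rightarrow> 'b \<Rightarrow> real) \<Rightarrow> (real \<times> real \<times> real) list \<Rightarrow> 'b \<Rightarrow> real" where
  "step_integral W \<phi> \<omega> = (\<Sum>(c, u, v)\<leftarrow>\<phi>. c * (W v \<omega> - W u \<omega>))"

text \<open>
  The stochastic integral of a deterministic \<open>g \<in> L\<^sup>2[a, b]\<close> against a Brownian motion \<open>W\<close> (with any
  constant variance rate): the \<open>L\<^sup>2(P)\<close>-limit of the elementary integrals of step functions that
  converge to \<open>g\<close> in \<open>L\<^sup>2[a, b]\<close>. By the isometry property it does not depend on the approximating sequence
  and is unique up to \<open>P\<close>-null sets; \<open>wiener_integral\<close> picks a version.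
\<close>

definition has_wiener_integral ::
  "'b measure \<Rightarrow> (real \<Rightarrow> 'b \<Rightarrow> real) \<Rightarrow> real \<Rightarrow> real \<Rightarrow> (real \<Rightarrow> real) \<Rightarrow> ('b \<Rightarrow> real) \<Rightarrow> bool" where
  "has_wiener_integral P W a b g I \<longleftrightarrow>
     I \<in> borel_measurable P \<and>
     (\<exists>\<phi> :: nat \<Rightarrow> (real \<times> real \<times> real) list.
        (\<forall>n. \<forall>(c, u, v)\<in>set (\<phi> n). a \<le> u \<and> u \<le> v \<and> v \<le> b) \<and>
        (\<lambda>n. \<integral>\<^sup>+s\<in>{a..b}. ennreal ((step_fun (\<phi> n) s - g s)\<^sup>2) \<partial>lborel) \<longlonglongrightarrow> 0 \<and>
        (\<lambda>n. \<integral>\<^sup>+\<omega>. ennreal ((step_integral W (\<phi> n) \<omega> - I \<omega>)\<^sup>2) \<partial>P) \<longlonglongrightarrow> 0)"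

definition wiener_integral ::
  "'b measure \<Rightarrow> (real \<Rightarrow> 'b \<Rightarrow> real) \<Rightarrow> real \<Rightarrow> real \<Rightarrow> (real \<Rightarrow> real) \<Rightarrow> 'b \<Rightarrow> real" where
  "wiener_integral P W a b g = (SOME I. has_wiener_integral P W a b g I)"

definition psi :: "nat \<Rightarrow> nat \<Rightarrow> real \<Rightarrow> real \<Rightarrow> real" where
  "psi j d s t = 1 / (fact (j - 1) * fact (d - j)) * s ^ (j - 1) * (t - s) ^ (d - j)"

definition Z_one :: "'b measure \<Rightarrow> nat \<Rightarrow> (nat \<Rightarrow> real \<Rightarrow> 'b \<Rightarrow> real) \<Rightarrow> 'b \<Rightarrow> real" where
  "Z_one P d W \<omega> = (\<Sum>j=1..d. wiener_integral P (W j) 0 1 (\<lambda>s. psi j d s 1) \<omega>)"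

end

theory Submission
  imports Defs
begin

text \<open>
  Write \<open>U\<^sub>n = \<mu> (n choose d) + V\<^sub>n\<close> and let \<open>y = (d! x / \<mu>)\<close> to the power \<open>1/d\<close>, so that \<open>\<mu> y\<^sup>d / d! = x\<close>.
  Splitting the last argument of a kernel into its mean and a degenerate part turns the increments
  of \<open>V\<close> into a U-statistic of order \<open>d - 1\<close> and a martingale, so an induction on the order bounds
  all even moments of \<open>V\<^sub>n - V\<^sub>m\<close>. Summing these bounds over \<open>m \<le> n\<close> yields one random variable \<open>Q\<close>
  with moments of any prescribed order that controls all increments of \<open>V\<close> and \<open>V'\<close> simultaneously.

  Given such a bound, the rest is deterministic: a first-order expansion of \<open>U\<^sub>N \<approx> x\<close> around \<open>N = y\<close> shows that
  the normalised stopped statistic differs from the normalised \<open>V'\<^sub>m - \<kappa> V\<^sub>m\<close> at the nonrandom time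
  \<open>m = \<lfloor>y\<rfloor>\<close>, with \<open>\<kappa> = (d-1)! \<mu>' / ((d'-1)! \<mu>)\<close> and each term in its own normalisation, by at most a power of
  \<open>Q\<close> times a negative power of \<open>y\<close>. This gives the almost sure limit and bounded moments at once.
  The linear Hoeffding projections of \<open>V\<close> and \<open>V'\<close> form a triangular array of independent variables whose
  characteristic function converges; its limiting variance is a sum of integrals of products of the \<open>\<psi>\<close>, which
  the isometry of the Wiener integral identifies with the variance in the definition of \<open>\<gamma>\<^sup>2\<close>.
\<close>

subsection \<open>Even moments\<close>

text \<open>The passage time depends on the same observations as the statistic that it stops, so no
  moment bound at a fixed time applies at \<open>N\<close>; this forces a bound on all increments at
  once. Such a uniform bound loses a factor \<open>n powr e\<close>, and the argument survives only
  for small \<open>e\<close>: \<open>N - y\<close> has order \<open>1/2 + e\<close>, so the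
  increments of \<open>V\<close> between \<open>N\<close> and \<open>y\<close> have order
  \<open>(1/2 + e) / 2 + d - 1 + e\<close>, which lies below the order \<open>d - 1/2\<close> of the
  fluctuations exactly when \<open>e < 1/6\<close>. The choice \<open>e = 1/16\<close> is the origin
  of the fractions below: \<open>15/16 = 1 - e\<close>, \<open>7/16 = 1/2 - e\<close>,
  \<open>21/32 = 3/4 - 3 e / 2\<close>, and \<open>5/32\<close> is what remains to spare. The loss
  would also spoil bounded moments if the pathwise bound were applied to the main term; it is
  applied to the error only, while the main term sits at a nonrandom time and has sharp moments.
  Only even moments are estimated, because even powers are nonnegative and expand by the binomial
  theorem; all other moments are reached by comparison with a higher even one.\<close>

definition lp :: "'a measure \<Rightarrow> nat \<Rightarrow> ('a \<Rightarrow> real) \<Rightarrow> bool" where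
  "lp M p Y \<longleftrightarrow> Y \<in> borel_measurable M \<and> integrable M (\<lambda>\<omega>. Y \<omega> ^ p)"

text \<open>Jensen's inequality with equal weights; the empty sum is separate because the weights
  must add up to \<open>1\<close>.\<close>

lemma sum_power_even_le:
  fixes a :: "'i \<Rightarrow> real"
  assumes "even p" "p > 0" "finite I"
  shows "(\<Sum>i\<in>I. a i) ^ p \<le> real (card I) ^ (p - 1) * (\<Sum>i\<in>I. a i ^ p)"
proof (cases "I = {}")
  case True
  then show ?thesis using assms by (simp add: power_0_left)
next
  case False
  define n where "n = real (card I)"
  have n: "n > 0" using False assms by (simp add: n_def card_gt_0_iff)
  have "(\<Sum>i\<in>I. (1 / n) *\<^sub>R a i) ^ p \<le> (\<Sum>i\<in>I. (1 / n) * a i ^ p)"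
    using convex_on_sum[OF assms(3) _ convex_power_even[OF assms(1)], of "\<lambda>_. 1 / n" a] False n
    by (simp add: n_def)
  hence "((\<Sum>i\<in>I. a i) / n) ^ p \<le> (\<Sum>i\<in>I. a i ^ p) / n"
    by (simp add: sum_divide_distrib)
  hence "(\<Sum>i\<in>I. a i) ^ p \<le> (\<Sum>i\<in>I. a i ^ p) / n * n ^ p"
    using n by (simp add: power_divide divide_simps)
  also have "n ^ p = n ^ (p - 1) * n" using assms power_minus_mult[of p n] by simp
  finally show ?thesis using n by (simp add: n_def mult_ac)
qed

lemma power_even_add_le:
  fixes a b :: real
  assumes "even p"
  shows "(a + b) ^ p \<le> 2 ^ p * (a ^ p + b ^ p)"
proof -
  have "\<bar>a + b\<bar> ^ p \<le> (2 * max \<bar>a\<bar> \<bar>b\<bar>) ^ p" by (intro power_mono) auto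
  also have "\<dots> \<le> 2 ^ p * (\<bar>a\<bar> ^ p + \<bar>b\<bar> ^ p)"
    unfolding power_mult_distrib by (intro mult_left_mono) (auto simp: max_def)
  finally show ?thesis using assms by (simp add: power_even_abs)
qed

text \<open>If \<open>t\<close> is the smaller one, \<open>k - j\<close> of its factors are traded
  for factors \<open>s\<close>; otherwise all factors \<open>s\<close> are traded for
  \<open>t\<close>. With \<open>j = 2\<close> it controls the higher terms of a binomial expansion,
  with \<open>j = 0\<close> the integrability of mixed products.\<close>

lemma abs_power_mult_le:
  fixes s t :: real
  assumes "j \<le> k" "k \<le> p"
  shows "\<bar>s\<bar> ^ (p - k) * \<bar>t\<bar> ^ k \<le> \<bar>s\<bar> ^ (p - j) * \<bar>t\<bar> ^ j + \<bar>t\<bar> ^ p"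
proof (cases "\<bar>t\<bar> \<le> \<bar>s\<bar>")
  case True
  have "\<bar>s\<bar> ^ (p - k) * \<bar>t\<bar> ^ k = \<bar>s\<bar> ^ (p - k) * (\<bar>t\<bar> ^ (k - j) * \<bar>t\<bar> ^ j)"
    using assms by (simp flip: power_add)
  also have "\<dots> \<le> \<bar>s\<bar> ^ (p - k) * (\<bar>s\<bar> ^ (k - j) * \<bar>t\<bar> ^ j)"
    using True by (intro mult_left_mono mult_right_mono power_mono) auto
  also have "\<dots> = \<bar>s\<bar> ^ (p - j) * \<bar>t\<bar> ^ j"
    using assms by (simp flip: power_add add: mult.assoc[symmetric])
  finally show ?thesis by (simp add: add_increasing2)
next
  case False
  have "\<bar>s\<bar> ^ (p - k) * \<bar>t\<bar> ^ k \<le> \<bar>t\<bar> ^ (p - k) * \<bar>t\<bar> ^ k"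
    using False by (intro mult_right_mono power_mono) auto
  also have "\<dots> = \<bar>t\<bar> ^ p" using assms by (simp flip: power_add)
  finally show ?thesis by (simp add: add_increasing)
qed

lemma abs_pow_even: "even p \<Longrightarrow> \<bar>x\<bar> ^ p = x ^ p" for x :: real
  by (rule power_even_abs)

text \<open>The linear term is kept exactly, because its expectation vanishes for martingale
  increments. Every later term is dominated by the quadratic one plus the top one, and the binomial
  coefficients add up to at most \<open>2 ^ p\<close>.\<close>

lemma power_add_taylor_le:
  fixes s t :: real
  assumes "even p" "p \<ge> 2"
  shows "(s + t) ^ p \<le> s ^ p + real p * s ^ (p - 1) * t + 2 ^ p * (s ^ (p - 2) * t\<^sup>2 + t ^ p)"
proof -
  have ev: "even (p - 2)" using assms by auto
  have "(s + t) ^ p = (t + s) ^ p" by (simp add: add.commute)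
  also have "\<dots> = (\<Sum>k\<le>p. real (p choose k) * t ^ k * s ^ (p - k))"
    by (rule binomial_ring)
  also have "{..p} = {0, 1} \<union> {2..p}" using assms by auto
  also have "(\<Sum>k\<in>{0, 1} \<union> {2..p}. real (p choose k) * t ^ k * s ^ (p - k)) =
      s ^ p + real p * s ^ (p - 1) * t + (\<Sum>k=2..p. real (p choose k) * t ^ k * s ^ (p - k))"
    by (subst sum.union_disjoint) auto
  also have "(\<Sum>k=2..p. real (p choose k) * t ^ k * s ^ (p - k)) \<le>
      (\<Sum>k=2..p. real (p choose k) * (s ^ (p - 2) * t\<^sup>2 + t ^ p))"
  proof (rule sum_mono)
    fix k assume k: "k \<in> {2..p}"
    have "real (p choose k) * t ^ k * s ^ (p - k) \<le> real (p choose k) * (\<bar>s\<bar> ^ (p - k) * \<bar>t\<bar> ^ k)"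
      using mult_left_mono[OF abs_ge_self[of "t ^ k * s ^ (p - k)"], of "real (p choose k)"]
      by (simp add: mult.assoc abs_mult power_abs mult.commute[of "\<bar>s\<bar> ^ (p - k)"])
    also have "\<dots> \<le> real (p choose k) * (\<bar>s\<bar> ^ (p - 2) * \<bar>t\<bar> ^ 2 + \<bar>t\<bar> ^ p)"
      using k by (intro mult_left_mono abs_power_mult_le) auto
    also have "\<dots> = real (p choose k) * (s ^ (p - 2) * t\<^sup>2 + t ^ p)"
      using ev assms by (simp add: abs_pow_even)
    finally show "real (p choose k) * t ^ k * s ^ (p - k) \<le> \<dots>" .
  qed
  also have "\<dots> = (\<Sum>k=2..p. real (p choose k)) * (s ^ (p - 2) * t\<^sup>2 + t ^ p)"
    by (simp add: sum_distrib_right)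
  also have "\<dots> \<le> 2 ^ p * (s ^ (p - 2) * t\<^sup>2 + t ^ p)"
  proof (rule mult_right_mono)
    have "(\<Sum>k=2..p. p choose k) \<le> (\<Sum>k\<le>p. p choose k)" by (intro sum_mono2) auto
    also have "\<dots> = 2 ^ p" by (rule choose_row_sum)
    finally have "real (\<Sum>k=2..p. p choose k) \<le> real (2 ^ p)" by (rule of_nat_mono)
    thus "(\<Sum>k=2..p. real (p choose k)) \<le> 2 ^ p" by simp
    show "0 \<le> s ^ (p - 2) * t\<^sup>2 + t ^ p"
      using ev assms by (intro add_nonneg_nonneg mult_nonneg_nonneg zero_le_even_power) auto
  qed
  finally show ?thesis by simp
qed

text \<open>Young's inequality with the threshold at \<open>n * t\<^sup>2 = s\<^sup>2\<close>: the
  coefficient \<open>1 / n\<close> of the power of \<open>s\<close> is small enough to be paid at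
  each of \<open>n\<close> steps.\<close>

lemma young_power_le:
  fixes s t :: real
  assumes "q \<ge> 1" "n \<ge> (1::nat)"
  shows "s ^ (2 * q - 2) * t\<^sup>2 \<le> s ^ (2 * q) / n + n ^ (q - 1) * t ^ (2 * q)"
proof -
  define a b where "a = s\<^sup>2" and "b = t\<^sup>2"
  have ab: "a \<ge> 0" "b \<ge> 0" by (auto simp: a_def b_def)
  have "a ^ (q - 1) * b \<le> a ^ q / n + n ^ (q - 1) * b ^ q"
  proof (cases "n * b \<le> a")
    case True
    have "a ^ (q - 1) * (n * b) \<le> a ^ (q - 1) * a" using True ab by (intro mult_left_mono) auto
    also have "\<dots> = a ^ q" using assms power_minus_mult[of q a] by simp
    finally have "a ^ (q - 1) * b \<le> a ^ q / n" using assms by (simp add: field_simps)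
    thus ?thesis using ab by (simp add: add_increasing2)
  next
    case False
    have "a ^ (q - 1) * b \<le> (n * b) ^ (q - 1) * b"
      using False ab by (intro mult_right_mono power_mono) auto
    also have "\<dots> = n ^ (q - 1) * b ^ q"
      using assms power_minus_mult[of q b] by (simp add: power_mult_distrib mult.assoc)
    finally show ?thesis using ab by (simp add: add_increasing)
  qed
  moreover have "2 * (q - 1) = 2 * q - 2" using assms by simp
  ultimately show ?thesis by (simp add: a_def b_def flip: power_mult)
qed

lemma lpI: "Y \<in> borel_measurable M \<Longrightarrow> integrable M (\<lambda>\<omega>. Y \<omega> ^ p) \<Longrightarrow> lp M p Y"
  by (simp add: lp_def)

lemma lp_measurable [measurable_dest]: "lp M p Y \<Longrightarrow> Y \<in> borel_measurable M"
  by (simp add: lp_def)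

lemma lp_sum:
  assumes "even p" "p > 0" "finite I" "\<And>i. i \<in> I \<Longrightarrow> lp M p (Y i)"
  shows "lp M p (\<lambda>\<omega>. \<Sum>i\<in>I. Y i \<omega>)"
    and "(\<integral>\<omega>. (\<Sum>i\<in>I. Y i \<omega>) ^ p \<partial>M) \<le> real (card I) ^ (p - 1) * (\<Sum>i\<in>I. \<integral>\<omega>. Y i \<omega> ^ p \<partial>M)"
proof -
  note [measurable] = lp_measurable[OF assms(4)]
  have le: "(\<Sum>i\<in>I. Y i \<omega>) ^ p \<le> real (card I) ^ (p - 1) * (\<Sum>i\<in>I. Y i \<omega> ^ p)" for \<omega>
    by (rule sum_power_even_le) fact+
  have i: "integrable M (\<lambda>\<omega>. real (card I) ^ (p - 1) * (\<Sum>i\<in>I. Y i \<omega> ^ p))"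
    using assms(4) by (intro integrable_mult_right Bochner_Integration.integrable_sum) (auto simp: lp_def)
  have i2: "integrable M (\<lambda>\<omega>. (\<Sum>i\<in>I. Y i \<omega>) ^ p)"
  proof (rule Bochner_Integration.integrable_bound[OF i])
    show "AE \<omega> in M. norm ((\<Sum>i\<in>I. Y i \<omega>) ^ p) \<le> norm (real (card I) ^ (p - 1) * (\<Sum>i\<in>I. Y i \<omega> ^ p))"
      using le assms(1) by (intro AE_I2) (auto simp: zero_le_even_power intro: order_trans[OF _ abs_ge_self])
  qed measurable
  show "lp M p (\<lambda>\<omega>. \<Sum>i\<in>I. Y i \<omega>)" using i2 by (intro lpI) auto
  have "(\<integral>\<omega>. (\<Sum>i\<in>I. Y i \<omega>) ^ p \<partial>M) \<le> (\<integral>\<omega>. real (card I) ^ (p - 1) * (\<Sum>i\<in>I. Y i \<omega> ^ p) \<partial>M)"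
    by (intro integral_mono i i2 le)
  also have "\<dots> = real (card I) ^ (p - 1) * (\<Sum>i\<in>I. \<integral>\<omega>. Y i \<omega> ^ p \<partial>M)"
    using assms(4) by (simp add: Bochner_Integration.integral_sum lp_def)
  finally show "(\<integral>\<omega>. (\<Sum>i\<in>I. Y i \<omega>) ^ p \<partial>M) \<le> \<dots>" .
qed

lemma lp_add:
  assumes "even p" "lp M p Y" "lp M p Z"
  shows "lp M p (\<lambda>\<omega>. Y \<omega> + Z \<omega>)"
    and "(\<integral>\<omega>. (Y \<omega> + Z \<omega>) ^ p \<partial>M) \<le> 2 ^ p * ((\<integral>\<omega>. Y \<omega> ^ p \<partial>M) + (\<integral>\<omega>. Z \<omega> ^ p \<partial>M))"
proof -
  note [measurable] = lp_measurable[OF assms(2)] lp_measurable[OF assms(3)]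
  have i: "integrable M (\<lambda>\<omega>. 2 ^ p * (Y \<omega> ^ p + Z \<omega> ^ p))"
    using assms by (auto simp: lp_def)
  have i2: "integrable M (\<lambda>\<omega>. (Y \<omega> + Z \<omega>) ^ p)"
    by (rule Bochner_Integration.integrable_bound[OF i])
       (use power_even_add_le[OF assms(1)] assms(1) in
         \<open>auto simp: zero_le_even_power intro!: AE_I2 intro: order_trans[OF _ abs_ge_self]\<close>)
  show "lp M p (\<lambda>\<omega>. Y \<omega> + Z \<omega>)" using i2 by (intro lpI) auto
  have "(\<integral>\<omega>. (Y \<omega> + Z \<omega>) ^ p \<partial>M) \<le> (\<integral>\<omega>. 2 ^ p * (Y \<omega> ^ p + Z \<omega> ^ p) \<partial>M)"
    by (intro integral_mono i i2 power_even_add_le assms)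
  also have "\<dots> = 2 ^ p * ((\<integral>\<omega>. Y \<omega> ^ p \<partial>M) + (\<integral>\<omega>. Z \<omega> ^ p \<partial>M))"
    using assms by (simp add: lp_def)
  finally show "(\<integral>\<omega>. (Y \<omega> + Z \<omega>) ^ p \<partial>M) \<le> \<dots>" .
qed

lemma lp_cmult: "lp M p Y \<Longrightarrow> lp M p (\<lambda>\<omega>. c * Y \<omega>)"
  unfolding lp_def by (auto simp: power_mult_distrib)

lemma lp_diff:
  assumes "even p" "lp M p Y" "lp M p Z"
  shows "lp M p (\<lambda>\<omega>. Y \<omega> - Z \<omega>)"
    and "(\<integral>\<omega>. (Y \<omega> - Z \<omega>) ^ p \<partial>M) \<le> 2 ^ p * ((\<integral>\<omega>. Y \<omega> ^ p \<partial>M) + (\<integral>\<omega>. Z \<omega> ^ p \<partial>M))"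
  using lp_add[OF assms(1,2) lp_cmult[OF assms(3), of "-1"]] assms(1) by simp_all

lemma lp_integrable_mult:
  assumes "even p" "j \<le> p" "lp M p Y" "lp M p Z"
  shows "integrable M (\<lambda>\<omega>. Y \<omega> ^ (p - j) * Z \<omega> ^ j)"
proof -
  note [measurable] = lp_measurable[OF assms(3)] lp_measurable[OF assms(4)]
  have i: "integrable M (\<lambda>\<omega>. Y \<omega> ^ p + Z \<omega> ^ p)"
    using assms by (auto simp: lp_def)
  show ?thesis
  proof (rule Bochner_Integration.integrable_bound[OF i])
    show "AE \<omega> in M. norm (Y \<omega> ^ (p - j) * Z \<omega> ^ j) \<le> norm (Y \<omega> ^ p + Z \<omega> ^ p)"
      using abs_power_mult_le[of 0 j p] assms(1,2)
      by (intro AE_I2) (auto simp: abs_mult power_abs abs_pow_even intro: order_trans[OF _ abs_ge_self])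
  qed measurable
qed

context prob_space
begin

lemma lp_const: "lp M p (\<lambda>_. c)"
  by (simp add: lp_def)

lemma lp_integrable_lower:
  assumes "even p" "j \<le> p" "lp M p Y"
  shows "integrable M (\<lambda>\<omega>. Y \<omega> ^ j)"
  using lp_integrable_mult[OF assms(1,2) lp_const[of p 1] assms(3)] by simp

lemma lp_lower:
  assumes "even p" "j \<le> p" "lp M p Y"
  shows "lp M j Y"
  using lp_integrable_lower[OF assms] assms(3) by (simp add: lp_def)

lemma lp_integrable:
  assumes "even p" "p > 0" "lp M p Y"
  shows "integrable M Y"
  using lp_integrable_lower[OF assms(1) _ assms(3), of 1] assms(2) by simp

lemma expectation_power_le:
  assumes "even p" "p > 0" "lp M p Y"
  shows "expectation Y ^ p \<le> expectation (\<lambda>\<omega>. Y \<omega> ^ p)"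
  using assms lp_integrable[OF assms]
  by (intro jensens_inequality[where I=UNIV and q="\<lambda>x. x ^ p"] convex_power_even) (auto simp: lp_def)

text \<open>An even power of a martingale, with the sharp order in the number of steps: expanding
  \<open>(S\<^sub>k + \<xi>\<^sub>k)\<^sup>2\<^sup>q\<close> costs a factor \<open>1 + O(1/n)\<close> at each of the \<open>n\<close> steps, hence only a constant in total.\<close>

lemma martingale_moment_le:
  fixes Y \<xi> :: "nat \<Rightarrow> 'a \<Rightarrow> real"
  assumes q: "q \<ge> 1" and p: "p = 2 * q"
    and S0: "\<And>\<omega>. Y 0 \<omega> = 0" and SS: "\<And>k \<omega>. k < n \<Longrightarrow> Y (Suc k) \<omega> = Y k \<omega> + \<xi> k \<omega>"
    and lp: "\<And>k. k < n \<Longrightarrow> lp M p (\<xi> k)"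
    and b: "\<And>k. k < n \<Longrightarrow> expectation (\<lambda>\<omega>. \<xi> k \<omega> ^ p) \<le> b" and b0: "b \<ge> 0"
    and mart: "\<And>k. k < n \<Longrightarrow> expectation (\<lambda>\<omega>. Y k \<omega> ^ (p - 1) * \<xi> k \<omega>) = 0"
  shows "expectation (\<lambda>\<omega>. Y n \<omega> ^ p) \<le> (2 ^ (p + 1) * exp (2 ^ p)) * real n ^ q * b"
proof (cases "n = 0")
  case True
  then show ?thesis using S0 p q by (simp add: power_0_left)
next
  case n: False
  have ev: "even p" "p \<ge> 2" "p > 0" using p q by auto
  \<comment> \<open>\<open>D\<close> is the price of one increment and \<open>r\<close> the growth
    factor of one step. The recursion \<open>E (Suc k) <= r * E k + D\<close> for the moments is
    solved by \<open>k * r ^ k * D\<close>, because \<open>r \<ge> 1\<close>.\<close>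
  define D where "D = 2 ^ (p + 1) * real n ^ (q - 1) * b"
  define r where "r = 1 + 2 ^ p / real n"
  have r1: "r \<ge> 1" by (simp add: r_def)
  have D0: "D \<ge> 0" using b0 by (simp add: D_def)
  have lpS: "lp M p (Y k)" if "k \<le> n" for k
    using that
  proof (induction k)
    case 0
    have "Y 0 = (\<lambda>_. 0)" using S0 by auto
    then show ?case using lp_const[of p 0] by simp
  next
    case (Suc k)
    then have "Y (Suc k) = (\<lambda>\<omega>. Y k \<omega> + \<xi> k \<omega>)" using SS by auto
    then show ?case using lp_add(1)[OF ev(1) Suc.IH lp[of k]] Suc.prems by simp
  qed
  have main: "expectation (\<lambda>\<omega>. Y k \<omega> ^ p) \<le> real k * r ^ k * D" if "k \<le> n" for k
    using that
  proof (induction k)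
    case 0
    then show ?case using S0 ev by (simp add: power_0_left)
  next
    case (Suc k)
    then have k: "k < n" by simp
    have l1: "lp M p (Y k)" and l2: "lp M p (\<xi> k)" using lpS[of k] lp[of k] k by auto
    have i1: "integrable M (\<lambda>\<omega>. Y k \<omega> ^ p)" "integrable M (\<lambda>\<omega>. \<xi> k \<omega> ^ p)"
      using l1 l2 by (auto simp: lp_def)
    have i3: "integrable M (\<lambda>\<omega>. Y k \<omega> ^ (p - 1) * \<xi> k \<omega>)"
      using lp_integrable_mult[OF ev(1) _ l1 l2, of 1] ev by simp
    have pw: "(Y k \<omega> + \<xi> k \<omega>) ^ p \<le> r * Y k \<omega> ^ p + real p * (Y k \<omega> ^ (p - 1) * \<xi> k \<omega>) +
       2 ^ (p + 1) * real n ^ (q - 1) * \<xi> k \<omega> ^ p" for \<omega>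
    proof -
      have n1: "1 \<le> n" using n by simp
      have y: "Y k \<omega> ^ (p - 2) * (\<xi> k \<omega>)\<^sup>2 \<le> Y k \<omega> ^ p / n + real n ^ (q - 1) * \<xi> k \<omega> ^ p"
        using young_power_le[OF q n1, of "Y k \<omega>" "\<xi> k \<omega>"] unfolding p .
      have "(1::real) \<le> real n ^ (q - 1)" using n1 by (simp add: one_le_power)
      hence z: "\<xi> k \<omega> ^ p \<le> real n ^ (q - 1) * \<xi> k \<omega> ^ p"
        using mult_right_mono[of 1 "real n ^ (q - 1)" "\<xi> k \<omega> ^ p"] ev by (simp add: zero_le_even_power)
      have "(Y k \<omega> + \<xi> k \<omega>) ^ p \<le> Y k \<omega> ^ p + real p * Y k \<omega> ^ (p - 1) * \<xi> k \<omega> +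
          2 ^ p * (Y k \<omega> ^ (p - 2) * (\<xi> k \<omega>)\<^sup>2 + \<xi> k \<omega> ^ p)"
        by (rule power_add_taylor_le[OF ev(1,2)])
      also have "\<dots> \<le> Y k \<omega> ^ p + real p * Y k \<omega> ^ (p - 1) * \<xi> k \<omega> +
          2 ^ p * ((Y k \<omega> ^ p / n + real n ^ (q - 1) * \<xi> k \<omega> ^ p) + real n ^ (q - 1) * \<xi> k \<omega> ^ p)"
        by (intro add_left_mono mult_left_mono add_mono y z) auto
      also have "\<dots> = r * Y k \<omega> ^ p + real p * (Y k \<omega> ^ (p - 1) * \<xi> k \<omega>) +
       2 ^ (p + 1) * real n ^ (q - 1) * \<xi> k \<omega> ^ p"
        using n by (simp add: r_def field_simps)
      finally show ?thesis .
    qed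
    have "expectation (\<lambda>\<omega>. Y (Suc k) \<omega> ^ p) = expectation (\<lambda>\<omega>. (Y k \<omega> + \<xi> k \<omega>) ^ p)"
      using SS[OF k] by simp
    also have "\<dots> \<le> expectation (\<lambda>\<omega>. r * Y k \<omega> ^ p + real p * (Y k \<omega> ^ (p - 1) * \<xi> k \<omega>) +
       2 ^ (p + 1) * real n ^ (q - 1) * \<xi> k \<omega> ^ p)"
      using lp_add(1)[OF ev(1) l1 l2] i1 i3 by (intro integral_mono pw) (auto simp: lp_def)
    also have "\<dots> = r * expectation (\<lambda>\<omega>. Y k \<omega> ^ p) + 2 ^ (p + 1) * real n ^ (q - 1) * expectation (\<lambda>\<omega>. \<xi> k \<omega> ^ p)"
      using i1 i3 mart[OF k] by simp
    also have "\<dots> \<le> r * (real k * r ^ k * D) + D"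
    proof (rule add_mono)
      show "2 ^ (p + 1) * real n ^ (q - 1) * expectation (\<lambda>\<omega>. \<xi> k \<omega> ^ p) \<le> D"
        unfolding D_def using b[OF k] by (intro mult_left_mono) auto
      show "r * expectation (\<lambda>\<omega>. Y k \<omega> ^ p) \<le> r * (real k * r ^ k * D)"
        using Suc r1 by (intro mult_left_mono) auto
    qed
    also have "\<dots> \<le> r * (real k * r ^ k * D) + r ^ Suc k * D"
      using mult_right_mono[OF one_le_power[OF r1, of "Suc k"] D0] by simp
    finally show ?case by (simp add: algebra_simps)
  qed
  have "r ^ n \<le> exp (2 ^ p)" unfolding r_def
    using n by (intro exp_ge_one_plus_x_over_n_power_n) (auto intro: order_trans[of _ 0])
  hence "real n * r ^ n * D \<le> real n * exp (2 ^ p) * D"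
    using D0 by (intro mult_right_mono mult_left_mono) auto
  also have "\<dots> = (2 ^ (p + 1) * exp (2 ^ p)) * (real n * real n ^ (q - 1)) * b"
    by (simp add: D_def mult_ac)
  also have "real n * real n ^ (q - 1) = real n ^ q"
    using q by (cases q) auto
  finally show ?thesis using main[of n] by linarith
qed

end

subsection \<open>Moments of U-statistics\<close>

text \<open>The library's \<open>indep_var\<close> requires both random variables to have values in the same type.\<close>

definition (in prob_space) product_law :: "'b measure \<Rightarrow> ('a \<Rightarrow> 'b) \<Rightarrow> 'c measure \<Rightarrow> ('a \<Rightarrow> 'c) \<Rightarrow> bool" where
  "product_law A Y B Z \<longleftrightarrow> Y \<in> measurable M A \<and> Z \<in> measurable M B \<and>
     distr M A Y \<Otimes>\<^sub>M distr M B Z = distr M (A \<Otimes>\<^sub>M B) (\<lambda>\<omega>. (Y \<omega>, Z \<omega>))"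

lemma (in prob_space) product_law_compose:
  assumes "product_law A Y B Z" and g: "g \<in> measurable A A'" and h: "h \<in> measurable B B'"
  shows "product_law A' (\<lambda>\<omega>. g (Y \<omega>)) B' (\<lambda>\<omega>. h (Z \<omega>))"
proof -
  have [measurable]: "Y \<in> measurable M A" "Z \<in> measurable M B" and
    e: "distr M A Y \<Otimes>\<^sub>M distr M B Z = distr M (A \<Otimes>\<^sub>M B) (\<lambda>\<omega>. (Y \<omega>, Z \<omega>))"
    using assms by (auto simp: product_law_def)
  note g [measurable] h [measurable]
  interpret D: prob_space "distr M B' (\<lambda>\<omega>. h (Z \<omega>))" by (rule prob_space_distr) simp
  have "distr M A' (\<lambda>\<omega>. g (Y \<omega>)) \<Otimes>\<^sub>M distr M B' (\<lambda>\<omega>. h (Z \<omega>)) =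
    distr (distr M A Y) A' g \<Otimes>\<^sub>M distr (distr M B Z) B' h"
    by (simp add: distr_distr comp_def)
  also have "\<dots> = distr (distr M A Y \<Otimes>\<^sub>M distr M B Z) (A' \<Otimes>\<^sub>M B') (\<lambda>(x, y). (g x, h y))"
    by (rule pair_measure_distr) (auto simp: distr_distr comp_def intro: D.sigma_finite_measure_axioms)
  also have "\<dots> = distr M (A' \<Otimes>\<^sub>M B') (\<lambda>\<omega>. (g (Y \<omega>), h (Z \<omega>)))"
    unfolding e by (simp add: distr_distr comp_def)
  finally show ?thesis by (simp add: product_law_def)
qed

text \<open>Independence means that \<open>(Y \<omega>, Z \<omega>)\<close> under \<open>M\<close>
  and \<open>(Y \<omega>, Z \<omega>')\<close> under \<open>M \<Otimes>\<^sub>M M\<close> have the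
  same law, so Fubini on the product of \<open>M\<close> with itself gives all six claims. The inner
  integral resamples one of the two variables.\<close>

lemma (in prob_space)
  fixes \<Phi> :: "_ \<Rightarrow> real"
  assumes ind: "product_law A Y B Z" and m: "\<Phi> \<in> borel_measurable (A \<Otimes>\<^sub>M B)"
    and i: "integrable M (\<lambda>\<omega>. \<Phi> (Y \<omega>, Z \<omega>))"
  shows product_law_AE_integrable: "AE \<omega> in M. integrable M (\<lambda>\<omega>'. \<Phi> (Y \<omega>, Z \<omega>'))"
    and product_law_integrable_iterated: "integrable M (\<lambda>\<omega>. \<integral>\<omega>'. \<Phi> (Y \<omega>, Z \<omega>') \<partial>M)"
    and product_law_integral_iterated:
      "(\<integral>\<omega>. \<Phi> (Y \<omega>, Z \<omega>) \<partial>M) = (\<integral>\<omega>. \<integral>\<omega>'. \<Phi> (Y \<omega>, Z \<omega>') \<partial>M \<partial>M)"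
    and product_law_AE_integrable': "AE \<omega>' in M. integrable M (\<lambda>\<omega>. \<Phi> (Y \<omega>, Z \<omega>'))"
    and product_law_integrable_iterated': "integrable M (\<lambda>\<omega>'. \<integral>\<omega>. \<Phi> (Y \<omega>, Z \<omega>') \<partial>M)"
    and product_law_integral_iterated':
      "(\<integral>\<omega>. \<Phi> (Y \<omega>, Z \<omega>) \<partial>M) = (\<integral>\<omega>'. \<integral>\<omega>. \<Phi> (Y \<omega>, Z \<omega>') \<partial>M \<partial>M)"
proof -
  note m [measurable]
  have [measurable]: "Y \<in> measurable M A" "Z \<in> measurable M B"
    using ind by (auto simp: product_law_def)
  interpret pp: pair_prob_space M M ..
  have d: "distr M A Y \<Otimes>\<^sub>M distr M B Z = distr M (A \<Otimes>\<^sub>M B) (\<lambda>x. (Y x, Z x))"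
    using ind by (auto simp: product_law_def)
  interpret DY: prob_space "distr M A Y" by (rule prob_space_distr) simp
  interpret DZ: prob_space "distr M B Z" by (rule prob_space_distr) simp
  have d2: "distr (M \<Otimes>\<^sub>M M) (A \<Otimes>\<^sub>M B) (\<lambda>(x, y). (Y x, Z y)) = distr M (A \<Otimes>\<^sub>M B) (\<lambda>x. (Y x, Z x))"
    unfolding d[symmetric]
    by (subst pair_measure_distr) (auto intro: DZ.sigma_finite_measure_axioms)
  have "integrable (distr M (A \<Otimes>\<^sub>M B) (\<lambda>x. (Y x, Z x))) \<Phi>"
    using i by (subst integrable_distr_eq) auto
  hence "integrable (distr (M \<Otimes>\<^sub>M M) (A \<Otimes>\<^sub>M B) (\<lambda>(x, y). (Y x, Z y))) \<Phi>" by (simp only: d2)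
  hence ii: "integrable (M \<Otimes>\<^sub>M M) (\<lambda>z. \<Phi> (Y (fst z), Z (snd z)))"
    by (subst (asm) integrable_distr_eq) (auto simp: case_prod_beta)
  have "(\<integral>\<omega>. \<Phi> (Y \<omega>, Z \<omega>) \<partial>M) = integral\<^sup>L (distr M (A \<Otimes>\<^sub>M B) (\<lambda>x. (Y x, Z x))) \<Phi>"
    by (subst integral_distr) auto
  also have "\<dots> = integral\<^sup>L (distr (M \<Otimes>\<^sub>M M) (A \<Otimes>\<^sub>M B) (\<lambda>(x, y). (Y x, Z y))) \<Phi>" by (simp only: d2)
  also have "\<dots> = (\<integral>z. \<Phi> (Y (fst z), Z (snd z)) \<partial>(M \<Otimes>\<^sub>M M))"
    by (subst integral_distr) (auto simp: case_prod_beta)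
  finally have e: "(\<integral>\<omega>. \<Phi> (Y \<omega>, Z \<omega>) \<partial>M) = (\<integral>z. \<Phi> (Y (fst z), Z (snd z)) \<partial>(M \<Otimes>\<^sub>M M))" .
  have ii': "integrable (M \<Otimes>\<^sub>M M) (case_prod (\<lambda>x y. \<Phi> (Y x, Z y)))"
    using ii by (simp add: case_prod_beta')
  show "AE \<omega> in M. integrable M (\<lambda>\<omega>'. \<Phi> (Y \<omega>, Z \<omega>'))" by (rule pp.AE_integrable_fst[OF ii'])
  show "integrable M (\<lambda>\<omega>. \<integral>\<omega>'. \<Phi> (Y \<omega>, Z \<omega>') \<partial>M)" by (rule pp.integrable_fst[OF ii'])
  show "(\<integral>\<omega>. \<Phi> (Y \<omega>, Z \<omega>) \<partial>M) = (\<integral>\<omega>. \<integral>\<omega>'. \<Phi> (Y \<omega>, Z \<omega>') \<partial>M \<partial>M)"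
    using pp.integral_fst[OF ii'] e by (simp add: case_prod_beta')
  show "AE \<omega>' in M. integrable M (\<lambda>\<omega>. \<Phi> (Y \<omega>, Z \<omega>'))" by (rule pp.AE_integrable_snd[OF ii'])
  show "integrable M (\<lambda>\<omega>'. \<integral>\<omega>. \<Phi> (Y \<omega>, Z \<omega>') \<partial>M)" by (rule pp.integrable_snd[OF ii'])
  show "(\<integral>\<omega>. \<Phi> (Y \<omega>, Z \<omega>) \<partial>M) = (\<integral>\<omega>'. \<integral>\<omega>. \<Phi> (Y \<omega>, Z \<omega>') \<partial>M \<partial>M)"
    using pp.integral_snd[OF ii'] e by (simp add: case_prod_beta')
qed

section \<open>Increasing index tuples\<close>

definition idx :: "nat \<Rightarrow> nat \<Rightarrow> (nat \<Rightarrow> nat) set" where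
  "idx d n = {i \<in> {1..d} \<rightarrow>\<^sub>E {1..n}. strict_mono_on {1..d} i}"

lemma finite_idx [simp, intro]: "finite (idx d n)"
  by (rule finite_subset[of _ "{1..d} \<rightarrow>\<^sub>E {1..n}"]) (auto simp: idx_def intro: finite_PiE)

lemma idx_0 [simp]: "idx 0 n = {\<lambda>_. undefined}"
  by (auto simp: idx_def strict_mono_on_def)

lemma idx_Suc_0 [simp]: "idx (Suc d) 0 = {}"
  by (auto simp: idx_def PiE_def Pi_def)

lemma idx_inj_on: "i \<in> idx d n \<Longrightarrow> inj_on i {1..d}"
  by (auto simp: idx_def strict_mono_on_imp_inj_on)

lemma idx_range: "i \<in> idx d n \<Longrightarrow> k \<in> {1..d} \<Longrightarrow> i k \<in> {1..n}"
  by (auto simp: idx_def)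

lemma idx_mono: "m \<le> n \<Longrightarrow> idx d m \<subseteq> idx d n"
  by (fastforce simp: idx_def PiE_def Pi_def)

text \<open>Pascal's rule for sets: by monotonicity only the last entry can equal
  \<open>Suc n\<close>. This is what turns a U-statistic into a sum of increments.\<close>

lemma idx_Suc_Suc: "idx (Suc d) (Suc n) = idx (Suc d) n \<union> (\<lambda>i. i(Suc d := Suc n)) ` idx d n"
proof (intro equalityI subsetI)
  fix i assume i: "i \<in> idx (Suc d) (Suc n)"
  have ir: "i k \<in> {1..Suc n}" if "k \<in> {1..Suc d}" for k using idx_range[OF i that] .
  have mono: "i k < i l" if "k \<in> {1..Suc d}" "l \<in> {1..Suc d}" "k < l" for k l
    using i that by (auto simp: idx_def strict_mono_on_def)
  have ext: "i k = undefined" if "k \<notin> {1..Suc d}" for k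
    using i that by (auto simp: idx_def PiE_def extensional_def)
  show "i \<in> idx (Suc d) n \<union> (\<lambda>i. i(Suc d := Suc n)) ` idx d n"
  proof (cases "i (Suc d) = Suc n")
    case True
    have "restrict i {1..d} \<in> idx d n"
    proof -
      have "i k \<in> {1..n}" if "k \<in> {1..d}" for k
        using mono[of k "Suc d"] ir[of k] True that by auto
      thus ?thesis using mono by (auto simp: idx_def strict_mono_on_def)
    qed
    moreover have "i = (restrict i {1..d})(Suc d := Suc n)"
      using ext True by (auto simp: fun_eq_iff restrict_def)
    ultimately show ?thesis by blast
  next
    case False
    have "i k \<in> {1..n}" if "k \<in> {1..Suc d}" for k
      using mono[of k "Suc d"] ir[of k] ir[of "Suc d"] False that by (cases "k = Suc d") auto
    thus ?thesis using i by (auto simp: idx_def)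
  qed
next
  fix i assume "i \<in> idx (Suc d) n \<union> (\<lambda>i. i(Suc d := Suc n)) ` idx d n"
  then show "i \<in> idx (Suc d) (Suc n)"
  proof
    assume "i \<in> idx (Suc d) n"
    then show ?thesis using idx_mono[of n "Suc n" "Suc d"] by auto
  next
    assume "i \<in> (\<lambda>i. i(Suc d := Suc n)) ` idx d n"
    then obtain j where j: "j \<in> idx d n" "i = j(Suc d := Suc n)" by auto
    have jr: "j k \<in> {1..n}" if "k \<in> {1..d}" for k using idx_range[OF j(1) that] .
    have jm: "j k < j l" if "k \<in> {1..d}" "l \<in> {1..d}" "k < l" for k l
      using j(1) that by (auto simp: idx_def strict_mono_on_def)
    have je: "j k = undefined" if "k \<notin> {1..d}" for k
      using j(1) that by (auto simp: idx_def PiE_def extensional_def)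
    have "i \<in> {1..Suc d} \<rightarrow>\<^sub>E {1..Suc n}"
      using jr je unfolding j(2) by (fastforce simp: PiE_def Pi_def extensional_def le_Suc_eq)
    moreover have "strict_mono_on {1..Suc d} i"
      using jr jm unfolding j(2) strict_mono_on_def by (fastforce simp: le_Suc_eq less_Suc_eq_le)
    ultimately show ?thesis by (simp add: idx_def)
  qed
qed

lemma sum_idx_Suc_Suc:
  fixes g :: "_ \<Rightarrow> real"
  shows "(\<Sum>i\<in>idx (Suc d) (Suc n). g i) = (\<Sum>i\<in>idx (Suc d) n. g i) + (\<Sum>i\<in>idx d n. g (i(Suc d := Suc n)))"
proof -
  have disj: "idx (Suc d) n \<inter> (\<lambda>i. i(Suc d := Suc n)) ` idx d n = {}"
  proof -
    have "i (Suc d) \<noteq> Suc n" if "i \<in> idx (Suc d) n" for i using idx_range[OF that, of "Suc d"] by auto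
    thus ?thesis by fastforce
  qed
  have inj: "inj_on (\<lambda>i. i(Suc d := Suc n)) (idx d n)"
  proof (rule inj_onI)
    fix i j assume i: "i \<in> idx d n" and j: "j \<in> idx d n" and eq: "i(Suc d := Suc n) = j(Suc d := Suc n)"
    have "i (Suc d) = undefined" "j (Suc d) = undefined"
      using i j by (auto simp: idx_def PiE_def extensional_def)
    thus "i = j" using eq by (metis fun_upd_triv fun_upd_upd)
  qed
  show ?thesis unfolding idx_Suc_Suc using disj inj by (simp add: sum.union_disjoint sum.reindex)
qed

lemma card_idx: "card (idx d n) = n choose d"
proof (induction n arbitrary: d)
  case 0
  then show ?case by (cases d) auto
next
  case (Suc n)
  show ?case
  proof (cases d)
    case (Suc e)
    have "real (card (idx (Suc e) (Suc n))) = real (card (idx (Suc e) n)) + real (card (idx e n))"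
      using sum_idx_Suc_Suc[of "\<lambda>_. 1" e n] by simp
    hence "card (idx (Suc e) (Suc n)) = card (idx (Suc e) n) + card (idx e n)" by linarith
    then show ?thesis using Suc.IH Suc by simp
  qed simp
qed

lemma card_idx_le: "card (idx d n) \<le> n ^ d"
  using card_mono[of "{1..d} \<rightarrow>\<^sub>E {1..n}" "idx d n"] by (auto simp: idx_def card_PiE intro: finite_PiE)

lemma U_stat_idx: "U_stat d f X n \<omega> = (\<Sum>i\<in>idx d n. f (\<lambda>k\<in>{1..d}. X (i k) \<omega>))"
  by (simp add: U_stat_def idx_def)

lemma upd_measurable [measurable]:
  "(\<lambda>(y, x). y(Suc d := x)) \<in> measurable (PiM {1..d} (\<lambda>_. S) \<Otimes>\<^sub>M S) (PiM {1..Suc d} (\<lambda>_. S))"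
proof -
  have "{1..Suc d} = insert (Suc d) {1..d}" by auto
  thus ?thesis using measurable_add_dim[of "Suc d" "{1..d}" "\<lambda>_. S"] by simp
qed

lemma upd_measurable2:
  assumes "f \<in> measurable N (PiM {1..d} (\<lambda>_. S))" "g \<in> measurable N S"
  shows "(\<lambda>x. (f x)(Suc d := g x)) \<in> measurable N (PiM {1..Suc d} (\<lambda>_. S))"
  using measurable_compose[OF measurable_Pair[OF assms] upd_measurable] by simp

section \<open>I.i.d. sequences, their tuples and their U-statistics\<close>

locale iid_seq = prob_space M for M :: "'a measure" +
  fixes S :: "'s measure" and X :: "nat \<Rightarrow> 'a \<Rightarrow> 's"
  assumes indep: "indep_vars (\<lambda>_. S) X UNIV"
    and ident: "\<And>i. distr M S (X i) = distr M S (X 0)"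
begin

abbreviation "TS d \<equiv> PiM {1..d} (\<lambda>_. S)"

definition tup :: "nat \<Rightarrow> (nat \<Rightarrow> nat) \<Rightarrow> 'a \<Rightarrow> nat \<Rightarrow> 's" where
  "tup d i \<omega> = (\<lambda>k\<in>{1..d}. X (i k) \<omega>)"

lemma X_measurable [measurable]: "X i \<in> measurable M S"
  using indep by (auto simp: indep_vars_def)

lemma tup_measurable [measurable]: "tup d i \<in> measurable M (TS d)"
  unfolding tup_def by measurable

text \<open>Injectivity makes the entries distinct members of the sequence. The index map drops out
  of the law, which is how every expectation is reduced to the reference tuple with indices
  \<open>1..d\<close>.\<close>

lemma distr_tuple:
  assumes "finite J" "inj_on i J"
  shows "distr M (PiM J (\<lambda>_. S)) (\<lambda>\<omega>. \<lambda>k\<in>J. X (i k) \<omega>) = PiM J (\<lambda>_. distr M S (X 0))"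
proof (cases "J = {}")
  \<comment> \<open>Order \<open>0\<close> does occur in the inductions below, while the product
    characterisation of independence is applied with a nonempty index set.\<close>
  case True
  interpret D: prob_space "distr M (PiM J (\<lambda>_. S)) (\<lambda>\<omega>. \<lambda>k\<in>J. X (i k) \<omega>)"
    by (rule prob_space_distr) simp
  interpret D2: prob_space "PiM J (\<lambda>_. distr M S (X 0))"
    by (intro prob_space_PiM prob_space_distr) simp
  show ?thesis
  proof (rule measure_eqI)
    fix A assume "A \<in> sets (distr M (PiM J (\<lambda>_. S)) (\<lambda>\<omega>. \<lambda>k\<in>J. X (i k) \<omega>))"
    hence "A = {} \<or> A = {\<lambda>_. undefined}" using True by (auto simp: PiM_empty)
    thus "emeasure (distr M (PiM J (\<lambda>_. S)) (\<lambda>\<omega>. \<lambda>k\<in>J. X (i k) \<omega>)) A =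
        emeasure (PiM J (\<lambda>_. distr M S (X 0))) A"
      using D.emeasure_space_1 D2.emeasure_space_1 True by (auto simp: space_PiM)
  qed (use True in \<open>simp add: PiM_empty\<close>)
next
  case False
  have "indep_vars (\<lambda>_. S) X (i ` J)" by (rule indep_vars_subset[OF indep]) auto
  hence *: "distr M (PiM (i ` J) (\<lambda>_. S)) (\<lambda>\<omega>. \<lambda>k\<in>i ` J. X k \<omega>) = PiM (i ` J) (\<lambda>j. distr M S (X j))"
    using False by (subst (asm) indep_vars_iff_distr_eq_PiM') auto
  have **: "(\<lambda>j. distr M S (X j)) = (\<lambda>_. distr M S (X 0))" using ident by auto
  have "distr M (PiM J (\<lambda>_. S)) (\<lambda>\<omega>. \<lambda>k\<in>J. X (i k) \<omega>) =
     distr M (PiM J (\<lambda>_. S)) ((\<lambda>\<omega>. \<lambda>n\<in>J. \<omega> (i n)) \<circ> (\<lambda>\<omega>. \<lambda>k\<in>i ` J. X k \<omega>))"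
    by (rule distr_cong) auto
  also have "\<dots> = distr (distr M (PiM (i ` J) (\<lambda>_. S)) (\<lambda>\<omega>. \<lambda>k\<in>i ` J. X k \<omega>)) (PiM J (\<lambda>_. S)) (\<lambda>\<omega>. \<lambda>n\<in>J. \<omega> (i n))"
    by (rule distr_distr[symmetric]) (auto intro!: measurable_restrict)
  also have "\<dots> = distr (PiM (i ` J) (\<lambda>_. distr M S (X 0))) (PiM J (\<lambda>_. distr M S (X 0))) (\<lambda>\<omega>. \<lambda>n\<in>J. \<omega> (i n))"
    unfolding * ** by (rule distr_cong) (auto intro!: sets_PiM_cong)
  also have "\<dots> = PiM J (\<lambda>_. distr M S (X 0))"
    using assms by (intro distr_PiM_reindex prob_space_distr) auto
  finally show ?thesis .
qed

lemma
  fixes \<phi> :: "_ \<Rightarrow> real"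
  assumes J: "finite J" "inj_on i J" "inj_on i' J" and m [measurable]: "\<phi> \<in> borel_measurable (PiM J (\<lambda>_. S))"
  shows integrable_tuple_cong: "integrable M (\<lambda>\<omega>. \<phi> (\<lambda>k\<in>J. X (i k) \<omega>)) \<longleftrightarrow> integrable M (\<lambda>\<omega>. \<phi> (\<lambda>k\<in>J. X (i' k) \<omega>))"
    and integral_tuple_cong: "(\<integral>\<omega>. \<phi> (\<lambda>k\<in>J. X (i k) \<omega>) \<partial>M) = (\<integral>\<omega>. \<phi> (\<lambda>k\<in>J. X (i' k) \<omega>) \<partial>M)"
proof -
  have e: "distr M (PiM J (\<lambda>_. S)) (\<lambda>\<omega>. \<lambda>k\<in>J. X (i k) \<omega>) = distr M (PiM J (\<lambda>_. S)) (\<lambda>\<omega>. \<lambda>k\<in>J. X (i' k) \<omega>)"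
    using distr_tuple[OF J(1,2)] distr_tuple[OF J(1,3)] by simp
  show "integrable M (\<lambda>\<omega>. \<phi> (\<lambda>k\<in>J. X (i k) \<omega>)) \<longleftrightarrow> integrable M (\<lambda>\<omega>. \<phi> (\<lambda>k\<in>J. X (i' k) \<omega>))"
    using integrable_distr_eq[of "\<lambda>\<omega>. \<lambda>k\<in>J. X (i k) \<omega>" M "PiM J (\<lambda>_. S)" \<phi>]
      integrable_distr_eq[of "\<lambda>\<omega>. \<lambda>k\<in>J. X (i' k) \<omega>" M "PiM J (\<lambda>_. S)" \<phi>] e by simp
  show "(\<integral>\<omega>. \<phi> (\<lambda>k\<in>J. X (i k) \<omega>) \<partial>M) = (\<integral>\<omega>. \<phi> (\<lambda>k\<in>J. X (i' k) \<omega>) \<partial>M)"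
    using integral_distr[of "\<lambda>\<omega>. \<lambda>k\<in>J. X (i k) \<omega>" M "PiM J (\<lambda>_. S)" \<phi>]
      integral_distr[of "\<lambda>\<omega>. \<lambda>k\<in>J. X (i' k) \<omega>" M "PiM J (\<lambda>_. S)" \<phi>] e by simp
qed

lemma AE_tuple_cong:
  assumes J: "finite J" "inj_on i J" "inj_on i' J" and m [measurable]: "{x \<in> space (PiM J (\<lambda>_. S)). \<phi> x} \<in> sets (PiM J (\<lambda>_. S))"
  shows "(AE \<omega> in M. \<phi> (\<lambda>k\<in>J. X (i k) \<omega>)) \<longleftrightarrow> (AE \<omega> in M. \<phi> (\<lambda>k\<in>J. X (i' k) \<omega>))"
proof -
  have e: "distr M (PiM J (\<lambda>_. S)) (\<lambda>\<omega>. \<lambda>k\<in>J. X (i k) \<omega>) = distr M (PiM J (\<lambda>_. S)) (\<lambda>\<omega>. \<lambda>k\<in>J. X (i' k) \<omega>)"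
    using distr_tuple[OF J(1,2)] distr_tuple[OF J(1,3)] by simp
  show ?thesis
    using AE_distr_iff[OF _ m, of "\<lambda>\<omega>. \<lambda>k\<in>J. X (i k) \<omega>" M, unfolded e]
      AE_distr_iff[OF _ m, of "\<lambda>\<omega>. \<lambda>k\<in>J. X (i' k) \<omega>" M] by auto
qed

lemma
  fixes \<phi> :: "_ \<Rightarrow> real"
  assumes m [measurable]: "\<phi> \<in> borel_measurable S"
  shows integrable_X_cong: "integrable M (\<lambda>\<omega>. \<phi> (X k \<omega>)) \<longleftrightarrow> integrable M (\<lambda>\<omega>. \<phi> (X l \<omega>))"
    and integral_X_cong: "(\<integral>\<omega>. \<phi> (X k \<omega>) \<partial>M) = (\<integral>\<omega>. \<phi> (X l \<omega>) \<partial>M)"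
proof -
  have e: "distr M S (X k) = distr M S (X l)" using ident[of k] ident[of l] by simp
  show "integrable M (\<lambda>\<omega>. \<phi> (X k \<omega>)) \<longleftrightarrow> integrable M (\<lambda>\<omega>. \<phi> (X l \<omega>))"
    using integrable_distr_eq[of "X k" M S \<phi>] integrable_distr_eq[of "X l" M S \<phi>] e by simp
  show "(\<integral>\<omega>. \<phi> (X k \<omega>) \<partial>M) = (\<integral>\<omega>. \<phi> (X l \<omega>) \<partial>M)"
    using integral_distr[of "X k" M S \<phi>] integral_distr[of "X l" M S \<phi>] e by simp
qed

lemma indep_tuple:
  assumes "l \<notin> i ` J"
  shows "product_law (PiM J (\<lambda>_. S)) (\<lambda>\<omega>. \<lambda>k\<in>J. X (i k) \<omega>) S (X l)"
proof -
  have "indep_var (PiM (i ` J) (\<lambda>_. S)) (\<lambda>\<omega>. restrict (\<lambda>k. X k \<omega>) (i ` J)) (PiM {l} (\<lambda>_. S)) (\<lambda>\<omega>. restrict (\<lambda>k. X k \<omega>) {l})"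
    using assms by (intro indep_var_restrict[OF indep]) auto
  hence "product_law (PiM (i ` J) (\<lambda>_. S)) (\<lambda>\<omega>. restrict (\<lambda>k. X k \<omega>) (i ` J)) (PiM {l} (\<lambda>_. S)) (\<lambda>\<omega>. restrict (\<lambda>k. X k \<omega>) {l})"
    unfolding indep_var_distribution_eq product_law_def .
  hence "product_law (PiM J (\<lambda>_. S)) (\<lambda>\<omega>. (\<lambda>y. \<lambda>k\<in>J. y (i k)) (restrict (\<lambda>k. X k \<omega>) (i ` J)))
      S (\<lambda>\<omega>. (\<lambda>y. y l) (restrict (\<lambda>k. X k \<omega>) {l}))"
    by (rule product_law_compose) (intro measurable_restrict measurable_component_singleton; auto)+
  also have "(\<lambda>\<omega>. (\<lambda>y. \<lambda>k\<in>J. y (i k)) (restrict (\<lambda>k. X k \<omega>) (i ` J))) = (\<lambda>\<omega>. \<lambda>k\<in>J. X (i k) \<omega>)"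
    by (auto simp: fun_eq_iff restrict_def)
  also have "(\<lambda>\<omega>. (\<lambda>y. y l) (restrict (\<lambda>k. X k \<omega>) {l})) = X l" by auto
  finally show ?thesis .
qed

lemma tup_upd: "tup (Suc d) (i(Suc d := k)) \<omega> = (tup d i \<omega>)(Suc d := X k \<omega>)"
  by (auto simp: tup_def fun_eq_iff restrict_def)

lemma tup_Suc_id: "tup (Suc d) (\<lambda>k. k) \<omega> = (tup d (\<lambda>k. k) \<omega>)(Suc d := X (Suc d) \<omega>)"
  using tup_upd[of d "\<lambda>k. k" "Suc d"] by (simp add: fun_upd_idem)

lemma restrict_tup: "restrict (tup (Suc d) i \<omega>) {1..d} = tup d i \<omega>"
  by (auto simp: tup_def fun_eq_iff restrict_def)

lemma inj_upd: "i \<in> idx d n \<Longrightarrow> n < k \<Longrightarrow> inj_on (i(Suc d := k)) {1..Suc d}"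
proof (rule inj_onI)
  fix x y assume i: "i \<in> idx d n" "n < k" and xy: "x \<in> {1..Suc d}" "y \<in> {1..Suc d}"
    and eq: "(i(Suc d := k)) x = (i(Suc d := k)) y"
  have r: "i z < k" if "z \<in> {1..d}" for z using idx_range[OF i(1) that] i(2) by auto
  have "x = Suc d \<or> x \<in> {1..d}" "y = Suc d \<or> y \<in> {1..d}" using xy by auto
  thus "x = y" using eq r[of x] r[of y] inj_onD[OF idx_inj_on[OF i(1)], of x y] by auto
qed

abbreviation U where "U d f \<equiv> U_stat d f X"

lemma U_tup: "U d f n \<omega> = (\<Sum>i\<in>idx d n. f (tup d i \<omega>))"
  by (simp add: U_stat_idx tup_def)

text \<open>By \<open>U_Suc\<close> this is the step from \<open>n\<close> to \<open>Suc n\<close>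
  of the statistic of order \<open>Suc d\<close>; the argument \<open>d\<close> counts the positions
  left free once the last one is taken by the new observation.\<close>

definition incr :: "nat \<Rightarrow> ((nat \<Rightarrow> 's) \<Rightarrow> real) \<Rightarrow> nat \<Rightarrow> 'a \<Rightarrow> real" where
  "incr d F n \<omega> = (\<Sum>i\<in>idx d n. F ((tup d i \<omega>)(Suc d := X (Suc n) \<omega>)))"

lemma U_Suc_0 [simp]: "U (Suc d) f 0 \<omega> = 0"
  by (simp add: U_tup)

lemma U_Suc: "U (Suc d) f (Suc n) \<omega> = U (Suc d) f n \<omega> + incr d f n \<omega>"
  by (simp add: U_tup incr_def sum_idx_Suc_Suc tup_upd)

lemma U_eq_sum_incr: "U (Suc d) f n \<omega> = (\<Sum>k<n. incr d f k \<omega>)"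
  by (induction n) (auto simp: U_Suc)

lemma incr_eq_U: "incr d F n \<omega> = U d (\<lambda>y. F (y(Suc d := X (Suc n) \<omega>))) n \<omega>"
  by (simp add: incr_def U_tup)

definition kern :: "nat \<Rightarrow> nat \<Rightarrow> ((nat \<Rightarrow> 's) \<Rightarrow> real) \<Rightarrow> bool" where
  "kern p d f \<longleftrightarrow> f \<in> borel_measurable (TS d) \<and> integrable M (\<lambda>\<omega>. f (tup d (\<lambda>k. k) \<omega>) ^ p)"

definition kmom :: "nat \<Rightarrow> nat \<Rightarrow> ((nat \<Rightarrow> 's) \<Rightarrow> real) \<Rightarrow> real" where
  "kmom p d f = (\<integral>\<omega>. f (tup d (\<lambda>k. k) \<omega>) ^ p \<partial>M)"

lemma kern_measurable: "kern p d f \<Longrightarrow> f \<in> borel_measurable (TS d)"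
  by (simp add: kern_def)

lemma kmom_nonneg: "even p \<Longrightarrow> 0 \<le> kmom p d f"
  unfolding kmom_def by (intro integral_nonneg_AE) (auto simp: zero_le_even_power)

lemma kern_lp:
  assumes "kern p d f" "inj_on i {1..d}"
  shows "lp M p (\<lambda>\<omega>. f (tup d i \<omega>))" and "(\<integral>\<omega>. f (tup d i \<omega>) ^ p \<partial>M) = kmom p d f"
proof -
  have m [measurable]: "f \<in> borel_measurable (TS d)" using assms by (simp add: kern_def)
  have m2: "(\<lambda>y. f y ^ p) \<in> borel_measurable (TS d)" by measurable
  have "integrable M (\<lambda>\<omega>. f (tup d i \<omega>) ^ p)"
    using integrable_tuple_cong[OF _ assms(2) _ m2, of "\<lambda>k. k"] assms(1) by (simp add: kern_def tup_def)
  thus "lp M p (\<lambda>\<omega>. f (tup d i \<omega>))" by (intro lpI) auto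
  show "(\<integral>\<omega>. f (tup d i \<omega>) ^ p \<partial>M) = kmom p d f"
    using integral_tuple_cong[OF _ assms(2) _ m2, of "\<lambda>k. k"] by (simp add: kmom_def tup_def)
qed

lemma kern_integrable:
  assumes "kern p d f" "even p" "p > 0"
  shows "integrable M (\<lambda>\<omega>. f (tup d (\<lambda>k. k) \<omega>))"
  using lp_integrable[OF assms(2,3) kern_lp(1)[OF assms(1), of "\<lambda>k. k"]] by auto

lemma U_lp:
  assumes "kern p d f" "even p" "p > 0"
  shows "lp M p (U d f n)" and "expectation (\<lambda>\<omega>. U d f n \<omega> ^ p) \<le> real n ^ (d * p) * kmom p d f"
proof -
  have l: "lp M p (\<lambda>\<omega>. f (tup d i \<omega>))" if "i \<in> idx d n" for i
    by (rule kern_lp(1)[OF assms(1) idx_inj_on[OF that]])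
  have e: "U d f n = (\<lambda>\<omega>. \<Sum>i\<in>idx d n. f (tup d i \<omega>))" by (auto simp: U_tup)
  show "lp M p (U d f n)" unfolding e by (rule lp_sum(1)[OF assms(2,3) _ l]) auto
  have "expectation (\<lambda>\<omega>. U d f n \<omega> ^ p) \<le>
      real (card (idx d n)) ^ (p - 1) * (\<Sum>i\<in>idx d n. \<integral>\<omega>. f (tup d i \<omega>) ^ p \<partial>M)"
    unfolding e by (rule lp_sum(2)[OF assms(2,3) _ l]) auto
  also have "\<dots> = real (card (idx d n)) ^ p * kmom p d f"
    using kern_lp(2)[OF assms(1) idx_inj_on] power_minus_mult[OF assms(3), of "real (card (idx d n))"] by simp
  also have "\<dots> \<le> (real n ^ d) ^ p * kmom p d f"
    using of_nat_mono[OF card_idx_le[of d n], where 'a = real]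
    by (intro mult_right_mono power_mono kmom_nonneg assms) auto
  finally show "expectation (\<lambda>\<omega>. U d f n \<omega> ^ p) \<le> real n ^ (d * p) * kmom p d f"
    by (simp add: power_mult)
qed

text \<open>A crude count of terms, with no cancellation inside the increment: for a degenerate
  kernel the square-root gain comes from the martingale structure across increments.\<close>

lemma incr_lp:
  assumes "kern p (Suc d) f" "even p" "p > 0"
  shows "lp M p (incr d f n)" and "expectation (\<lambda>\<omega>. incr d f n \<omega> ^ p) \<le> real n ^ (d * p) * kmom p (Suc d) f"
proof -
  have l: "lp M p (\<lambda>\<omega>. f (tup (Suc d) (i(Suc d := Suc n)) \<omega>))" if "i \<in> idx d n" for i
    by (rule kern_lp(1)[OF assms(1) inj_upd[OF that]]) auto
  have e: "incr d f n = (\<lambda>\<omega>. \<Sum>i\<in>idx d n. f (tup (Suc d) (i(Suc d := Suc n)) \<omega>))"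
    by (auto simp: incr_def tup_upd)
  show "lp M p (incr d f n)" unfolding e by (rule lp_sum(1)[OF assms(2,3) _ l]) auto
  have "expectation (\<lambda>\<omega>. incr d f n \<omega> ^ p) \<le>
      real (card (idx d n)) ^ (p - 1) * (\<Sum>i\<in>idx d n. \<integral>\<omega>. f (tup (Suc d) (i(Suc d := Suc n)) \<omega>) ^ p \<partial>M)"
    unfolding e by (rule lp_sum(2)[OF assms(2,3) _ l]) auto
  also have "(\<Sum>i\<in>idx d n. \<integral>\<omega>. f (tup (Suc d) (i(Suc d := Suc n)) \<omega>) ^ p \<partial>M) =
     (\<Sum>i\<in>idx d n. kmom p (Suc d) f)"
    by (intro sum.cong refl kern_lp(2)[OF assms(1) inj_upd]) auto
  also have "real (card (idx d n)) ^ (p - 1) * \<dots> = real (card (idx d n)) ^ p * kmom p (Suc d) f"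
    using power_minus_mult[OF assms(3), of "real (card (idx d n))"] by simp
  also have "\<dots> \<le> (real n ^ d) ^ p * kmom p (Suc d) f"
    using of_nat_mono[OF card_idx_le[of d n], where 'a = real]
    by (intro mult_right_mono power_mono kmom_nonneg assms) auto
  finally show "expectation (\<lambda>\<omega>. incr d f n \<omega> ^ p) \<le> real n ^ (d * p) * kmom p (Suc d) f"
    by (simp add: power_mult)
qed

text \<open>\<open>X 0\<close> is independent of all observations that enter the statistics, so at a
  tuple of those this is the conditional expectation given the first \<open>d\<close>
  arguments.\<close>

definition last_mean :: "nat \<Rightarrow> ((nat \<Rightarrow> 's) \<Rightarrow> real) \<Rightarrow> (nat \<Rightarrow> 's) \<Rightarrow> real" where
  "last_mean d f y = (\<integral>\<omega>. f (y(Suc d := X 0 \<omega>)) \<partial>M)"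

lemma section_measurable:
  assumes "f \<in> borel_measurable (TS (Suc d))"
  shows "(\<lambda>(y, x). f (y(Suc d := x))) \<in> borel_measurable (TS d \<Otimes>\<^sub>M S)"
  using measurable_compose[OF upd_measurable assms] by (simp add: case_prod_beta')

lemma section_measurable1:
  assumes "f \<in> borel_measurable (TS (Suc d))" "y \<in> space (TS d)"
  shows "(\<lambda>x. f (y(Suc d := x))) \<in> borel_measurable S"
  using measurable_compose[OF measurable_Pair1' [OF assms(2)] section_measurable[OF assms(1)]] by simp

lemma section_measurable2:
  assumes "f \<in> borel_measurable (TS (Suc d))" "x \<in> space S"
  shows "(\<lambda>y. f (y(Suc d := x))) \<in> borel_measurable (TS d)"
  using measurable_compose[OF measurable_Pair2' [OF assms(2)] section_measurable[OF assms(1)]] by simp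

lemma last_mean_measurable [measurable]:
  assumes "f \<in> borel_measurable (TS (Suc d))"
  shows "last_mean d f \<in> borel_measurable (TS d)"
proof -
  have "(\<lambda>(y, \<omega>). f (y(Suc d := X 0 \<omega>))) \<in> borel_measurable (TS d \<Otimes>\<^sub>M M)"
  proof -
    have "(\<lambda>(y, \<omega>). (y, X 0 \<omega>)) \<in> measurable (TS d \<Otimes>\<^sub>M M) (TS d \<Otimes>\<^sub>M S)" by measurable
    from measurable_compose[OF this section_measurable[OF assms]] show ?thesis
      by (simp add: case_prod_beta')
  qed
  thus ?thesis unfolding last_mean_def by (rule borel_measurable_lebesgue_integral)
qed

lemma last_mean_eq:
  assumes "f \<in> borel_measurable (TS (Suc d))" "y \<in> space (TS d)"
  shows "(\<integral>\<omega>. f (y(Suc d := X k \<omega>)) \<partial>M) = last_mean d f y"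
  unfolding last_mean_def by (rule integral_X_cong[OF section_measurable1[OF assms]])

lemma tup_space: "\<omega> \<in> space M \<Longrightarrow> tup d i \<omega> \<in> space (TS d)"
  using tup_measurable measurable_space by metis

lemma AE_tup_cong:
  assumes "inj_on i {1..d}" "{x \<in> space (TS d). \<phi> x} \<in> sets (TS d)"
    "AE \<omega> in M. \<phi> (tup d (\<lambda>k. k) \<omega>)"
  shows "AE \<omega> in M. \<phi> (tup d i \<omega>)"
  using AE_tuple_cong[OF _ assms(1) _ assms(2), of "\<lambda>k. k"] assms(3) by (simp add: tup_def)

text \<open>Degeneracy in the last argument alone makes the increments of \<open>U (Suc d) F\<close>
  martingale differences.\<close>

definition degen :: "nat \<Rightarrow> ((nat \<Rightarrow> 's) \<Rightarrow> real) \<Rightarrow> bool" where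
  "degen d F \<longleftrightarrow> (AE \<omega> in M. last_mean d F (tup d (\<lambda>k. k) \<omega>) = 0)"

text \<open>Given \<open>X 1, ..., X n\<close>, the new observation \<open>X (Suc n)\<close>
  integrates each summand of the increment to \<open>last_mean d F\<close>, which vanishes, and the
  power of the past is a factor already known at that time.\<close>

lemma degen_orthogonal:
  assumes k: "kern p (Suc d) F" and p: "even p" "p > 0" and dg: "degen d F" and mn: "m \<le> n"
  shows "expectation (\<lambda>\<omega>. (U (Suc d) F n \<omega> - U (Suc d) F m \<omega>) ^ (p - 1) * incr d F n \<omega>) = 0"
proof -
  have F [measurable]: "F \<in> borel_measurable (TS (Suc d))" using k by (rule kern_measurable)
  have lpU: "lp M p (\<lambda>\<omega>. U (Suc d) F n \<omega> - U (Suc d) F m \<omega>)"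
    by (intro lp_diff(1) U_lp k p)
  \<comment> \<open>The power of the past as a function of the single tuple
    \<open>X 1, ..., X n\<close>: the form to which Fubini against \<open>X (Suc n)\<close>
    applies.\<close>
  define H where "H = (\<lambda>y. ((\<Sum>i\<in>idx (Suc d) n. F (\<lambda>k\<in>{1..Suc d}. y (i k))) -
      (\<Sum>i\<in>idx (Suc d) m. F (\<lambda>k\<in>{1..Suc d}. y (i k)))) ^ (p - 1))"
  have comp: "(\<lambda>y. \<lambda>k\<in>{1..e}. y (i k)) \<in> measurable (TS n) (TS e)" if "i \<in> idx e n" for i e
    using idx_range[OF that] by (intro measurable_restrict measurable_component_singleton) auto
  have H [measurable]: "H \<in> borel_measurable (TS n)"
    unfolding H_def using idx_mono[OF mn, of "Suc d"]
    by (intro borel_measurable_power borel_measurable_diff borel_measurable_sum measurable_compose[OF comp F]) auto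
  have HU: "H (tup n (\<lambda>k. k) \<omega>) = (U (Suc d) F n \<omega> - U (Suc d) F m \<omega>) ^ (p - 1)" for \<omega>
  proof -
    have "(\<lambda>k\<in>{1..Suc d}. tup n (\<lambda>k. k) \<omega> (i k)) = tup (Suc d) i \<omega>" if "i \<in> idx (Suc d) n" for i
      using idx_range[OF that] by (auto simp: tup_def fun_eq_iff)
    moreover have "i \<in> idx (Suc d) n" if "i \<in> idx (Suc d) m" for i using idx_mono[OF mn] that by auto
    ultimately show ?thesis by (simp add: H_def U_tup)
  qed
  have 1: "integrable M (\<lambda>\<omega>. H (tup n (\<lambda>k. k) \<omega>) * F ((tup d i \<omega>)(Suc d := X (Suc n) \<omega>)))"
    "(\<integral>\<omega>. H (tup n (\<lambda>k. k) \<omega>) * F ((tup d i \<omega>)(Suc d := X (Suc n) \<omega>)) \<partial>M) = 0"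
    if i: "i \<in> idx d n" for i
  proof -
    have l: "lp M p (\<lambda>\<omega>. F (tup (Suc d) (i(Suc d := Suc n)) \<omega>))"
      by (rule kern_lp(1)[OF k inj_upd[OF i]]) auto
    show int: "integrable M (\<lambda>\<omega>. H (tup n (\<lambda>k. k) \<omega>) * F ((tup d i \<omega>)(Suc d := X (Suc n) \<omega>)))"
      using lp_integrable_mult[OF p(1) _ lpU l, of 1] p unfolding HU by (simp add: tup_upd)
    define \<Phi> where "\<Phi> = (\<lambda>(y, x). H y * F ((\<lambda>k\<in>{1..d}. y (i k))(Suc d := x)))"
    have \<Phi>: "\<Phi> \<in> borel_measurable (TS n \<Otimes>\<^sub>M S)"
    proof -
      have "(\<lambda>z. (\<lambda>k\<in>{1..d}. fst z (i k))(Suc d := snd z)) \<in> measurable (TS n \<Otimes>\<^sub>M S) (TS (Suc d))"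
        using measurable_compose[OF measurable_fst comp[OF i]]
        by (rule upd_measurable2) measurable
      thus ?thesis unfolding \<Phi>_def case_prod_beta' by measurable
    qed
    have ti: "(\<lambda>k\<in>{1..d}. tup n (\<lambda>k. k) \<omega> (i k)) = tup d i \<omega>" for \<omega>
      using idx_range[OF i] by (auto simp: tup_def fun_eq_iff)
    have pl: "product_law (TS n) (tup n (\<lambda>k. k)) S (X (Suc n))"
      using indep_tuple[of "Suc n" "\<lambda>k. k" "{1..n}"] by (simp add: tup_def[abs_def])
    have "(\<integral>\<omega>. \<Phi> (tup n (\<lambda>k. k) \<omega>, X (Suc n) \<omega>) \<partial>M) =
        (\<integral>\<omega>. \<integral>\<omega>'. \<Phi> (tup n (\<lambda>k. k) \<omega>, X (Suc n) \<omega>') \<partial>M \<partial>M)"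
      using int by (intro product_law_integral_iterated[OF pl \<Phi>]) (simp only: \<Phi>_def ti prod.case)
    also have "\<dots> = (\<integral>\<omega>. H (tup n (\<lambda>k. k) \<omega>) * last_mean d F (tup d i \<omega>) \<partial>M)"
      by (intro Bochner_Integration.integral_cong refl)
         (simp only: \<Phi>_def ti prod.case integral_mult_right_zero last_mean_eq[OF F tup_space])
    also have "\<dots> = (\<integral>\<omega>. 0 \<partial>M)"
    proof (rule integral_cong_AE)
      have "{x \<in> space (TS d). last_mean d F x = 0} \<in> sets (TS d)" by measurable
      from AE_tup_cong[OF idx_inj_on[OF i] this] have "AE \<omega> in M. last_mean d F (tup d i \<omega>) = 0"
        using dg by (simp add: degen_def)
      thus "AE \<omega> in M. H (tup n (\<lambda>k. k) \<omega>) * last_mean d F (tup d i \<omega>) = 0" by auto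
    qed measurable
    finally show "(\<integral>\<omega>. H (tup n (\<lambda>k. k) \<omega>) * F ((tup d i \<omega>)(Suc d := X (Suc n) \<omega>)) \<partial>M) = 0"
      by (simp only: \<Phi>_def ti prod.case Bochner_Integration.integral_zero)
  qed
  have "expectation (\<lambda>\<omega>. (U (Suc d) F n \<omega> - U (Suc d) F m \<omega>) ^ (p - 1) * incr d F n \<omega>) =
    expectation (\<lambda>\<omega>. \<Sum>i\<in>idx d n. H (tup n (\<lambda>k. k) \<omega>) * F ((tup d i \<omega>)(Suc d := X (Suc n) \<omega>)))"
    by (simp add: HU incr_def sum_distrib_left)
  also have "\<dots> = 0" using 1 by simp
  finally show ?thesis .
qed

text \<open>The martingale bound for the process restarted at time \<open>m\<close>.\<close>

lemma degen_moment_le: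
  assumes q: "q \<ge> 1" "p = 2 * q" and k: "kern p (Suc d) F" and dg: "degen d F" and mn: "m \<le> n"
    and b: "\<And>k. m \<le> k \<Longrightarrow> k < n \<Longrightarrow> expectation (\<lambda>\<omega>. incr d F k \<omega> ^ p) \<le> b" "b \<ge> 0"
  shows "expectation (\<lambda>\<omega>. (U (Suc d) F n \<omega> - U (Suc d) F m \<omega>) ^ p) \<le>
     (2 ^ (p + 1) * exp (2 ^ p)) * real (n - m) ^ q * b"
proof -
  have p: "even p" "p > 0" using q by auto
  have "expectation (\<lambda>\<omega>. (U (Suc d) F (m + (n - m)) \<omega> - U (Suc d) F m \<omega>) ^ p) \<le>
     (2 ^ (p + 1) * exp (2 ^ p)) * real (n - m) ^ q * b"
    by (rule martingale_moment_le[where \<xi> = "\<lambda>k. incr d F (m + k)"])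
       (use q(1) b mn in \<open>auto simp: U_Suc simp del: One_nat_def
          intro!: incr_lp(1)[OF k p] degen_orthogonal[OF k p dg] q(2)\<close>)
  thus ?thesis using mn by simp
qed


lemma product_law_tup: "product_law (TS d) (tup d (\<lambda>k. k)) S (X (Suc d))"
  using indep_tuple[of "Suc d" "\<lambda>k. k" "{1..d}"] by (simp add: tup_def[abs_def])

lemma last_mean_AE_integrable:
  assumes "f \<in> borel_measurable (TS (Suc d))" "integrable M (\<lambda>\<omega>. f (tup (Suc d) (\<lambda>k. k) \<omega>))"
  shows "AE \<omega> in M. integrable M (\<lambda>\<omega>'. f ((tup d (\<lambda>k. k) \<omega>)(Suc d := X (Suc d) \<omega>')))"
    and "integrable M (\<lambda>\<omega>. last_mean d f (tup d (\<lambda>k. k) \<omega>))"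
    and "(\<integral>\<omega>. last_mean d f (tup d (\<lambda>k. k) \<omega>) \<partial>M) = (\<integral>\<omega>. f (tup (Suc d) (\<lambda>k. k) \<omega>) \<partial>M)"
proof -
  note m = section_measurable[OF assms(1)]
  have i: "integrable M (\<lambda>\<omega>. (\<lambda>(y, x). f (y(Suc d := x))) (tup d (\<lambda>k. k) \<omega>, X (Suc d) \<omega>))"
    using assms(2) by (simp add: tup_Suc_id)
  have e: "(\<integral>\<omega>'. (\<lambda>(y, x). f (y(Suc d := x))) (tup d (\<lambda>k. k) \<omega>, X (Suc d) \<omega>') \<partial>M) =
    last_mean d f (tup d (\<lambda>k. k) \<omega>)" if "\<omega> \<in> space M" for \<omega>
    using last_mean_eq[OF assms(1) tup_space[OF that]] by simp
  show "AE \<omega> in M. integrable M (\<lambda>\<omega>'. f ((tup d (\<lambda>k. k) \<omega>)(Suc d := X (Suc d) \<omega>')))"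
    using product_law_AE_integrable[OF product_law_tup m i] by (simp only: prod.case)
  show "integrable M (\<lambda>\<omega>. last_mean d f (tup d (\<lambda>k. k) \<omega>))"
    by (rule iffD1[OF Bochner_Integration.integrable_cong[OF refl e] product_law_integrable_iterated[OF product_law_tup m i]])
  show "(\<integral>\<omega>. last_mean d f (tup d (\<lambda>k. k) \<omega>) \<partial>M) = (\<integral>\<omega>. f (tup (Suc d) (\<lambda>k. k) \<omega>) \<partial>M)"
    using trans[OF product_law_integral_iterated[OF product_law_tup m i] Bochner_Integration.integral_cong[OF refl e]]
    by (simp only: tup_Suc_id prod.case)
qed

text \<open>Conditional Jensen, applied on the almost sure set where the section of the
  \<open>p\<close>-th power of \<open>f\<close> is integrable.\<close>

lemma last_mean_kern:
  assumes k: "kern p (Suc d) f" and p: "even p" "p > 0"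
  shows "kern p d (last_mean d f)" and "kmom p d (last_mean d f) \<le> kmom p (Suc d) f"
proof -
  have m [measurable]: "f \<in> borel_measurable (TS (Suc d))" by (rule kern_measurable[OF k])
  let ?t = "tup d (\<lambda>k. k)"
  have i1: "integrable M (\<lambda>\<omega>. f (tup (Suc d) (\<lambda>k. k) \<omega>))" by (rule kern_integrable[OF k p])
  have i2: "integrable M (\<lambda>\<omega>. (\<lambda>y. f y ^ p) (tup (Suc d) (\<lambda>k. k) \<omega>))" using k by (simp add: kern_def)
  have m2: "(\<lambda>y. f y ^ p) \<in> borel_measurable (TS (Suc d))" by measurable
  have "AE \<omega> in M. last_mean d f (?t \<omega>) ^ p \<le> last_mean d (\<lambda>y. f y ^ p) (?t \<omega>)"
    using last_mean_AE_integrable(1)[OF m2 i2] AE_space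
  proof eventually_elim
    case (elim \<omega>)
    have mm: "(\<lambda>x. f ((?t \<omega>)(Suc d := x))) \<in> borel_measurable S"
      by (rule section_measurable1[OF m tup_space[OF elim(2)]])
    have "lp M p (\<lambda>\<omega>'. f ((?t \<omega>)(Suc d := X (Suc d) \<omega>')))"
      by (rule lpI[OF measurable_compose[OF X_measurable mm] elim(1)])
    from expectation_power_le[OF p this] show ?case
      unfolding last_mean_eq[OF m tup_space[OF elim(2)]] last_mean_eq[OF m2 tup_space[OF elim(2)]] .
  qed
  moreover note i3 = last_mean_AE_integrable(2)[OF m2 i2]
  ultimately have i4: "integrable M (\<lambda>\<omega>. last_mean d f (?t \<omega>) ^ p)"
    by (intro Bochner_Integration.integrable_bound[OF i3])
       (use p in \<open>auto simp: zero_le_even_power elim!: eventually_mono intro: order_trans[OF _ abs_ge_self]\<close>)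
  show "kern p d (last_mean d f)" using i4 last_mean_measurable[OF m] by (simp add: kern_def)
  have "kmom p d (last_mean d f) \<le> (\<integral>\<omega>. last_mean d (\<lambda>y. f y ^ p) (?t \<omega>) \<partial>M)"
    unfolding kmom_def by (intro integral_mono_AE i3 i4) fact
  also have "\<dots> = kmom p (Suc d) f"
    unfolding kmom_def by (rule last_mean_AE_integrable(3)[OF m2 i2])
  finally show "kmom p d (last_mean d f) \<le> kmom p (Suc d) f" .
qed

lemma kern_restrict:
  assumes "kern p d g"
  shows "kern p (Suc d) (\<lambda>w. g (restrict w {1..d}))" "kmom p (Suc d) (\<lambda>w. g (restrict w {1..d})) = kmom p d g"
proof -
  have "(\<lambda>w. restrict w {1..d}) \<in> measurable (TS (Suc d)) (TS d)"
    by (rule measurable_restrict_subset) auto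
  from measurable_compose[OF this kern_measurable[OF assms]]
  show "kern p (Suc d) (\<lambda>w. g (restrict w {1..d}))" using assms unfolding kern_def restrict_tup by simp
  show "kmom p (Suc d) (\<lambda>w. g (restrict w {1..d})) = kmom p d g" unfolding kmom_def restrict_tup ..
qed

lemma kern_diff:
  assumes "kern p d f" "kern p d g" "even p"
  shows "kern p d (\<lambda>w. f w - g w)" "kmom p d (\<lambda>w. f w - g w) \<le> 2 ^ p * (kmom p d f + kmom p d g)"
  using lp_diff[OF assms(3) kern_lp(1)[OF assms(1), of "\<lambda>k. k"] kern_lp(1)[OF assms(2), of "\<lambda>k. k"]]
    kern_measurable[OF assms(1)] kern_measurable[OF assms(2)]
  by (auto simp: kern_def kmom_def lp_def)

lemma restrict_upd_extensional: "y \<in> space (TS d) \<Longrightarrow> restrict (y(Suc d := x)) {1..d} = y"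
  by (auto simp: space_PiM PiE_def extensional_def fun_eq_iff)

lemma incr_restrict: "incr d (\<lambda>w. g (restrict w {1..d})) k \<omega> = U d g k \<omega>"
proof -
  have "restrict ((tup d i \<omega>)(Suc d := x)) {1..d} = tup d i \<omega>" for i x
    by (auto simp: tup_def fun_eq_iff)
  thus ?thesis by (simp add: incr_def U_tup del: restrict_fupd)
qed

text \<open>The mean matters in order \<open>0\<close>: there the kernel is a constant, hence
  \<open>0\<close>. In positive order there are no tuples at time \<open>0\<close>.\<close>

lemma U_0_mean_zero:
  assumes "kern p d f" "even p" "p > 0" "expectation (\<lambda>\<omega>. f (tup d (\<lambda>k. k) \<omega>)) = 0"
  shows "U d f 0 \<omega> = 0" and "d = 0 \<Longrightarrow> U d f n \<omega> = 0"
proof -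
  have "U 0 f n \<omega> = 0" if "d = 0" for n
  proof -
    have "f (tup d (\<lambda>k. k) \<omega>) = f (\<lambda>_. undefined)" for \<omega> using that by (simp add: tup_def restrict_def)
    hence "f (\<lambda>_. undefined) = 0" using assms(4) by (simp add: prob_space)
    thus ?thesis using that by (simp add: U_tup tup_def restrict_def)
  qed
  thus "U d f 0 \<omega> = 0" "d = 0 \<Longrightarrow> U d f n \<omega> = 0" by (cases d; auto)+
qed

text \<open>The bounds are multiplied out with a common upper bound \<open>N\<close> for the sample sizes, so that no
  truncated exponent \<open>d - 1\<close> occurs and the induction on the order can start at \<open>0\<close>.\<close>

lemma U_increment_moment:
  assumes q: "q \<ge> 1" "p = 2 * q"
  shows "\<exists>C\<ge>0. \<forall>f. kern p d f \<longrightarrow> expectation (\<lambda>\<omega>. f (tup d (\<lambda>k. k) \<omega>)) = 0 \<longrightarrow>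
    (\<forall>m n N. m \<le> n \<longrightarrow> n \<le> N \<longrightarrow>
      expectation (\<lambda>\<omega>. (U d f n \<omega> - U d f m \<omega>) ^ p) * real N ^ p \<le> C * real (n - m) ^ q * real N ^ (d * p) * kmom p d f)"
proof (induction d)
  case 0
  have "U 0 f n \<omega> - U 0 f m \<omega> = 0" for f n m \<omega> by (simp add: U_tup)
  then show ?case using q by (intro exI[of _ 0]) (simp only: power_0_left, simp)
next
  case (Suc d)
  have p: "even p" "p > 0" using q by auto
  from Suc obtain C where C: "C \<ge> 0" and IH: "\<And>f m n N. kern p d f \<Longrightarrow> expectation (\<lambda>\<omega>. f (tup d (\<lambda>k. k) \<omega>)) = 0 \<Longrightarrow>
     m \<le> n \<Longrightarrow> n \<le> N \<Longrightarrow> expectation (\<lambda>\<omega>. (U d f n \<omega> - U d f m \<omega>) ^ p) * real N ^ p \<le> C * real (n - m) ^ q * real N ^ (d * p) * kmom p d f"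
    by blast
  define B where "B = 2 ^ (p + 1) * exp (2 ^ p :: real)"
  have B: "B \<ge> 0" by (simp add: B_def)
  define C' where "C' = 2 ^ p * (B * 2 ^ (p + 1) + C)"
  show ?case
  proof (rule exI[of _ C'], intro conjI allI impI)
    show "C' \<ge> 0" using B C by (simp add: C'_def)
    fix f and m n N :: nat
    assume k: "kern p (Suc d) f" and mean: "expectation (\<lambda>\<omega>. f (tup (Suc d) (\<lambda>k. k) \<omega>)) = 0" and mn: "m \<le> n" and nN: "n \<le> N"
    have m [measurable]: "f \<in> borel_measurable (TS (Suc d))" by (rule kern_measurable[OF k])
    have if1: "integrable M (\<lambda>\<omega>. f (tup (Suc d) (\<lambda>k. k) \<omega>))" by (rule kern_integrable[OF k p])
    define g where "g = last_mean d f"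
    have g: "kern p d g" "kmom p d g \<le> kmom p (Suc d) f"
      unfolding g_def by (rule last_mean_kern[OF k p])+
    have gmean: "expectation (\<lambda>\<omega>. g (tup d (\<lambda>k. k) \<omega>)) = 0"
      using last_mean_AE_integrable(3)[OF m if1] mean by (simp add: g_def)
    define F where "F = (\<lambda>w. f w - g (restrict w {1..d}))"
    have F: "kern p (Suc d) F" and Fm: "kmom p (Suc d) F \<le> 2 ^ (p + 1) * kmom p (Suc d) f"
    proof -
      note d = kern_diff[OF k kern_restrict(1)[OF g(1)] p(1)]
      show "kern p (Suc d) F" unfolding F_def by (rule d(1))
      have "kmom p (Suc d) F \<le> 2 ^ p * (kmom p (Suc d) f + kmom p d g)"
        unfolding F_def using d(2) unfolding kern_restrict(2)[OF g(1)] .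
      also have "\<dots> \<le> 2 ^ p * (kmom p (Suc d) f + kmom p (Suc d) f)"
        using g(2) by (intro mult_left_mono add_left_mono) auto
      finally show "kmom p (Suc d) F \<le> 2 ^ (p + 1) * kmom p (Suc d) f" by simp
    qed
    have Fm1 [measurable]: "F \<in> borel_measurable (TS (Suc d))" using F by (rule kern_measurable)
    have dg: "degen d F"
      unfolding degen_def using last_mean_AE_integrable(1)[OF m if1] AE_space
    proof eventually_elim
      case (elim \<omega>)
      let ?t = "tup d (\<lambda>k. k) \<omega>"
      have "last_mean d F ?t = (\<integral>\<omega>'. F (?t(Suc d := X (Suc d) \<omega>')) \<partial>M)"
        by (rule last_mean_eq[OF Fm1 tup_space[OF elim(2)], symmetric])
      also have "\<dots> = (\<integral>\<omega>'. f (?t(Suc d := X (Suc d) \<omega>')) - g ?t \<partial>M)"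
        unfolding F_def restrict_upd_extensional[OF tup_space[OF elim(2)]] ..
      also have "\<dots> = last_mean d f ?t - g ?t"
        by (subst Bochner_Integration.integral_diff[OF elim(1)])
           (auto simp: prob_space intro: last_mean_eq[OF m tup_space[OF elim(2)]])
      finally show ?case by (simp add: g_def)
    qed
    have split: "U (Suc d) f n \<omega> - U (Suc d) f m \<omega> =
        (U (Suc d) F n \<omega> - U (Suc d) F m \<omega>) + (\<Sum>k=m..<n. U d g k \<omega>)" for \<omega>
    proof -
      have inc: "incr d f k \<omega> = incr d F k \<omega> + U d g k \<omega>" for k
        unfolding incr_restrict[of d g, symmetric] incr_def by (simp add: F_def sum.distrib[symmetric] del: restrict_fupd)
      have "U (Suc d) h n \<omega> - U (Suc d) h m \<omega> = (\<Sum>k=m..<n. incr d h k \<omega>)" for h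
        using mn by (induction n) (auto simp: U_Suc le_Suc_eq)
      thus ?thesis by (simp add: inc sum.distrib)
    qed
    have l1: "lp M p (\<lambda>\<omega>. U (Suc d) F n \<omega> - U (Suc d) F m \<omega>)" by (intro lp_diff U_lp F p)
    have l2: "lp M p (\<lambda>\<omega>. \<Sum>k=m..<n. U d g k \<omega>)" by (intro lp_sum(1) U_lp g p) auto
    have kf: "kmom p (Suc d) f \<ge> 0" by (rule kmom_nonneg[OF p(1)])
    have e1: "expectation (\<lambda>\<omega>. (U (Suc d) F n \<omega> - U (Suc d) F m \<omega>) ^ p) \<le>
        B * real (n - m) ^ q * (real N ^ (d * p) * (2 ^ (p + 1) * kmom p (Suc d) f))"
      unfolding B_def
    proof (rule degen_moment_le[OF q F dg mn])
      fix k assume "m \<le> k" "k < n"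
      have "expectation (\<lambda>\<omega>. incr d F k \<omega> ^ p) \<le> real k ^ (d * p) * kmom p (Suc d) F"
        by (rule incr_lp(2)[OF F p])
      also have "\<dots> \<le> real N ^ (d * p) * (2 ^ (p + 1) * kmom p (Suc d) f)"
        using \<open>k < n\<close> nN kf Fm by (intro mult_mono power_mono kmom_nonneg p) auto
      finally show "expectation (\<lambda>\<omega>. incr d F k \<omega> ^ p) \<le> \<dots>" .
    qed (use kf in auto)
    have e2: "expectation (\<lambda>\<omega>. (\<Sum>k=m..<n. U d g k \<omega>) ^ p) * real N ^ p \<le>
       C * real (n - m) ^ q * real N ^ (Suc d * p) * kmom p (Suc d) f"
    proof -
      have "expectation (\<lambda>\<omega>. (\<Sum>k=m..<n. U d g k \<omega>) ^ p) * real N ^ p \<le>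
         (real (n - m) ^ (p - 1) * (\<Sum>k=m..<n. expectation (\<lambda>\<omega>. U d g k \<omega> ^ p))) * real N ^ p"
        using lp_sum(2)[OF p, of "{m..<n}" M "U d g"] U_lp(1)[OF g(1) p] by (intro mult_right_mono) auto
      also have "\<dots> = real (n - m) ^ (p - 1) * (\<Sum>k=m..<n. expectation (\<lambda>\<omega>. U d g k \<omega> ^ p) * real N ^ p)"
        by (simp add: sum_distrib_right)
      also have "\<dots> \<le> real (n - m) ^ (p - 1) * (\<Sum>k=m..<n. C * real N ^ q * real N ^ (d * p) * kmom p (Suc d) f)"
      proof (intro mult_left_mono sum_mono)
        fix k assume kk: "k \<in> {m..<n}"
        have "expectation (\<lambda>\<omega>. U d g k \<omega> ^ p) * real N ^ p \<le> C * real k ^ q * real N ^ (d * p) * kmom p d g"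
          using IH[OF g(1) gmean, of 0 k N] U_0_mean_zero(1)[OF g(1) p gmean] kk nN by simp
        also have "\<dots> \<le> C * real N ^ q * real N ^ (d * p) * kmom p (Suc d) f"
          using kk nN C g kf by (intro mult_mono power_mono kmom_nonneg p) auto
        finally show "expectation (\<lambda>\<omega>. U d g k \<omega> ^ p) * real N ^ p \<le> \<dots>" .
      qed auto
      also have "\<dots> = real (n - m) ^ p * (C * real N ^ q * real N ^ (d * p) * kmom p (Suc d) f)"
        using power_minus_mult[OF p(2), of "real (n - m)"] by simp
      \<comment> \<open>The drift adds up \<open>n - m\<close> terms, each of which carries
        \<open>real N ^ q\<close> from the induction hypothesis. Only half of the power of
        \<open>n - m\<close> has to be kept; the other half is weakened to a second factor
        \<open>real N ^ q\<close>.\<close>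
      also have "real (n - m) ^ p = real (n - m) ^ q * real (n - m) ^ q"
        by (simp add: q(2) mult_2 power_add)
      also have "real (n - m) ^ q * real (n - m) ^ q * (C * real N ^ q * real N ^ (d * p) * kmom p (Suc d) f) \<le>
          real (n - m) ^ q * real N ^ q * (C * real N ^ q * real N ^ (d * p) * kmom p (Suc d) f)"
        using nN C kf by (intro mult_right_mono mult_left_mono power_mono) auto
      also have "\<dots> = C * real (n - m) ^ q * (real N ^ q * real N ^ q * real N ^ (d * p)) * kmom p (Suc d) f"
        by (simp add: mult_ac)
      also have "real N ^ q * real N ^ q * real N ^ (d * p) = real N ^ (Suc d * p)"
        by (simp add: q(2) flip: power_add)
      finally show ?thesis .
    qed
    have "expectation (\<lambda>\<omega>. (U (Suc d) f n \<omega> - U (Suc d) f m \<omega>) ^ p) * real N ^ p \<le>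
      2 ^ p * (expectation (\<lambda>\<omega>. (U (Suc d) F n \<omega> - U (Suc d) F m \<omega>) ^ p) + expectation (\<lambda>\<omega>. (\<Sum>k=m..<n. U d g k \<omega>) ^ p)) * real N ^ p"
      unfolding split using lp_add(2)[OF p(1) l1 l2] by (intro mult_right_mono) auto
    also have "\<dots> = 2 ^ p * (expectation (\<lambda>\<omega>. (U (Suc d) F n \<omega> - U (Suc d) F m \<omega>) ^ p) * real N ^ p +
        expectation (\<lambda>\<omega>. (\<Sum>k=m..<n. U d g k \<omega>) ^ p) * real N ^ p)" by (simp add: algebra_simps)
    also have "\<dots> \<le> 2 ^ p * (B * real (n - m) ^ q * (real N ^ (d * p) * (2 ^ (p + 1) * kmom p (Suc d) f)) * real N ^ p +
        C * real (n - m) ^ q * real N ^ (Suc d * p) * kmom p (Suc d) f)"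
      using e1 e2 by (intro mult_left_mono add_mono mult_right_mono) auto
    also have "\<dots> = C' * real (n - m) ^ q * real N ^ (Suc d * p) * kmom p (Suc d) f"
      by (simp add: C'_def algebra_simps power_add)
    finally show "expectation (\<lambda>\<omega>. (U (Suc d) f n \<omega> - U (Suc d) f m \<omega>) ^ p) * real N ^ p \<le> \<dots>" .
  qed
qed

end

subsection \<open>Hoeffding projections\<close>

text \<open>The coefficient counts the increasing tuples with the index \<open>Suc k\<close> in
  position \<open>j\<close>: \<open>j - 1\<close> smaller indices out of \<open>k\<close>, and
  \<open>d - j\<close> larger ones out of \<open>n - 1 - k\<close>.\<close>

definition lin_sum :: "nat \<Rightarrow> nat \<Rightarrow> (nat \<Rightarrow> nat \<Rightarrow> real) \<Rightarrow> real" where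
  "lin_sum d n h = (\<Sum>k<n. \<Sum>j=1..d. real (k choose (j - 1)) * real ((n - 1 - k) choose (d - j)) * h j k)"

text \<open>Pascal's rule in \<open>n - 1 - k\<close>: the positions up to \<open>d\<close> come
  from the sums of order \<open>d\<close> at earlier times, and only the last position brings in a
  new term. This matches the recursion of \<open>U\<close> over its increments.\<close>

lemma lin_sum_Suc: "lin_sum (Suc d) n h = (\<Sum>k<n. lin_sum d k h + real (k choose d) * h (Suc d) k)"
proof (induction n)
  case 0
  then show ?case by (simp add: lin_sum_def)
next
  case (Suc n)
  define a where "a = (\<lambda>k j. real (k choose (j - 1)) * real ((n - k) choose (Suc d - j)) * h j k)"
  define b where "b = (\<lambda>k j. real (k choose (j - 1)) * real ((n - 1 - k) choose (Suc d - j)) * h j k)"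
  have top: "(\<Sum>j=1..Suc d. a n j) = real (n choose d) * h (Suc d) n"
  proof -
    \<comment> \<open>At \<open>k = n\<close> no larger index is left, so
      \<open>0 choose (Suc d - j)\<close> kills every position but the last.\<close>
    have "a n j = 0" if "j \<in> {1..d}" for j
      using that by (simp add: a_def Suc_diff_le)
    hence "(\<Sum>j=1..d. a n j) = 0" by (rule sum.neutral[OF ballI])
    moreover have "(\<Sum>j=1..Suc d. a n j) = (\<Sum>j=1..d. a n j) + a n (Suc d)" by simp
    ultimately show ?thesis by (simp only:) (simp add: a_def)
  qed
  have "(\<Sum>j=1..Suc d. a k j) - (\<Sum>j=1..Suc d. b k j) =
      (\<Sum>j=1..d. real (k choose (j - 1)) * real ((n - 1 - k) choose (d - j)) * h j k)" if "k < n" for k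
  proof -
    have nk: "n - k = Suc (n - 1 - k)" using that by simp
    have "a k j - b k j = real (k choose (j - 1)) * real ((n - 1 - k) choose (d - j)) * h j k" if "j \<in> {1..d}" for j
      using that unfolding a_def b_def nk by (simp add: Suc_diff_le algebra_simps)
    hence "(\<Sum>j=1..d. a k j - b k j) = (\<Sum>j=1..d. real (k choose (j - 1)) * real ((n - 1 - k) choose (d - j)) * h j k)"
      by (rule sum.cong[OF refl])
    moreover have "a k (Suc d) = b k (Suc d)" by (simp add: a_def b_def)
    ultimately show ?thesis by (simp add: sum_subtractf)
  qed
  hence "(\<Sum>k<n. \<Sum>j=1..Suc d. a k j) - (\<Sum>k<n. \<Sum>j=1..Suc d. b k j) = lin_sum d n h"
    unfolding lin_sum_def by (subst sum_subtractf[symmetric]) (rule sum.cong, simp_all only: lessThan_iff)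
  moreover have "lin_sum (Suc d) (Suc n) h = (\<Sum>k<n. \<Sum>j=1..Suc d. a k j) + (\<Sum>j=1..Suc d. a n j)"
    by (simp add: lin_sum_def a_def)
  moreover have "lin_sum (Suc d) n h = (\<Sum>k<n. \<Sum>j=1..Suc d. b k j)"
    by (simp add: lin_sum_def b_def)
  ultimately show ?case using Suc top by simp
qed

lemma lin_sum_cong:
  assumes "\<And>j k. j \<in> {1..d} \<Longrightarrow> k < n \<Longrightarrow> h j k = h' j k"
  shows "lin_sum d n h = lin_sum d n h'"
  using assms by (simp add: lin_sum_def)

context iid_seq begin

text \<open>Left uncentred, unlike \<open>kernel_proj\<close>, so that it combines with
  \<open>last_mean\<close> and can be applied to powers of a kernel; the centring is done in the
  kernel instead.\<close>

definition proj :: "nat \<Rightarrow> ((nat \<Rightarrow> 's) \<Rightarrow> real) \<Rightarrow> nat \<Rightarrow> 's \<Rightarrow> real" where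
  "proj d f j x = (\<integral>\<omega>. f (\<lambda>k\<in>{1..d}. if k = j then x else X k \<omega>) \<partial>M)"

lemma proj_upd:
  assumes "j \<in> {1..d}"
  shows "proj d f j x = (\<integral>\<omega>. f ((tup d (\<lambda>k. k) \<omega>)(j := x)) \<partial>M)"
proof -
  have "(\<lambda>k\<in>{1..d}. if k = j then x else X k \<omega>) = (tup d (\<lambda>k. k) \<omega>)(j := x)" for \<omega>
    using assms by (auto simp: tup_def fun_eq_iff)
  thus ?thesis by (simp only: proj_def)
qed

lemma proj_last: "proj (Suc d) f (Suc d) x = (\<integral>\<omega>. f ((tup d (\<lambda>k. k) \<omega>)(Suc d := x)) \<partial>M)"
proof -
  have "(\<lambda>k\<in>{1..Suc d}. if k = Suc d then x else X k \<omega>) = (tup d (\<lambda>k. k) \<omega>)(Suc d := x)" for \<omega>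
    by (auto simp: tup_def fun_eq_iff)
  thus ?thesis by (simp only: proj_def)
qed

lemma upd_component_measurable:
  assumes "j \<in> {1..d}"
  shows "(\<lambda>(y, x). y(j := x)) \<in> measurable (TS d \<Otimes>\<^sub>M S) (TS d)"
  unfolding case_prod_beta'
  by (rule measurable_fun_upd[where J="{1..d}"]) (use assms in auto)

lemma
  assumes f: "f \<in> borel_measurable (TS d)" and i: "integrable M (\<lambda>\<omega>. f (tup d (\<lambda>k. k) \<omega>))" and j: "j \<in> {1..d}"
  shows proj_measurable: "proj d f j \<in> borel_measurable S"
    and proj_AE_integrable: "AE \<omega>' in M. integrable M (\<lambda>\<omega>. f ((tup d (\<lambda>k. k) \<omega>)(j := X 0 \<omega>')))"
    and proj_integrable: "integrable M (\<lambda>\<omega>. proj d f j (X l \<omega>))"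
    and proj_integral: "(\<integral>\<omega>. proj d f j (X l \<omega>) \<partial>M) = (\<integral>\<omega>. f (tup d (\<lambda>k. k) \<omega>) \<partial>M)"
proof -
  have m: "(\<lambda>(y, x). f (y(j := x))) \<in> borel_measurable (TS d \<Otimes>\<^sub>M S)"
    using measurable_compose[OF upd_component_measurable[OF j] f] by (simp add: case_prod_beta')
  have "(\<lambda>(x, \<omega>). (tup d (\<lambda>k. k) \<omega>, x)) \<in> measurable (S \<Otimes>\<^sub>M M) (TS d \<Otimes>\<^sub>M S)" by measurable
  from measurable_compose[OF this m]
  have "(\<lambda>(x, \<omega>). f ((tup d (\<lambda>k. k) \<omega>)(j := x))) \<in> borel_measurable (S \<Otimes>\<^sub>M M)"
    by (simp add: case_prod_beta')
  from borel_measurable_lebesgue_integral[OF this]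
  show pm: "proj d f j \<in> borel_measurable S"
    by (subst measurable_cong[OF proj_upd[OF j]])
  \<comment> \<open>Index \<open>0\<close> in position \<open>j\<close> keeps the indices distinct,
    so resampling this argument does not change the law of the tuple.\<close>
  define i0 where "i0 = (\<lambda>k. k)(j := 0::nat)"
  have i0: "inj_on i0 {1..d}" by (auto simp: i0_def inj_on_def)
  have pl: "product_law (TS d) (tup d (\<lambda>k. k)) S (X 0)"
    using indep_tuple[of 0 "\<lambda>k. k" "{1..d}"] by (simp add: tup_def[abs_def])
  have t0: "(tup d (\<lambda>k. k) \<omega>)(j := X 0 \<omega>) = tup d i0 \<omega>" for \<omega>
    using j by (auto simp: tup_def fun_eq_iff i0_def)
  have int: "integrable M (\<lambda>\<omega>. (\<lambda>(y, x). f (y(j := x))) (tup d (\<lambda>k. k) \<omega>, X 0 \<omega>))"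
    unfolding prod.case t0 using integrable_tuple_cong[OF _ i0 _ f, of "\<lambda>k. k"] i by (simp add: tup_def)
  show "AE \<omega>' in M. integrable M (\<lambda>\<omega>. f ((tup d (\<lambda>k. k) \<omega>)(j := X 0 \<omega>')))"
    using product_law_AE_integrable'[OF pl m int] by (simp only: prod.case)
  have i0': "integrable M (\<lambda>\<omega>. proj d f j (X 0 \<omega>))"
    using product_law_integrable_iterated'[OF pl m int] by (simp only: prod.case proj_upd[OF j])
  thus "integrable M (\<lambda>\<omega>. proj d f j (X l \<omega>))" using integrable_X_cong[OF pm] by blast
  have "(\<integral>\<omega>. proj d f j (X l \<omega>) \<partial>M) = (\<integral>\<omega>. proj d f j (X 0 \<omega>) \<partial>M)"
    by (rule integral_X_cong[OF pm])
  also have "\<dots> = (\<integral>\<omega>. f ((tup d (\<lambda>k. k) \<omega>)(j := X 0 \<omega>)) \<partial>M)"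
    using product_law_integral_iterated'[OF pl m int] by (simp only: prod.case proj_upd[OF j])
  also have "\<dots> = (\<integral>\<omega>. f (tup d (\<lambda>k. k) \<omega>) \<partial>M)"
    unfolding t0 using integral_tuple_cong[OF _ i0 _ f, of "\<lambda>k. k"] by (simp add: tup_def)
  finally show "(\<integral>\<omega>. proj d f j (X l \<omega>) \<partial>M) = \<dots>" .
qed

lemma AE_X_cong:
  assumes "{x \<in> space S. \<phi> x} \<in> sets S" "AE \<omega> in M. \<phi> (X 0 \<omega>)"
  shows "AE \<omega> in M. \<phi> (X l \<omega>)"
  using AE_distr_iff[OF X_measurable[of l] assms(1)] AE_distr_iff[OF X_measurable[of 0] assms(1)] assms(2)
  unfolding ident[of l] by simp

lemma proj_lp:
  assumes k: "kern p d f" and p: "even p" "p > 0" and j: "j \<in> {1..d}"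
  shows "lp M p (\<lambda>\<omega>. proj d f j (X l \<omega>))" "expectation (\<lambda>\<omega>. proj d f j (X l \<omega>) ^ p) \<le> kmom p d f"
proof -
  have m [measurable]: "f \<in> borel_measurable (TS d)" by (rule kern_measurable[OF k])
  have i1: "integrable M (\<lambda>\<omega>. f (tup d (\<lambda>k. k) \<omega>))" by (rule kern_integrable[OF k p])
  have i2: "integrable M (\<lambda>\<omega>. (\<lambda>y. f y ^ p) (tup d (\<lambda>k. k) \<omega>))" using k by (simp add: kern_def)
  have m2: "(\<lambda>y. f y ^ p) \<in> borel_measurable (TS d)" by measurable
  note [measurable] = proj_measurable[OF m i1 j] proj_measurable[OF m2 i2 j]
  have "AE \<omega>' in M. proj d f j (X 0 \<omega>') ^ p \<le> proj d (\<lambda>y. f y ^ p) j (X 0 \<omega>')"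
    using proj_AE_integrable[OF m2 i2 j] AE_space
  proof eventually_elim
    case (elim \<omega>')
    have "X 0 \<omega>' \<in> space S" using elim(2) measurable_space[OF X_measurable] by blast
    hence "(\<lambda>y. y(j := X 0 \<omega>')) \<in> measurable (TS d) (TS d)"
      using measurable_compose[OF measurable_Pair2' upd_component_measurable[OF j]] by simp
    hence "(\<lambda>\<omega>. f ((tup d (\<lambda>k. k) \<omega>)(j := X 0 \<omega>'))) \<in> borel_measurable M"
      by measurable
    hence "lp M p (\<lambda>\<omega>. f ((tup d (\<lambda>k. k) \<omega>)(j := X 0 \<omega>')))"
      by (rule lpI) (rule elim(1))
    from expectation_power_le[OF p this] show ?case by (simp only: proj_upd[OF j])
  qed
  hence le: "AE \<omega>' in M. proj d f j (X l \<omega>') ^ p \<le> proj d (\<lambda>y. f y ^ p) j (X l \<omega>')"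
    by (rule AE_X_cong[rotated]) measurable
  note i3 = proj_integrable[OF m2 i2 j, of l]
  have i4: "integrable M (\<lambda>\<omega>. proj d f j (X l \<omega>) ^ p)"
    by (rule Bochner_Integration.integrable_bound[OF i3])
       (use le p in \<open>auto simp: zero_le_even_power elim!: eventually_mono intro: order_trans[OF _ abs_ge_self]\<close>)
  show "lp M p (\<lambda>\<omega>. proj d f j (X l \<omega>))" using i4 by (intro lpI) auto
  have "expectation (\<lambda>\<omega>. proj d f j (X l \<omega>) ^ p) \<le> (\<integral>\<omega>. proj d (\<lambda>y. f y ^ p) j (X l \<omega>) \<partial>M)"
    by (intro integral_mono_AE i3 i4 le)
  also have "\<dots> = kmom p d f" unfolding kmom_def by (rule proj_integral[OF m2 i2 j])
  finally show "expectation (\<lambda>\<omega>. proj d f j (X l \<omega>) ^ p) \<le> kmom p d f" .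
qed

text \<open>Tower property: averaging out the last argument commutes with fixing the argument in
  position \<open>j\<close>. It is claimed almost surely, because the section through a given
  \<open>x\<close> need not be integrable.\<close>

lemma proj_last_mean:
  assumes f: "f \<in> borel_measurable (TS (Suc d))" and i: "integrable M (\<lambda>\<omega>. f (tup (Suc d) (\<lambda>k. k) \<omega>))" and j: "j \<in> {1..d}"
  shows "AE \<omega> in M. proj (Suc d) f j (X l \<omega>) = proj d (last_mean d f) j (X l \<omega>)"
proof (rule AE_X_cong)
  have j': "j \<in> {1..Suc d}" "j \<noteq> Suc d" using j by auto
  note [measurable] = proj_measurable[OF f i j'(1)]
    proj_measurable[OF last_mean_measurable[OF f] last_mean_AE_integrable(2)[OF f i] j]
  show "{x \<in> space S. proj (Suc d) f j x = proj d (last_mean d f) j x} \<in> sets S" by measurable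
  show "AE \<omega> in M. proj (Suc d) f j (X 0 \<omega>) = proj d (last_mean d f) j (X 0 \<omega>)"
    using proj_AE_integrable[OF f i j'(1)] AE_space
  proof eventually_elim
    case (elim \<omega>')
    define x where "x = X 0 \<omega>'"
    have x: "x \<in> space S" using elim(2) measurable_space[OF X_measurable] by (auto simp: x_def)
    have u [measurable]: "(\<lambda>y. y(j := x)) \<in> measurable (TS d) (TS d)"
      using measurable_compose[OF measurable_Pair2'[OF x] upd_component_measurable[OF j]] by simp
    have tw: "(tup (Suc d) (\<lambda>k. k) \<omega>)(j := x) = (tup d (\<lambda>k. k) \<omega>)(j := x, Suc d := X (Suc d) \<omega>)" for \<omega>
      unfolding tup_Suc_id using j'(2) by (rule fun_upd_twist[symmetric])
    define \<Phi> where "\<Phi> = (\<lambda>(y, z). f (y(j := x, Suc d := z)))"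
    have m: "\<Phi> \<in> borel_measurable (TS d \<Otimes>\<^sub>M S)"
    proof -
      have "(\<lambda>(y, z). (y(j := x), z)) \<in> measurable (TS d \<Otimes>\<^sub>M S) (TS d \<Otimes>\<^sub>M S)" by measurable
      from measurable_compose[OF this section_measurable[OF f]] show ?thesis
        by (simp add: \<Phi>_def case_prod_beta' del: fun_upd_apply)
    qed
    have int: "integrable M (\<lambda>\<omega>. \<Phi> (tup d (\<lambda>k. k) \<omega>, X (Suc d) \<omega>))"
      using elim(1) by (simp only: \<Phi>_def prod.case tw x_def[symmetric])
    have sp: "(tup d (\<lambda>k. k) \<omega>)(j := x) \<in> space (TS d)" if "\<omega> \<in> space M" for \<omega>
      using measurable_space[OF u tup_space[OF that]] .
    have "proj (Suc d) f j x = (\<integral>\<omega>. \<Phi> (tup d (\<lambda>k. k) \<omega>, X (Suc d) \<omega>) \<partial>M)"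
      by (simp only: proj_upd[OF j'(1)] \<Phi>_def prod.case tw)
    also have "\<dots> = (\<integral>\<omega>. \<integral>\<omega>'. \<Phi> (tup d (\<lambda>k. k) \<omega>, X (Suc d) \<omega>') \<partial>M \<partial>M)"
      by (rule product_law_integral_iterated[OF product_law_tup m int])
    also have "\<dots> = (\<integral>\<omega>. last_mean d f ((tup d (\<lambda>k. k) \<omega>)(j := x)) \<partial>M)"
      by (intro Bochner_Integration.integral_cong refl) (simp only: \<Phi>_def prod.case last_mean_eq[OF f sp])
    also have "\<dots> = proj d (last_mean d f) j x" by (simp only: proj_upd[OF j])
    finally show ?case by (simp add: x_def)
  qed
qed


text \<open>For a kernel of mean zero this is the Hajek projection of \<open>U d f n\<close>, the
  first-order part of its Hoeffding decomposition.\<close>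

definition linpart :: "nat \<Rightarrow> ((nat \<Rightarrow> 's) \<Rightarrow> real) \<Rightarrow> nat \<Rightarrow> 'a \<Rightarrow> real" where
  "linpart d f n \<omega> = lin_sum d n (\<lambda>j k. proj d f j (X (Suc k) \<omega>))"

lemma linpart_lp:
  assumes "kern p d f" "even p" "p > 0"
  shows "lp M p (linpart d f n)"
  unfolding linpart_def[abs_def] lin_sum_def
  by (intro lp_sum(1)[OF assms(2,3)] lp_cmult proj_lp(1)[OF assms]) auto

lemma linpart_Suc:
  assumes "kern 2 (Suc d) f"
  shows "AE \<omega> in M. linpart (Suc d) f n \<omega> =
    (\<Sum>k<n. linpart d (last_mean d f) k \<omega> + real (k choose d) * proj (Suc d) f (Suc d) (X (Suc k) \<omega>))"
proof -
  have "AE \<omega> in M. \<forall>k. \<forall>j\<in>{1..d}. proj (Suc d) f j (X (Suc k) \<omega>) = proj d (last_mean d f) j (X (Suc k) \<omega>)"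
    using kern_integrable[OF assms]
    by (intro AE_all_countable[THEN iffD2] allI AE_finite_allI proj_last_mean kern_measurable[OF assms]) auto
  thus ?thesis
  proof eventually_elim
    case (elim \<omega>)
    have "lin_sum d k (\<lambda>j k. proj (Suc d) f j (X (Suc k) \<omega>)) =
        lin_sum d k (\<lambda>j k. proj d (last_mean d f) j (X (Suc k) \<omega>))" for k
      using elim by (intro lin_sum_cong) auto
    thus ?case by (simp add: linpart_def lin_sum_Suc)
  qed
qed

text \<open>\<open>F\<close> has lost both its conditional mean given the first \<open>d\<close>
  arguments and its projection on the last one, so it averages to zero in two ways: over the last
  argument, which makes \<open>U (Suc d) F\<close> a martingale, and over the first \<open>d\<close>
  with the last one frozen, which makes each increment a statistic of order \<open>d\<close> with a
  kernel of mean zero.\<close>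

lemma linear_approx_step_mean:
  fixes d f
  defines "F \<equiv> (\<lambda>w. f w - last_mean d f (restrict w {1..d}) - proj (Suc d) f (Suc d) (w (Suc d)))"
  assumes k: "kern 2 (Suc d) f" and mean: "expectation (\<lambda>\<omega>. f (tup (Suc d) (\<lambda>k. k) \<omega>)) = 0"
  shows "kern 2 (Suc d) F" "kmom 2 (Suc d) F \<le> 36 * kmom 2 (Suc d) f" "degen d F"
    "AE \<omega>' in M. integrable M (\<lambda>\<omega>. F ((tup d (\<lambda>k. k) \<omega>)(Suc d := X 0 \<omega>'))) \<and>
       (\<integral>\<omega>. F ((tup d (\<lambda>k. k) \<omega>)(Suc d := X 0 \<omega>')) \<partial>M) = 0"
proof -
  have p: "even (2::nat)" "(2::nat) > 0" by auto
  have m [measurable]: "f \<in> borel_measurable (TS (Suc d))" by (rule kern_measurable[OF k])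
  have if1: "integrable M (\<lambda>\<omega>. f (tup (Suc d) (\<lambda>k. k) \<omega>))" by (rule kern_integrable[OF k p])
  define g where "g = last_mean d f"
  define f2 where "f2 = proj (Suc d) f (Suc d)"
  have Sd: "Suc d \<in> {1..Suc d}" by auto
  note f2m [measurable] = proj_measurable[OF m if1 Sd, folded f2_def]
  have g: "kern 2 d g" "kmom 2 d g \<le> kmom 2 (Suc d) f"
    unfolding g_def by (rule last_mean_kern[OF k p])+
  have gi: "integrable M (\<lambda>\<omega>. g (tup d (\<lambda>k. k) \<omega>))" by (rule kern_integrable[OF g(1) p])
  have gmean: "expectation (\<lambda>\<omega>. g (tup d (\<lambda>k. k) \<omega>)) = 0"
    using last_mean_AE_integrable(3)[OF m if1] mean by (simp add: g_def)
  have f2mean: "expectation (\<lambda>\<omega>. f2 (X l \<omega>)) = 0" and f2int: "integrable M (\<lambda>\<omega>. f2 (X l \<omega>))" for l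
    using proj_integral[OF m if1 Sd] proj_integrable[OF m if1 Sd] mean by (simp_all add: f2_def)
  have tlast: "tup (Suc d) (\<lambda>k. k) \<omega> (Suc d) = X (Suc d) \<omega>" for \<omega> by (simp add: tup_def)
  have f2k: "kern 2 (Suc d) (\<lambda>w. f2 (w (Suc d)))" "kmom 2 (Suc d) (\<lambda>w. f2 (w (Suc d))) \<le> kmom 2 (Suc d) f"
  proof -
    have "(\<lambda>w. f2 (w (Suc d))) \<in> borel_measurable (TS (Suc d))"
      using Sd by measurable
    thus "kern 2 (Suc d) (\<lambda>w. f2 (w (Suc d)))"
      using proj_lp(1)[OF k p Sd, of "Suc d"] by (simp add: kern_def lp_def f2_def tlast)
    show "kmom 2 (Suc d) (\<lambda>w. f2 (w (Suc d))) \<le> kmom 2 (Suc d) f"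
      using proj_lp(2)[OF k p Sd, of "Suc d"] unfolding kmom_def tlast f2_def .
  qed
  have F_eq: "F = (\<lambda>w. (f w - g (restrict w {1..d})) - f2 (w (Suc d)))"
    by (simp add: F_def g_def f2_def)
  note d1 = kern_diff[OF k kern_restrict(1)[OF g(1)] p(1)]
  note d2 = kern_diff[OF d1(1) f2k(1) p(1)]
  show Fk: "kern 2 (Suc d) F" unfolding F_eq by (rule d2(1))
  \<comment> \<open>\<open>36 = 4 * (4 * (1 + 1) + 1)\<close>: two subtractions, each costing the
    factor \<open>2 ^ 2\<close> of \<open>kern_diff\<close>.\<close>
  have "kmom 2 (Suc d) (\<lambda>w. f w - g (restrict w {1..d})) \<le> 4 * (kmom 2 (Suc d) f + kmom 2 (Suc d) f)"
    using d1(2) g(2) unfolding kern_restrict(2)[OF g(1)] by simp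
  thus "kmom 2 (Suc d) F \<le> 36 * kmom 2 (Suc d) f"
    unfolding F_eq using d2(2) f2k(2) by simp
  have Fm [measurable]: "F \<in> borel_measurable (TS (Suc d))" using Fk by (rule kern_measurable)
  have F_upd: "F ((tup d (\<lambda>k. k) \<omega>)(Suc d := x)) = f ((tup d (\<lambda>k. k) \<omega>)(Suc d := x)) - g (tup d (\<lambda>k. k) \<omega>) - f2 x" for \<omega> x
  proof -
    have "restrict ((tup d (\<lambda>k. k) \<omega>)(Suc d := x)) {1..d} = tup d (\<lambda>k. k) \<omega>"
      by (auto simp: tup_def fun_eq_iff)
    thus ?thesis by (simp only: F_eq fun_upd_same)
  qed
  show "degen d F"
    unfolding degen_def using last_mean_AE_integrable(1)[OF m if1] AE_space
  proof eventually_elim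
    case (elim \<omega>)
    let ?t = "tup d (\<lambda>k. k) \<omega>"
    have "last_mean d F ?t = (\<integral>\<omega>'. F (?t(Suc d := X (Suc d) \<omega>')) \<partial>M)"
      by (rule last_mean_eq[OF Fm tup_space[OF elim(2)], symmetric])
    also have "\<dots> = (\<integral>\<omega>'. f (?t(Suc d := X (Suc d) \<omega>')) - g ?t - f2 (X (Suc d) \<omega>') \<partial>M)"
      unfolding F_upd ..
    also have "\<dots> = (\<integral>\<omega>'. f (?t(Suc d := X (Suc d) \<omega>')) - g ?t \<partial>M) - (\<integral>\<omega>'. f2 (X (Suc d) \<omega>') \<partial>M)"
      by (intro Bochner_Integration.integral_diff Bochner_Integration.integrable_diff elim(1) f2int) simp
    also have "\<dots> = (\<integral>\<omega>'. f (?t(Suc d := X (Suc d) \<omega>')) \<partial>M) - g ?t"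
      unfolding f2mean by (subst Bochner_Integration.integral_diff[OF elim(1)]) (auto simp: prob_space)
    also have "\<dots> = last_mean d f ?t - g ?t"
      by (simp only: last_mean_eq[OF m tup_space[OF elim(2)]])
    finally show ?case by (simp add: g_def)
  qed
  show "AE \<omega>' in M. integrable M (\<lambda>\<omega>. F ((tup d (\<lambda>k. k) \<omega>)(Suc d := X 0 \<omega>'))) \<and>
       (\<integral>\<omega>. F ((tup d (\<lambda>k. k) \<omega>)(Suc d := X 0 \<omega>')) \<partial>M) = 0"
    using proj_AE_integrable[OF m if1 Sd]
  proof eventually_elim
    case (elim \<omega>')
    let ?x = "X 0 \<omega>'"
    have tw: "(tup (Suc d) (\<lambda>k. k) \<omega>)(Suc d := ?x) = (tup d (\<lambda>k. k) \<omega>)(Suc d := ?x)" for \<omega>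
      unfolding tup_Suc_id by simp
    note e = elim[unfolded tw]
    have i2: "integrable M (\<lambda>\<omega>. f ((tup d (\<lambda>k. k) \<omega>)(Suc d := ?x)) - g (tup d (\<lambda>k. k) \<omega>))"
      by (intro Bochner_Integration.integrable_diff e gi)
    have i3: "integrable M (\<lambda>\<omega>. F ((tup d (\<lambda>k. k) \<omega>)(Suc d := ?x)))"
      unfolding F_upd by (intro Bochner_Integration.integrable_diff i2) simp
    have "(\<integral>\<omega>. F ((tup d (\<lambda>k. k) \<omega>)(Suc d := ?x)) \<partial>M) =
        (\<integral>\<omega>. f ((tup d (\<lambda>k. k) \<omega>)(Suc d := ?x)) - g (tup d (\<lambda>k. k) \<omega>) \<partial>M) - f2 ?x"
      unfolding F_upd by (subst Bochner_Integration.integral_diff[OF i2]) (auto simp: prob_space)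
    also have "\<dots> = 0"
      unfolding Bochner_Integration.integral_diff[OF e gi] gmean f2_def proj_last by simp
    finally show ?case using i3 by simp
  qed
qed

text \<open>In the step from \<open>d\<close> to \<open>Suc d\<close>, an increment for the doubly
  centred \<open>F\<close> has second moment of order \<open>2 * d - 1\<close> in \<open>N\<close>,
  one less than for a merely degenerate kernel, and \<open>N\<close> orthogonal increments give
  order \<open>2 * d\<close>. Hence a statistic of order \<open>d \<ge> 1\<close> has a nonlinear
  remainder of size \<open>N ^ (d - 1)\<close> in mean square, below the order
  \<open>d - 1/2\<close> of the linear part. The conditional mean has lower order and is left to the
  induction.\<close>

lemma U_linear_approx:
  "\<exists>C\<ge>0. \<forall>f. kern 2 d f \<longrightarrow> expectation (\<lambda>\<omega>. f (tup d (\<lambda>k. k) \<omega>)) = 0 \<longrightarrow>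
    (\<forall>n N. n \<le> N \<longrightarrow>
      expectation (\<lambda>\<omega>. (U d f n \<omega> - linpart d f n \<omega>) ^ 2) * real N ^ 2 \<le> C * real N ^ (d * 2) * kmom 2 d f)"
proof (induction d)
  case 0
  have "expectation (\<lambda>\<omega>. (U 0 f n \<omega> - linpart 0 f n \<omega>) ^ 2) = 0"
    if "kern 2 0 f" "expectation (\<lambda>\<omega>. f (tup 0 (\<lambda>k. k) \<omega>)) = 0" for f n
  proof -
    have "U 0 f n \<omega> - linpart 0 f n \<omega> = 0" for \<omega>
      using U_0_mean_zero(2)[OF that(1) _ _ that(2)] by (simp add: linpart_def lin_sum_def)
    thus ?thesis by simp
  qed
  then show ?case by (intro exI[of _ 0]) auto
next
  case (Suc d)
  have p: "even (2::nat)" "(2::nat) > 0" by auto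
  from Suc obtain C where C: "C \<ge> 0" and IH: "\<And>f n N. kern 2 d f \<Longrightarrow> expectation (\<lambda>\<omega>. f (tup d (\<lambda>k. k) \<omega>)) = 0 \<Longrightarrow>
     n \<le> N \<Longrightarrow> expectation (\<lambda>\<omega>. (U d f n \<omega> - linpart d f n \<omega>) ^ 2) * real N ^ 2 \<le> C * real N ^ (d * 2) * kmom 2 d f"
    by blast
  have "\<exists>C\<ge>0. \<forall>f. kern 2 d f \<longrightarrow> expectation (\<lambda>\<omega>. f (tup d (\<lambda>k. k) \<omega>)) = 0 \<longrightarrow>
    (\<forall>m n N. m \<le> n \<longrightarrow> n \<le> N \<longrightarrow>
      expectation (\<lambda>\<omega>. (U d f n \<omega> - U d f m \<omega>) ^ 2) * real N ^ 2 \<le> C * real (n - m) ^ 1 * real N ^ (d * 2) * kmom 2 d f)"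
    by (rule U_increment_moment) auto
  from this[unfolded power_one_right] obtain C1 where C1: "C1 \<ge> 0" and I1: "\<And>f m n N. kern 2 d f \<Longrightarrow> expectation (\<lambda>\<omega>. f (tup d (\<lambda>k. k) \<omega>)) = 0 \<Longrightarrow>
     m \<le> n \<Longrightarrow> n \<le> N \<Longrightarrow> expectation (\<lambda>\<omega>. (U d f n \<omega> - U d f m \<omega>) ^ 2) * real N ^ 2 \<le> C1 * real (n - m) * real N ^ (d * 2) * kmom 2 d f"
    by blast
  define B where "B = 2 ^ (2 + 1) * exp (2 ^ 2 :: real)"
  have B: "B \<ge> 0" by (simp add: B_def)
  define C' where "C' = 4 * (36 * B * C1 + C)"
  show ?case
  proof (rule exI[of _ C'], intro conjI allI impI)
    show "C' \<ge> 0" using B C C1 by (simp add: C'_def)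
    fix f and n N :: nat
    assume k: "kern 2 (Suc d) f" and mean: "expectation (\<lambda>\<omega>. f (tup (Suc d) (\<lambda>k. k) \<omega>)) = 0" and nN: "n \<le> N"
    have m [measurable]: "f \<in> borel_measurable (TS (Suc d))" by (rule kern_measurable[OF k])
    have if1: "integrable M (\<lambda>\<omega>. f (tup (Suc d) (\<lambda>k. k) \<omega>))" by (rule kern_integrable[OF k p])
    define g where "g = last_mean d f"
    define f2 where "f2 = proj (Suc d) f (Suc d)"
    define F where "F = (\<lambda>w. f w - g (restrict w {1..d}) - f2 (w (Suc d)))"
    note Fs = linear_approx_step_mean[OF k mean, folded g_def f2_def, folded F_def]
    have F: "kern 2 (Suc d) F" by (rule Fs(1))
    have F0: "AE \<omega>' in M. (\<integral>\<omega>. F ((tup d (\<lambda>k. k) \<omega>)(Suc d := X 0 \<omega>')) \<partial>M) = 0"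
      unfolding F_def using Fs(4) by (rule eventually_mono) (erule conjunct2)
    have Fm [measurable]: "F \<in> borel_measurable (TS (Suc d))" using F by (rule kern_measurable)
    have g: "kern 2 d g" "kmom 2 d g \<le> kmom 2 (Suc d) f"
      unfolding g_def by (rule last_mean_kern[OF k p])+
    have gmean: "expectation (\<lambda>\<omega>. g (tup d (\<lambda>k. k) \<omega>)) = 0"
      using last_mean_AE_integrable(3)[OF m if1] mean by (simp add: g_def)
    have kf: "kmom 2 (Suc d) f \<ge> 0" by (rule kmom_nonneg[OF p(1)])
    show "expectation (\<lambda>\<omega>. (U (Suc d) f n \<omega> - linpart (Suc d) f n \<omega>) ^ 2) * real N ^ 2 \<le>
        C' * real N ^ (Suc d * 2) * kmom 2 (Suc d) f"
    proof (cases "N = 0")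
      case True
      then show ?thesis by simp
    next
      case N: False
      define b where "b = C1 * real N * real N ^ (d * 2) * (36 * kmom 2 (Suc d) f) / real N ^ 2"
      have b0: "b \<ge> 0" using C1 kf by (simp add: b_def)
      have inc: "expectation (\<lambda>\<omega>. incr d F l \<omega> ^ 2) \<le> b" if "l < n" for l
      proof (cases "d \<le> l")
        \<comment> \<open>With fewer than \<open>d\<close> past observations the increment is an
          empty sum. The case is separated because below \<open>X (Suc l)\<close> has to be
          independent of \<open>X 1, ..., X d\<close>.\<close>
        case False
        then have "card (idx d l) = 0" by (simp add: card_idx binomial_eq_0)
        hence "incr d F l \<omega> = 0" for \<omega> by (simp add: incr_def)
        then show ?thesis using b0 by simp
      next
        case dl: True
        have comp: "(\<lambda>y. \<lambda>k\<in>{1..d}. y (i k)) \<in> measurable (TS l) (TS d)" if "i \<in> idx d l" for i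
          using idx_range[OF that] by (intro measurable_restrict measurable_component_singleton) auto
        define \<Phi> where "\<Phi> = (\<lambda>(y, x). (\<Sum>i\<in>idx d l. F ((\<lambda>k\<in>{1..d}. y (i k))(Suc d := x))) ^ 2)"
        have \<Phi>: "\<Phi> \<in> borel_measurable (TS l \<Otimes>\<^sub>M S)"
        proof -
          have "(\<lambda>z. (\<lambda>k\<in>{1..d}. fst z (i k))(Suc d := snd z)) \<in> measurable (TS l \<Otimes>\<^sub>M S) (TS (Suc d))"
            if "i \<in> idx d l" for i
            using measurable_compose[OF measurable_fst comp[OF that]]
            by (rule upd_measurable2) measurable
          from measurable_compose[OF this Fm] show ?thesis unfolding \<Phi>_def case_prod_beta'
            by (intro borel_measurable_power borel_measurable_sum)
        qed
        have ti: "(\<lambda>k\<in>{1..d}. tup l (\<lambda>k. k) \<omega> (i k)) = tup d i \<omega>" if "i \<in> idx d l" for \<omega> i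
          using idx_range[OF that] by (auto simp: tup_def fun_eq_iff)
        \<comment> \<open>The kernel with its last argument frozen at an independently resampled
          value. For almost every \<open>\<omega>'\<close> it is a kernel of order \<open>d\<close>
          with mean zero, to which \<open>U_increment_moment\<close> applies.\<close>
        define Fx where "Fx = (\<lambda>\<omega>' y. F (y(Suc d := X (Suc l) \<omega>')))"
        have PU: "\<Phi> (tup l (\<lambda>k. k) \<omega>, X (Suc l) \<omega>') = U d (Fx \<omega>') l \<omega> ^ 2" for \<omega> \<omega>'
          unfolding \<Phi>_def prod.case U_tup Fx_def by (simp only: ti cong: sum.cong)
        have pl: "product_law (TS l) (tup l (\<lambda>k. k)) S (X (Suc l))" by (rule product_law_tup)
        have int: "integrable M (\<lambda>\<omega>. \<Phi> (tup l (\<lambda>k. k) \<omega>, X (Suc l) \<omega>))"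
          using incr_lp(1)[OF F p, of l] unfolding PU by (simp add: lp_def incr_eq_U[abs_def] Fx_def)
        have pl2: "product_law (TS d) (tup d (\<lambda>k. k)) S (X (Suc l))"
          using indep_tuple[of "Suc l" "\<lambda>k. k" "{1..d}"] dl by (simp add: tup_def[abs_def])
        note secm = section_measurable[OF Fm]
        have sec2m: "(\<lambda>(y, x). F (y(Suc d := x)) ^ 2) \<in> borel_measurable (TS d \<Otimes>\<^sub>M S)"
          using borel_measurable_power[OF secm, of 2] by (simp add: case_prod_beta')
        define i1 where "i1 = (\<lambda>k. k)(Suc d := Suc l)"
        have i1: "inj_on i1 {1..Suc d}" using dl by (auto simp: i1_def inj_on_def)
        have ti1: "tup (Suc d) i1 \<omega> = (tup d (\<lambda>k. k) \<omega>)(Suc d := X (Suc l) \<omega>)" for \<omega>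
          unfolding i1_def by (rule tup_upd)
        note lpF = kern_lp[OF F i1, unfolded ti1]
        have int2: "integrable M (\<lambda>\<omega>. (\<lambda>(y, x). F (y(Suc d := x)) ^ 2) (tup d (\<lambda>k. k) \<omega>, X (Suc l) \<omega>))"
          using lpF(1) unfolding prod.case lp_def by blast
        have mean0: "AE \<omega>' in M. expectation (\<lambda>\<omega>. Fx \<omega>' (tup d (\<lambda>k. k) \<omega>)) = 0"
        proof -
          have "(\<lambda>(x, \<omega>). (tup d (\<lambda>k. k) \<omega>, x)) \<in> measurable (S \<Otimes>\<^sub>M M) (TS d \<Otimes>\<^sub>M S)" by measurable
          from measurable_compose[OF this secm]
          have "(\<lambda>(x, \<omega>). F ((tup d (\<lambda>k. k) \<omega>)(Suc d := x))) \<in> borel_measurable (S \<Otimes>\<^sub>M M)"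
            by (simp add: case_prod_beta')
          from borel_measurable_lebesgue_integral[OF this]
          have mm0: "(\<lambda>x. \<integral>\<omega>. F ((tup d (\<lambda>k. k) \<omega>)(Suc d := x)) \<partial>M) \<in> borel_measurable S" .
          define G where "G = (\<lambda>x. \<integral>\<omega>. F ((tup d (\<lambda>k. k) \<omega>)(Suc d := x)) \<partial>M)"
          have G [measurable]: "G \<in> borel_measurable S" unfolding G_def by (rule mm0)
          have Gs: "{x \<in> space S. G x = 0} \<in> sets S" by measurable
          have "AE \<omega>' in M. G (X 0 \<omega>') = 0"
            unfolding G_def by (rule F0)
          from AE_X_cong[OF Gs this] have "AE \<omega>' in M. (\<integral>\<omega>. F ((tup d (\<lambda>k. k) \<omega>)(Suc d := X (Suc l) \<omega>')) \<partial>M) = 0"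
            unfolding G_def .
          thus ?thesis by (simp only: Fx_def)
        qed
        have kFx: "AE \<omega>' in M. kern 2 d (Fx \<omega>')"
          using product_law_AE_integrable'[OF pl2 sec2m int2] AE_space
        proof eventually_elim
          case (elim \<omega>')
          have "X (Suc l) \<omega>' \<in> space S" using elim(2) measurable_space[OF X_measurable] by blast
          from section_measurable2[OF Fm this] elim(1) show ?case
            unfolding kern_def Fx_def prod.case by blast
        qed
        have iter: "expectation (\<lambda>\<omega>. incr d F l \<omega> ^ 2) = (\<integral>\<omega>'. \<integral>\<omega>. U d (Fx \<omega>') l \<omega> ^ 2 \<partial>M \<partial>M)"
          using product_law_integral_iterated'[OF pl \<Phi> int] unfolding PU
          by (simp add: incr_eq_U[abs_def] Fx_def)
        have "(\<integral>\<omega>'. \<integral>\<omega>. U d (Fx \<omega>') l \<omega> ^ 2 \<partial>M \<partial>M) * real N ^ 2 = (\<integral>\<omega>'. (\<integral>\<omega>. U d (Fx \<omega>') l \<omega> ^ 2 \<partial>M) * real N ^ 2 \<partial>M)"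
          by simp
        also have "\<dots> \<le> (\<integral>\<omega>'. C1 * real l * real N ^ (d * 2) * kmom 2 d (Fx \<omega>') \<partial>M)"
        proof (rule integral_mono_AE)
          show "integrable M (\<lambda>\<omega>'. (\<integral>\<omega>. U d (Fx \<omega>') l \<omega> ^ 2 \<partial>M) * real N ^ 2)"
            using product_law_integrable_iterated'[OF pl \<Phi> int] unfolding PU by simp
          show "integrable M (\<lambda>\<omega>'. C1 * real l * real N ^ (d * 2) * kmom 2 d (Fx \<omega>'))"
            using product_law_integrable_iterated'[OF pl2 sec2m int2]
            unfolding kmom_def Fx_def prod.case by (rule integrable_mult_right)
          show "AE \<omega>' in M. (\<integral>\<omega>. U d (Fx \<omega>') l \<omega> ^ 2 \<partial>M) * real N ^ 2 \<le> C1 * real l * real N ^ (d * 2) * kmom 2 d (Fx \<omega>')"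
            using mean0 kFx
          proof eventually_elim
            case (elim \<omega>')
            show ?case using I1[OF elim(2,1), of 0 l N] U_0_mean_zero(1)[OF elim(2) p elim(1)] that nN by simp
          qed
        qed
        also have "\<dots> = C1 * real l * real N ^ (d * 2) * (\<integral>\<omega>'. kmom 2 d (Fx \<omega>') \<partial>M)" by simp
        also have "(\<integral>\<omega>'. kmom 2 d (Fx \<omega>') \<partial>M) = kmom 2 (Suc d) F"
          using product_law_integral_iterated'[OF pl2 sec2m int2] lpF(2)
          unfolding kmom_def Fx_def prod.case by simp
        also have "C1 * real l * real N ^ (d * 2) * kmom 2 (Suc d) F \<le> C1 * real N * real N ^ (d * 2) * (36 * kmom 2 (Suc d) f)"
          using that nN C1 Fs(2) kf by (intro mult_mono kmom_nonneg) auto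
        finally show ?thesis unfolding iter b_def using N by (simp add: field_simps)
      qed
      have e1: "expectation (\<lambda>\<omega>. (U (Suc d) F n \<omega>) ^ 2) * real N ^ 2 \<le> B * 36 * C1 * real N ^ (Suc d * 2) * kmom 2 (Suc d) f"
      proof -
        have "expectation (\<lambda>\<omega>. (U (Suc d) F n \<omega> - U (Suc d) F 0 \<omega>) ^ 2) \<le> B * real (n - 0) ^ 1 * b"
          unfolding B_def by (rule degen_moment_le) (use F Fs(3) inc b0 in auto)
        also have "\<dots> \<le> B * real N * b" using nN B b0 by (intro mult_right_mono mult_left_mono) auto
        finally have "expectation (\<lambda>\<omega>. (U (Suc d) F n \<omega>) ^ 2) * real N ^ 2 \<le> B * real N * b * real N ^ 2"
          by (intro mult_right_mono) auto
        also have "\<dots> = B * 36 * C1 * real N ^ (Suc d * 2) * kmom 2 (Suc d) f"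
          using N by (simp add: b_def power2_eq_square)
        finally show ?thesis .
      qed
      have l1: "lp M 2 (U (Suc d) F n)" by (intro U_lp F p)
      have l2: "lp M 2 (\<lambda>\<omega>. U d g l \<omega> - linpart d g l \<omega>)" for l by (intro lp_diff(1) U_lp linpart_lp g p)
      have l3: "lp M 2 (\<lambda>\<omega>. \<Sum>l<n. U d g l \<omega> - linpart d g l \<omega>)" by (intro lp_sum(1) l2 p) auto
      have e2: "expectation (\<lambda>\<omega>. (\<Sum>l<n. U d g l \<omega> - linpart d g l \<omega>) ^ 2) * real N ^ 2 \<le> C * real N ^ (Suc d * 2) * kmom 2 (Suc d) f"
      proof -
        have "expectation (\<lambda>\<omega>. (\<Sum>l<n. U d g l \<omega> - linpart d g l \<omega>) ^ 2) * real N ^ 2 \<le>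
            (real n * (\<Sum>l<n. expectation (\<lambda>\<omega>. (U d g l \<omega> - linpart d g l \<omega>) ^ 2))) * real N ^ 2"
          using lp_sum(2)[OF p, of "{..<n}" M "\<lambda>l \<omega>. U d g l \<omega> - linpart d g l \<omega>"] l2
          by (intro mult_right_mono) auto
        also have "\<dots> = real n * (\<Sum>l<n. expectation (\<lambda>\<omega>. (U d g l \<omega> - linpart d g l \<omega>) ^ 2) * real N ^ 2)"
          by (simp add: sum_distrib_right)
        also have "\<dots> \<le> real n * (\<Sum>l<n. C * real N ^ (d * 2) * kmom 2 (Suc d) f)"
        proof (intro mult_left_mono sum_mono)
          fix l assume "l \<in> {..<n}"
          have "expectation (\<lambda>\<omega>. (U d g l \<omega> - linpart d g l \<omega>) ^ 2) * real N ^ 2 \<le> C * real N ^ (d * 2) * kmom 2 d g"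
            using IH[OF g(1) gmean] \<open>l \<in> {..<n}\<close> nN by simp
          also have "\<dots> \<le> C * real N ^ (d * 2) * kmom 2 (Suc d) f" using C g(2) by (intro mult_left_mono) auto
          finally show "expectation (\<lambda>\<omega>. (U d g l \<omega> - linpart d g l \<omega>) ^ 2) * real N ^ 2 \<le> \<dots>" .
        qed auto
        also have "\<dots> = (real n * real n) * (C * real N ^ (d * 2) * kmom 2 (Suc d) f)" by simp
        also have "\<dots> \<le> (real N * real N) * (C * real N ^ (d * 2) * kmom 2 (Suc d) f)"
          using nN C kf by (intro mult_right_mono mult_mono) auto
        also have "\<dots> = C * real N ^ (Suc d * 2) * kmom 2 (Suc d) f" by (simp add: power2_eq_square)
        finally show ?thesis .
      qed
      \<comment> \<open>The projection on the last argument, counted \<open>l choose d\<close> times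
        at step \<open>l\<close>, is exactly what \<open>linpart_Suc\<close> contains beyond the
        lower order, so it cancels.\<close>
      have "AE \<omega> in M. U (Suc d) f n \<omega> - linpart (Suc d) f n \<omega> = U (Suc d) F n \<omega> + (\<Sum>l<n. U d g l \<omega> - linpart d g l \<omega>)"
        using linpart_Suc[OF k, of n]
      proof eventually_elim
        case (elim \<omega>)
        have "incr d f l \<omega> = incr d F l \<omega> + U d g l \<omega> + real (l choose d) * f2 (X (Suc l) \<omega>)" for l
          unfolding incr_restrict[of d g, symmetric] incr_def card_idx[symmetric]
          by (simp add: F_def sum.distrib sum_subtractf del: restrict_fupd)
        thus ?case unfolding elim U_eq_sum_incr
          by (simp add: sum.distrib sum_subtractf g_def f2_def)
      qed
      hence "expectation (\<lambda>\<omega>. (U (Suc d) f n \<omega> - linpart (Suc d) f n \<omega>) ^ 2) =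
          expectation (\<lambda>\<omega>. (U (Suc d) F n \<omega> + (\<Sum>l<n. U d g l \<omega> - linpart d g l \<omega>)) ^ 2)"
        using lp_measurable[OF l1] lp_measurable[OF l3] lp_measurable[OF U_lp(1)[OF k p]] lp_measurable[OF linpart_lp[OF k p]]
        by (intro integral_cong_AE) (auto elim: eventually_mono)
      also have "\<dots> \<le> 2 ^ 2 * (expectation (\<lambda>\<omega>. (U (Suc d) F n \<omega>) ^ 2) + expectation (\<lambda>\<omega>. (\<Sum>l<n. U d g l \<omega> - linpart d g l \<omega>) ^ 2))"
        by (rule lp_add(2)[OF p(1) l1 l3])
      finally have "expectation (\<lambda>\<omega>. (U (Suc d) f n \<omega> - linpart (Suc d) f n \<omega>) ^ 2) * real N ^ 2 \<le>
        4 * (expectation (\<lambda>\<omega>. (U (Suc d) F n \<omega>) ^ 2) + expectation (\<lambda>\<omega>. (\<Sum>l<n. U d g l \<omega> - linpart d g l \<omega>) ^ 2)) * real N ^ 2"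
        by (intro mult_right_mono) auto
      also have "\<dots> = 4 * (expectation (\<lambda>\<omega>. (U (Suc d) F n \<omega>) ^ 2) * real N ^ 2 +
          expectation (\<lambda>\<omega>. (\<Sum>l<n. U d g l \<omega> - linpart d g l \<omega>) ^ 2) * real N ^ 2)" by (simp add: algebra_simps)
      also have "\<dots> \<le> 4 * (B * 36 * C1 * real N ^ (Suc d * 2) * kmom 2 (Suc d) f + C * real N ^ (Suc d * 2) * kmom 2 (Suc d) f)"
        using e1 e2 by (intro mult_left_mono add_mono) auto
      also have "\<dots> = C' * real N ^ (Suc d * 2) * kmom 2 (Suc d) f" by (simp add: C'_def algebra_simps)
      finally show ?thesis .
    qed
  qed
qed

end

text \<open>The dominating variable is the sum of the series itself, integrable by monotone
  convergence. \<open>enn2real\<close> sends infinity to \<open>0\<close>, so the variable is finite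
  everywhere and the bounds hold off a null set.\<close>

lemma integrable_dominating_series:
  fixes s :: "nat \<Rightarrow> 'a \<Rightarrow> real"
  assumes i: "\<And>n. integrable M (s n)" and nn: "\<And>n \<omega>. s n \<omega> \<ge> 0" and sm: "summable (\<lambda>n. \<integral>\<omega>. s n \<omega> \<partial>M)"
  shows "\<exists>Q. Q \<in> borel_measurable M \<and> (\<forall>\<omega>. Q \<omega> \<ge> 0) \<and> integrable M Q \<and> (AE \<omega> in M. \<forall>n. s n \<omega> \<le> Q \<omega>)"
proof -
  have [measurable]: "\<And>n. s n \<in> borel_measurable M" using i by auto
  define T where "T = (\<lambda>\<omega>. \<Sum>n. ennreal (s n \<omega>))"
  have T [measurable]: "T \<in> borel_measurable M" unfolding T_def by measurable
  have "(\<integral>\<^sup>+\<omega>. T \<omega> \<partial>M) = (\<Sum>n. \<integral>\<^sup>+\<omega>. ennreal (s n \<omega>) \<partial>M)"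
    unfolding T_def by (rule nn_integral_suminf) auto
  also have "\<dots> = (\<Sum>n. ennreal (\<integral>\<omega>. s n \<omega> \<partial>M))"
    using i nn by (simp add: nn_integral_eq_integral)
  also have "\<dots> = ennreal (\<Sum>n. \<integral>\<omega>. s n \<omega> \<partial>M)"
    by (rule suminf_ennreal_eq[OF _ summable_sums[OF sm]]) (auto intro: integral_nonneg_AE simp: nn)
  finally have fin: "(\<integral>\<^sup>+\<omega>. T \<omega> \<partial>M) < \<infinity>" by simp
  have ae: "AE \<omega> in M. T \<omega> \<noteq> \<infinity>"
    by (rule nn_integral_PInf_AE[OF T]) (use fin in auto)
  define Q where "Q = (\<lambda>\<omega>. enn2real (T \<omega>))"
  have [measurable]: "Q \<in> borel_measurable M" unfolding Q_def by measurable
  have "(\<integral>\<^sup>+\<omega>. ennreal (Q \<omega>) \<partial>M) = (\<integral>\<^sup>+\<omega>. T \<omega> \<partial>M)"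
    using ae by (intro nn_integral_cong_AE) (auto simp: Q_def less_top elim!: eventually_mono)
  hence "integrable M Q" using fin
    by (intro integrableI_nonneg) (auto simp: Q_def)
  moreover have "AE \<omega> in M. \<forall>n. s n \<omega> \<le> Q \<omega>"
    using ae
  proof eventually_elim
    case (elim \<omega>)
    show ?case
    proof
      fix n
      have "ennreal (s n \<omega>) \<le> T \<omega>"
        unfolding T_def using sum_le_suminf[of "\<lambda>n. ennreal (s n \<omega>)" "{n}"] by simp
      also have "T \<omega> = ennreal (Q \<omega>)" using elim by (simp add: Q_def less_top)
      finally show "s n \<omega> \<le> Q \<omega>" by (simp add: Q_def)
    qed
  qed
  ultimately show ?thesis by (intro exI[of _ Q]) (auto simp: Q_def)
qed

context iid_seq begin

text \<open>The true order of the increments is \<open>sqrt (n - m)\<close> times the power \<open>d - 1\<close> of \<open>n\<close>; giving away the power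
  \<open>1/16\<close> makes the bounds on the moments of order \<open>16 r\<close> summable over all pairs \<open>m \<le> n\<close>.\<close>

lemma U_envelope:
  assumes k: "\<And>p. even p \<Longrightarrow> p > 0 \<Longrightarrow> kern p d f" and mean: "expectation (\<lambda>\<omega>. f (tup d (\<lambda>k. k) \<omega>)) = 0"
    and d: "d \<ge> 1" and r: "r \<ge> 3"
  shows "\<exists>Q. Q \<in> borel_measurable M \<and> (\<forall>\<omega>. Q \<omega> \<ge> 0) \<and> integrable M (\<lambda>\<omega>. Q \<omega> ^ (16 * r)) \<and>
    (AE \<omega> in M. \<forall>m n. m \<le> n \<longrightarrow> \<bar>U d f n \<omega> - U d f m \<omega>\<bar> \<le> Q \<omega> * sqrt (real (n - m)) * real n powr (real d - 15/16))"
proof -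
  define p q where "p = 16 * r" and "q = 8 * r"
  have pq: "q \<ge> 1" "p = 2 * q" "even p" "p > 0" using r by (auto simp: p_def q_def)
  from U_increment_moment[OF pq(1,2), of d] k[OF pq(3,4)] mean
  obtain C where C: "C \<ge> 0" and I: "\<And>m n N. m \<le> n \<Longrightarrow> n \<le> N \<Longrightarrow>
      expectation (\<lambda>\<omega>. (U d f n \<omega> - U d f m \<omega>) ^ p) * real N ^ p \<le> C * real (n - m) ^ q * real N ^ (d * p) * kmom p d f"
    by blast
  define K where "K = C * kmom p d f"
  have K0: "K \<ge> 0" using C kmom_nonneg[OF pq(3)] by (simp add: K_def)
  define w where "w = (\<lambda>m n. sqrt (real (n - m)) * real n powr (real d - 15/16))"
  have w0: "w m n \<ge> 0" for m n by (simp add: w_def)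
  have wp: "w m n > 0" if "m < n" for m n using that by (simp add: w_def)
  define s where "s = (\<lambda>n \<omega>. \<Sum>m<n. ((U d f n \<omega> - U d f m \<omega>) / w m n) ^ p)"
  have lpd: "integrable M (\<lambda>\<omega>. (U d f n \<omega> - U d f m \<omega>) ^ p)" for n m
    using lp_diff(1)[OF pq(3) U_lp(1)[OF k[OF pq(3,4)] pq(3,4)] U_lp(1)[OF k[OF pq(3,4)] pq(3,4)]]
    by (simp add: lp_def)
  have si: "integrable M (s n)" for n
    unfolding s_def power_divide using lpd by auto
  have s0: "s n \<omega> \<ge> 0" for n \<omega>
    unfolding s_def using pq(3) by (intro sum_nonneg) (auto simp: zero_le_even_power)
  \<comment> \<open>\<open>(d - 15/16) * p = (d - 1) * p + r\<close> for \<open>p = 16 * r\<close>: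
    the loss \<open>1/16\<close> buys the extra factor \<open>real n ^ r\<close>.\<close>
  have wpow: "w m n ^ p = real (n - m) ^ q * (real n ^ (d * p) / real n ^ p * real n ^ r)" if "m < n" for m n
  proof -
    have n: "real n > 0" using that by simp
    have "(real n powr (real d - 15/16)) ^ p = real n powr ((real d - 15/16) * real p)"
      using n by (simp add: powr_realpow[symmetric] powr_powr)
    also have "(real d - 15/16) * real p = real (d * p) - real p + real r"
      by (simp add: p_def algebra_simps)
    also have "real n powr \<dots> = real n ^ (d * p) / real n ^ p * real n ^ r"
      using n by (simp only: powr_add powr_diff powr_realpow)
    finally have e: "(real n powr (real d - 15/16)) ^ p = real n ^ (d * p) / real n ^ p * real n ^ r" .
    have "sqrt (real (n - m)) ^ p = real (n - m) ^ q"
      by (simp add: pq(2) power_mult)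
    thus ?thesis by (simp add: w_def power_mult_distrib e)
  qed
  \<comment> \<open>Each of the \<open>n\<close> terms of \<open>s n\<close> has expectation at most
    \<open>K / real n ^ r\<close>, so \<open>r \<ge> 3\<close> leaves a summable
    \<open>1 / real n ^ 2\<close>.\<close>
  have Es: "(\<integral>\<omega>. s n \<omega> \<partial>M) \<le> K * (1 / real n ^ 2)" for n
  proof (cases "n = 0")
    case True
    then show ?thesis by (simp add: s_def)
  next
    case n: False
    have "(\<integral>\<omega>. s n \<omega> \<partial>M) = (\<Sum>m<n. expectation (\<lambda>\<omega>. (U d f n \<omega> - U d f m \<omega>) ^ p) / w m n ^ p)"
      unfolding s_def power_divide using lpd by simp
    also have "\<dots> \<le> (\<Sum>m<n. K / real n ^ r)"
    proof (rule sum_mono)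
      fix m assume m: "m \<in> {..<n}"
      have "expectation (\<lambda>\<omega>. (U d f n \<omega> - U d f m \<omega>) ^ p) * real n ^ p \<le> K * real (n - m) ^ q * real n ^ (d * p)"
        using I[of m n n] m by (simp add: K_def mult_ac)
      hence "expectation (\<lambda>\<omega>. (U d f n \<omega> - U d f m \<omega>) ^ p) \<le> K * real (n - m) ^ q * (real n ^ (d * p) / real n ^ p)"
        using n by (simp add: field_simps)
      also have "\<dots> = K / real n ^ r * w m n ^ p"
        using m n wpow[of m n] by simp
      finally show "expectation (\<lambda>\<omega>. (U d f n \<omega> - U d f m \<omega>) ^ p) / w m n ^ p \<le> K / real n ^ r"
        using wp[of m n] m by (simp add: pos_divide_le_eq)
    qed
    also have "\<dots> = K * (real n / real n ^ r)" by simp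
    also have "real n / real n ^ r \<le> 1 / real n ^ 2"
    proof -
      have "real n * real n ^ 2 \<le> real n ^ r"
        using power_increasing[OF r, of "real n"] n by (simp add: power3_eq_cube power2_eq_square)
      thus ?thesis using n by (simp add: field_simps)
    qed
    finally show ?thesis using K0 by (simp add: mult_left_mono)
  qed
  have "summable (\<lambda>n. \<integral>\<omega>. s n \<omega> \<partial>M)"
  proof (rule summable_comparison_test')
    show "summable (\<lambda>n. K * (1 / real n ^ 2))"
      using inverse_power_summable[of 2, where 'a=real] by (intro summable_mult) (simp add: inverse_eq_divide)
    show "norm (\<integral>\<omega>. s n \<omega> \<partial>M) \<le> K * (1 / real n ^ 2)" if "n \<ge> 0" for n
      using Es[of n] s0 by (simp add: integral_nonneg_AE)
  qed
  from integrable_dominating_series[OF si s0 this] obtain Q0 where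
    Q0: "Q0 \<in> borel_measurable M" "\<And>\<omega>. Q0 \<omega> \<ge> 0" "integrable M Q0" "AE \<omega> in M. \<forall>n. s n \<omega> \<le> Q0 \<omega>"
    by auto
  define Q where "Q = (\<lambda>\<omega>. root p (Q0 \<omega>))"
  have Qp: "Q \<omega> ^ p = Q0 \<omega>" for \<omega>
    using Q0(2) pq(4) by (simp add: Q_def real_root_pow_pos2)
  have Qm: "Q \<in> borel_measurable M"
  proof -
    have "root p \<in> borel_measurable borel"
      by (intro borel_measurable_continuous_onI continuous_intros)
    from measurable_compose[OF Q0(1) this] show ?thesis by (simp add: Q_def)
  qed
  show ?thesis
  proof (rule exI[of _ Q], intro conjI)
    show "Q \<in> borel_measurable M" by (rule Qm)
    show "\<forall>\<omega>. Q \<omega> \<ge> 0" using Q0(2) pq(4) by (simp add: Q_def)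
    show "integrable M (\<lambda>\<omega>. Q \<omega> ^ (16 * r))" using Q0(3) Qp by (simp add: p_def)
    show "AE \<omega> in M. \<forall>m n. m \<le> n \<longrightarrow> \<bar>U d f n \<omega> - U d f m \<omega>\<bar> \<le> Q \<omega> * sqrt (real (n - m)) * real n powr (real d - 15/16)"
      using Q0(4)
    proof eventually_elim
      case (elim \<omega>)
      show ?case
      proof (intro allI impI)
        fix m n :: nat assume mn: "m \<le> n"
        show "\<bar>U d f n \<omega> - U d f m \<omega>\<bar> \<le> Q \<omega> * sqrt (real (n - m)) * real n powr (real d - 15/16)"
        proof (cases "m = n")
          case False
          hence mn: "m < n" using mn by simp
          have "((U d f n \<omega> - U d f m \<omega>) / w m n) ^ p \<le> s n \<omega>"
            unfolding s_def using mn pq(3)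
            by (intro member_le_sum[of m "{..<n}" "\<lambda>m. ((U d f n \<omega> - U d f m \<omega>) / w m n) ^ p"])
               (auto simp: zero_le_even_power)
          also have "\<dots> \<le> Q \<omega> ^ p" using elim Qp by simp
          finally have "\<bar>(U d f n \<omega> - U d f m \<omega>) / w m n\<bar> ^ p \<le> Q \<omega> ^ p"
            using pq(3) by (simp only: abs_pow_even)
          hence "\<bar>(U d f n \<omega> - U d f m \<omega>) / w m n\<bar> \<le> Q \<omega>"
            using Q0(2) pq(4) by (subst (asm) power_mono_iff) (auto simp: Q_def)
          thus ?thesis using wp[OF mn] by (simp add: w_def abs_divide field_simps abs_mult)
        qed simp
      qed
    qed
  qed
qed

end

subsection \<open>Deterministic expansion at the passage time\<close>

text \<open>Multiplied by \<open>x\<close> so that the induction can start at \<open>d = 0\<close>,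
  where an exponent \<open>d - 1\<close> would be truncated.\<close>

lemma prod_diff_power_bound:
  "\<exists>C\<ge>0. \<forall>x\<ge>(1::real). \<bar>(\<Prod>i=0..<d. x - real i) - x ^ d\<bar> * x \<le> C * x ^ d"
proof (induction d)
  case 0
  show ?case by (intro exI[of _ 0]) auto
next
  case (Suc d)
  then obtain C where C: "C \<ge> 0" "\<And>x. x \<ge> 1 \<Longrightarrow> \<bar>(\<Prod>i=0..<d. x - real i) - x ^ d\<bar> * x \<le> C * x ^ d" by blast
  show ?case
  proof (rule exI[of _ "C * (1 + real d) + real d"], intro conjI allI impI)
    show "0 \<le> C * (1 + real d) + real d" using C by simp
    fix x :: real assume x: "1 \<le> x"
    let ?P = "\<Prod>i=0..<d. x - real i"
    have "(\<Prod>i=0..<Suc d. x - real i) - x ^ Suc d = (?P - x ^ d) * (x - real d) - real d * x ^ d"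
      by (simp add: algebra_simps)
    also have "\<bar>\<dots>\<bar> \<le> \<bar>?P - x ^ d\<bar> * \<bar>x - real d\<bar> + real d * x ^ d"
      using x by (intro order_trans[OF abs_triangle_ineq4]) (simp add: abs_mult)
    also have "\<dots> \<le> \<bar>?P - x ^ d\<bar> * (x * (1 + real d)) + real d * x ^ d"
    proof -
      have "\<bar>x - real d\<bar> \<le> x + real d" using x by auto
      also have "real d \<le> x * real d" using x by (simp add: mult_le_cancel_right1)
      finally have "\<bar>x - real d\<bar> \<le> x * (1 + real d)" by (simp add: algebra_simps)
      thus ?thesis by (intro add_right_mono mult_left_mono) auto
    qed
    also have "\<dots> = (\<bar>?P - x ^ d\<bar> * x) * (1 + real d) + real d * x ^ d" by simp
    also have "\<dots> \<le> (C * x ^ d) * (1 + real d) + real d * x ^ d"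
      using C(2)[OF x] by (intro add_right_mono mult_right_mono) auto
    finally have "\<bar>(\<Prod>i=0..<Suc d. x - real i) - x ^ Suc d\<bar> * x \<le> (C * x ^ d * (1 + real d) + real d * x ^ d) * x"
      using x by (intro mult_right_mono) auto
    thus "\<bar>(\<Prod>i=0..<Suc d. x - real i) - x ^ Suc d\<bar> * x \<le> (C * (1 + real d) + real d) * x ^ Suc d"
      by (simp add: algebra_simps)
  qed
qed

lemma binomial_power_bound:
  assumes "d \<ge> 1"
  shows "\<exists>C\<ge>0. \<forall>n. \<bar>real (n choose d) - real n ^ d / fact d\<bar> \<le> C * real n ^ (d - 1)"
proof -
  from prod_diff_power_bound[of d] obtain C where C: "C \<ge> 0"
    "\<And>x::real. x \<ge> 1 \<Longrightarrow> \<bar>(\<Prod>i=0..<d. x - real i) - x ^ d\<bar> * x \<le> C * x ^ d" by blast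
  have "\<bar>real (n choose d) - real n ^ d / fact d\<bar> \<le> C * real n ^ (d - 1)" for n
  proof (cases "n = 0")
    case True
    then show ?thesis using assms C(1) by (simp add: binomial_eq_0 power_0_left)
  next
    case False
    then have n: "real n \<ge> 1" by simp
    have "real (n choose d) = (\<Prod>i=0..<d. real n - real i) / fact d"
      by (simp add: binomial_gbinomial gbinomial_prod_rev)
    hence "\<bar>real (n choose d) - real n ^ d / fact d\<bar> = \<bar>(\<Prod>i=0..<d. real n - real i) - real n ^ d\<bar> / fact d"
      by (simp add: diff_divide_distrib[symmetric])
    also have "\<dots> \<le> \<bar>(\<Prod>i=0..<d. real n - real i) - real n ^ d\<bar> / 1"
      by (intro divide_left_mono) (auto simp: fact_ge_1)
    also have "\<dots> \<le> C * real n ^ (d - 1)"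
    proof -
      have "real n ^ d = real n ^ (d - 1) * real n" using assms power_minus_mult[of d "real n"] by simp
      thus ?thesis using C(2)[OF n] n by (simp add: mult.assoc[symmetric])
    qed
    finally show ?thesis .
  qed
  thus ?thesis using C(1) by blast
qed

text \<open>Inverts the power: a bound on \<open>N ^ d - y ^ d\<close> becomes a bound on
  \<open>N - y\<close> after division by \<open>y ^ (d - 1)\<close>.\<close>

lemma abs_diff_power_ge:
  fixes a b :: real
  assumes "a \<ge> 0" "b \<ge> 0" "d \<ge> 1"
  shows "\<bar>a - b\<bar> * b ^ (d - 1) \<le> \<bar>a ^ d - b ^ d\<bar>"
proof -
  have d: "x ^ d = x * x ^ (d - 1)" for x :: real
    using assms(3) power_minus_mult[of d x] by (simp add: mult.commute)
  show ?thesis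
  proof (cases "a \<ge> b")
    case True
    have "a * b ^ (d - 1) \<le> a * a ^ (d - 1)" using True assms by (intro mult_left_mono power_mono) auto
    hence "(a - b) * b ^ (d - 1) \<le> a ^ d - b ^ d" unfolding d[of a] d[of b] by (simp add: algebra_simps)
    thus ?thesis using True by simp
  next
    case False
    have "a * a ^ (d - 1) \<le> a * b ^ (d - 1)" using False assms by (intro mult_left_mono power_mono) auto
    hence "(b - a) * b ^ (d - 1) \<le> b ^ d - a ^ d" unfolding d[of a] d[of b] by (simp add: algebra_simps)
    thus ?thesis using False by simp
  qed
qed

lemma power_taylor1_bound:
  fixes t :: real
  shows "\<bar>(1 + t) ^ a - 1 - real a * t\<bar> \<le> 2 ^ a * t\<^sup>2 * (1 + \<bar>t\<bar>) ^ a"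
proof (cases "a \<ge> 2")
  case False
  then have "a = 0 \<or> a = 1" by auto
  then show ?thesis by auto
next
  case True
  have "(1 + t) ^ a = (t + 1) ^ a" by (simp add: add.commute)
  also have "\<dots> = (\<Sum>k\<le>a. real (a choose k) * t ^ k * 1 ^ (a - k))" by (rule binomial_ring)
  also have "\<dots> = (\<Sum>k\<in>{0, 1} \<union> {2..a}. real (a choose k) * t ^ k)"
    using True by (intro sum.cong) auto
  also have "\<dots> = 1 + real a * t + (\<Sum>k=2..a. real (a choose k) * t ^ k)"
    by (subst sum.union_disjoint) auto
  finally have "\<bar>(1 + t) ^ a - 1 - real a * t\<bar> = \<bar>\<Sum>k=2..a. real (a choose k) * t ^ k\<bar>" by simp
  also have "\<dots> \<le> (\<Sum>k=2..a. real (a choose k) * (t\<^sup>2 * (1 + \<bar>t\<bar>) ^ a))"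
  proof (rule order_trans[OF sum_abs], rule sum_mono)
    fix k assume k: "k \<in> {2..a}"
    have "\<bar>t\<bar> ^ (2 + (k - 2)) = \<bar>t\<bar> ^ 2 * \<bar>t\<bar> ^ (k - 2)" by (rule power_add)
    also have "2 + (k - 2) = k" using k le_add_diff_inverse[of 2 k] by (simp only: atLeastAtMost_iff)
    finally have "\<bar>t\<bar> ^ k = \<bar>t\<bar> ^ 2 * \<bar>t\<bar> ^ (k - 2)" .
    also have "\<bar>t\<bar> ^ (k - 2) \<le> (1 + \<bar>t\<bar>) ^ (k - 2)" by (intro power_mono) auto
    also have "(1 + \<bar>t\<bar>) ^ (k - 2) \<le> (1 + \<bar>t\<bar>) ^ a" using k by (intro power_increasing) auto
    finally have "\<bar>t\<bar> ^ k \<le> t\<^sup>2 * (1 + \<bar>t\<bar>) ^ a" by (simp add: mult_left_mono)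
    thus "\<bar>real (a choose k) * t ^ k\<bar> \<le> real (a choose k) * (t\<^sup>2 * (1 + \<bar>t\<bar>) ^ a)"
      by (simp add: abs_mult power_abs mult_left_mono)
  qed
  also have "\<dots> = real (\<Sum>k=2..a. a choose k) * (t\<^sup>2 * (1 + \<bar>t\<bar>) ^ a)" by (simp add: sum_distrib_right)
  also have "\<dots> \<le> real (2 ^ a) * (t\<^sup>2 * (1 + \<bar>t\<bar>) ^ a)"
  proof (rule mult_right_mono)
    have "(\<Sum>k=2..a. a choose k) \<le> (\<Sum>k\<le>a. a choose k)" by (intro sum_mono2) auto
    thus "real (\<Sum>k=2..a. a choose k) \<le> real (2 ^ a)" unfolding choose_row_sum by (rule of_nat_mono)
  qed auto
  finally show ?thesis by (simp add: mult.assoc)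
qed

text \<open>Functions of a configuration \<open>c\<close> that are at most of order \<open>y\<^sup>e\<close>, up to a power of \<open>Q\<close> (which will be
  a random variable with finite moments): the calculus that replaces case distinctions on rare events.\<close>

locale poly_bound =
  fixes Cf :: "'c set" and Q y :: "'c \<Rightarrow> real"
  assumes Q1: "\<And>c. c \<in> Cf \<Longrightarrow> 1 \<le> Q c" and y1: "\<And>c. c \<in> Cf \<Longrightarrow> 1 \<le> y c"
begin

definition pb :: "real \<Rightarrow> ('c \<Rightarrow> real) \<Rightarrow> bool" where
  "pb e F \<longleftrightarrow> (\<exists>C E. C \<ge> 0 \<and> (\<forall>c\<in>Cf. \<bar>F c\<bar> \<le> C * Q c ^ E * y c powr e))"

lemma pbI: "C \<ge> 0 \<Longrightarrow> (\<And>c. c \<in> Cf \<Longrightarrow> \<bar>F c\<bar> \<le> C * Q c ^ E * y c powr e) \<Longrightarrow> pb e F"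
  unfolding pb_def by blast

lemma pbE:
  assumes "pb e F"
  obtains C E where "C \<ge> 0" "\<And>c. c \<in> Cf \<Longrightarrow> \<bar>F c\<bar> \<le> C * Q c ^ E * y c powr e"
  using assms unfolding pb_def by blast

lemma pb_le: "pb e F \<Longrightarrow> (\<And>c. c \<in> Cf \<Longrightarrow> \<bar>G c\<bar> \<le> \<bar>F c\<bar>) \<Longrightarrow> pb e G"
  unfolding pb_def by (meson order_trans)

lemma pb_cong: "pb e F \<Longrightarrow> (\<And>c. c \<in> Cf \<Longrightarrow> G c = F c) \<Longrightarrow> pb e G"
  by (erule pb_le) simp

lemma pb_mono:
  assumes "pb e F" "e \<le> e'"
  shows "pb e' F"
proof -
  obtain C E where C: "C \<ge> 0" "\<And>c. c \<in> Cf \<Longrightarrow> \<bar>F c\<bar> \<le> C * Q c ^ E * y c powr e" using assms(1) by (rule pbE) blast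
  show ?thesis
  proof (rule pbI[OF C(1)])
    fix c assume c: "c \<in> Cf"
    have "C * Q c ^ E * y c powr e \<le> C * Q c ^ E * y c powr e'"
      using C(1) Q1[OF c] y1[OF c] assms(2) by (intro mult_left_mono powr_mono mult_nonneg_nonneg) auto
    thus "\<bar>F c\<bar> \<le> C * Q c ^ E * y c powr e'" using C(2)[OF c] by linarith
  qed
qed

lemma pb_const: "pb 0 (\<lambda>_. k)"
  by (rule pbI[of "\<bar>k\<bar>" _ 0]) (use y1 in force)+

lemma pb_Q: "pb 0 Q"
  by (rule pbI[of 1 _ 1]) (use Q1 y1 in force)+

lemma pb_y: "pb a (\<lambda>c. y c powr a)"
  by (rule pbI[of 1 _ 0]) auto

lemma pb_add:
  assumes "pb e F" "pb e G"
  shows "pb e (\<lambda>c. F c + G c)"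
proof -
  obtain C E where C: "C \<ge> 0" "\<And>c. c \<in> Cf \<Longrightarrow> \<bar>F c\<bar> \<le> C * Q c ^ E * y c powr e" using assms(1) by (rule pbE) blast
  obtain C' E' where C': "C' \<ge> 0" "\<And>c. c \<in> Cf \<Longrightarrow> \<bar>G c\<bar> \<le> C' * Q c ^ E' * y c powr e" using assms(2) by (rule pbE) blast
  show ?thesis
  proof (rule pbI[of "C + C'" _ "E + E'"])
    fix c assume c: "c \<in> Cf"
    have "Q c ^ E \<le> Q c ^ (E + E')" "Q c ^ E' \<le> Q c ^ (E + E')"
      using Q1[OF c] by (auto intro!: power_increasing)
    hence "C * Q c ^ E * y c powr e + C' * Q c ^ E' * y c powr e \<le> C * Q c ^ (E + E') * y c powr e + C' * Q c ^ (E + E') * y c powr e"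
      using C(1) C'(1) by (intro add_mono mult_right_mono mult_left_mono) auto
    thus "\<bar>F c + G c\<bar> \<le> (C + C') * Q c ^ (E + E') * y c powr e"
      using C(2)[OF c] C'(2)[OF c] by (simp add: algebra_simps)
  qed (use C C' in auto)
qed

lemma pb_mult:
  assumes "pb e F" "pb e' G"
  shows "pb (e + e') (\<lambda>c. F c * G c)"
proof -
  obtain C E where C: "C \<ge> 0" "\<And>c. c \<in> Cf \<Longrightarrow> \<bar>F c\<bar> \<le> C * Q c ^ E * y c powr e" using assms(1) by (rule pbE) blast
  obtain C' E' where C': "C' \<ge> 0" "\<And>c. c \<in> Cf \<Longrightarrow> \<bar>G c\<bar> \<le> C' * Q c ^ E' * y c powr e'" using assms(2) by (rule pbE) blast
  show ?thesis
  proof (rule pbI[of "C * C'" _ "E + E'"])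
    fix c assume c: "c \<in> Cf"
    have "\<bar>F c * G c\<bar> \<le> (C * Q c ^ E * y c powr e) * (C' * Q c ^ E' * y c powr e')"
      unfolding abs_mult using C(2)[OF c] C'(2)[OF c] C(1) Q1[OF c] by (intro mult_mono) auto
    also have "\<dots> = C * C' * Q c ^ (E + E') * y c powr (e + e')"
      by (simp add: powr_add power_add mult_ac)
    finally show "\<bar>F c * G c\<bar> \<le> C * C' * Q c ^ (E + E') * y c powr (e + e')" .
  qed (use C C' in auto)
qed

lemma pb_cmult: "pb e F \<Longrightarrow> pb e (\<lambda>c. k * F c)"
  using pb_mult[OF pb_const, of e F k] by simp

lemma pb_minus: "pb e F \<Longrightarrow> pb e (\<lambda>c. - F c)"
  by (erule pb_le) simp

lemma pb_diff: "pb e F \<Longrightarrow> pb e G \<Longrightarrow> pb e (\<lambda>c. F c - G c)"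
  using pb_add[OF _ pb_minus, of e F G] by simp

lemma pb_abs: "pb e F \<Longrightarrow> pb e (\<lambda>c. \<bar>F c\<bar>)"
  by (erule pb_le) simp

lemma pb_power: "pb e F \<Longrightarrow> pb (real n * e) (\<lambda>c. F c ^ n)"
proof (induction n)
  case 0
  then show ?case using pb_const[of 1] by simp
next
  case (Suc n)
  then show ?case using pb_mult[OF Suc.prems Suc.IH] by (simp add: algebra_simps)
qed

lemma pb_powr:
  assumes "pb e F" "r \<ge> 0"
  shows "pb (e * r) (\<lambda>c. \<bar>F c\<bar> powr r)"
proof -
  obtain C E where C: "C \<ge> 0" "\<And>c. c \<in> Cf \<Longrightarrow> \<bar>F c\<bar> \<le> C * Q c ^ E * y c powr e" using assms(1) by (rule pbE) blast
  show ?thesis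
  \<comment> \<open>The power of \<open>Q\<close> is rounded up to a natural exponent, which is
    harmless because \<open>Q c \<ge> 1\<close>.\<close>
  proof (rule pbI[of "C powr r" _ "nat \<lceil>real E * r\<rceil>"])
    fix c assume c: "c \<in> Cf"
    have "\<bar>F c\<bar> powr r \<le> (C * Q c ^ E * y c powr e) powr r"
      using C(2)[OF c] assms(2) by (intro powr_mono2) auto
    also have "\<dots> = C powr r * (Q c ^ E) powr r * y c powr (e * r)"
      using C(1) Q1[OF c] y1[OF c] by (simp add: powr_mult powr_powr)
    also have "(Q c ^ E) powr r = Q c powr (real E * r)"
      using Q1[OF c] by (simp add: powr_realpow[symmetric] powr_powr)
    also have "Q c powr (real E * r) \<le> Q c powr (real (nat \<lceil>real E * r\<rceil>))"
      using Q1[OF c] by (intro powr_mono) linarith+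
    also have "\<dots> = Q c ^ nat \<lceil>real E * r\<rceil>" using Q1[OF c] by (intro powr_realpow) auto
    finally show "\<bar>\<bar>F c\<bar> powr r\<bar> \<le> C powr r * Q c ^ nat \<lceil>real E * r\<rceil> * y c powr (e * r)"
      by (simp add: mult_left_mono mult_right_mono)
  qed auto
qed

end

text \<open>A configuration packs a bound \<open>Q\<close>, a scale \<open>y\<close>, one path of
  each centred statistic and a crossing: the statistic is at or below the level
  \<open>\<mu> * y ^ d / fact d\<close> at \<open>K - 1\<close> and at or above it at
  \<open>K\<close>. Letting \<open>N\<close> be either of the two times treats
  \<open>N_minus\<close> and \<open>N_plus\<close> together.\<close>

locale passage = poly_bound Cf Q y for Cf :: "'c set" and Q y :: "'c \<Rightarrow> real" +
  fixes d d' :: nat and \<mu> \<mu>' :: real and v v' :: "'c \<Rightarrow> nat \<Rightarrow> real" and N K :: "'c \<Rightarrow> nat"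
  assumes d: "d \<ge> 1" and d': "d' \<ge> 1" and \<mu>: "\<mu> > 0"
    and v: "\<And>c m n. c \<in> Cf \<Longrightarrow> m \<le> n \<Longrightarrow> \<bar>v c n - v c m\<bar> \<le> Q c * sqrt (real (n - m)) * real n powr (real d - 15/16)"
    and v': "\<And>c m n. c \<in> Cf \<Longrightarrow> m \<le> n \<Longrightarrow> \<bar>v' c n - v' c m\<bar> \<le> Q c * sqrt (real (n - m)) * real n powr (real d' - 15/16)"
    and v0: "\<And>c. c \<in> Cf \<Longrightarrow> v c 0 = 0" and v'0: "\<And>c. c \<in> Cf \<Longrightarrow> v' c 0 = 0"
    and K1: "\<And>c. c \<in> Cf \<Longrightarrow> K c \<ge> 1"
    and NK: "\<And>c. c \<in> Cf \<Longrightarrow> N c = K c - 1 \<or> N c = K c"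
    and lower: "\<And>c. c \<in> Cf \<Longrightarrow> \<mu> * real ((K c - 1) choose d) + v c (K c - 1) \<le> \<mu> * y c ^ d / fact d"
    and upper: "\<And>c. c \<in> Cf \<Longrightarrow> \<mu> * y c ^ d / fact d \<le> \<mu> * real (K c choose d) + v c (K c)"
begin

abbreviation "m c \<equiv> nat \<lfloor>y c\<rfloor>"

lemma sqrt_mult_powr: "sqrt (real n) * real n powr (a - 15/16) = real n powr (a - 7/16)"
  by (cases "n = 0") (auto simp: powr_half_sqrt[symmetric] powr_add[symmetric])

lemma v_le: "c \<in> Cf \<Longrightarrow> \<bar>v c n\<bar> \<le> Q c * real n powr (real d - 7/16)"
  using v[of c 0 n] v0[of c] sqrt_mult_powr[of n "real d"] by (simp add: mult.assoc)

lemma v'_le: "c \<in> Cf \<Longrightarrow> \<bar>v' c n\<bar> \<le> Q c * real n powr (real d' - 7/16)"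
  using v'[of c 0 n] v'0[of c] sqrt_mult_powr[of n "real d'"] by (simp add: mult.assoc)

lemma N_le_K: "c \<in> Cf \<Longrightarrow> N c \<le> K c"
  using NK[of c] by auto

text \<open>The signed overshoot of the level at the passage time.\<close>

definition s where "s c = \<mu> * real (N c choose d) + v c (N c) - \<mu> * y c ^ d / fact d"

lemma K_power_le:
  assumes c: "c \<in> Cf" and "real a \<le> e"
  shows "real (K c) ^ a \<le> real (K c) powr e"
  using K1[OF c] assms(2) by (simp add: powr_realpow[symmetric] powr_mono)

text \<open>The level lies between the values at \<open>K - 1\<close> and \<open>K\<close>, and
  \<open>N\<close> is one of these times, so the overshoot is at most one increment. The
  deterministic part of that increment, \<open>(K - 1) choose (d - 1)\<close> times
  \<open>\<mu>\<close>, has order \<open>d - 1\<close> and fits under the bound.\<close>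

lemma s_le:
  assumes c: "c \<in> Cf"
  shows "\<bar>s c\<bar> \<le> (\<mu> + 1) * Q c * real (K c) powr (real d - 15/16)"
proof -
  obtain k where k: "K c = Suc k" using K1[OF c] by (cases "K c") auto
  obtain e where e: "d = Suc e" using d by (cases d) auto
  have "\<bar>s c\<bar> \<le> \<bar>\<mu> * real (K c choose d) + v c (K c) - (\<mu> * real (k choose d) + v c k)\<bar>"
    using NK[OF c] lower[OF c] upper[OF c] k by (auto simp: s_def)
  also have "\<dots> = \<bar>\<mu> * real (k choose e) + (v c (Suc k) - v c k)\<bar>"
    by (simp add: k e algebra_simps)
  also have "\<dots> \<le> \<mu> * real (k choose e) + \<bar>v c (Suc k) - v c k\<bar>"
    using \<mu> by (intro order_trans[OF abs_triangle_ineq]) (simp add: abs_mult)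
  also have "\<dots> \<le> \<mu> * real (K c) powr (real d - 15/16) + Q c * real (K c) powr (real d - 15/16)"
  proof (rule add_mono)
    have "real (k choose e) \<le> real (k ^ e)"
      by (cases "e \<le> k") (auto simp: binomial_le_pow binomial_eq_0 simp del: of_nat_power)
    also have "\<dots> \<le> real (K c) ^ e" unfolding k by (simp add: power_mono)
    also have "\<dots> \<le> real (K c) powr (real d - 15/16)" by (rule K_power_le[OF c]) (simp add: e)
    finally show "\<mu> * real (k choose e) \<le> \<mu> * real (K c) powr (real d - 15/16)" using \<mu> by simp
    show "\<bar>v c (Suc k) - v c k\<bar> \<le> Q c * real (K c) powr (real d - 15/16)"
      using v[OF c, of k "Suc k"] k by simp
  qed
  also have "\<dots> \<le> (\<mu> + 1) * Q c * real (K c) powr (real d - 15/16)"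
  proof -
    have "\<mu> \<le> \<mu> * Q c" using \<mu> Q1[OF c] by simp
    hence "\<mu> * real (K c) powr (real d - 15/16) \<le> \<mu> * Q c * real (K c) powr (real d - 15/16)"
      by (intro mult_right_mono) auto
    thus ?thesis by (simp add: algebra_simps)
  qed
  finally show ?thesis .
qed

lemma binomial_error:
  assumes "a \<ge> 1"
  shows "\<exists>C\<ge>0. \<forall>c\<in>Cf. \<bar>real (N c choose a) - real (N c) ^ a / fact a\<bar> \<le> C * real (K c) powr (real a - 1)"
proof -
  obtain C where C: "C \<ge> 0" "\<And>n. \<bar>real (n choose a) - real n ^ a / fact a\<bar> \<le> C * real n ^ (a - 1)"
    using binomial_power_bound[OF assms] by blast
  show ?thesis
  proof (rule exI[of _ C], intro conjI ballI C(1))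
    fix c assume c: "c \<in> Cf"
    have "real (N c) ^ (a - 1) \<le> real (K c) ^ (a - 1)" using N_le_K[OF c] by (intro power_mono) auto
    also have "\<dots> \<le> real (K c) powr (real a - 1)" by (rule K_power_le[OF c]) (use assms in simp)
    finally show "\<bar>real (N c choose a) - real (N c) ^ a / fact a\<bar> \<le> C * real (K c) powr (real a - 1)"
      using C(2)[of "N c"] C(1) by (meson mult_left_mono order_trans)
  qed
qed

text \<open>Obtained by solving the definition of \<open>s\<close> for
  \<open>real (N c) ^ d\<close>. The bound is in terms of \<open>K\<close>, since \<open>K\<close>
  is not yet controlled by \<open>y\<close>; \<open>pb_K\<close> bootstraps that control from
  here.\<close>

lemma power_diff_le: "\<exists>C\<ge>1. \<forall>c\<in>Cf. \<bar>real (N c) ^ d - y c ^ d\<bar> \<le> C * Q c * real (K c) powr (real d - 7/16)"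
proof -
  obtain C where C: "C \<ge> 0" "\<And>c. c \<in> Cf \<Longrightarrow> \<bar>real (N c choose d) - real (N c) ^ d / fact d\<bar> \<le> C * real (K c) powr (real d - 1)"
    using binomial_error[OF d] by blast
  define C' where "C' = 1 + fact d / \<mu> * (\<mu> * C + 1 + (\<mu> + 1))"
  show ?thesis
  proof (rule exI[of _ C'], intro conjI ballI)
    show "C' \<ge> 1" using C \<mu> by (simp add: C'_def)
    fix c assume c: "c \<in> Cf"
    let ?k = "real (K c) powr (real d - 7/16)"
    have K: "1 \<le> real (K c)" using K1[OF c] by simp
    have q: "?k \<le> Q c * ?k" using Q1[OF c] by (simp add: mult_le_cancel_right1)
    have "\<mu> / fact d * (real (N c) ^ d - y c ^ d) =
       s c - v c (N c) - \<mu> * (real (N c choose d) - real (N c) ^ d / fact d)"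
      by (simp add: s_def algebra_simps diff_divide_distrib)
    also have "\<bar>\<dots>\<bar> \<le> \<bar>s c\<bar> + \<bar>v c (N c)\<bar> + \<mu> * \<bar>real (N c choose d) - real (N c) ^ d / fact d\<bar>"
      using \<mu> by (simp add: abs_mult order_trans[OF abs_triangle_ineq4] add_right_mono abs_triangle_ineq4)
    also have "\<dots> \<le> (\<mu> + 1) * (Q c * ?k) + Q c * ?k + \<mu> * (C * (Q c * ?k))"
    proof (intro add_mono mult_left_mono)
      have "\<bar>s c\<bar> \<le> (\<mu> + 1) * Q c * real (K c) powr (real d - 15/16)" by (rule s_le[OF c])
      also have "\<dots> \<le> (\<mu> + 1) * Q c * ?k"
        using K \<mu> Q1[OF c] by (intro mult_left_mono powr_mono) auto
      finally show "\<bar>s c\<bar> \<le> (\<mu> + 1) * (Q c * ?k)" by simp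
      have "\<bar>v c (N c)\<bar> \<le> Q c * real (N c) powr (real d - 7/16)" by (rule v_le[OF c])
      also have "\<dots> \<le> Q c * ?k"
        using N_le_K[OF c] Q1[OF c] d by (intro mult_left_mono powr_mono2) auto
      finally show "\<bar>v c (N c)\<bar> \<le> Q c * ?k" .
      have "\<bar>real (N c choose d) - real (N c) ^ d / fact d\<bar> \<le> C * real (K c) powr (real d - 1)" by (rule C(2)[OF c])
      also have "\<dots> \<le> C * ?k" using K C(1) by (intro mult_left_mono powr_mono) auto
      also have "\<dots> \<le> C * (Q c * ?k)" using q C(1) by (intro mult_left_mono) auto
      finally show "\<bar>real (N c choose d) - real (N c) ^ d / fact d\<bar> \<le> C * (Q c * ?k)" .
    qed (use \<mu> in auto)
    also have "\<dots> = (\<mu> * C + 1 + (\<mu> + 1)) * (Q c * ?k)" by (simp add: algebra_simps)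
    finally have "\<mu> / fact d * \<bar>real (N c) ^ d - y c ^ d\<bar> \<le> (\<mu> * C + 1 + (\<mu> + 1)) * (Q c * ?k)"
      using \<mu> by (simp add: abs_mult)
    hence "\<bar>real (N c) ^ d - y c ^ d\<bar> \<le> fact d / \<mu> * (\<mu> * C + 1 + (\<mu> + 1)) * (Q c * ?k)"
      using \<mu> by (simp add: field_simps)
    also have "\<dots> \<le> C' * (Q c * ?k)"
      using Q1[OF c] by (intro mult_right_mono) (auto simp: C'_def)
    finally show "\<bar>real (N c) ^ d - y c ^ d\<bar> \<le> C' * Q c * ?k" by simp
  qed
qed

text \<open>Bootstrapping: if \<open>K \<ge> 4 * y\<close>, then \<open>N \<ge> K / 2\<close>, so
  \<open>N ^ d - y ^ d\<close> is at least a fixed multiple of \<open>K ^ d\<close>, while up to a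
  constant it is at most \<open>Q * K powr (d - 7/16)\<close>. Hence \<open>K powr (7/16)\<close> is
  bounded by a multiple of \<open>Q\<close>: so late a passage is paid for by \<open>Q\<close>
  alone.\<close>

lemma pb_K: "pb 1 (\<lambda>c. real (K c))"
proof -
  obtain C where C: "C \<ge> 1" "\<And>c. c \<in> Cf \<Longrightarrow> \<bar>real (N c) ^ d - y c ^ d\<bar> \<le> C * Q c * real (K c) powr (real d - 7/16)"
    using power_diff_le by blast
  define D where "D = 2 ^ (d + 1) * C"
  have D1: "D \<ge> 1" using mult_mono[OF one_le_power[of "2::real" "d+1"] C(1)] unfolding D_def by simp
  show ?thesis
  proof (rule pbI[of "4 + D ^ 3" _ 3])
    fix c assume c: "c \<in> Cf"
    have q: "Q c ^ 3 \<ge> 1" and yc: "y c \<ge> 1" using Q1[OF c] y1[OF c] by (auto intro: one_le_power)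
    show "\<bar>real (K c)\<bar> \<le> (4 + D ^ 3) * Q c ^ 3 * y c powr 1"
    proof (cases "real (K c) < 4 * y c")
      case True
      have "4 * y c \<le> (4 + D ^ 3) * Q c ^ 3 * y c"
        using q yc D1 mult_mono[of 4 "4 + D ^ 3" 1 "Q c ^ 3"] by (intro mult_right_mono) auto
      hence "real (K c) \<le> (4 + D ^ 3) * Q c ^ 3 * y c" using True by linarith
      thus ?thesis using yc by simp
    next
      case False
      let ?k = "real (K c)"
      have k: "?k \<ge> 4" "?k \<ge> 4 * y c" using False yc by auto
      have N: "real (N c) \<ge> ?k / 2" using NK[OF c] k by auto
      have "(y c) ^ d \<le> (real (N c) / 2) ^ d" using N k yc by (intro power_mono) auto
      also have "\<dots> \<le> real (N c) ^ d / 2"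
        using self_le_power[of "2::real" d] d unfolding power_divide by (intro divide_left_mono) auto
      finally have "real (N c) ^ d / 2 \<le> real (N c) ^ d - y c ^ d" by simp
      also have "\<dots> \<le> C * Q c * ?k powr (real d - 7/16)" using C(2)[OF c] by simp
      finally have "real (N c) ^ d / 2 \<le> C * Q c * ?k powr (real d - 7/16)" .
      moreover have "(?k / 2) ^ d \<le> real (N c) ^ d" using N k by (intro power_mono) auto
      ultimately have "(?k / 2) ^ d \<le> 2 * (C * Q c * ?k powr (real d - 7/16))" by linarith
      hence "?k ^ d / 2 ^ d * 2 ^ d \<le> 2 * (C * Q c * ?k powr (real d - 7/16)) * 2 ^ d"
        unfolding power_divide by (rule mult_right_mono) simp
      hence "?k ^ d \<le> D * Q c * ?k powr (real d - 7/16)"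
        unfolding D_def by (simp add: mult_ac)
      hence "?k powr (real d - 7/16) * ?k powr (7/16) \<le> ?k powr (real d - 7/16) * (D * Q c)"
        using k by (simp add: powr_realpow[symmetric] powr_add[symmetric] mult_ac)
      hence "?k powr (7/16) \<le> D * Q c" using k by simp
      \<comment> \<open>The third power is the first whose exponent, \<open>21/16\<close>, exceeds
        \<open>1\<close>; a whole power keeps the exponent of \<open>Q\<close> natural.\<close>
      hence "(?k powr (7/16)) ^ 3 \<le> (D * Q c) ^ 3" by (intro power_mono) auto
      moreover have "(?k powr (7/16)) ^ 3 = ?k powr (21/16)"
        using k by (simp add: powr_realpow[symmetric] powr_powr)
      moreover have "?k powr 1 \<le> ?k powr (21/16)" using k by (intro powr_mono) auto
      ultimately have "?k \<le> D ^ 3 * Q c ^ 3" using k by (simp add: power_mult_distrib)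
      also have "\<dots> \<le> (4 + D ^ 3) * Q c ^ 3" using q by (intro mult_right_mono) (use Q1[OF c] in auto)
      also have "\<dots> \<le> (4 + D ^ 3) * Q c ^ 3 * y c"
        using mult_left_mono[OF yc, of "(4 + D ^ 3) * Q c ^ 3"] q D1 Q1[OF c] by simp
      finally show ?thesis using yc by simp
    qed
  qed (use D1 in auto)
qed

lemma pb_K_powr: "r \<ge> 0 \<Longrightarrow> pb r (\<lambda>c. real (K c) powr r)"
  using pb_powr[OF pb_K, of r] by simp

lemma pb_power_diff: "pb (real d - 7/16) (\<lambda>c. real (N c) ^ d - y c ^ d)"
proof -
  obtain C where C: "C \<ge> 1" "\<And>c. c \<in> Cf \<Longrightarrow> \<bar>real (N c) ^ d - y c ^ d\<bar> \<le> C * Q c * real (K c) powr (real d - 7/16)"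
    using power_diff_le by blast
  have "pb (0 + (real d - 7/16)) (\<lambda>c. (C * Q c) * real (K c) powr (real d - 7/16))"
    using d by (intro pb_mult pb_cmult pb_Q pb_K_powr) auto
  hence "pb (real d - 7/16) (\<lambda>c. (C * Q c) * real (K c) powr (real d - 7/16))" by simp
  thus ?thesis by (rule pb_le) (rule order_trans[OF C(2) abs_ge_self])
qed

lemma pb_N_y: "pb (9/16) (\<lambda>c. real (N c) - y c)"
proof (rule pb_le)
  show "pb (9/16) (\<lambda>c. (real (N c) ^ d - y c ^ d) * y c powr (1 - real d))"
    using pb_mult[OF pb_power_diff pb_y[of "1 - real d"]] by simp
  fix c assume c: "c \<in> Cf"
  have y: "y c \<ge> 1" by (rule y1[OF c])
  have "\<bar>real (N c) - y c\<bar> * y c ^ (d - 1) \<le> \<bar>real (N c) ^ d - y c ^ d\<bar>"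
    using y d by (intro abs_diff_power_ge) auto
  hence "\<bar>real (N c) - y c\<bar> * y c ^ (d - 1) * y c powr (1 - real d) \<le> \<bar>real (N c) ^ d - y c ^ d\<bar> * y c powr (1 - real d)"
    by (intro mult_right_mono) auto
  moreover have "y c ^ (d - 1) * y c powr (1 - real d) = 1"
    using y d by (simp add: powr_realpow[symmetric] powr_add[symmetric] of_nat_diff)
  ultimately show "\<bar>real (N c) - y c\<bar> \<le> \<bar>(real (N c) ^ d - y c ^ d) * y c powr (1 - real d)\<bar>"
    by (simp add: abs_mult mult.assoc)
qed

lemma m_y: "c \<in> Cf \<Longrightarrow> real (m c) \<le> y c" "c \<in> Cf \<Longrightarrow> y c - 1 \<le> real (m c)"
  using y1[of c] by auto

text \<open>The span between \<open>N\<close> and \<open>m\<close> is at most the distance of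
  \<open>N\<close> from \<open>y\<close> plus one, of order \<open>9/16\<close>; its square root
  adds \<open>9/32\<close> to \<open>a - 15/16\<close>. The later of the two times is at most
  \<open>K + y\<close>.\<close>

lemma pb_increment:
  fixes u :: "'c \<Rightarrow> nat \<Rightarrow> real"
  assumes u: "\<And>c m n. c \<in> Cf \<Longrightarrow> m \<le> n \<Longrightarrow> \<bar>u c n - u c m\<bar> \<le> Q c * sqrt (real (n - m)) * real n powr (real a - 15/16)"
    and a: "a \<ge> 1"
  shows "pb (real a - 21/32) (\<lambda>c. u c (N c) - u c (m c))"
proof (rule pb_le)
  have "pb (9/16) (\<lambda>c. \<bar>real (N c) - y c\<bar> + 1)"
    by (intro pb_add pb_abs pb_N_y pb_mono[OF pb_const]) auto
  from pb_powr[OF this, of "1/2"] have 1: "pb (9/32) (\<lambda>c. \<bar>\<bar>real (N c) - y c\<bar> + 1\<bar> powr (1/2))" by simp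
  have "pb 1 (\<lambda>c. real (K c) + y c powr 1)" by (intro pb_add pb_K pb_y)
  from pb_powr[OF this, of "real a - 15/16"] a
  have 2: "pb (real a - 15/16) (\<lambda>c. \<bar>real (K c) + y c powr 1\<bar> powr (real a - 15/16))" by simp
  show "pb (real a - 21/32) (\<lambda>c. Q c * \<bar>\<bar>real (N c) - y c\<bar> + 1\<bar> powr (1/2) * \<bar>real (K c) + y c powr 1\<bar> powr (real a - 15/16))"
    using pb_mult[OF pb_mult[OF pb_Q 1] 2] by (rule pb_mono) simp
  fix c assume c: "c \<in> Cf"
  have y: "y c \<ge> 1" and q: "Q c \<ge> 1" using y1 Q1 c by auto
  define M where "M = max (N c) (m c)"
  have "\<bar>u c (N c) - u c (m c)\<bar> \<le> Q c * sqrt \<bar>real (N c) - real (m c)\<bar> * real M powr (real a - 15/16)"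
  proof (cases "m c \<le> N c")
    case True
    then show ?thesis using u[OF c True] by (simp add: M_def max_def of_nat_diff)
  next
    case False
    then show ?thesis using u[OF c, of "N c" "m c"] by (simp add: M_def max_def of_nat_diff abs_minus_commute)
  qed
  also have "\<dots> \<le> Q c * sqrt (\<bar>real (N c) - y c\<bar> + 1) * (real (K c) + y c) powr (real a - 15/16)"
  proof (intro mult_mono mult_left_mono powr_mono2)
    show "sqrt \<bar>real (N c) - real (m c)\<bar> \<le> sqrt (\<bar>real (N c) - y c\<bar> + 1)"
      using m_y[OF c] by (intro real_sqrt_le_mono) linarith
    show "real M \<le> real (K c) + y c" using m_y(1)[OF c] of_nat_mono[OF N_le_K[OF c], where 'a=real] y
      unfolding M_def of_nat_max by (intro max.boundedI) linarith+
  qed (use q a in auto)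
  finally show "\<bar>u c (N c) - u c (m c)\<bar> \<le> \<bar>Q c * \<bar>\<bar>real (N c) - y c\<bar> + 1\<bar> powr (1/2) * \<bar>real (K c) + y c powr 1\<bar> powr (real a - 15/16)\<bar>"
    using y q by (simp add: powr_half_sqrt abs_mult)
qed

text \<open>\<open>t\<close> is the relative deviation of the passage time from \<open>y\<close>,
  and \<open>R a\<close> the remainder of the first-order expansion of \<open>N ^ a\<close> in
  \<open>t\<close>.\<close>

definition t where "t c = (real (N c) - y c) / y c"

definition R where "R a c = real (N c) ^ a - y c ^ a * (1 + real a * t c)"

lemma pb_t: "pb (-7/16) t"
proof (rule pb_cong)
  show "pb (-7/16) (\<lambda>c. (real (N c) - y c) * y c powr (-1))"
    using pb_mult[OF pb_N_y pb_y[of "-1"]] by simp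
  show "t c = (real (N c) - y c) * y c powr (-1)" if "c \<in> Cf" for c
    using y1[OF that] by (simp add: t_def powr_minus divide_inverse)
qed

lemma pb_R: "pb (real a - 7/8) (R a)"
proof (rule pb_le)
  have 1: "pb (real 2 * (-7/16)) (\<lambda>c. t c ^ 2)" by (rule pb_power[OF pb_t])
  have "pb 0 (\<lambda>c. 1 + \<bar>t c\<bar>)" by (intro pb_add pb_const pb_abs pb_mono[OF pb_t]) auto
  from pb_power[OF this, of a] have 2: "pb 0 (\<lambda>c. (1 + \<bar>t c\<bar>) ^ a)" by simp
  show "pb (real a - 7/8) (\<lambda>c. y c powr real a * (2 ^ a * t c ^ 2 * (1 + \<bar>t c\<bar>) ^ a))"
    using pb_mult[OF pb_y[of "real a"] pb_mult[OF pb_cmult[OF 1, of "2 ^ a"] 2]] by (rule pb_mono) simp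
  fix c assume c: "c \<in> Cf"
  have y: "y c \<ge> 1" by (rule y1[OF c])
  have "real (N c) = y c * (1 + t c)" using y by (simp add: t_def field_simps)
  hence "real (N c) ^ a = y c ^ a * (1 + t c) ^ a" by (simp only: power_mult_distrib)
  hence "R a c = y c ^ a * ((1 + t c) ^ a - 1 - real a * t c)"
    by (simp add: R_def algebra_simps)
  hence "\<bar>R a c\<bar> \<le> y c ^ a * (2 ^ a * (t c)\<^sup>2 * (1 + \<bar>t c\<bar>) ^ a)"
    using y power_taylor1_bound[of "t c" a] by (simp add: abs_mult mult_left_mono)
  thus "\<bar>R a c\<bar> \<le> \<bar>y c powr real a * (2 ^ a * t c ^ 2 * (1 + \<bar>t c\<bar>) ^ a)\<bar>"
    using y by (simp add: powr_realpow abs_mult)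
qed

lemma pb_binomial_error:
  assumes "a \<ge> 1"
  shows "pb (real a - 1) (\<lambda>c. real (N c choose a) - real (N c) ^ a / fact a)"
proof -
  obtain C where C: "C \<ge> 0" "\<And>c. c \<in> Cf \<Longrightarrow> \<bar>real (N c choose a) - real (N c) ^ a / fact a\<bar> \<le> C * real (K c) powr (real a - 1)"
    using binomial_error[OF assms] by blast
  show ?thesis
    by (rule pb_le[where F="\<lambda>c. C * real (K c) powr (real a - 1)"])
      (use assms C in \<open>auto intro!: pb_cmult pb_K_powr simp: abs_mult\<close>)
qed

lemma pb_s: "pb (real d - 15/16) s"
proof (rule pb_le)
  show "pb (real d - 15/16) (\<lambda>c. ((\<mu> + 1) * Q c) * real (K c) powr (real d - 15/16))"
    using pb_mult[OF pb_cmult[OF pb_Q] pb_K_powr[of "real d - 15/16"]] d by simp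
  show "\<bar>s c\<bar> \<le> \<bar>((\<mu> + 1) * Q c) * real (K c) powr (real d - 15/16)\<bar>" if "c \<in> Cf" for c
    using s_le[OF that] by (meson abs_ge_self order_trans)
qed

definition \<kappa> where "\<kappa> = fact (d - 1) * \<mu>' / (fact (d' - 1) * \<mu>)"

text \<open>\<open>b - b0\<close> before division by the normalisation, see
  \<open>pb_b_diff\<close>; the power \<open>d' - d\<close> of \<open>y\<close> brings
  \<open>v\<close> to the order of \<open>v'\<close>.\<close>

definition G where
  "G c = \<mu>' * real (N c choose d') + v' c (N c) - \<mu>' * y c ^ d' / fact d' - v' c (m c) + \<kappa> * v c (m c) * y c powr (real d' - real d)"

text \<open>The deviation \<open>t\<close> enters the expansions of both binomial coefficients. It
  is eliminated by solving the level equation of order \<open>d\<close>, which also produces the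
  term \<open>- \<kappa> * v\<close>. Of the six error terms that remain, the increments of
  \<open>v\<close> and \<open>v'\<close> between \<open>N\<close> and \<open>m\<close> are the
  largest and dictate \<open>21/32\<close>.\<close>

lemma pb_G: "pb (real d' - 21/32) G"
proof (rule pb_cong)
  let ?e = "\<lambda>a c. real (N c choose a) - real (N c) ^ a / fact a"
  let ?y = "\<lambda>c. y c powr (real d' - real d)"
  let ?k = "\<mu>' / fact d' * (real d' / real d)"
  have sc: "pb (real d' - 21/32) (\<lambda>c. ?y c * F c)" if "pb e F" "e \<le> real d - 21/32" for e F
    using pb_mult[OF pb_y that(1)] by (rule pb_mono) (use that(2) in simp)
  define e where "e = ?e"
  define i i' where "i = (\<lambda>c. v c (N c) - v c (m c))" and "i' = (\<lambda>c. v' c (N c) - v' c (m c))"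
  have pe: "pb (real d - 1) (e d)" "pb (real d' - 1) (e d')"
    unfolding e_def by (intro pb_binomial_error d d')+
  have pi: "pb (real d - 21/32) i" "pb (real d' - 21/32) i'"
    unfolding i_def i'_def by (intro pb_increment v v' d d'; assumption)+
  have 1: "pb (real d' - 21/32) (\<lambda>c. \<mu>' * e d' c)" by (rule pb_cmult[OF pb_mono[OF pe(2)]]) simp
  have 2: "pb (real d' - 21/32) (\<lambda>c. \<mu>' / fact d' * R d' c)" by (rule pb_cmult[OF pb_mono[OF pb_R]]) simp
  have "pb (real d - 15/16) (\<lambda>c. \<mu> * e d c)" by (rule pb_cmult[OF pb_mono[OF pe(1)]]) simp
  from pb_cmult[OF sc[OF pb_diff[OF pb_s this]]]
  have 3: "pb (real d' - 21/32) (\<lambda>c. \<kappa> * (?y c * (s c - \<mu> * e d c)))" by simp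
  have 4: "pb (real d' - 21/32) (\<lambda>c. \<kappa> * (?y c * i c))" by (rule pb_cmult[OF sc[OF pi(1)]]) simp
  have 5: "pb (real d' - 21/32) (\<lambda>c. ?k * (?y c * R d c))" by (rule pb_cmult[OF sc[OF pb_R]]) simp
  show "pb (real d' - 21/32) (\<lambda>c. \<mu>' * ?e d' c + (v' c (N c) - v' c (m c)) + \<mu>' / fact d' * R d' c +
     \<kappa> * (?y c * (s c - \<mu> * ?e d c)) - \<kappa> * (?y c * (v c (N c) - v c (m c))) - ?k * (?y c * R d c))"
    using pb_diff[OF pb_diff[OF pb_add[OF pb_add[OF pb_add[OF 1 pi(2)] 2] 3] 4] 5]
    unfolding e_def i_def i'_def .
  fix c assume c: "c \<in> Cf"
  have y: "y c > 0" using y1[OF c] by simp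
  have fd: "fact d = real d * fact (d - 1)" "fact d' = real d' * fact (d' - 1)"
    using d d' by (simp_all add: fact_reduce)
  have dp: "real d > 0" "real d' > 0" using d d' by auto
  have yy: "?y c * y c ^ d = y c ^ d'"
    using y by (simp add: powr_realpow[symmetric] powr_add[symmetric])
  \<comment> \<open>The factor \<open>fact d / \<mu>\<close> arises from solving the level equation
    for \<open>t\<close>, the other one from the ratio of the first-order coefficients; together
    they are \<open>\<kappa>\<close>.\<close>
  have k: "?k * (fact d / \<mu>) = \<kappa>"
    unfolding \<kappa>_def fd using dp by (simp add: field_simps)
  have "real d * y c ^ d * t c = (real (N c) ^ d - y c ^ d) - R d c" by (simp add: R_def algebra_simps)
  also have "real (N c) ^ d - y c ^ d = fact d / \<mu> * (s c - v c (N c) - \<mu> * ?e d c)"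
    using \<mu> by (simp add: s_def field_simps)
  finally have t: "real d * y c ^ d * t c = fact d / \<mu> * (s c - v c (N c) - \<mu> * ?e d c) - R d c" .
  have "\<mu>' / fact d' * (real (N c) ^ d' - y c ^ d') = \<mu>' / fact d' * R d' c + \<mu>' / fact d' * (real d' * (?y c * y c ^ d) * t c)"
    unfolding yy by (simp add: R_def algebra_simps)
  also have "\<mu>' / fact d' * (real d' * (?y c * y c ^ d) * t c) = ?k * (?y c * (real d * y c ^ d * t c))"
    using dp by simp
  also have "\<dots> = (?k * (fact d / \<mu>)) * (?y c * (s c - v c (N c) - \<mu> * ?e d c)) - ?k * (?y c * R d c)"
    unfolding t by (simp add: algebra_simps)
  also have "\<dots> = \<kappa> * (?y c * (s c - v c (N c) - \<mu> * ?e d c)) - ?k * (?y c * R d c)"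
    unfolding k ..
  finally have *: "\<mu>' / fact d' * (real (N c) ^ d' - y c ^ d') =
    \<mu>' / fact d' * R d' c + (\<kappa> * (?y c * (s c - v c (N c) - \<mu> * ?e d c)) - ?k * (?y c * R d c))" .
  have "G c = \<mu>' * ?e d' c + (v' c (N c) - v' c (m c)) + \<mu>' / fact d' * (real (N c) ^ d' - y c ^ d') + \<kappa> * (?y c * v c (m c))"
    by (simp add: G_def algebra_simps)
  also have "\<dots> = \<mu>' * ?e d' c + (v' c (N c) - v' c (m c)) + \<mu>' / fact d' * R d' c +
     \<kappa> * (?y c * (s c - \<mu> * ?e d c)) - \<kappa> * (?y c * (v c (N c) - v c (m c))) - ?k * (?y c * R d c)"
    unfolding * by (simp only: ring_distribs)
  finally show "G c = \<dots>" .
qed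

definition b where "b c = (\<mu>' * real (N c choose d') + v' c (N c) - \<mu>' * y c ^ d' / fact d') / y c powr (real d' - 1/2)"

definition b0 where "b0 c = v' c (m c) / y c powr (real d' - 1/2) - \<kappa> * (v c (m c) / y c powr (real d - 1/2))"

lemma pb_b_diff: "pb (-5/32) (\<lambda>c. b c - b0 c)"
proof (rule pb_cong)
  show "pb (-5/32) (\<lambda>c. G c * y c powr (- (real d' - 1/2)))"
    using pb_mult[OF pb_G pb_y] by (rule pb_mono) simp
  fix c assume c: "c \<in> Cf"
  have y: "y c > 0" using y1[OF c] by simp
  define p where "p = y c powr (real d' - 1/2)"
  have h: "y c powr (real d' - real d) / p = 1 / y c powr (real d - 1/2)"
    unfolding p_def using y by (simp add: powr_diff[symmetric] powr_minus_divide[symmetric])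
  have "\<kappa> * v c (m c) * y c powr (real d' - real d) / p = \<kappa> * v c (m c) * (y c powr (real d' - real d) / p)"
    by simp
  also have "\<dots> = \<kappa> * (v c (m c) / y c powr (real d - 1/2))" unfolding h by simp
  finally have e: "\<kappa> * v c (m c) * y c powr (real d' - real d) / p = \<kappa> * (v c (m c) / y c powr (real d - 1/2))" .
  have "G c * y c powr (- (real d' - 1/2)) = G c / p"
    by (simp only: powr_minus_divide p_def) simp
  also have "\<dots> = b c - b0 c"
    unfolding G_def add_divide_distrib e by (simp add: b_def b0_def p_def diff_divide_distrib add_divide_distrib)
  finally show "b c - b0 c = G c * y c powr (- (real d' - 1/2))" ..
qed

lemma pb_fluct:
  assumes u: "\<And>c n. c \<in> Cf \<Longrightarrow> \<bar>u c n\<bar> \<le> Q c * real n powr (real a - 7/16)" and a: "a \<ge> 1"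
  shows "pb (1/16) (\<lambda>c. u c (m c) / y c powr (real a - 1/2))"
proof (rule pb_le)
  show "pb (1/16) (\<lambda>c. Q c * y c powr (1/16))" using pb_mult[OF pb_Q pb_y[of "1/16"]] by simp
  fix c assume c: "c \<in> Cf"
  have y: "y c \<ge> 1" and q: "Q c \<ge> 1" using y1 Q1 c by auto
  have "\<bar>u c (m c)\<bar> \<le> Q c * real (m c) powr (real a - 7/16)" by (rule u[OF c])
  also have "\<dots> \<le> Q c * y c powr (real a - 7/16)"
    using q m_y(1)[OF c] a by (intro mult_left_mono powr_mono2) auto
  also have "y c powr (real a - 7/16) = y c powr (1/16) * y c powr (real a - 1/2)"
    using y by (simp add: powr_add[symmetric])
  finally show "\<bar>u c (m c) / y c powr (real a - 1/2)\<bar> \<le> \<bar>Q c * y c powr (1/16)\<bar>"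
    using y q by (simp add: abs_mult field_simps)
qed

text \<open>This weaker bound keeps the loss \<open>1/16\<close> of the envelope. It serves the
  almost sure limit, where a further factor \<open>y powr (1/2)\<close> is divided out.\<close>

lemma pb_b: "pb (1/16) b"
proof (rule pb_cong)
  have "pb (1/16) b0"
    unfolding b0_def[abs_def] by (intro pb_diff pb_cmult pb_fluct v_le v'_le d d')
  moreover have "pb (1/16) (\<lambda>c. b c - b0 c)" by (rule pb_mono[OF pb_b_diff]) simp
  ultimately show "pb (1/16) (\<lambda>c. (b c - b0 c) + b0 c)" by (intro pb_add)
qed simp

end

subsection \<open>A central limit theorem for weighted sums\<close>

lemma exp_minus_bound:
  fixes u :: real
  assumes "u \<ge> 0"
  shows "\<bar>exp (- u) - (1 - u)\<bar> \<le> u\<^sup>2"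
proof -
  have "1 - u \<le> exp (- u)" using exp_ge_add_one_self[of "- u"] by simp
  moreover have "exp (- u) \<le> 1 - u + u\<^sup>2"
  proof -
    have "exp (- u) = 1 / exp u" by (simp add: exp_minus divide_inverse)
    also have "\<dots> \<le> 1 / (1 + u)" using assms exp_ge_add_one_self[of u] by (intro divide_left_mono) auto
    also have "\<dots> \<le> 1 - u + u\<^sup>2"
    proof -
      have "1 \<le> (1 - u + u\<^sup>2) * (1 + u)" using assms by (simp add: algebra_simps power2_eq_square)
      thus ?thesis using assms by (simp add: pos_divide_le_eq)
    qed
    finally show ?thesis .
  qed
  ultimately show ?thesis by (simp add: abs_le_iff)
qed

lemma step_function_integral:
  fixes g :: "nat \<Rightarrow> real"
  assumes "m > 0"
  shows "(\<integral>s. indicator {0..<1} s * g (nat \<lfloor>real m * s\<rfloor>) \<partial>lborel) = (\<Sum>k<m. g k) / real m"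
    and "(\<lambda>s. indicator {0..<1} s * g (nat \<lfloor>real m * s\<rfloor>)) \<in> borel_measurable lborel"
proof -
  have e: "indicator {0..<1} s * g (nat \<lfloor>real m * s\<rfloor>) = (\<Sum>k<m. g k * indicator {real k / real m..<real (Suc k) / real m} s)" for s
  proof -
    have ind: "s \<in> {real k / real m..<real (Suc k) / real m} \<longleftrightarrow> 0 \<le> s \<and> nat \<lfloor>real m * s\<rfloor> = k" for k
    proof -
      have "s \<in> {real k / real m..<real (Suc k) / real m} \<longleftrightarrow> real k \<le> real m * s \<and> real m * s < real (Suc k)"
        using assms by (auto simp: field_simps)
      also have "\<dots> \<longleftrightarrow> \<lfloor>real m * s\<rfloor> = int k" by (simp add: floor_eq_iff add.commute)
      also have "\<dots> \<longleftrightarrow> 0 \<le> s \<and> nat \<lfloor>real m * s\<rfloor> = k"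
      proof
        assume *: "\<lfloor>real m * s\<rfloor> = int k"
        hence "0 \<le> real m * s" by (metis of_nat_0_le_iff zero_le_floor)
        thus "0 \<le> s \<and> nat \<lfloor>real m * s\<rfloor> = k" using * assms by (auto simp: zero_le_mult_iff)
      next
        assume *: "0 \<le> s \<and> nat \<lfloor>real m * s\<rfloor> = k"
        hence "0 \<le> \<lfloor>real m * s\<rfloor>" by simp
        thus "\<lfloor>real m * s\<rfloor> = int k" using * by auto
      qed
      finally show ?thesis .
    qed
    show ?thesis
    proof (cases "0 \<le> s \<and> s < 1")
      case True
      define k where "k = nat \<lfloor>real m * s\<rfloor>"
      have "real m * s < real m" using True assms by simp
      hence "k < m" using True by (simp add: k_def nat_less_iff floor_less_iff)
      have "(\<Sum>l<m. g l * indicator {real l / real m..<real (Suc l) / real m} s) = (\<Sum>l<m. if l = k then g l else 0)"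
      proof (intro sum.cong refl)
        fix l
        have "indicator {real l / real m..<real (Suc l) / real m} s = (if l = k then 1 else 0 :: real)"
          unfolding indicator_def ind k_def using True by auto
        thus "g l * indicator {real l / real m..<real (Suc l) / real m} s = (if l = k then g l else 0)"
          by (simp only:) simp
      qed
      thus ?thesis using True \<open>k < m\<close> by (simp add: k_def[symmetric])
    next
      case False
      have "indicator {real l / real m..<real (Suc l) / real m} s = (0::real)" if "l < m" for l
      proof -
        have "real (Suc l) / real m \<le> 1" "real l / real m \<ge> 0" using that assms by auto
        hence "s \<notin> {real l / real m..<real (Suc l) / real m}"
          using False unfolding atLeastLessThan_iff by linarith
        thus ?thesis by (rule indicator_simps(2))
      qed
      thus ?thesis using False by simp
    qed
  qed
  show "(\<integral>s. indicator {0..<1} s * g (nat \<lfloor>real m * s\<rfloor>) \<partial>lborel) = (\<Sum>k<m. g k) / real m"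
  proof -
    have "(\<integral>s. (\<Sum>k<m. g k * indicator {real k / real m..<real (Suc k) / real m} s) \<partial>lborel) =
        (\<Sum>k<m. g k * (real (Suc k) / real m - real k / real m))"
      by (subst Bochner_Integration.integral_sum) (auto simp: divide_right_mono)
    also have "\<dots> = (\<Sum>k<m. g k / real m)" by (simp add: diff_divide_distrib[symmetric])
    finally show ?thesis unfolding e by (simp add: sum_divide_distrib)
  qed
  show "(\<lambda>s. indicator {0..<1} s * g (nat \<lfloor>real m * s\<rfloor>)) \<in> borel_measurable lborel"
    unfolding e by measurable
qed

text \<open>The average is the integral of a step function on the unit interval, so pointwise
  convergence inside the interval together with a uniform bound gives the limit by dominated
  convergence.\<close>

lemma riemann_sum_limit:
  fixes g :: "nat \<Rightarrow> nat \<Rightarrow> real"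
  assumes b: "\<And>m k. k < m \<Longrightarrow> \<bar>g m k\<bar> \<le> B"
    and l: "\<And>s. 0 < s \<Longrightarrow> s < 1 \<Longrightarrow> (\<lambda>m. g m (nat \<lfloor>real m * s\<rfloor>)) \<longlonglongrightarrow> h s"
    and h: "h \<in> borel_measurable lborel"
  shows "(\<lambda>m. (\<Sum>k<m. g m k) / real m) \<longlonglongrightarrow> (\<integral>s. indicator {0..<1} s * h s \<partial>lborel)"
proof -
  \<comment> \<open>Shifted to \<open>Suc m\<close>, since \<open>step_function_integral\<close>
    divides by the number of steps.\<close>
  have "(\<lambda>m. \<integral>s. indicator {0..<1} s * g (Suc m) (nat \<lfloor>real (Suc m) * s\<rfloor>) \<partial>lborel) \<longlonglongrightarrow> (\<integral>s. indicator {0..<1} s * h s \<partial>lborel)"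
  proof (rule integral_dominated_convergence[where w = "\<lambda>s. indicator {0..<1} s * B"])
    show "(\<lambda>s. indicator {0..<1} s * g (Suc m) (nat \<lfloor>real (Suc m) * s\<rfloor>)) \<in> borel_measurable lborel" for m
      by (rule step_function_integral(2)) simp
    show "(\<lambda>s. indicator {0..<1} s * h s) \<in> borel_measurable lborel" using h by measurable
    show "integrable lborel (\<lambda>s::real. indicator {0..<1} s * B)" by simp
    show "AE s in lborel. (\<lambda>m. indicator {0..<1} s * g (Suc m) (nat \<lfloor>real (Suc m) * s\<rfloor>)) \<longlonglongrightarrow> indicator {0..<1} s * h s"
      using AE_lborel_singleton[of 0]
    proof eventually_elim
      case (elim s)
      show ?case
      proof (cases "s \<in> {0..<1}")
        case True
        with elim have "(\<lambda>m. g m (nat \<lfloor>real m * s\<rfloor>)) \<longlonglongrightarrow> h s" by (intro l) auto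
        from LIMSEQ_Suc[OF this] show ?thesis using True by simp
      qed simp
    qed
    show "AE s in lborel. norm (indicator {0..<1} s * g (Suc m) (nat \<lfloor>real (Suc m) * s\<rfloor>)) \<le> indicator {0..<1} s * B" for m
    proof (rule AE_I2)
      fix s :: real
      show "norm (indicator {0..<1} s * g (Suc m) (nat \<lfloor>real (Suc m) * s\<rfloor>)) \<le> indicator {0..<1} s * B"
      proof (cases "s \<in> {0..<1}")
        case True
        hence "real (Suc m) * s < real (Suc m)" by simp
        moreover have "real (nat \<lfloor>real (Suc m) * s\<rfloor>) \<le> real (Suc m) * s"
          using True by (intro of_nat_floor) auto
        ultimately have "nat \<lfloor>real (Suc m) * s\<rfloor> < Suc m"
          unfolding of_nat_less_iff[where 'a=real, symmetric] by (rule le_less_trans[rotated])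
        from b[OF this] show ?thesis using True by simp
      qed simp
    qed
  qed
  hence "(\<lambda>m. (\<Sum>k<Suc m. g (Suc m) k) / real (Suc m)) \<longlonglongrightarrow> (\<integral>s. indicator {0..<1} s * h s \<partial>lborel)"
    by (subst (asm) step_function_integral(1)) auto
  thus ?thesis by (rule LIMSEQ_imp_Suc)
qed

context iid_seq begin

text \<open>Each factor of the characteristic function is compared with that of a centered normal
  law of the same variance. Third absolute moments of order \<open>m powr (-3/2)\<close> make the
  total error vanish; fourth moments, being even, are the ones assumed to dominate them. It remains
  that the sum of the variances converges, and this is a Riemann sum. Nothing is divided by the
  variance, so a limit of variance \<open>0\<close> is included.\<close>

lemma triangular_clt:
  fixes \<phi> :: "'i \<Rightarrow> 's \<Rightarrow> real" and a :: "nat \<Rightarrow> nat \<Rightarrow> 'i \<Rightarrow> real" and \<psi> :: "'i \<Rightarrow> real \<Rightarrow> real"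
  assumes fin: "finite I"
    and \<phi>m: "\<And>i. i \<in> I \<Longrightarrow> \<phi> i \<in> borel_measurable S"
    and \<phi>4: "\<And>i. i \<in> I \<Longrightarrow> lp M 4 (\<lambda>\<omega>. \<phi> i (X 0 \<omega>))"
    and \<phi>0: "\<And>i. i \<in> I \<Longrightarrow> expectation (\<lambda>\<omega>. \<phi> i (X 0 \<omega>)) = 0"
    and ab: "\<And>m k i. k < m \<Longrightarrow> i \<in> I \<Longrightarrow> \<bar>a m k i\<bar> \<le> C / sqrt (real m)"
    and al: "\<And>s i. 0 < s \<Longrightarrow> s < 1 \<Longrightarrow> i \<in> I \<Longrightarrow> (\<lambda>m. sqrt (real m) * a m (nat \<lfloor>real m * s\<rfloor>) i) \<longlonglongrightarrow> \<psi> i s"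
    and \<psi>m: "\<And>i. i \<in> I \<Longrightarrow> \<psi> i \<in> borel_measurable lborel"
  defines "\<sigma>2 \<equiv> (\<Sum>i\<in>I. \<Sum>j\<in>I. expectation (\<lambda>\<omega>. \<phi> i (X 0 \<omega>) * \<phi> j (X 0 \<omega>)) *
      (\<integral>s. indicator {0..<1} s * (\<psi> i s * \<psi> j s) \<partial>lborel))"
  shows "(\<lambda>m. char (distr M borel (\<lambda>\<omega>. \<Sum>k<m. \<Sum>i\<in>I. a m k i * \<phi> i (X (Suc k) \<omega>))) t) \<longlonglongrightarrow> exp (- (t\<^sup>2 * \<sigma>2 / 2))"
proof -
  define c where "c = (\<lambda>i j. expectation (\<lambda>\<omega>. \<phi> i (X 0 \<omega>) * \<phi> j (X 0 \<omega>)))"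
  define \<eta> where "\<eta> = (\<lambda>m k x. \<Sum>i\<in>I. a m k i * \<phi> i x)"
  have \<eta>m [measurable]: "\<eta> m k \<in> borel_measurable S" for m k
    unfolding \<eta>_def using \<phi>m by (intro borel_measurable_sum borel_measurable_times) auto
  define \<Phi> where "\<Phi> = (\<lambda>x. \<Sum>i\<in>I. \<bar>\<phi> i x\<bar>)"
  have \<Phi>m [measurable]: "\<Phi> \<in> borel_measurable S" unfolding \<Phi>_def using \<phi>m by (intro borel_measurable_sum borel_measurable_abs) auto
  have \<Phi>4: "lp M 4 (\<lambda>\<omega>. \<Phi> (X 0 \<omega>))"
  proof -
    have "lp M 4 (\<lambda>\<omega>. \<bar>\<phi> i (X 0 \<omega>)\<bar>)" if "i \<in> I" for i
      using \<phi>4[OF that] by (auto simp: lp_def)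
    thus ?thesis unfolding \<Phi>_def using fin by (intro lp_sum(1)) auto
  qed
  have \<Phi>0: "\<Phi> x \<ge> 0" for x by (auto simp: \<Phi>_def intro: sum_nonneg)
  have C0: "C \<ge> 0" if ne: "I \<noteq> {}"
  proof -
    obtain i where "i \<in> I" using ne by auto
    from ab[of 0 1 i, OF _ this] show ?thesis by simp
  qed
  have \<eta>le: "\<bar>\<eta> m k x\<bar> \<le> \<bar>C\<bar> / sqrt (real m) * \<Phi> x" if "k < m" for m k x
  proof (cases "I = {}")
    case False
    have "\<bar>\<eta> m k x\<bar> \<le> (\<Sum>i\<in>I. \<bar>a m k i * \<phi> i x\<bar>)" unfolding \<eta>_def by (rule sum_abs)
    also have "\<dots> \<le> (\<Sum>i\<in>I. C / sqrt (real m) * \<bar>\<phi> i x\<bar>)"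
      unfolding abs_mult using ab[OF that] by (intro sum_mono mult_right_mono) auto
    finally show ?thesis using C0[OF False] by (simp add: \<Phi>_def sum_distrib_left)
  qed (simp add: \<eta>_def \<Phi>_def)
  define B2 B3 where "B2 = C\<^sup>2 * expectation (\<lambda>\<omega>. \<Phi> (X 0 \<omega>) ^ 2)" and "B3 = \<bar>C\<bar> ^ 3 * expectation (\<lambda>\<omega>. \<Phi> (X 0 \<omega>) ^ 3)"
  have \<Phi>i: "integrable M (\<lambda>\<omega>. \<Phi> (X 0 \<omega>) ^ j)" if "j \<le> 4" for j
    by (rule lp_integrable_lower[OF _ that \<Phi>4]) simp
  have \<eta>i: "integrable M (\<lambda>\<omega>. \<bar>\<eta> m k (X 0 \<omega>)\<bar> ^ j)" and \<eta>E: "expectation (\<lambda>\<omega>. \<bar>\<eta> m k (X 0 \<omega>)\<bar> ^ j) \<le> (\<bar>C\<bar> / sqrt (real m)) ^ j * expectation (\<lambda>\<omega>. \<Phi> (X 0 \<omega>) ^ j)"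
    if "k < m" "j \<le> 4" for m k j
  proof -
    have le: "\<bar>\<eta> m k x\<bar> ^ j \<le> (\<bar>C\<bar> / sqrt (real m)) ^ j * \<Phi> x ^ j" for x
      unfolding power_mult_distrib[symmetric] by (intro power_mono \<eta>le that) auto
    show i: "integrable M (\<lambda>\<omega>. \<bar>\<eta> m k (X 0 \<omega>)\<bar> ^ j)"
      by (rule Bochner_Integration.integrable_bound[OF integrable_mult_right[OF \<Phi>i[OF that(2)], of "(\<bar>C\<bar> / sqrt (real m)) ^ j"]])
         (use le in \<open>auto intro!: AE_I2 intro: order_trans[OF _ abs_ge_self]\<close>)
    have "expectation (\<lambda>\<omega>. \<bar>\<eta> m k (X 0 \<omega>)\<bar> ^ j) \<le> expectation (\<lambda>\<omega>. (\<bar>C\<bar> / sqrt (real m)) ^ j * \<Phi> (X 0 \<omega>) ^ j)"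
      by (intro integral_mono i integrable_mult_right \<Phi>i that le)
    thus "expectation (\<lambda>\<omega>. \<bar>\<eta> m k (X 0 \<omega>)\<bar> ^ j) \<le> (\<bar>C\<bar> / sqrt (real m)) ^ j * expectation (\<lambda>\<omega>. \<Phi> (X 0 \<omega>) ^ j)" by simp
  qed
  define v where "v = (\<lambda>m k. expectation (\<lambda>\<omega>. (\<eta> m k (X 0 \<omega>))\<^sup>2))"
  have v0: "v m k \<ge> 0" for m k by (simp add: v_def)
  have vle: "v m k \<le> B2 / real m" if "k < m" for m k
    using \<eta>E[OF that, of 2] that by (simp add: v_def B2_def power_divide)
  have E3: "expectation (\<lambda>\<omega>. \<bar>\<eta> m k (X 0 \<omega>)\<bar> ^ 3) \<le> B3 / (real m * sqrt (real m))" if "k < m" for m k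
    using \<eta>E[OF that, of 3] that by (simp add: B3_def power_divide power3_eq_cube)
  have \<phi>prod: "integrable M (\<lambda>\<omega>. \<phi> i (X 0 \<omega>) * \<phi> j (X 0 \<omega>))" if "i \<in> I" "j \<in> I" for i j
  proof -
    have 2: "lp M 2 (\<lambda>\<omega>. \<phi> i (X 0 \<omega>))" if "i \<in> I" for i by (rule lp_lower[OF _ _ \<phi>4[OF that]]) auto
    from lp_integrable_mult[OF _ _ 2[OF that(1)] 2[OF that(2)], of 1] show ?thesis by simp
  qed
  have v_eq: "v m k = (\<Sum>i\<in>I. \<Sum>j\<in>I. a m k i * a m k j * c i j)" for m k
  proof -
    have "v m k = expectation (\<lambda>\<omega>. \<Sum>i\<in>I. \<Sum>j\<in>I. (a m k i * a m k j) * (\<phi> i (X 0 \<omega>) * \<phi> j (X 0 \<omega>)))"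
      unfolding v_def \<eta>_def power2_eq_square sum_product by (simp add: mult_ac)
    also have "\<dots> = (\<Sum>i\<in>I. \<Sum>j\<in>I. a m k i * a m k j * c i j)"
      by (simp add: Bochner_Integration.integral_sum \<phi>prod c_def)
    finally show ?thesis .
  qed
  have sum_v: "(\<lambda>m. \<Sum>k<m. v m k) \<longlonglongrightarrow> \<sigma>2"
  proof -
    have "(\<lambda>m. (\<Sum>k<m. real m * (a m k i * a m k j)) / real m) \<longlonglongrightarrow> (\<integral>s. indicator {0..<1} s * (\<psi> i s * \<psi> j s) \<partial>lborel)"
      if ij: "i \<in> I" "j \<in> I" for i j
    proof (rule riemann_sum_limit)
      fix m k :: nat assume km: "k < m"
      have le: "C / sqrt (real m) \<le> \<bar>C\<bar> / sqrt (real m)" by (intro divide_right_mono) auto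
      have "\<bar>a m k i\<bar> * \<bar>a m k j\<bar> \<le> (\<bar>C\<bar> / sqrt (real m)) * (\<bar>C\<bar> / sqrt (real m))"
        using ij by (intro mult_mono order_trans[OF ab[OF km] le]) auto
      hence "real m * (\<bar>a m k i\<bar> * \<bar>a m k j\<bar>) \<le> real m * ((\<bar>C\<bar> / sqrt (real m)) * (\<bar>C\<bar> / sqrt (real m)))"
        by (intro mult_left_mono) auto
      also have "\<dots> = C\<^sup>2" using km by (simp add: power2_eq_square)
      finally show "\<bar>real m * (a m k i * a m k j)\<bar> \<le> C\<^sup>2" by (simp add: abs_mult)
    next
      fix s :: real assume s: "0 < s" "s < 1"
      have "(\<lambda>m. (sqrt (real m) * a m (nat \<lfloor>real m * s\<rfloor>) i) * (sqrt (real m) * a m (nat \<lfloor>real m * s\<rfloor>) j)) \<longlonglongrightarrow> \<psi> i s * \<psi> j s"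
        by (intro tendsto_mult al s ij)
      moreover have "(sqrt (real m) * x) * (sqrt (real m) * y) = real m * (x * y)" for m x y
        using real_sqrt_mult_self[of "real m"] by (simp add: mult_ac)
      ultimately show "(\<lambda>m. real m * (a m (nat \<lfloor>real m * s\<rfloor>) i * a m (nat \<lfloor>real m * s\<rfloor>) j)) \<longlonglongrightarrow> \<psi> i s * \<psi> j s" by simp
    qed (use \<psi>m ij in measurable)
    hence lim: "(\<lambda>m. \<Sum>i\<in>I. \<Sum>j\<in>I. c i j * ((\<Sum>k<m. real m * (a m k i * a m k j)) / real m)) \<longlonglongrightarrow> \<sigma>2"
      unfolding \<sigma>2_def c_def by (intro tendsto_sum tendsto_mult tendsto_const)
    have eq: "(\<Sum>i\<in>I. \<Sum>j\<in>I. c i j * ((\<Sum>k<m. real m * (a m k i * a m k j)) / real m)) = (\<Sum>k<m. v m k)" if "m > 0" for m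
    proof -
      have "(\<Sum>k<m. real m * (a m k i * a m k j)) / real m = (\<Sum>k<m. a m k i * a m k j)" for i j
        using that by (simp flip: sum_distrib_left)
      hence "(\<Sum>i\<in>I. \<Sum>j\<in>I. c i j * ((\<Sum>k<m. real m * (a m k i * a m k j)) / real m)) =
        (\<Sum>i\<in>I. \<Sum>j\<in>I. \<Sum>k<m. a m k i * a m k j * c i j)" by (simp add: sum_distrib_left mult_ac)
      also have "\<dots> = (\<Sum>i\<in>I. \<Sum>k<m. \<Sum>j\<in>I. a m k i * a m k j * c i j)" by (intro sum.cong refl sum.swap)
      also have "\<dots> = (\<Sum>k<m. \<Sum>i\<in>I. \<Sum>j\<in>I. a m k i * a m k j * c i j)" by (rule sum.swap)
      finally show ?thesis by (simp add: v_eq)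
    qed
    show ?thesis
      by (rule Lim_transform_eventually[OF lim eventually_mono[OF eventually_gt_at_top[of 0] eq]])
  qed
  define T where "T = (\<lambda>m \<omega>. \<Sum>k<m. \<eta> m k (X (Suc k) \<omega>))"
  have char_eq: "char (distr M borel (T m)) t = (\<Prod>k<m. char (distr M borel (\<lambda>\<omega>. \<eta> m k (X (Suc k) \<omega>))) t)" for m
  proof -
    have "indep_vars (\<lambda>_. borel) (\<lambda>l \<omega>. \<eta> m (l - 1) (X l \<omega>)) {1..m}"
      by (rule indep_vars_compose2[OF indep_vars_subset[OF indep]]) auto
    from char_distr_sum[OF this, of t]
    have "char (distr M borel (\<lambda>\<omega>. \<Sum>l\<in>{1..m}. \<eta> m (l - 1) (X l \<omega>))) t =
        (\<Prod>l\<in>{1..m}. char (distr M borel (\<lambda>\<omega>. \<eta> m (l - 1) (X l \<omega>))) t)" .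
    moreover have "(\<Sum>l\<in>{1..m}. \<eta> m (l - 1) (X l \<omega>)) = T m \<omega>" for \<omega>
      unfolding T_def by (rule sum.reindex_bij_witness[of _ Suc "\<lambda>l. l - 1"]) auto
    moreover have "(\<Prod>l\<in>{1..m}. char (distr M borel (\<lambda>\<omega>. \<eta> m (l - 1) (X l \<omega>))) t) =
       (\<Prod>k<m. char (distr M borel (\<lambda>\<omega>. \<eta> m k (X (Suc k) \<omega>))) t)"
      by (rule prod.reindex_bij_witness[of _ Suc "\<lambda>l. l - 1"]) auto
    ultimately show ?thesis by simp
  qed
  \<comment> \<open>Two errors: the second-order expansion of the characteristic function, paid by a
    third moment, and the replacement of \<open>1 - u\<close> by \<open>exp (- u)\<close>, paid by
    the square of a variance.\<close>
  have close: "cmod (char (distr M borel (\<lambda>\<omega>. \<eta> m k (X (Suc k) \<omega>))) t - exp (- (t\<^sup>2 * v m k / 2)))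
     \<le> \<bar>t\<bar> ^ 3 / 6 * (B3 / (real m * sqrt (real m))) + t ^ 4 / 4 * (B2 / real m)\<^sup>2" if km: "k < m" for m k
  proof -
    let ?Z = "\<lambda>\<omega>. \<eta> m k (X 0 \<omega>)"
    have dX: "distr M borel (\<lambda>\<omega>. \<eta> m k (X (Suc k) \<omega>)) = distr M borel ?Z"
    proof -
      have "distr M borel (\<lambda>\<omega>. \<eta> m k (X l \<omega>)) = distr (distr M S (X l)) borel (\<eta> m k)" for l
        by (simp add: distr_distr comp_def)
      thus ?thesis using ident[of "Suc k"] by simp
    qed
    have mean: "expectation ?Z = 0" and i1: "integrable M ?Z"
      unfolding \<eta>_def using \<phi>0 lp_integrable[OF _ _ \<phi>4] by simp_all
    have i2: "integrable M (\<lambda>\<omega>. (?Z \<omega>)\<^sup>2)" using \<eta>i[OF km, of 2] by simp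
    have i3: "integrable M (\<lambda>\<omega>. \<bar>?Z \<omega>\<bar> ^ 3)" using \<eta>i[OF km, of 3] by simp
    have "cmod (char (distr M borel ?Z) t - (1 - t^2 * v m k / 2)) \<le>
        (t^2 / 6) * expectation (\<lambda>x. min (6 * (?Z x)^2) (\<bar>t\<bar> * \<bar>?Z x\<bar>^3))"
      by (rule char_approx3') (use i1 i2 mean in \<open>auto simp: v_def\<close>)
    also have "\<dots> \<le> (t^2 / 6) * expectation (\<lambda>x. \<bar>t\<bar> * \<bar>?Z x\<bar>^3)"
      using i2 i3 by (intro mult_left_mono integral_mono Bochner_Integration.integrable_min integrable_mult_right) auto
    also have "\<dots> = \<bar>t\<bar> ^ 3 / 6 * expectation (\<lambda>x. \<bar>?Z x\<bar>^3)"
      by (simp add: power3_eq_cube power2_eq_square)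
    also have "\<dots> \<le> \<bar>t\<bar> ^ 3 / 6 * (B3 / (real m * sqrt (real m)))"
      by (intro mult_left_mono E3 km) auto
    finally have 1: "cmod (char (distr M borel ?Z) t - (1 - t^2 * v m k / 2)) \<le> \<bar>t\<bar> ^ 3 / 6 * (B3 / (real m * sqrt (real m)))" .
    define u where "u = t\<^sup>2 * v m k / 2"
    have u0: "u \<ge> 0" using v0[of m k] by (simp add: u_def)
    have "cmod (complex_of_real (1 - u) - complex_of_real (exp (- u))) = \<bar>exp (- u) - (1 - u)\<bar>"
      unfolding of_real_diff[symmetric] norm_of_real by (rule abs_minus_commute)
    also have "\<dots> \<le> u\<^sup>2" by (rule exp_minus_bound[OF u0])
    also have "\<dots> \<le> (t\<^sup>2 * (B2 / real m) / 2)\<^sup>2"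
      unfolding u_def using vle[OF km] v0[of m k] by (intro power_mono divide_right_mono mult_left_mono) auto
    also have "\<dots> = t ^ 4 / 4 * (B2 / real m)\<^sup>2" by (simp add: power_mult_distrib power_divide flip: power_mult)
    finally have 2: "cmod (complex_of_real (1 - u) - complex_of_real (exp (- u))) \<le> t ^ 4 / 4 * (B2 / real m)\<^sup>2" .
    have e: "char (distr M borel ?Z) t - exp (- (t\<^sup>2 * v m k / 2)) =
       (char (distr M borel ?Z) t - (1 - t^2 * v m k / 2)) + (complex_of_real (1 - u) - complex_of_real (exp (- u)))"
      by (simp add: u_def)
    show ?thesis unfolding dX e using 1 2 by (intro norm_triangle_le) linarith
  qed
  have bound: "cmod (char (distr M borel (T m)) t - exp (- (t\<^sup>2 * (\<Sum>k<m. v m k) / 2)))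
      \<le> \<bar>t\<bar> ^ 3 / 6 * B3 * (1 / sqrt (real m)) + t ^ 4 / 4 * B2\<^sup>2 * (1 / real m)" if "m > 0" for m
  proof -
    have e: "complex_of_real (exp (- (t\<^sup>2 * (\<Sum>k<m. v m k) / 2))) = (\<Prod>k<m. complex_of_real (exp (- (t\<^sup>2 * v m k / 2))))"
      by (simp add: exp_sum[symmetric] sum_distrib_left sum_divide_distrib sum_negf flip: of_real_prod)
    have "cmod (char (distr M borel (T m)) t - exp (- (t\<^sup>2 * (\<Sum>k<m. v m k) / 2))) \<le>
       (\<Sum>k<m. cmod (char (distr M borel (\<lambda>\<omega>. \<eta> m k (X (Suc k) \<omega>))) t - exp (- (t\<^sup>2 * v m k / 2))))"
      unfolding char_eq e
    proof (rule norm_prod_diff)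
      fix k
      interpret D: real_distribution "distr M borel (\<lambda>\<omega>. \<eta> m k (X (Suc k) \<omega>))"
        by (rule real_distribution_distr) simp
      show "cmod (char (distr M borel (\<lambda>\<omega>. \<eta> m k (X (Suc k) \<omega>))) t) \<le> 1" by (rule D.cmod_char_le_1)
      show "cmod (complex_of_real (exp (- (t\<^sup>2 * v m k / 2)))) \<le> 1"
        using v0[of m k] by (simp only: norm_of_real) simp
    qed
    also have "\<dots> \<le> (\<Sum>k<m. \<bar>t\<bar> ^ 3 / 6 * (B3 / (real m * sqrt (real m))) + t ^ 4 / 4 * (B2 / real m)\<^sup>2)"
      by (intro sum_mono close) auto
    also have "\<dots> = \<bar>t\<bar> ^ 3 / 6 * B3 * (1 / sqrt (real m)) + t ^ 4 / 4 * B2\<^sup>2 * (1 / real m)"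
      using that by (simp add: field_simps power2_eq_square)
    finally show ?thesis .
  qed
  have "(\<lambda>m. \<bar>t\<bar> ^ 3 / 6 * B3 * (1 / sqrt (real m)) + t ^ 4 / 4 * B2\<^sup>2 * (1 / real m)) \<longlonglongrightarrow>
      \<bar>t\<bar> ^ 3 / 6 * B3 * 0 + t ^ 4 / 4 * B2\<^sup>2 * 0"
  proof (intro tendsto_add tendsto_mult tendsto_const)
    have "filterlim (\<lambda>m. sqrt (real m)) at_top sequentially"
      by (rule filterlim_compose[OF sqrt_at_top filterlim_real_sequentially])
    thus "(\<lambda>m. 1 / sqrt (real m)) \<longlonglongrightarrow> 0" by (intro tendsto_divide_0[OF tendsto_const] filterlim_at_top_imp_at_infinity)
    show "(\<lambda>m. 1 / real m) \<longlonglongrightarrow> 0" by (rule lim_1_over_n)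
  qed
  hence "(\<lambda>m. char (distr M borel (T m)) t - exp (- (t\<^sup>2 * (\<Sum>k<m. v m k) / 2))) \<longlonglongrightarrow> 0"
    by (intro Lim_null_comparison[OF eventually_mono[OF eventually_gt_at_top[of 0] bound]]) simp_all
  moreover have "(\<lambda>m. complex_of_real (exp (- (t\<^sup>2 * (\<Sum>k<m. v m k) / 2)))) \<longlonglongrightarrow> complex_of_real (exp (- (t\<^sup>2 * \<sigma>2 / 2)))"
    by (intro tendsto_of_real tendsto_exp tendsto_minus tendsto_divide tendsto_mult tendsto_const sum_v) auto
  ultimately have "(\<lambda>m. char (distr M borel (T m)) t) \<longlonglongrightarrow> 0 + complex_of_real (exp (- (t\<^sup>2 * \<sigma>2 / 2)))"
    by (auto dest: tendsto_add)
  thus ?thesis by (simp add: T_def[abs_def] \<eta>_def)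
qed

end

subsection \<open>Wiener integrals\<close>

text \<open>The inequality of arithmetic and geometric means with a free weight: a small
  \<open>e\<close> makes the last term negligible, which yields convergence of squared norms in
  \<open>L2_lim_norm\<close>.\<close>

lemma power2_diff_bound:
  fixes a b e :: real
  assumes "e > 0"
  shows "\<bar>a\<^sup>2 - b\<^sup>2\<bar> \<le> (1 + 1 / e) * (a - b)\<^sup>2 + e * b\<^sup>2"
proof -
  have "2 * (\<bar>b\<bar> * \<bar>a - b\<bar>) \<le> e * b\<^sup>2 + (a - b)\<^sup>2 / e"
  proof -
    have "0 \<le> (sqrt e * \<bar>b\<bar> - \<bar>a - b\<bar> / sqrt e)\<^sup>2" by simp
    also have "\<dots> = e * b\<^sup>2 - 2 * (\<bar>b\<bar> * \<bar>a - b\<bar>) + (a - b)\<^sup>2 / e"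
      using assms by (simp add: power2_diff power_mult_distrib power_divide)
    finally show ?thesis by simp
  qed
  moreover have "\<bar>a\<^sup>2 - b\<^sup>2\<bar> = \<bar>(a - b)\<^sup>2 + 2 * (b * (a - b))\<bar>"
    by (simp add: power2_eq_square algebra_simps)
  moreover have "\<dots> \<le> (a - b)\<^sup>2 + 2 * (\<bar>b\<bar> * \<bar>a - b\<bar>)"
    by (intro order_trans[OF abs_triangle_ineq]) (simp add: abs_mult)
  ultimately show ?thesis by (simp add: algebra_simps)
qed

text \<open>Nonnegative integrals, as in \<open>has_wiener_integral\<close>: convergence to
  \<open>0\<close> then forces the differences to be square integrable eventually, and with them the
  limit, instead of presupposing it.\<close>

definition L2_lim :: "'b measure \<Rightarrow> (nat \<Rightarrow> 'b \<Rightarrow> real) \<Rightarrow> ('b \<Rightarrow> real) \<Rightarrow> bool" where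
  "L2_lim N h g \<longleftrightarrow> (\<forall>n. lp N 2 (h n)) \<and> g \<in> borel_measurable N \<and>
     (\<lambda>n. \<integral>\<^sup>+x. ennreal ((h n x - g x)\<^sup>2) \<partial>N) \<longlonglongrightarrow> 0"

lemma L2_lim_eventually:
  assumes "L2_lim N h g"
  shows "\<forall>\<^sub>F n in sequentially. integrable N (\<lambda>x. (h n x - g x)\<^sup>2)"
    and "(\<lambda>n. \<integral>x. (h n x - g x)\<^sup>2 \<partial>N) \<longlonglongrightarrow> 0"
    and "lp N 2 g"
proof -
  have [measurable]: "\<And>n. h n \<in> borel_measurable N" "g \<in> borel_measurable N"
    and l: "(\<lambda>n. \<integral>\<^sup>+x. ennreal ((h n x - g x)\<^sup>2) \<partial>N) \<longlonglongrightarrow> 0" and hl: "\<And>n. lp N 2 (h n)"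
    using assms by (auto simp: L2_lim_def lp_def)
  have "\<forall>\<^sub>F n in sequentially. (\<integral>\<^sup>+x. ennreal ((h n x - g x)\<^sup>2) \<partial>N) < 1"
    using l by (rule order_tendstoD) simp
  thus ev: "\<forall>\<^sub>F n in sequentially. integrable N (\<lambda>x. (h n x - g x)\<^sup>2)"
  proof eventually_elim
    case (elim n)
    hence "(\<integral>\<^sup>+x. ennreal ((h n x - g x)\<^sup>2) \<partial>N) < \<infinity>" by (rule less_trans) simp
    thus ?case by (intro integrableI_nonneg) auto
  qed
  have "\<forall>\<^sub>F n in sequentially. (\<integral>\<^sup>+x. ennreal ((h n x - g x)\<^sup>2) \<partial>N) = ennreal (\<integral>x. (h n x - g x)\<^sup>2 \<partial>N)"
    using ev by eventually_elim (simp add: nn_integral_eq_integral)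
  hence "(\<lambda>n. ennreal (\<integral>x. (h n x - g x)\<^sup>2 \<partial>N)) \<longlonglongrightarrow> ennreal 0"
    using l by (subst (asm) tendsto_cong) (auto elim: eventually_mono)
  thus "(\<lambda>n. \<integral>x. (h n x - g x)\<^sup>2 \<partial>N) \<longlonglongrightarrow> 0"
    by (subst (asm) tendsto_ennreal_iff) auto
  from ev obtain n where "integrable N (\<lambda>x. (h n x - g x)\<^sup>2)" by (auto simp: eventually_sequentially)
  hence "lp N 2 (\<lambda>x. h n x - g x)" by (intro lpI) auto
  from lp_diff(1)[OF _ hl[of n] this] show "lp N 2 g" by simp
qed

lemma L2_lim_norm:
  assumes "L2_lim N h g"
  shows "(\<lambda>n. \<integral>x. (h n x)\<^sup>2 \<partial>N) \<longlonglongrightarrow> (\<integral>x. (g x)\<^sup>2 \<partial>N)"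
proof (rule LIMSEQ_I)
  fix r :: real assume r: "r > 0"
  note ev = L2_lim_eventually[OF assms]
  define B where "B = (\<integral>x. (g x)\<^sup>2 \<partial>N)"
  have B: "B \<ge> 0" by (simp add: B_def)
  define e where "e = r / (2 * (B + 1))"
  have e: "e > 0" "e * B < r / 2"
  proof -
    show "e > 0" using r B by (simp add: e_def)
    have "e * B < e * (B + 1)" using \<open>e > 0\<close> by simp
    also have "\<dots> = r / 2" using B by (simp add: e_def divide_simps)
    finally show "e * B < r / 2" .
  qed
  have gi: "integrable N (\<lambda>x. (g x)\<^sup>2)" and hi: "integrable N (\<lambda>x. (h n x)\<^sup>2)" for n
    using ev(3) assms by (auto simp: lp_def L2_lim_def)
  have le: "\<bar>(\<integral>x. (h n x)\<^sup>2 \<partial>N) - B\<bar> \<le> (1 + 1 / e) * (\<integral>x. (h n x - g x)\<^sup>2 \<partial>N) + e * B"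
    if "integrable N (\<lambda>x. (h n x - g x)\<^sup>2)" for n
  proof -
    have "\<bar>(\<integral>x. (h n x)\<^sup>2 \<partial>N) - B\<bar> = \<bar>\<integral>x. (h n x)\<^sup>2 - (g x)\<^sup>2 \<partial>N\<bar>"
      unfolding B_def using gi hi by simp
    also have "\<dots> \<le> (\<integral>x. \<bar>(h n x)\<^sup>2 - (g x)\<^sup>2\<bar> \<partial>N)" by (rule integral_abs_bound)
    also have "\<dots> \<le> (\<integral>x. (1 + 1 / e) * (h n x - g x)\<^sup>2 + e * (g x)\<^sup>2 \<partial>N)"
      using gi hi that power2_diff_bound[OF e(1)] by (intro integral_mono) auto
    also have "\<dots> = (1 + 1 / e) * (\<integral>x. (h n x - g x)\<^sup>2 \<partial>N) + e * B"
      unfolding B_def using gi that by simp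
    finally show ?thesis .
  qed
  have "(\<lambda>n. (1 + 1 / e) * (\<integral>x. (h n x - g x)\<^sup>2 \<partial>N) + e * B) \<longlonglongrightarrow> (1 + 1 / e) * 0 + e * B"
    by (intro tendsto_intros ev(2))
  hence "\<forall>\<^sub>F n in sequentially. (1 + 1 / e) * (\<integral>x. (h n x - g x)\<^sup>2 \<partial>N) + e * B < r"
    by (rule order_tendstoD) (use e(2) r in simp)
  with ev(1) have "\<forall>\<^sub>F n in sequentially. norm ((\<integral>x. (h n x)\<^sup>2 \<partial>N) - B) < r"
    by eventually_elim (use le in force)
  thus "\<exists>no. \<forall>n\<ge>no. norm ((\<integral>x. (h n x)\<^sup>2 \<partial>N) - (\<integral>x. (g x)\<^sup>2 \<partial>N)) < r"
    by (simp add: eventually_sequentially B_def)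
qed

lemma L2_lim_cmult:
  assumes "L2_lim N h g"
  shows "L2_lim N (\<lambda>n x. c * h n x) (\<lambda>x. c * g x)"
proof -
  have [measurable]: "\<And>n. h n \<in> borel_measurable N" "g \<in> borel_measurable N"
    using assms by (auto simp: L2_lim_def lp_def)
  have "(\<integral>\<^sup>+x. ennreal ((c * h n x - c * g x)\<^sup>2) \<partial>N) = ennreal (c\<^sup>2) * (\<integral>\<^sup>+x. ennreal ((h n x - g x)\<^sup>2) \<partial>N)" for n
    by (subst nn_integral_cmult[symmetric]) (auto simp: ennreal_mult[symmetric] power_mult_distrib[symmetric] right_diff_distrib)
  moreover have "(\<lambda>n. ennreal (c\<^sup>2) * (\<integral>\<^sup>+x. ennreal ((h n x - g x)\<^sup>2) \<partial>N)) \<longlonglongrightarrow> ennreal (c\<^sup>2) * 0"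
    using assms by (intro ennreal_tendsto_cmult) (auto simp: L2_lim_def)
  ultimately have "(\<lambda>n. \<integral>\<^sup>+x. ennreal ((c * h n x - c * g x)\<^sup>2) \<partial>N) \<longlonglongrightarrow> 0" by simp
  moreover have "lp N 2 (\<lambda>x. c * h n x)" for n using assms by (intro lp_cmult) (auto simp: L2_lim_def)
  ultimately show ?thesis by (simp add: L2_lim_def)
qed

lemma L2_lim_add:
  assumes "L2_lim N h g" "L2_lim N h' g'"
  shows "L2_lim N (\<lambda>n x. h n x + h' n x) (\<lambda>x. g x + g' x)"
proof -
  have [measurable]: "\<And>n. h n \<in> borel_measurable N" "g \<in> borel_measurable N" "\<And>n. h' n \<in> borel_measurable N" "g' \<in> borel_measurable N"
    using assms by (auto simp: L2_lim_def lp_def)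
  have le: "(\<integral>\<^sup>+x. ennreal ((h n x + h' n x - (g x + g' x))\<^sup>2) \<partial>N) \<le>
      2 * (\<integral>\<^sup>+x. ennreal ((h n x - g x)\<^sup>2) \<partial>N) + 2 * (\<integral>\<^sup>+x. ennreal ((h' n x - g' x)\<^sup>2) \<partial>N)" for n
  proof -
    have *: "(a + b)\<^sup>2 \<le> 2 * a\<^sup>2 + 2 * b\<^sup>2" for a b :: real
      using zero_le_power2[of "a - b"] by (simp add: power2_eq_square algebra_simps)
    have "ennreal ((h n x + h' n x - (g x + g' x))\<^sup>2) \<le> 2 * ennreal ((h n x - g x)\<^sup>2) + 2 * ennreal ((h' n x - g' x)\<^sup>2)" for x
    proof -
      have "(h n x + h' n x - (g x + g' x))\<^sup>2 \<le> 2 * (h n x - g x)\<^sup>2 + 2 * (h' n x - g' x)\<^sup>2"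
        using *[of "h n x - g x" "h' n x - g' x"] by (simp add: algebra_simps)
      hence "ennreal ((h n x + h' n x - (g x + g' x))\<^sup>2) \<le> ennreal (2 * (h n x - g x)\<^sup>2 + 2 * (h' n x - g' x)\<^sup>2)"
        by (rule ennreal_leI)
      thus ?thesis by (simp add: ennreal_mult)
    qed
    hence "(\<integral>\<^sup>+x. ennreal ((h n x + h' n x - (g x + g' x))\<^sup>2) \<partial>N) \<le>
      (\<integral>\<^sup>+x. 2 * ennreal ((h n x - g x)\<^sup>2) + 2 * ennreal ((h' n x - g' x)\<^sup>2) \<partial>N)" by (intro nn_integral_mono)
    also have "\<dots> = 2 * (\<integral>\<^sup>+x. ennreal ((h n x - g x)\<^sup>2) \<partial>N) + 2 * (\<integral>\<^sup>+x. ennreal ((h' n x - g' x)\<^sup>2) \<partial>N)"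
      by (simp add: nn_integral_add nn_integral_cmult)
    finally show ?thesis .
  qed
  have "(\<lambda>n. 2 * (\<integral>\<^sup>+x. ennreal ((h n x - g x)\<^sup>2) \<partial>N) + 2 * (\<integral>\<^sup>+x. ennreal ((h' n x - g' x)\<^sup>2) \<partial>N)) \<longlonglongrightarrow> 2 * 0 + 2 * 0"
    using assms by (intro tendsto_add ennreal_tendsto_cmult) (auto simp: L2_lim_def)
  hence lim: "(\<lambda>n. 2 * (\<integral>\<^sup>+x. ennreal ((h n x - g x)\<^sup>2) \<partial>N) + 2 * (\<integral>\<^sup>+x. ennreal ((h' n x - g' x)\<^sup>2) \<partial>N)) \<longlonglongrightarrow> 0"
    by simp
  have "(\<lambda>n. \<integral>\<^sup>+x. ennreal ((h n x + h' n x - (g x + g' x))\<^sup>2) \<partial>N) \<longlonglongrightarrow> 0"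
    by (rule tendsto_sandwich[OF always_eventually[OF allI] always_eventually[OF allI[OF le]] tendsto_const lim]) simp
  moreover have "lp N 2 (\<lambda>x. h n x + h' n x)" for n using assms by (intro lp_add(1)) (auto simp: L2_lim_def)
  ultimately show ?thesis by (simp add: L2_lim_def)
qed

lemma L2_lim_sum:
  assumes "finite I" "\<And>i. i \<in> I \<Longrightarrow> L2_lim N (h i) (g i)"
  shows "L2_lim N (\<lambda>n x. \<Sum>i\<in>I. h i n x) (\<lambda>x. \<Sum>i\<in>I. g i x)"
  using assms
proof (induction I rule: finite_induct)
  case empty
  then show ?case by (simp add: L2_lim_def lp_def)
next
  case (insert i I)
  then show ?case using L2_lim_add[of N "h i" "g i"] by simp
qed

text \<open>Polarisation reduces inner products to norms.\<close>

lemma L2_lim_inner: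
  assumes "L2_lim N h g" "L2_lim N h' g'"
  shows "(\<lambda>n. \<integral>x. h n x * h' n x \<partial>N) \<longlonglongrightarrow> (\<integral>x. g x * g' x \<partial>N)"
proof -
  have pol: "(\<integral>x. a x * b x \<partial>N) = ((\<integral>x. (a x + b x)\<^sup>2 \<partial>N) - (\<integral>x. (a x + (-1) * b x)\<^sup>2 \<partial>N)) / 4"
    if "lp N 2 a" "lp N 2 b" for a b
  proof -
    have i: "integrable N (\<lambda>x. (a x + b x)\<^sup>2)" "integrable N (\<lambda>x. (a x + (-1) * b x)\<^sup>2)"
      using lp_add(1)[OF _ that] lp_add(1)[OF _ that(1) lp_cmult[OF that(2), of "-1"]] by (auto simp: lp_def)
    have "((\<integral>x. (a x + b x)\<^sup>2 \<partial>N) - (\<integral>x. (a x + (-1) * b x)\<^sup>2 \<partial>N)) = (\<integral>x. (a x + b x)\<^sup>2 - (a x + (-1) * b x)\<^sup>2 \<partial>N)"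
      by (rule Bochner_Integration.integral_diff[OF i, symmetric])
    also have "\<dots> = (\<integral>x. 4 * (a x * b x) \<partial>N)"
      by (rule Bochner_Integration.integral_cong) (auto simp: power2_eq_square algebra_simps)
    finally show ?thesis by simp
  qed
  have "(\<lambda>n. ((\<integral>x. (h n x + h' n x)\<^sup>2 \<partial>N) - (\<integral>x. (h n x + (-1) * h' n x)\<^sup>2 \<partial>N)) / 4) \<longlonglongrightarrow>
     ((\<integral>x. (g x + g' x)\<^sup>2 \<partial>N) - (\<integral>x. (g x + (-1) * g' x)\<^sup>2 \<partial>N)) / 4"
    by (intro tendsto_intros L2_lim_norm L2_lim_add L2_lim_cmult assms) simp
  moreover have "lp N 2 (h n)" "lp N 2 (h' n)" "lp N 2 g" "lp N 2 g'" for n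
    using assms L2_lim_eventually(3) by (auto simp: L2_lim_def)
  ultimately show ?thesis by (simp only: pol)
qed

definition step_on_unit :: "(real \<times> real \<times> real) list \<Rightarrow> bool" where
  "step_on_unit \<phi> \<longleftrightarrow> (\<forall>(c, u, v)\<in>set \<phi>. 0 \<le> u \<and> u \<le> v \<and> v \<le> 1)"

lemma step_fun_lp: "lp lborel 2 (\<lambda>s. indicator {0..1} s * step_fun \<phi> s)"
proof (induction \<phi>)
  case Nil
  then show ?case by (simp add: step_fun_def lp_def)
next
  case (Cons x \<phi>)
  obtain c u v where x: "x = (c, u, v)" by (cases x) auto
  have e: "(indicator {0..1} s * (c * indicator {u<..v} s))\<^sup>2 = c\<^sup>2 * indicator ({0..1} \<inter> {u<..v}) s" for s :: real
    by (auto simp: indicator_def)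
  have "lp lborel 2 (\<lambda>s. indicator {0..1} s * (c * indicator {u<..v} s))"
    by (intro lpI) (auto simp: e intro!: integrable_mult_right integrable_real_indicator
        order.strict_trans1[OF emeasure_mono[of "{0..1} \<inter> {u<..v}" "{0..1}"]])
  from lp_add(1)[OF _ this Cons] show ?case by (simp add: step_fun_def x algebra_simps)
qed

text \<open>The length of an overlap in the form in which the covariance of two increments appears
  when the process has covariance \<open>min s t\<close>.\<close>

lemma interval_overlap:
  fixes u v u' v' :: real
  assumes "0 \<le> u" "u \<le> v" "v \<le> 1" "0 \<le> u'" "u' \<le> v'" "v' \<le> 1"
  shows "(\<integral>s. indicator {0..1} s * (indicator {u<..v} s * indicator {u'<..v'} s) \<partial>lborel) =
    min v v' - min v u' - min u v' + min u u'"
proof -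
  have "indicator {0..1} s * (indicator {u<..v} s * indicator {u'<..v'} s) = (indicator {max u u'<..min v v'} s :: real)" for s
    using assms by (auto simp: indicator_def)
  hence "(\<integral>s. indicator {0..1} s * (indicator {u<..v} s * indicator {u'<..v'} s) \<partial>lborel) = measure lborel {max u u'<..min v v'}"
    by simp
  also have "\<dots> = (if max u u' \<le> min v v' then min v v' - max u u' else 0)" by auto
  also have "\<dots> = min v v' - min v u' - min u v' + min u u'"
    using assms by (auto simp: min_def max_def)
  finally show ?thesis .
qed

text \<open>A centered process with the second-order structure of a vector of correlated Brownian motions;
  this is all that the variance of a Wiener integral depends on.\<close>

locale brownian_covariance = prob_space P for P :: "'b measure" +
  fixes K :: "'k set" and V :: "'k \<Rightarrow> real \<Rightarrow> 'b \<Rightarrow> real" and c :: "'k \<Rightarrow> 'k \<Rightarrow> real"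
  assumes V_lp: "\<And>k t. k \<in> K \<Longrightarrow> t \<ge> 0 \<Longrightarrow> lp P 2 (V k t)"
    and V_mean: "\<And>k t. k \<in> K \<Longrightarrow> t \<ge> 0 \<Longrightarrow> expectation (V k t) = 0"
    and V_cov: "\<And>k l s t. k \<in> K \<Longrightarrow> l \<in> K \<Longrightarrow> s \<ge> 0 \<Longrightarrow> t \<ge> 0 \<Longrightarrow> expectation (\<lambda>\<omega>. V k s \<omega> * V l t \<omega>) = c k l * min s t"
begin

lemma lp2_mult: "lp P 2 Y \<Longrightarrow> lp P 2 Z \<Longrightarrow> integrable P (\<lambda>\<omega>. Y \<omega> * Z \<omega>)"
  using lp_integrable_mult[of 2 1 P Y Z] by simp

lemma step_integral_lp:
  assumes "k \<in> K" "step_on_unit \<phi>"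
  shows "lp P 2 (step_integral (V k) \<phi>)" "expectation (step_integral (V k) \<phi>) = 0"
proof -
  have "lp P 2 (step_integral (V k) \<phi>) \<and> expectation (step_integral (V k) \<phi>) = 0"
    using assms(2)
  proof (induction \<phi>)
    case Nil
    then show ?case by (simp add: step_integral_def[abs_def] lp_def)
  next
    case (Cons x \<phi>)
    obtain a u v where x: "x = (a, u, v)" by (cases x) auto
    have uv: "0 \<le> u" "0 \<le> v" and IH: "lp P 2 (step_integral (V k) \<phi>)" "expectation (step_integral (V k) \<phi>) = 0"
      using Cons by (auto simp: step_on_unit_def x)
    have e: "step_integral (V k) (x # \<phi>) = (\<lambda>\<omega>. a * (V k v \<omega> - V k u \<omega>) + step_integral (V k) \<phi> \<omega>)"
      by (auto simp: step_integral_def x)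
    have l: "lp P 2 (\<lambda>\<omega>. V k v \<omega> - V k u \<omega>)" using V_lp[OF assms(1)] uv by (intro lp_diff) auto
    have "lp P 2 (step_integral (V k) (x # \<phi>))" unfolding e by (intro lp_add lp_cmult l IH) auto
    moreover have "integrable P (V k v)" "integrable P (V k u)" "integrable P (step_integral (V k) \<phi>)"
      using lp_integrable[of 2] V_lp[OF assms(1)] uv IH by auto
    ultimately show ?case unfolding e using IH V_mean[OF assms(1)] uv by simp
  qed
  thus "lp P 2 (step_integral (V k) \<phi>)" "expectation (step_integral (V k) \<phi>) = 0" by auto
qed

text \<open>The isometry for elementary integrals, by bilinearity: both lists are taken apart one
  interval at a time, so overlapping intervals are harmless. \<open>single\<close> is the inner
  induction, for one interval against the second list.\<close>

lemma step_integral_cov: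
  assumes k: "k \<in> K" and l: "l \<in> K" and \<phi>: "step_on_unit \<phi>" and \<phi>': "step_on_unit \<phi>'"
  shows "expectation (\<lambda>\<omega>. step_integral (V k) \<phi> \<omega> * step_integral (V l) \<phi>' \<omega>) =
    c k l * (\<integral>s. indicator {0..1} s * (step_fun \<phi> s * step_fun \<phi>' s) \<partial>lborel)"
proof -
  define A where "A = (\<lambda>\<phi> s. indicator {0..1} s * step_fun \<phi> s :: real)"
  have A_Cons: "A ((a, u, v) # \<phi>) s = a * (indicator {0..1} s * indicator {u<..v} s) + A \<phi> s" for a u v \<phi> s
    by (simp add: A_def step_fun_def algebra_simps)
  have Al: "lp lborel 2 (A \<phi>)" for \<phi> unfolding A_def by (rule step_fun_lp)
  have S_Cons: "step_integral (V k) ((a, u, v) # \<phi>) \<omega> = a * (V k v \<omega> - V k u \<omega>) + step_integral (V k) \<phi> \<omega>" for k a u v \<phi> \<omega>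
    by (simp add: step_integral_def)
  have one: "lp lborel 2 (\<lambda>s. indicator {0..1} s * indicator {u<..v} s :: real)" for u v :: real
    using Al[of "[(1, u, v)]"] by (simp add: A_def step_fun_def)
  have Vd: "lp P 2 (\<lambda>\<omega>. V k v \<omega> - V k u \<omega>)" if "k \<in> K" "0 \<le> u" "0 \<le> v" for k u v
    using V_lp that by (intro lp_diff) auto
  have 2: "integrable lborel (\<lambda>s. a s * b s)" if "lp lborel 2 a" "lp lborel 2 b" for a b :: "real \<Rightarrow> real"
    using lp_integrable_mult[of 2 1 lborel a b] that by simp
  have single: "expectation (\<lambda>\<omega>. (V k v \<omega> - V k u \<omega>) * step_integral (V l) \<phi>' \<omega>) =
      c k l * (\<integral>s. (indicator {0..1} s * indicator {u<..v} s) * A \<phi>' s \<partial>lborel)"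
    if uv: "0 \<le> u" "u \<le> v" "v \<le> 1" and "step_on_unit \<phi>'" for u v \<phi>'
    using that(4)
  proof (induction \<phi>')
    case Nil
    then show ?case by (simp add: step_integral_def A_def step_fun_def)
  next
    case (Cons x \<phi>')
    obtain a u' v' where x: "x = (a, u', v')" by (cases x) auto
    have uv': "0 \<le> u'" "u' \<le> v'" "v' \<le> 1" and s: "step_on_unit \<phi>'" using Cons(2) by (auto simp: step_on_unit_def x)
    have V: "lp P 2 (V k u)" "lp P 2 (V k v)" "lp P 2 (V l u')" "lp P 2 (V l v')"
      using V_lp k l uv uv' by auto
    note i = lp2_mult[OF Vd[OF k, of u v] Vd[OF l, of u' v']] lp2_mult[OF Vd[OF k, of u v] step_integral_lp(1)[OF l s]]
    have "expectation (\<lambda>\<omega>. (V k v \<omega> - V k u \<omega>) * step_integral (V l) (x # \<phi>') \<omega>) =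
      expectation (\<lambda>\<omega>. a * ((V k v \<omega> - V k u \<omega>) * (V l v' \<omega> - V l u' \<omega>)) + (V k v \<omega> - V k u \<omega>) * step_integral (V l) \<phi>' \<omega>)"
      by (simp add: x S_Cons algebra_simps)
    also have "\<dots> = a * expectation (\<lambda>\<omega>. (V k v \<omega> - V k u \<omega>) * (V l v' \<omega> - V l u' \<omega>)) +
        expectation (\<lambda>\<omega>. (V k v \<omega> - V k u \<omega>) * step_integral (V l) \<phi>' \<omega>)"
      using i uv uv' by simp
    also have "expectation (\<lambda>\<omega>. (V k v \<omega> - V k u \<omega>) * (V l v' \<omega> - V l u' \<omega>)) =
       expectation (\<lambda>\<omega>. V k v \<omega> * V l v' \<omega> - V k v \<omega> * V l u' \<omega> - V k u \<omega> * V l v' \<omega> + V k u \<omega> * V l u' \<omega>)"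
      by (simp add: algebra_simps)
    also have "\<dots> = c k l * min v v' - c k l * min v u' - c k l * min u v' + c k l * min u u'"
      using lp2_mult V V_cov[OF k l] uv uv' by simp
    also have "\<dots> = c k l * (min v v' - min v u' - min u v' + min u u')" by (simp add: algebra_simps)
    also have "(min v v' - min v u' - min u v' + min u u') = (\<integral>s. indicator {0..1} s * (indicator {u<..v} s * indicator {u'<..v'} s) \<partial>lborel)"
      by (rule interval_overlap[symmetric]) (use uv uv' in auto)
    also have "((\<integral>s. indicator {0..1} s * (indicator {u<..v} s * indicator {u'<..v'} s) \<partial>lborel) :: real) =
        (\<integral>s. (indicator {0..1} s * indicator {u<..v} s) * (indicator {0..1} s * indicator {u'<..v'} s) \<partial>lborel)"
      by (intro Bochner_Integration.integral_cong) (auto simp: indicator_def)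
    also note Cons(1)[OF s]
    also have "a * (c k l * (\<integral>s. (indicator {0..1} s * indicator {u<..v} s) * (indicator {0..1} s * indicator {u'<..v'} s) \<partial>lborel)) +
        c k l * (\<integral>s. (indicator {0..1} s * indicator {u<..v} s) * A \<phi>' s \<partial>lborel) =
       c k l * (\<integral>s. a * ((indicator {0..1} s * indicator {u<..v} s) * (indicator {0..1} s * indicator {u'<..v'} s)) +
         (indicator {0..1} s * indicator {u<..v} s) * A \<phi>' s \<partial>lborel)"
      using 2[OF one one, of u v u' v'] 2[OF one[of u v] Al[of \<phi>']]
      by (subst Bochner_Integration.integral_add) (auto simp: algebra_simps)
    also have "\<dots> = c k l * (\<integral>s. (indicator {0..1} s * indicator {u<..v} s) * A (x # \<phi>') s \<partial>lborel)"
      by (simp add: x A_Cons algebra_simps)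
    finally show ?case .
  qed
  have "expectation (\<lambda>\<omega>. step_integral (V k) \<phi> \<omega> * step_integral (V l) \<phi>' \<omega>) = c k l * (\<integral>s. A \<phi> s * A \<phi>' s \<partial>lborel)"
    using \<phi>
  proof (induction \<phi>)
    case Nil
    then show ?case by (simp add: step_integral_def A_def step_fun_def)
  next
    case (Cons x \<phi>)
    obtain a u v where x: "x = (a, u, v)" by (cases x) auto
    have uv: "0 \<le> u" "u \<le> v" "v \<le> 1" and s: "step_on_unit \<phi>" using Cons(2) by (auto simp: step_on_unit_def x)
    have "expectation (\<lambda>\<omega>. step_integral (V k) (x # \<phi>) \<omega> * step_integral (V l) \<phi>' \<omega>) =
      expectation (\<lambda>\<omega>. a * ((V k v \<omega> - V k u \<omega>) * step_integral (V l) \<phi>' \<omega>) + step_integral (V k) \<phi> \<omega> * step_integral (V l) \<phi>' \<omega>)"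
      by (simp add: x S_Cons algebra_simps)
    also have "\<dots> = a * expectation (\<lambda>\<omega>. (V k v \<omega> - V k u \<omega>) * step_integral (V l) \<phi>' \<omega>) +
        expectation (\<lambda>\<omega>. step_integral (V k) \<phi> \<omega> * step_integral (V l) \<phi>' \<omega>)"
      using lp2_mult[OF Vd[OF k, of u v] step_integral_lp(1)[OF l \<phi>']] lp2_mult[OF step_integral_lp(1)[OF k s] step_integral_lp(1)[OF l \<phi>']] uv
      by simp
    also note single[OF uv \<phi>']
    also note Cons(1)[OF s]
    also have "a * (c k l * (\<integral>s. (indicator {0..1} s * indicator {u<..v} s) * A \<phi>' s \<partial>lborel)) + c k l * (\<integral>s. A \<phi> s * A \<phi>' s \<partial>lborel) =
       c k l * (\<integral>s. a * ((indicator {0..1} s * indicator {u<..v} s) * A \<phi>' s) + A \<phi> s * A \<phi>' s \<partial>lborel)"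
      using 2[OF one[of u v] Al[of \<phi>']] 2[OF Al[of \<phi>] Al[of \<phi>']]
      by (subst Bochner_Integration.integral_add) (auto simp: algebra_simps)
    also have "\<dots> = c k l * (\<integral>s. A (x # \<phi>) s * A \<phi>' s \<partial>lborel)"
      by (simp add: x A_Cons algebra_simps)
    finally show ?case .
  qed
  also have "(\<integral>s. A \<phi> s * A \<phi>' s \<partial>lborel) = (\<integral>s. indicator {0..1} s * (step_fun \<phi> s * step_fun \<phi>' s) \<partial>lborel)"
    by (intro Bochner_Integration.integral_cong) (auto simp: A_def indicator_def)
  finally show ?thesis .
qed

text \<open>Mean and variance pass to the \<open>L2\<close> limit from the elementary integrals, so
  the formula holds for arbitrary versions \<open>I k\<close>. The isometry leaves inner products of
  step functions, which converge to those of the \<open>g k\<close> on the unit interval.\<close>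

lemma wiener_combination:
  assumes fin: "finite K" and I: "\<And>k. k \<in> K \<Longrightarrow> has_wiener_integral P (V k) 0 1 (g k) (I k)"
    and g: "\<And>k. k \<in> K \<Longrightarrow> g k \<in> borel_measurable borel"
  shows "variance (\<lambda>\<omega>. \<Sum>k\<in>K. \<alpha> k * I k \<omega>) =
     (\<Sum>k\<in>K. \<Sum>l\<in>K. \<alpha> k * \<alpha> l * c k l * (\<integral>s. indicator {0..1} s * (g k s * g l s) \<partial>lborel))"
proof -
  define R where "R = (\<lambda>k \<phi>. (\<forall>n. step_on_unit (\<phi> n)) \<and>
    (\<lambda>n. \<integral>\<^sup>+s\<in>{0..1}. ennreal ((step_fun (\<phi> n) s - g k s)\<^sup>2) \<partial>lborel) \<longlonglongrightarrow> 0 \<and>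
    (\<lambda>n. \<integral>\<^sup>+\<omega>. ennreal ((step_integral (V k) (\<phi> n) \<omega> - I k \<omega>)\<^sup>2) \<partial>P) \<longlonglongrightarrow> 0)"
  have "\<forall>k\<in>K. \<exists>\<phi>. R k \<phi>"
  proof
    fix k assume "k \<in> K"
    from I[OF this] show "\<exists>\<phi>. R k \<phi>"
      unfolding has_wiener_integral_def step_on_unit_def R_def by (rule conjunct2)
  qed
  from bchoice[OF this] obtain \<phi> where R: "\<And>k. k \<in> K \<Longrightarrow> R k (\<phi> k)" by auto
  have \<phi>: "\<And>k n. k \<in> K \<Longrightarrow> step_on_unit (\<phi> k n)"
    "\<And>k. k \<in> K \<Longrightarrow> (\<lambda>n. \<integral>\<^sup>+s\<in>{0..1}. ennreal ((step_fun (\<phi> k n) s - g k s)\<^sup>2) \<partial>lborel) \<longlonglongrightarrow> 0"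
    "\<And>k. k \<in> K \<Longrightarrow> (\<lambda>n. \<integral>\<^sup>+\<omega>. ennreal ((step_integral (V k) (\<phi> k n) \<omega> - I k \<omega>)\<^sup>2) \<partial>P) \<longlonglongrightarrow> 0"
    using R unfolding R_def by simp_all
  have Im: "I k \<in> borel_measurable P" if "k \<in> K" for k using I[OF that] by (simp add: has_wiener_integral_def)
  have LI: "L2_lim P (\<lambda>n. step_integral (V k) (\<phi> k n)) (I k)" if "k \<in> K" for k
    using step_integral_lp(1)[OF that] \<phi> Im that by (simp add: L2_lim_def)
  have Lg: "L2_lim lborel (\<lambda>n s. indicator {0..1} s * step_fun (\<phi> k n) s) (\<lambda>s. indicator {0..1} s * g k s)" if "k \<in> K" for k
  proof -
    have "(\<integral>\<^sup>+s\<in>{0..1}. ennreal ((step_fun (\<phi> k n) s - g k s)\<^sup>2) \<partial>lborel) =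
       (\<integral>\<^sup>+s. ennreal ((indicator {0..1} s * step_fun (\<phi> k n) s - indicator {0..1} s * g k s)\<^sup>2) \<partial>lborel)" for n
      by (intro nn_integral_cong) (auto simp: indicator_def)
    thus ?thesis using \<phi>(2)[OF that] g[OF that] step_fun_lp by (simp add: L2_lim_def)
  qed
  define Sn where "Sn = (\<lambda>n \<omega>. \<Sum>k\<in>K. \<alpha> k * step_integral (V k) (\<phi> k n) \<omega>)"
  have LS: "L2_lim P Sn (\<lambda>\<omega>. \<Sum>k\<in>K. \<alpha> k * I k \<omega>)"
    unfolding Sn_def by (intro L2_lim_sum fin L2_lim_cmult LI)
  \<comment> \<open>The mean is the inner product with the constant \<open>1\<close>, so it passes
    to the limit as well.\<close>
  have L1: "L2_lim P (\<lambda>n _. 1) (\<lambda>_. 1)" by (simp add: L2_lim_def lp_const)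
  have Sint: "integrable P (step_integral (V k) (\<phi> k n))" if "k \<in> K" for k n
    by (rule lp_integrable[of 2]) (use step_integral_lp(1)[OF that \<phi>(1)[OF that]] in auto)
  have "expectation (Sn n) = 0" for n
    unfolding Sn_def using Sint step_integral_lp(2) \<phi>(1) by simp
  hence mean: "expectation (\<lambda>\<omega>. \<Sum>k\<in>K. \<alpha> k * I k \<omega>) = 0"
    using L2_lim_inner[OF LS L1] by (simp add: LIMSEQ_const_iff)
  have "expectation (\<lambda>\<omega>. (Sn n \<omega>)\<^sup>2) = (\<Sum>k\<in>K. \<Sum>l\<in>K. \<alpha> k * \<alpha> l * c k l * (\<integral>s. (indicator {0..1} s * step_fun (\<phi> k n) s) * (indicator {0..1} s * step_fun (\<phi> l n) s) \<partial>lborel))" for n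
  proof -
    have "expectation (\<lambda>\<omega>. (Sn n \<omega>)\<^sup>2) = expectation (\<lambda>\<omega>. \<Sum>k\<in>K. \<Sum>l\<in>K. \<alpha> k * \<alpha> l * (step_integral (V k) (\<phi> k n) \<omega> * step_integral (V l) (\<phi> l n) \<omega>))"
      unfolding Sn_def power2_eq_square sum_product by (simp add: mult_ac)
    also have "\<dots> = (\<Sum>k\<in>K. \<Sum>l\<in>K. \<alpha> k * \<alpha> l * expectation (\<lambda>\<omega>. step_integral (V k) (\<phi> k n) \<omega> * step_integral (V l) (\<phi> l n) \<omega>))"
      using lp2_mult step_integral_lp(1) \<phi>(1) by (simp add: Bochner_Integration.integral_sum)
    also have "\<dots> = (\<Sum>k\<in>K. \<Sum>l\<in>K. \<alpha> k * \<alpha> l * (c k l * (\<integral>s. indicator {0..1} s * (step_fun (\<phi> k n) s * step_fun (\<phi> l n) s) \<partial>lborel)))"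
      by (intro sum.cong refl arg_cong2[of _ _ _ _ "(*)"] step_integral_cov \<phi>(1))
    also have "\<dots> = (\<Sum>k\<in>K. \<Sum>l\<in>K. \<alpha> k * \<alpha> l * c k l * (\<integral>s. (indicator {0..1} s * step_fun (\<phi> k n) s) * (indicator {0..1} s * step_fun (\<phi> l n) s) \<partial>lborel))"
    proof (intro sum.cong refl)
      fix k l
      have "(\<integral>s. indicator {0..1} s * (step_fun (\<phi> k n) s * step_fun (\<phi> l n) s) \<partial>lborel) =
        (\<integral>s. (indicator {0..1} s * step_fun (\<phi> k n) s) * (indicator {0..1} s * step_fun (\<phi> l n) s) \<partial>lborel)"
        by (intro Bochner_Integration.integral_cong) (auto simp: indicator_def)
      thus "\<alpha> k * \<alpha> l * (c k l * (\<integral>s. indicator {0..1} s * (step_fun (\<phi> k n) s * step_fun (\<phi> l n) s) \<partial>lborel)) =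
        \<alpha> k * \<alpha> l * c k l * (\<integral>s. (indicator {0..1} s * step_fun (\<phi> k n) s) * (indicator {0..1} s * step_fun (\<phi> l n) s) \<partial>lborel)" by simp
    qed
    finally show ?thesis .
  qed
  hence "(\<lambda>n. expectation (\<lambda>\<omega>. (Sn n \<omega>)\<^sup>2)) \<longlonglongrightarrow>
     (\<Sum>k\<in>K. \<Sum>l\<in>K. \<alpha> k * \<alpha> l * c k l * (\<integral>s. (indicator {0..1} s * g k s) * (indicator {0..1} s * g l s) \<partial>lborel))"
    by (simp only:) (intro tendsto_sum tendsto_mult tendsto_const L2_lim_inner Lg)
  from LIMSEQ_unique[OF L2_lim_norm[OF LS] this]
  have "expectation (\<lambda>\<omega>. (\<Sum>k\<in>K. \<alpha> k * I k \<omega>)\<^sup>2) =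
     (\<Sum>k\<in>K. \<Sum>l\<in>K. \<alpha> k * \<alpha> l * c k l * (\<integral>s. (indicator {0..1} s * g k s) * (indicator {0..1} s * g l s) \<partial>lborel))" .
  also have "\<dots> = (\<Sum>k\<in>K. \<Sum>l\<in>K. \<alpha> k * \<alpha> l * c k l * (\<integral>s. indicator {0..1} s * (g k s * g l s) \<partial>lborel))"
  proof (intro sum.cong refl)
    fix k l
    have "(\<integral>s. (indicator {0..1} s * g k s) * (indicator {0..1} s * g l s) \<partial>lborel) = (\<integral>s. indicator {0..1} s * (g k s * g l s) \<partial>lborel)"
      by (intro Bochner_Integration.integral_cong) (auto simp: indicator_def)
    thus "\<alpha> k * \<alpha> l * c k l * (\<integral>s. (indicator {0..1} s * g k s) * (indicator {0..1} s * g l s) \<partial>lborel) =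
      \<alpha> k * \<alpha> l * c k l * (\<integral>s. indicator {0..1} s * (g k s * g l s) \<partial>lborel)" by simp
  qed
  finally show ?thesis by (simp add: mean)
qed

end

section \<open>Existence of Wiener integrals of Lipschitz functions\<close>

lemma step_fun_append: "step_fun (\<phi> @ \<phi>') s = step_fun \<phi> s + step_fun \<phi>' s"
  by (simp add: step_fun_def)

lemma step_integral_append: "step_integral W (\<phi> @ \<phi>') \<omega> = step_integral W \<phi> \<omega> + step_integral W \<phi>' \<omega>"
  by (simp add: step_integral_def)

definition step_neg :: "(real \<times> real \<times> real) list \<Rightarrow> (real \<times> real \<times> real) list" where
  "step_neg \<phi> = map (\<lambda>(c, u, v). (- c, u, v)) \<phi>"

lemma step_fun_neg: "step_fun (step_neg \<phi>) s = - step_fun \<phi> s"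
  by (induction \<phi>) (auto simp: step_fun_def step_neg_def)

lemma step_integral_neg: "step_integral W (step_neg \<phi>) \<omega> = - step_integral W \<phi> \<omega>"
  by (induction \<phi>) (auto simp: step_integral_def step_neg_def algebra_simps)

lemma step_on_unit_diff: "step_on_unit \<phi> \<Longrightarrow> step_on_unit \<phi>' \<Longrightarrow> step_on_unit (\<phi> @ step_neg \<phi>')"
  by (auto simp: step_on_unit_def step_neg_def)

definition dyadic_step :: "(real \<Rightarrow> real) \<Rightarrow> nat \<Rightarrow> (real \<times> real \<times> real) list" where
  "dyadic_step g n = map (\<lambda>i. (g (real i / 2 ^ n), real i / 2 ^ n, real (Suc i) / 2 ^ n)) [0..<2 ^ n]"

lemma step_on_unit_dyadic: "step_on_unit (dyadic_step g n)"
proof -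
  have "real (Suc i) / 2 ^ n \<le> 1" if "i < 2 ^ n" for i
  proof -
    have "real (Suc i) \<le> real (2 ^ n)" using that by (intro of_nat_mono) auto
    thus ?thesis by simp
  qed
  thus ?thesis by (auto simp: step_on_unit_def dyadic_step_def divide_right_mono)
qed

lemma dyadic_step_close:
  assumes L: "\<And>s t. 0 \<le> s \<Longrightarrow> s \<le> 1 \<Longrightarrow> 0 \<le> t \<Longrightarrow> t \<le> 1 \<Longrightarrow> \<bar>g s - g t\<bar> \<le> L * \<bar>s - t\<bar>"
    and s: "0 < s" "s \<le> 1"
  shows "\<bar>step_fun (dyadic_step g n) s - g s\<bar> \<le> L / 2 ^ n"
proof -
  define m :: real where "m = 2 ^ n"
  have m: "m > 0" by (simp add: m_def)
  \<comment> \<open>The ceiling minus one rather than the floor: the intervals are open on the left,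
    so a dyadic point belongs to the interval that ends there. The point \<open>0\<close> lies in
    none of them, whence the hypothesis \<open>0 < s\<close>.\<close>
  define k where "k = nat (\<lceil>m * s\<rceil> - 1)"
  have c1: "\<lceil>m * s\<rceil> \<ge> 1" using s m by simp
  have kr: "real k = real_of_int \<lceil>m * s\<rceil> - 1" using c1 by (simp add: k_def of_nat_nat)
  have k1: "real k < m * s" "m * s \<le> real k + 1" unfolding kr by linarith+
  have ms: "m * s \<le> m" using s m by simp
  have "real k < 2 ^ n" using k1(1) ms unfolding m_def by linarith
  hence k2: "k < 2 ^ n" by simp
  have ind: "indicator {real i / m<..real (Suc i) / m} s = (if i = k then 1 else 0 :: real)" for i
  proof -
    have "s \<in> {real i / m<..real (Suc i) / m} \<longleftrightarrow> real i < m * s \<and> m * s \<le> real i + 1"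
      using m by (auto simp: field_simps)
    also have "\<dots> \<longleftrightarrow> i = k"
    proof
      assume "real i < m * s \<and> m * s \<le> real i + 1"
      hence "real i < real k + 1" "real k < real i + 1" using k1 by linarith+
      thus "i = k" by linarith
    qed (use k1 in auto)
    finally show ?thesis by (simp add: indicator_def)
  qed
  have "step_fun (dyadic_step g n) s = (\<Sum>i<2 ^ n. g (real i / m) * indicator {real i / m<..real (Suc i) / m} s)"
    by (simp add: step_fun_def dyadic_step_def m_def comp_def interv_sum_list_conv_sum_set_nat atLeast0LessThan)
  also have "\<dots> = (\<Sum>i<2 ^ n. if i = k then g (real i / m) else 0)"
    unfolding ind by (intro sum.cong) auto
  also have "\<dots> = g (real k / m)" using k2 by simp
  finally have e: "step_fun (dyadic_step g n) s = g (real k / m)" .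
  have "\<bar>g (real k / m) - g s\<bar> \<le> L * \<bar>real k / m - s\<bar>"
  proof (rule L)
    have "real k \<le> m" using k1 ms by linarith
    thus "real k / m \<le> 1" using m by simp
  qed (use s m in auto)
  also have "\<dots> \<le> L * (1 / m)"
  proof (rule mult_left_mono)
    have "real k / m \<le> s" "s \<le> real k / m + 1 / m" using k1 m by (auto simp: field_simps)
    thus "\<bar>real k / m - s\<bar> \<le> 1 / m" by simp
    show "0 \<le> L" using L[of 0 1] by simp
  qed
  finally show ?thesis by (simp add: e m_def)
qed

context brownian_covariance
begin

text \<open>\<open>wiener_integral\<close> is a choice and has its meaning only once some version
  exists. Lipschitz continuity gives the dyadic step functions geometric errors, so their elementary
  integrals converge almost surely along the whole sequence, and the rate passes to the
  limit.\<close>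

lemma wiener_integral_exists:
  assumes k: "k \<in> K"
    and L: "\<And>s t. 0 \<le> s \<Longrightarrow> s \<le> 1 \<Longrightarrow> 0 \<le> t \<Longrightarrow> t \<le> 1 \<Longrightarrow> \<bar>g s - g t\<bar> \<le> L * \<bar>s - t\<bar>"
  shows "\<exists>I. has_wiener_integral P (V k) 0 1 g I"
proof -
  have L0: "L \<ge> 0" using L[of 0 1] by simp
  have c0: "c k k \<ge> 0"
  proof -
    have "c k k = expectation (\<lambda>\<omega>. V k 1 \<omega> * V k 1 \<omega>)" using V_cov[OF k k, of 1 1] by simp
    thus ?thesis by simp
  qed
  define \<phi> where "\<phi> = dyadic_step g"
  define Y where "Y = (\<lambda>n. step_integral (V k) (\<phi> n))"
  have Yl: "lp P 2 (Y n)" for n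
    unfolding Y_def \<phi>_def by (intro step_integral_lp(1) k step_on_unit_dyadic)
  have [measurable]: "Y n \<in> borel_measurable P" for n using Yl[of n] by (simp add: lp_def)
  have Yd: "expectation (\<lambda>\<omega>. (Y n \<omega> - Y p \<omega>)\<^sup>2) \<le> c k k * (2 * L / 2 ^ n)\<^sup>2" if "n \<le> p" for n p
  proof -
    define \<theta> where "\<theta> = \<phi> n @ step_neg (\<phi> p)"
    have \<theta>: "step_on_unit \<theta>" unfolding \<theta>_def \<phi>_def by (intro step_on_unit_diff step_on_unit_dyadic)
    have "expectation (\<lambda>\<omega>. (Y n \<omega> - Y p \<omega>)\<^sup>2) = expectation (\<lambda>\<omega>. step_integral (V k) \<theta> \<omega> * step_integral (V k) \<theta> \<omega>)"
      by (simp add: Y_def \<theta>_def step_integral_append step_integral_neg power2_eq_square)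
    also have "\<dots> = c k k * (\<integral>s. indicator {0..1} s * (step_fun \<theta> s * step_fun \<theta> s) \<partial>lborel)"
      by (rule step_integral_cov[OF k k \<theta> \<theta>])
    also have "(\<integral>s. indicator {0..1} s * (step_fun \<theta> s * step_fun \<theta> s) \<partial>lborel) \<le> (\<integral>s. indicator {0..1} (s::real) * (2 * L / 2 ^ n)\<^sup>2 \<partial>lborel)"
    proof (rule integral_mono_AE)
      have "lp lborel 2 (\<lambda>s. indicator {0..1} s * step_fun \<theta> s)" by (rule step_fun_lp)
      moreover have "(indicator {0..1} s * step_fun \<theta> s)\<^sup>2 = indicator {0..1} s * (step_fun \<theta> s * step_fun \<theta> s)" for s
        by (auto simp: indicator_def power2_eq_square)
      ultimately show "integrable lborel (\<lambda>s. indicator {0..1} s * (step_fun \<theta> s * step_fun \<theta> s))" by (simp add: lp_def)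
      show "integrable lborel (\<lambda>s::real. indicator {0..1} s * (2 * L / 2 ^ n)\<^sup>2)" by simp
      show "AE s in lborel. indicator {0..1} s * (step_fun \<theta> s * step_fun \<theta> s) \<le> indicator {0..1} s * (2 * L / 2 ^ n)\<^sup>2"
        using AE_lborel_singleton[of 0]
      proof eventually_elim
        case (elim s)
        show ?case
        proof (cases "s \<in> {0..1}")
          case True
          hence s: "0 < s" "s \<le> 1" using elim by auto
          have "(2::real) ^ n \<le> 2 ^ p" using that by (intro power_increasing) auto
          hence "L / 2 ^ p \<le> L / 2 ^ n" using L0 by (intro divide_left_mono) auto
          moreover have "\<bar>step_fun (\<phi> n) s - g s\<bar> \<le> L / 2 ^ n" "\<bar>step_fun (\<phi> p) s - g s\<bar> \<le> L / 2 ^ p"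
            unfolding \<phi>_def by (rule dyadic_step_close[OF L s]; assumption)+
          ultimately have "\<bar>step_fun \<theta> s\<bar> \<le> 2 * L / 2 ^ n"
            unfolding \<theta>_def step_fun_append step_fun_neg by linarith
          hence "\<bar>step_fun \<theta> s\<bar>\<^sup>2 \<le> (2 * L / 2 ^ n)\<^sup>2" by (intro power_mono) auto
          thus ?thesis using True by (simp add: power2_eq_square)
        qed simp
      qed
    qed
    also have "\<dots> = (2 * L / 2 ^ n)\<^sup>2" by simp
    finally show ?thesis using c0 by (simp add: mult_left_mono)
  qed
  have Yi: "integrable P (\<lambda>\<omega>. (Y n \<omega> - Y p \<omega>)\<^sup>2)" for n p
    using lp_diff(1)[OF _ Yl[of n] Yl[of p]] by (simp add: lp_def)
  \<comment> \<open>Successive differences have second moments of order \<open>(1/4) ^ n\<close>.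
    The weight \<open>3 ^ n\<close> keeps the series summable and still forces pathwise differences
    of order \<open>(1 / sqrt 3) ^ n\<close>.\<close>
  have sm: "summable (\<lambda>n. \<integral>\<omega>. 3 ^ n * (Y n \<omega> - Y (Suc n) \<omega>)\<^sup>2 \<partial>P)"
  proof (rule summable_comparison_test')
    show "summable (\<lambda>n. (c k k * 4 * L\<^sup>2) * (3 / 4) ^ n)" by (intro summable_mult summable_geometric) simp
    fix n :: nat
    have "norm (\<integral>\<omega>. 3 ^ n * (Y n \<omega> - Y (Suc n) \<omega>)\<^sup>2 \<partial>P) = 3 ^ n * expectation (\<lambda>\<omega>. (Y n \<omega> - Y (Suc n) \<omega>)\<^sup>2)"
      by simp
    also have "\<dots> \<le> 3 ^ n * (c k k * (2 * L / 2 ^ n)\<^sup>2)" by (intro mult_left_mono Yd) auto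
    also have "\<dots> = (c k k * 4 * L\<^sup>2) * (3 / 4) ^ n"
    proof -
      have "((2::real) ^ n)\<^sup>2 = 4 ^ n" by (simp add: power2_eq_square flip: power_mult_distrib)
      thus ?thesis by (simp add: power_divide power_mult_distrib)
    qed
    finally show "norm (\<integral>\<omega>. 3 ^ n * (Y n \<omega> - Y (Suc n) \<omega>)\<^sup>2 \<partial>P) \<le> (c k k * 4 * L\<^sup>2) * (3 / 4) ^ n" .
  qed
  have "\<exists>Q. Q \<in> borel_measurable P \<and> (\<forall>\<omega>. Q \<omega> \<ge> 0) \<and> integrable P Q \<and> (AE \<omega> in P. \<forall>n. 3 ^ n * (Y n \<omega> - Y (Suc n) \<omega>)\<^sup>2 \<le> Q \<omega>)"
    by (rule integrable_dominating_series[OF _ _ sm]) (auto intro!: integrable_mult_right Yi)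
  then obtain Q where Q: "\<And>\<omega>. Q \<omega> \<ge> 0" "AE \<omega> in P. \<forall>n. 3 ^ n * (Y n \<omega> - Y (Suc n) \<omega>)\<^sup>2 \<le> Q \<omega>" by blast
  have conv: "AE \<omega> in P. convergent (\<lambda>n. Y n \<omega>)"
    using Q(2)
  proof eventually_elim
    case (elim \<omega>)
    have le: "\<bar>Y (Suc n) \<omega> - Y n \<omega>\<bar> \<le> sqrt (Q \<omega>) * (1 / sqrt 3) ^ n" for n
    proof -
      have "(Y n \<omega> - Y (Suc n) \<omega>)\<^sup>2 \<le> Q \<omega> / 3 ^ n" using elim by (simp add: field_simps)
      hence "sqrt ((Y n \<omega> - Y (Suc n) \<omega>)\<^sup>2) \<le> sqrt (Q \<omega> / 3 ^ n)" by (rule real_sqrt_le_mono)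
      hence "\<bar>Y n \<omega> - Y (Suc n) \<omega>\<bar> \<le> sqrt (Q \<omega> / 3 ^ n)" by (simp only: real_sqrt_abs)
      also have "sqrt (Q \<omega> / 3 ^ n) = sqrt (Q \<omega>) * (1 / sqrt 3) ^ n"
        by (simp only: real_sqrt_divide real_sqrt_power power_divide power_one times_divide_eq_right mult_1_right)
      finally show ?thesis by (simp add: abs_minus_commute)
    qed
    have "summable (\<lambda>n. Y (Suc n) \<omega> - Y n \<omega>)"
    proof (rule summable_comparison_test')
      show "summable (\<lambda>n. sqrt (Q \<omega>) * (1 / sqrt 3) ^ n)" by (intro summable_mult summable_geometric) simp
    qed (use le in auto)
    hence "convergent (\<lambda>n. \<Sum>i<n. Y (Suc i) \<omega> - Y i \<omega>)" by (simp add: summable_iff_convergent)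
    hence "convergent (\<lambda>n. Y n \<omega> - Y 0 \<omega>)" unfolding sum_lessThan_telescope[of "\<lambda>n. Y n \<omega>"] .
    from convergent_add[OF this convergent_const[of "Y 0 \<omega>"]] show ?case by simp
  qed
  define I where "I = (\<lambda>\<omega>. lim (\<lambda>n. Y n \<omega>))"
  have Im [measurable]: "I \<in> borel_measurable P" unfolding I_def by measurable
  have lim: "AE \<omega> in P. (\<lambda>n. Y n \<omega>) \<longlonglongrightarrow> I \<omega>"
    using conv by eventually_elim (simp add: I_def convergent_LIMSEQ_iff)
  \<comment> \<open>Fatou in the second index, applied to the bound \<open>Yd\<close> between two
    approximations.\<close>
  have close: "(\<integral>\<^sup>+\<omega>. ennreal ((Y n \<omega> - I \<omega>)\<^sup>2) \<partial>P) \<le> ennreal (c k k * (2 * L / 2 ^ n)\<^sup>2)" for n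
  proof -
    have "(\<integral>\<^sup>+\<omega>. ennreal ((Y n \<omega> - I \<omega>)\<^sup>2) \<partial>P) = (\<integral>\<^sup>+\<omega>. liminf (\<lambda>p. ennreal ((Y n \<omega> - Y p \<omega>)\<^sup>2)) \<partial>P)"
    proof (rule nn_integral_cong_AE)
      show "AE \<omega> in P. ennreal ((Y n \<omega> - I \<omega>)\<^sup>2) = liminf (\<lambda>p. ennreal ((Y n \<omega> - Y p \<omega>)\<^sup>2))"
        using lim
      proof eventually_elim
        case (elim \<omega>)
        have "(\<lambda>p. ennreal ((Y n \<omega> - Y p \<omega>)\<^sup>2)) \<longlonglongrightarrow> ennreal ((Y n \<omega> - I \<omega>)\<^sup>2)"
          by (intro tendsto_ennrealI tendsto_power tendsto_diff tendsto_const elim)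
        thus ?case by (rule lim_imp_Liminf[OF sequentially_bot, symmetric])
      qed
    qed
    also have "\<dots> \<le> liminf (\<lambda>p. \<integral>\<^sup>+\<omega>. ennreal ((Y n \<omega> - Y p \<omega>)\<^sup>2) \<partial>P)"
      by (rule nn_integral_liminf) measurable
    also have "\<dots> \<le> limsup (\<lambda>p. \<integral>\<^sup>+\<omega>. ennreal ((Y n \<omega> - Y p \<omega>)\<^sup>2) \<partial>P)"
      by (rule Liminf_le_Limsup) simp
    also have "\<dots> \<le> ennreal (c k k * (2 * L / 2 ^ n)\<^sup>2)"
    proof (rule Limsup_bounded)
      show "\<forall>\<^sub>F p in sequentially. (\<integral>\<^sup>+\<omega>. ennreal ((Y n \<omega> - Y p \<omega>)\<^sup>2) \<partial>P) \<le> ennreal (c k k * (2 * L / 2 ^ n)\<^sup>2)"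
        using eventually_ge_at_top[of n]
        by eventually_elim (simp only: nn_integral_eq_integral[OF Yi] AE_I2 zero_le_power2 Yd ennreal_leI)
    qed
    finally show ?thesis .
  qed
  have pow0: "(\<lambda>n. a * (2 * L / 2 ^ n)\<^sup>2) \<longlonglongrightarrow> 0" for a
  proof -
    have "(\<lambda>n. a * (2 * L * (1 / 2) ^ n)\<^sup>2) \<longlonglongrightarrow> a * (2 * L * 0)\<^sup>2"
      by (intro tendsto_intros LIMSEQ_power_zero) simp
    thus ?thesis by (simp add: power_one_over)
  qed
  have "has_wiener_integral P (V k) 0 1 g I"
    unfolding has_wiener_integral_def
  proof (intro conjI exI[of _ \<phi>] Im allI)
    show "\<forall>(c, u, v)\<in>set (\<phi> n). 0 \<le> u \<and> u \<le> v \<and> v \<le> 1" for n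
      using step_on_unit_dyadic[of g n] by (simp add: step_on_unit_def \<phi>_def)
    have 1: "(\<integral>\<^sup>+s\<in>{0..1}. ennreal ((step_fun (\<phi> n) s - g s)\<^sup>2) \<partial>lborel) \<le> ennreal (1 * (2 * L / 2 ^ n)\<^sup>2)" for n
    proof -
      have "(\<integral>\<^sup>+s\<in>{0..1}. ennreal ((step_fun (\<phi> n) s - g s)\<^sup>2) \<partial>lborel) \<le>
          (\<integral>\<^sup>+s. ennreal ((2 * L / 2 ^ n)\<^sup>2) * indicator {0..1} (s::real) \<partial>lborel)"
      proof (rule nn_integral_mono_AE)
        show "AE s in lborel. ennreal ((step_fun (\<phi> n) s - g s)\<^sup>2) * indicator {0..1} s \<le> ennreal ((2 * L / 2 ^ n)\<^sup>2) * indicator {0..1} s"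
          using AE_lborel_singleton[of 0]
        proof eventually_elim
          case (elim s)
          show ?case
          proof (cases "s \<in> {0..1}")
            case True
            hence s: "0 < s" "s \<le> 1" using elim by auto
            have "\<bar>step_fun (\<phi> n) s - g s\<bar> \<le> L / 2 ^ n" unfolding \<phi>_def by (rule dyadic_step_close[OF L s])
            also have "\<dots> \<le> 2 * L / 2 ^ n" using L0 by (intro divide_right_mono) auto
            finally have "\<bar>step_fun (\<phi> n) s - g s\<bar>\<^sup>2 \<le> (2 * L / 2 ^ n)\<^sup>2" by (intro power_mono) auto
            hence "ennreal ((step_fun (\<phi> n) s - g s)\<^sup>2) \<le> ennreal ((2 * L / 2 ^ n)\<^sup>2)" by (intro ennreal_leI) simp
            thus ?thesis by (rule mult_right_mono) simp
          qed simp
        qed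
      qed
      also have "\<dots> = ennreal ((2 * L / 2 ^ n)\<^sup>2)" by (subst nn_integral_cmult_indicator) auto
      finally show ?thesis by simp
    qed
    have lim1: "(\<lambda>n. ennreal (1 * (2 * L / 2 ^ n)\<^sup>2)) \<longlonglongrightarrow> 0" and lim2: "(\<lambda>n. ennreal (c k k * (2 * L / 2 ^ n)\<^sup>2)) \<longlonglongrightarrow> 0"
      using tendsto_ennrealI[OF pow0[of 1]] tendsto_ennrealI[OF pow0[of "c k k"]] by simp_all
    show "(\<lambda>n. \<integral>\<^sup>+s\<in>{0..1}. ennreal ((step_fun (\<phi> n) s - g s)\<^sup>2) \<partial>lborel) \<longlonglongrightarrow> 0"
      by (rule tendsto_sandwich[OF always_eventually[OF allI] always_eventually[OF allI[OF 1]] tendsto_const lim1]) simp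
    show "(\<lambda>n. \<integral>\<^sup>+\<omega>. ennreal ((step_integral (V k) (\<phi> n) \<omega> - I \<omega>)\<^sup>2) \<partial>P) \<longlonglongrightarrow> 0"
      by (rule tendsto_sandwich[OF always_eventually[OF allI] always_eventually[OF allI[OF close[unfolded Y_def]]] tendsto_const lim2]) simp
  qed
  thus ?thesis by blast
qed

lemma has_wiener_integral_wiener_integral:
  assumes "k \<in> K" "\<And>s t. 0 \<le> s \<Longrightarrow> s \<le> 1 \<Longrightarrow> 0 \<le> t \<Longrightarrow> t \<le> 1 \<Longrightarrow> \<bar>g s - g t\<bar> \<le> L * \<bar>s - t\<bar>"
  shows "has_wiener_integral P (V k) 0 1 g (wiener_integral P (V k) 0 1 g)"
  unfolding wiener_integral_def by (rule someI_ex[OF wiener_integral_exists[OF assms]])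

end

lemma psi_lipschitz:
  assumes "0 \<le> s" "s \<le> 1" "0 \<le> t" "t \<le> 1"
  shows "\<bar>psi j d s 1 - psi j d t 1\<bar> \<le> real (j - 1 + (d - j)) * \<bar>s - t\<bar>"
proof -
  let ?a = "j - 1" and ?b = "d - j"
  let ?f = "fact ?a * fact ?b :: real"
  have "\<bar>s ^ ?a * (1 - s) ^ ?b - t ^ ?a * (1 - t) ^ ?b\<bar> =
      \<bar>(s ^ ?a - t ^ ?a) * (1 - s) ^ ?b + t ^ ?a * ((1 - s) ^ ?b - (1 - t) ^ ?b)\<bar>" by (simp add: algebra_simps)
  also have "\<dots> \<le> \<bar>s ^ ?a - t ^ ?a\<bar> * \<bar>(1 - s) ^ ?b\<bar> + \<bar>t ^ ?a\<bar> * \<bar>(1 - s) ^ ?b - (1 - t) ^ ?b\<bar>"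
    unfolding abs_mult[symmetric] by (rule abs_triangle_ineq)
  also have "\<dots> \<le> \<bar>s ^ ?a - t ^ ?a\<bar> * 1 + 1 * \<bar>(1 - s) ^ ?b - (1 - t) ^ ?b\<bar>"
    using assms by (intro add_mono mult_left_mono mult_right_mono) (auto simp: power_abs intro!: power_le_one)
  also have "\<bar>s ^ ?a - t ^ ?a\<bar> \<le> real ?a * \<bar>s - t\<bar>"
    using norm_power_diff[of s t ?a] assms by simp
  also have "\<bar>(1 - s) ^ ?b - (1 - t) ^ ?b\<bar> \<le> real ?b * \<bar>s - t\<bar>"
    using norm_power_diff[of "1 - s" "1 - t" ?b] assms by (simp add: abs_minus_commute)
  finally have 1: "\<bar>s ^ ?a * (1 - s) ^ ?b - t ^ ?a * (1 - t) ^ ?b\<bar> \<le> real (?a + ?b) * \<bar>s - t\<bar>"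
    by (simp add: algebra_simps)
  have f1: "?f \<ge> 1" using mult_mono[OF fact_ge_1 fact_ge_1, of ?a ?b] by simp
  have "\<bar>psi j d s 1 - psi j d t 1\<bar> = \<bar>s ^ ?a * (1 - s) ^ ?b - t ^ ?a * (1 - t) ^ ?b\<bar> / ?f"
    by (simp add: psi_def diff_divide_distrib[symmetric] abs_divide)
  also have "\<dots> \<le> \<bar>s ^ ?a * (1 - s) ^ ?b - t ^ ?a * (1 - t) ^ ?b\<bar> / 1"
    using f1 by (intro divide_left_mono) auto
  finally show ?thesis using 1 by simp
qed

subsection \<open>Convergence in distribution with moments\<close>

text \<open>Fatou for the truncations. Weak convergence speaks about bounded continuous test
  functions, so this is the form in which it delivers moment bounds for the limit law.\<close>

lemma (in real_distribution) integrable_of_truncated_bound: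
  fixes h :: "real \<Rightarrow> real"
  assumes hm: "h \<in> borel_measurable borel" and nn: "\<And>z. h z \<ge> 0"
    and b: "\<And>n::nat. (\<integral>z. min (h z) (real n) \<partial>M) \<le> C"
  shows "integrable M h" "(\<integral>z. h z \<partial>M) \<le> C"
proof -
  note hm [measurable]
  have i: "integrable M (\<lambda>z. min (h z) (real n))" for n
  proof (rule integrable_const_bound[where B="real n"])
    have "\<bar>min (h z) (real n)\<bar> \<le> real n" for z using nn[of z] by (auto simp: min_def)
    thus "AE z in M. norm (min (h z) (real n)) \<le> real n" by simp
  qed measurable
  have C0: "C \<ge> 0" using b[of 0] nn by (simp add: min_absorb2)
  have "(\<integral>\<^sup>+z. ennreal (h z) \<partial>M) = (\<integral>\<^sup>+z. liminf (\<lambda>n. ennreal (min (h z) (real n))) \<partial>M)"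
  proof (rule nn_integral_cong)
    fix z
    have "\<forall>\<^sub>F n in sequentially. min (h z) (real n) = h z"
      using eventually_ge_at_top[of "nat \<lceil>h z\<rceil>"]
    proof eventually_elim
      case (elim n)
      have "h z \<le> real (nat \<lceil>h z\<rceil>)" by (rule real_nat_ceiling_ge)
      also have "\<dots> \<le> real n" using elim by simp
      finally show ?case by (rule min_absorb1)
    qed
    hence "(\<lambda>n. ennreal (min (h z) (real n))) \<longlonglongrightarrow> ennreal (h z)"
      by (intro tendsto_ennrealI tendsto_eventually)
    thus "ennreal (h z) = liminf (\<lambda>n. ennreal (min (h z) (real n)))"
      by (rule lim_imp_Liminf[OF sequentially_bot, symmetric])
  qed
  also have "\<dots> \<le> liminf (\<lambda>n. \<integral>\<^sup>+z. ennreal (min (h z) (real n)) \<partial>M)"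
    by (rule nn_integral_liminf) simp
  also have "\<dots> \<le> limsup (\<lambda>n. \<integral>\<^sup>+z. ennreal (min (h z) (real n)) \<partial>M)"
    by (rule Liminf_le_Limsup) simp
  also have "\<dots> \<le> ennreal C"
  proof (rule Limsup_bounded, rule always_eventually, rule allI)
    fix n
    have "(\<integral>\<^sup>+z. ennreal (min (h z) (real n)) \<partial>M) = ennreal (\<integral>z. min (h z) (real n) \<partial>M)"
      by (rule nn_integral_eq_integral[OF i]) (auto simp: nn)
    thus "(\<integral>\<^sup>+z. ennreal (min (h z) (real n)) \<partial>M) \<le> ennreal C" using b[of n] by (simp add: ennreal_leI)
  qed
  finally have le: "(\<integral>\<^sup>+z. ennreal (h z) \<partial>M) \<le> ennreal C" .
  show ih: "integrable M h"
    by (rule integrableI_nonneg) (use le nn in \<open>auto intro: le_less_trans\<close>)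
  show "(\<integral>z. h z \<partial>M) \<le> C"
    using le nn_integral_eq_integral[OF ih] nn C0 by simp
qed

text \<open>Cutting at level \<open>K\<close> changes a number \<open>a\<close> by at most
  \<open>a\<^sup>2 / K\<close>, so a bound on second moments makes truncation uniformly
  harmless.\<close>

lemma (in prob_space) truncation_error:
  fixes h :: "'a \<Rightarrow> real"
  assumes h: "h \<in> borel_measurable M" and i: "integrable M (\<lambda>\<omega>. (h \<omega>)\<^sup>2)" and b: "expectation (\<lambda>\<omega>. (h \<omega>)\<^sup>2) \<le> C" and K: "K > 0"
  shows "\<bar>expectation h - expectation (\<lambda>\<omega>. max (- K) (min K (h \<omega>)))\<bar> \<le> C / K"
proof -
  have le: "\<bar>a - max (- K) (min K a)\<bar> \<le> a\<^sup>2 / K" for a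
  proof (cases "\<bar>a\<bar> \<le> K")
    case False
    have "\<bar>a - max (- K) (min K a)\<bar> * K \<le> \<bar>a\<bar> * \<bar>a\<bar>"
      using False K by (intro mult_mono) (auto simp: min_def max_def abs_if)
    thus ?thesis using K by (simp add: pos_le_divide_eq power2_eq_square)
  qed (use K in \<open>auto simp: min_def max_def abs_if split: if_splits\<close>)
  have "lp M 2 h" using h i by (intro lpI)
  hence i1: "integrable M h" by (intro lp_integrable[of 2]) auto
  note h [measurable]
  have i2: "integrable M (\<lambda>\<omega>. max (- K) (min K (h \<omega>)))"
    by (rule integrable_const_bound[where B=K]) (use K in \<open>auto simp: abs_if min_def max_def\<close>)
  have "\<bar>expectation h - expectation (\<lambda>\<omega>. max (- K) (min K (h \<omega>)))\<bar> = \<bar>expectation (\<lambda>\<omega>. h \<omega> - max (- K) (min K (h \<omega>)))\<bar>"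
    using i1 i2 by simp
  also have "\<dots> \<le> expectation (\<lambda>\<omega>. \<bar>h \<omega> - max (- K) (min K (h \<omega>))\<bar>)" by (rule integral_abs_bound)
  also have "\<dots> \<le> expectation (\<lambda>\<omega>. (h \<omega>)\<^sup>2 / K)"
    using i1 i2 i le by (intro integral_mono) auto
  also have "\<dots> \<le> C / K" using b K by (simp add: divide_right_mono)
  finally show ?thesis .
qed

text \<open>Bounded second moments of \<open>h (Z n)\<close> act as uniform integrability: both
  sides are truncated at a level that does not depend on \<open>n\<close>, and the truncated
  expectations converge by weak convergence.\<close>

lemma (in prob_space) weak_conv_expectation:
  fixes Z :: "nat \<Rightarrow> 'a \<Rightarrow> real" and h :: "real \<Rightarrow> real"
  assumes \<nu>: "real_distribution \<nu>" and Z: "\<And>n. Z n \<in> borel_measurable M"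
    and w: "weak_conv_m (\<lambda>n. distr M borel (Z n)) \<nu>"
    and h: "\<And>z. isCont h z"
    and i: "\<And>n. integrable M (\<lambda>\<omega>. (h (Z n \<omega>))\<^sup>2)" and b: "\<And>n. expectation (\<lambda>\<omega>. (h (Z n \<omega>))\<^sup>2) \<le> C"
  shows "integrable \<nu> h" "(\<lambda>n. expectation (\<lambda>\<omega>. h (Z n \<omega>))) \<longlonglongrightarrow> (\<integral>z. h z \<partial>\<nu>)"
proof -
  interpret N: real_distribution \<nu> by fact
  have D: "real_distribution (distr M borel (Z n))" for n by (rule real_distribution_distr) (rule Z)
  have hm [measurable]: "h \<in> borel_measurable borel"
    using h by (intro borel_measurable_continuous_onI) (simp add: continuous_at_imp_continuous_on)
  have bc: "(\<lambda>n. expectation (\<lambda>\<omega>. g (Z n \<omega>))) \<longlonglongrightarrow> (\<integral>z. g z \<partial>\<nu>)"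
    if g: "\<And>z. isCont g z" "\<And>z. \<bar>g z\<bar> \<le> B" for g :: "real \<Rightarrow> real" and B
  proof -
    have gm: "g \<in> borel_measurable borel"
      using g by (intro borel_measurable_continuous_onI) (simp add: continuous_at_imp_continuous_on)
    have "(\<lambda>n. integral\<^sup>L (distr M borel (Z n)) g) \<longlonglongrightarrow> integral\<^sup>L \<nu> g"
      by (rule weak_conv_imp_integral_bdd_continuous_conv[OF D \<nu> w g(1), of B]) (use g(2) in simp)
    thus ?thesis by (simp add: integral_distr[OF Z gm])
  qed
  have "0 \<le> expectation (\<lambda>\<omega>. (h (Z 0 \<omega>))\<^sup>2)" by (intro integral_nonneg_AE) simp
  hence C0: "C \<ge> 0" using b[of 0] by linarith
  have Zm [measurable]: "Z n \<in> borel_measurable M" for n by (rule Z)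
  have h2: "(\<integral>z. min ((h z)\<^sup>2) (real n) \<partial>\<nu>) \<le> C" for n
  proof (rule LIMSEQ_le_const2)
    show "(\<lambda>k. expectation (\<lambda>\<omega>. min ((h (Z k \<omega>))\<^sup>2) (real n))) \<longlonglongrightarrow> (\<integral>z. min ((h z)\<^sup>2) (real n) \<partial>\<nu>)"
    proof (rule bc[of _ "real n"])
      show "isCont (\<lambda>z. min ((h z)\<^sup>2) (real n)) z" for z by (intro continuous_intros h)
      show "\<bar>min ((h z)\<^sup>2) (real n)\<bar> \<le> real n" for z using zero_le_power2[of "h z"] by (auto simp: min_def)
    qed
    have "expectation (\<lambda>\<omega>. min ((h (Z k \<omega>))\<^sup>2) (real n)) \<le> C" for k
    proof -
      have "expectation (\<lambda>\<omega>. min ((h (Z k \<omega>))\<^sup>2) (real n)) \<le> expectation (\<lambda>\<omega>. (h (Z k \<omega>))\<^sup>2)"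
        using i by (intro integral_mono Bochner_Integration.integrable_min) auto
      thus ?thesis using b[of k] by linarith
    qed
    thus "\<exists>N. \<forall>k\<ge>N. expectation (\<lambda>\<omega>. min ((h (Z k \<omega>))\<^sup>2) (real n)) \<le> C" by blast
  qed
  have h2m: "(\<lambda>z. (h z)\<^sup>2) \<in> borel_measurable borel" by measurable
  note ib = N.integrable_of_truncated_bound[OF h2m _ h2]
  have i\<nu>: "integrable \<nu> (\<lambda>z. (h z)\<^sup>2)" "(\<integral>z. (h z)\<^sup>2 \<partial>\<nu>) \<le> C" using ib by auto
  have hm\<nu>: "h \<in> borel_measurable \<nu>" by simp
  have "lp \<nu> 2 h" using i\<nu> hm\<nu> by (intro lpI)
  thus "integrable \<nu> h" by (intro N.lp_integrable[of 2]) auto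
  show "(\<lambda>n. expectation (\<lambda>\<omega>. h (Z n \<omega>))) \<longlonglongrightarrow> (\<integral>z. h z \<partial>\<nu>)"
  proof (rule LIMSEQ_I)
    fix r :: real assume r: "r > 0"
    \<comment> \<open>The level leaves two truncation errors below \<open>r / 4\<close> each, and
      \<open>r / 2\<close> for the truncated expectations; \<open>C + 1\<close> keeps it
      positive.\<close>
    define K where "K = 4 * (C + 1) / r"
    have K: "K > 0" "C / K < r / 4"
    proof -
      show K0: "K > 0" using C0 r by (simp add: K_def)
      have "C < C + 1" by simp
      also have "C + 1 = r / 4 * K" using r by (simp add: K_def)
      finally show "C / K < r / 4" using K0 by (simp add: pos_divide_less_eq)
    qed
    let ?t = "\<lambda>a. max (- K) (min K a)"
    have "(\<lambda>n. expectation (\<lambda>\<omega>. ?t (h (Z n \<omega>)))) \<longlonglongrightarrow> (\<integral>z. ?t (h z) \<partial>\<nu>)"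
    proof (rule bc[of _ K])
      show "isCont (\<lambda>z. ?t (h z)) z" for z by (intro continuous_intros h)
      show "\<bar>?t (h z)\<bar> \<le> K" for z using K(1) by (auto simp: min_def max_def)
    qed
    from LIMSEQ_D[OF this, of "r / 2"] r obtain n0 where n0:
      "\<And>n. n \<ge> n0 \<Longrightarrow> \<bar>expectation (\<lambda>\<omega>. ?t (h (Z n \<omega>))) - (\<integral>z. ?t (h z) \<partial>\<nu>)\<bar> < r / 2" by auto
    have e1: "\<bar>expectation (\<lambda>\<omega>. h (Z n \<omega>)) - expectation (\<lambda>\<omega>. ?t (h (Z n \<omega>)))\<bar> \<le> C / K" for n
      by (rule truncation_error) (use i b K in auto)
    have e2: "\<bar>(\<integral>z. h z \<partial>\<nu>) - (\<integral>z. ?t (h z) \<partial>\<nu>)\<bar> \<le> C / K"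
      by (rule N.truncation_error[OF hm\<nu> i\<nu> K(1)])
    show "\<exists>n0. \<forall>n\<ge>n0. norm (expectation (\<lambda>\<omega>. h (Z n \<omega>)) - (\<integral>z. h z \<partial>\<nu>)) < r"
    proof (intro exI[of _ n0] allI impI)
      fix n assume "n \<ge> n0"
      show "norm (expectation (\<lambda>\<omega>. h (Z n \<omega>)) - (\<integral>z. h z \<partial>\<nu>)) < r"
        using n0[OF \<open>n \<ge> n0\<close>] e1[of n] e2 K(2) unfolding real_norm_def by linarith
    qed
  qed
qed

text \<open>The characteristic functions are assumed to converge along all sequences tending to
  infinity: Levy's continuity theorem works along sequences, and together they determine the limit
  at \<open>at_top\<close>. Any continuous \<open>h\<close> whose square is at most
  \<open>1 + z ^ p\<close> for an even \<open>p\<close> inherits bounded second moments, and every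
  moment in question is such an \<open>h\<close>.\<close>

lemma (in prob_space) conv_from_char_and_moments:
  fixes Y :: "real \<Rightarrow> 'a \<Rightarrow> real"
  assumes \<nu>: "real_distribution \<nu>" and Y: "\<And>x. Y x \<in> borel_measurable M"
    and ch: "\<And>xs t. filterlim xs at_top sequentially \<Longrightarrow> (\<lambda>n. char (distr M borel (Y (xs n))) t) \<longlonglongrightarrow> char \<nu> t"
    and mom: "\<And>p. even p \<Longrightarrow> p > 0 \<Longrightarrow> (\<exists>C. \<forall>x\<ge>x0. lp M p (Y x) \<and> expectation (\<lambda>\<omega>. Y x \<omega> ^ p) \<le> C)"
  shows "conv_in_distr M Y at_top \<nu>" "moments_converge M Y at_top \<nu>"
proof -
  have w: "weak_conv_m (\<lambda>n. distr M borel (Y (xs n))) \<nu>" if "filterlim xs at_top sequentially" for xs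
    by (rule levy_continuity) (auto intro!: real_distribution_distr Y \<nu> ch that)
  have "((\<lambda>x. cdf (distr M borel (Y x)) z) \<longlongrightarrow> cdf \<nu> z) at_top" if "isCont (cdf \<nu>) z" for z
  proof (rule tendsto_at_topI_sequentially)
    fix xs :: "nat \<Rightarrow> real" assume "filterlim xs at_top sequentially"
    from w[OF this] that show "(\<lambda>n. cdf (distr M borel (Y (xs n))) z) \<longlonglongrightarrow> cdf \<nu> z"
      by (simp add: weak_conv_m_def weak_conv_def)
  qed
  thus "conv_in_distr M Y at_top \<nu>" using Y by (simp add: conv_in_distr_def)
  have main: "integrable \<nu> h \<and> (\<forall>\<^sub>F x in at_top. integrable M (\<lambda>\<omega>. h (Y x \<omega>))) \<and>
      ((\<lambda>x. expectation (\<lambda>\<omega>. h (Y x \<omega>))) \<longlongrightarrow> (\<integral>z. h z \<partial>\<nu>)) at_top"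
    if h: "\<And>z. isCont h z" and p: "even p" "p > 0" and hp: "\<And>z. (h z)\<^sup>2 \<le> 1 + z ^ p" for h p
  proof -
    have hm [measurable]: "h \<in> borel_measurable borel"
      using h by (intro borel_measurable_continuous_onI) (simp add: continuous_at_imp_continuous_on)
    have Ym [measurable]: "Y x \<in> borel_measurable M" for x by (rule Y)
    from mom[OF p] obtain C where C: "\<And>x. x \<ge> x0 \<Longrightarrow> lp M p (Y x)" "\<And>x. x \<ge> x0 \<Longrightarrow> expectation (\<lambda>\<omega>. Y x \<omega> ^ p) \<le> C" by blast
    have i: "integrable M (\<lambda>\<omega>. (h (Y x \<omega>))\<^sup>2)" and b: "expectation (\<lambda>\<omega>. (h (Y x \<omega>))\<^sup>2) \<le> 1 + C" if "x \<ge> x0" for x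
    proof -
      have ip: "integrable M (\<lambda>\<omega>. 1 + Y x \<omega> ^ p)" using C(1)[OF that] by (simp add: lp_def)
      show ii: "integrable M (\<lambda>\<omega>. (h (Y x \<omega>))\<^sup>2)"
        by (rule Bochner_Integration.integrable_bound[OF ip]) (use hp in \<open>auto intro!: AE_I2 intro: order_trans[OF _ abs_ge_self]\<close>)
      have "expectation (\<lambda>\<omega>. (h (Y x \<omega>))\<^sup>2) \<le> expectation (\<lambda>\<omega>. 1 + Y x \<omega> ^ p)"
        by (intro integral_mono ii ip hp)
      also have "\<dots> = 1 + expectation (\<lambda>\<omega>. Y x \<omega> ^ p)" using C(1)[OF that] by (simp add: lp_def prob_space)
      finally show "expectation (\<lambda>\<omega>. (h (Y x \<omega>))\<^sup>2) \<le> 1 + C" using C(2)[OF that] by simp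
    qed
    have i1: "integrable M (\<lambda>\<omega>. h (Y x \<omega>))" if "x \<ge> x0" for x
    proof -
      have "lp M 2 (\<lambda>\<omega>. h (Y x \<omega>))" using i[OF that] by (intro lpI) auto
      thus ?thesis by (intro lp_integrable[of 2]) auto
    qed
    have seq: "integrable \<nu> h \<and> (\<lambda>n. expectation (\<lambda>\<omega>. h (Y (xs n) \<omega>))) \<longlonglongrightarrow> (\<integral>z. h z \<partial>\<nu>)"
      if xs: "filterlim xs at_top sequentially" for xs
    proof -
      \<comment> \<open>Only finitely many terms change; the moment bounds, valid from
        \<open>x0\<close> on, then hold for every \<open>n\<close>.\<close>
      define ys where "ys = (\<lambda>n. max x0 (xs n))"
      have ys: "filterlim ys at_top sequentially"
        by (rule filterlim_at_top_mono[OF xs]) (auto simp: ys_def)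
      have ev: "\<forall>\<^sub>F n in sequentially. ys n = xs n"
        using filterlim_at_top[THEN iffD1, OF xs, rule_format, of x0] by eventually_elim (simp add: ys_def)
      have y0: "ys n \<ge> x0" for n by (simp add: ys_def)
      note wc = weak_conv_expectation[OF \<nu> Y w[OF ys] h i[OF y0] b[OF y0]]
      have "(\<lambda>n. expectation (\<lambda>\<omega>. h (Y (xs n) \<omega>))) \<longlonglongrightarrow> (\<integral>z. h z \<partial>\<nu>)"
        by (rule Lim_transform_eventually[OF wc(2)]) (use ev in \<open>auto elim!: eventually_mono\<close>)
      thus ?thesis using wc(1) by simp
    qed
    have "integrable \<nu> h" using seq[OF filterlim_real_sequentially] by simp
    moreover have "((\<lambda>x. expectation (\<lambda>\<omega>. h (Y x \<omega>))) \<longlongrightarrow> (\<integral>z. h z \<partial>\<nu>)) at_top"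
      by (rule tendsto_at_topI_sequentially) (use seq in blast)
    moreover have "\<forall>\<^sub>F x in at_top. integrable M (\<lambda>\<omega>. h (Y x \<omega>))"
      using eventually_ge_at_top[of x0] by eventually_elim (rule i1)
    ultimately show ?thesis by simp
  qed
  show "moments_converge M Y at_top \<nu>"
    unfolding moments_converge_def
  proof (intro conjI allI impI)
    fix k :: nat assume k: "k \<ge> 1"
    have m: "integrable \<nu> (\<lambda>z. z ^ k) \<and> (\<forall>\<^sub>F x in at_top. integrable M (\<lambda>\<omega>. Y x \<omega> ^ k)) \<and>
      ((\<lambda>x. expectation (\<lambda>\<omega>. Y x \<omega> ^ k)) \<longlongrightarrow> (\<integral>z. z ^ k \<partial>\<nu>)) at_top"
      by (rule main[of "\<lambda>z. z ^ k" "2 * k"]) (use k in \<open>auto simp: power_mult[symmetric] mult.commute\<close>)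
    thus "integrable \<nu> (\<lambda>z. z ^ k)" "\<forall>\<^sub>F x in at_top. integrable M (\<lambda>\<omega>. Y x \<omega> ^ k)"
      "((\<lambda>x. expectation (\<lambda>\<omega>. Y x \<omega> ^ k)) \<longlongrightarrow> (\<integral>z. z ^ k \<partial>\<nu>)) at_top" by auto
  next
    fix r :: real assume r: "r > 0"
    \<comment> \<open>An even exponent of at least \<open>2 * r\<close>: the square of the absolute
      moment function has to be dominated.\<close>
    define p where "p = 2 * (nat \<lceil>r\<rceil>)"
    have p: "even p" "p > 0" "2 * r \<le> real p" using r by (auto simp: p_def)
    have hp: "(\<bar>z\<bar> powr r)\<^sup>2 \<le> 1 + z ^ p" for z
    proof (cases "\<bar>z\<bar> \<le> 1")
      case True
      hence "(\<bar>z\<bar> powr r)\<^sup>2 \<le> 1" using r by (intro power_le_one) (auto intro!: powr_le1)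
      thus ?thesis using p(1) zero_le_even_power[of p z] by linarith
    next
      case False
      have "(\<bar>z\<bar> powr r)\<^sup>2 = \<bar>z\<bar> powr (2 * r)" by (simp add: power2_eq_square powr_add[symmetric])
      also have "\<dots> \<le> \<bar>z\<bar> powr (real p)" using False p(3) by (intro powr_mono) auto
      also have "\<dots> = z ^ p" using False p(1) by (subst powr_realpow) (auto simp: power_even_abs)
      finally show ?thesis by simp
    qed
    have c: "isCont (\<lambda>z. \<bar>z\<bar> powr r) z" for z :: real
      unfolding isCont_def using r by (intro tendsto_powr' tendsto_intros) auto
    from main[OF c p(1,2) hp]
    show "integrable \<nu> (\<lambda>z. \<bar>z\<bar> powr r)" "\<forall>\<^sub>F x in at_top. integrable M (\<lambda>\<omega>. \<bar>Y x \<omega>\<bar> powr r)"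
      "((\<lambda>x. expectation (\<lambda>\<omega>. \<bar>Y x \<omega>\<bar> powr r)) \<longlongrightarrow> (\<integral>z. \<bar>z\<bar> powr r \<partial>\<nu>)) at_top" by auto
  qed
qed

text \<open>\<open>iexp\<close> is Lipschitz, so an error that vanishes in mean does not affect the
  limit of characteristic functions; this takes the place of Slutsky's lemma.\<close>

lemma (in prob_space) char_diff_le:
  assumes "Y \<in> borel_measurable M" "Z \<in> borel_measurable M" "integrable M (\<lambda>\<omega>. Y \<omega> - Z \<omega>)"
  shows "cmod (char (distr M borel Y) t - char (distr M borel Z) t) \<le> \<bar>t\<bar> * expectation (\<lambda>\<omega>. \<bar>Y \<omega> - Z \<omega>\<bar>)"
proof -
  note [measurable] = assms(1,2)
  have i: "integrable M (\<lambda>\<omega>. iexp (t * W \<omega>))" if "W \<in> borel_measurable M" for W :: "'a \<Rightarrow> real"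
    by (rule integrable_const_bound[where B=1]) (use that in \<open>auto\<close>)
  have c: "char (distr M borel W) t = (CLINT \<omega>|M. iexp (t * W \<omega>))" if "W \<in> borel_measurable M" for W
    unfolding char_def using that by (subst integral_distr) auto
  have le: "cmod (iexp a - iexp b) \<le> \<bar>a - b\<bar>" for a b :: real
  proof -
    have "iexp a - iexp b = iexp b * (iexp (a - b) - 1)" by (simp add: exp_diff algebra_simps)
    also have "cmod \<dots> = cmod (iexp (a - b) - 1)" by (simp add: norm_mult)
    also have "\<dots> \<le> \<bar>a - b\<bar>" using iexp_approx1[of "a - b" 0] by simp
    finally show ?thesis .
  qed
  have "char (distr M borel Y) t - char (distr M borel Z) t = (CLINT \<omega>|M. iexp (t * Y \<omega>) - iexp (t * Z \<omega>))"
    using c[OF assms(1)] c[OF assms(2)] i[OF assms(1)] i[OF assms(2)] by simp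
  also have "cmod \<dots> \<le> expectation (\<lambda>\<omega>. cmod (iexp (t * Y \<omega>) - iexp (t * Z \<omega>)))" by (rule integral_norm_bound)
  also have "\<dots> \<le> expectation (\<lambda>\<omega>. \<bar>t\<bar> * \<bar>Y \<omega> - Z \<omega>\<bar>)"
  proof (rule integral_mono)
    show "integrable M (\<lambda>\<omega>. cmod (iexp (t * Y \<omega>) - iexp (t * Z \<omega>)))"
      using i[OF assms(1)] i[OF assms(2)] by (intro integrable_norm Bochner_Integration.integrable_diff)
    show "integrable M (\<lambda>\<omega>. \<bar>t\<bar> * \<bar>Y \<omega> - Z \<omega>\<bar>)" using assms(3) by auto
    show "cmod (iexp (t * Y \<omega>) - iexp (t * Z \<omega>)) \<le> \<bar>t\<bar> * \<bar>Y \<omega> - Z \<omega>\<bar>" for \<omega>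
      using le[of "t * Y \<omega>" "t * Z \<omega>"] by (simp add: abs_mult[symmetric] right_diff_distrib)
  qed
  finally show ?thesis by simp
qed

lemma real_distribution_normal_law:
  assumes "v \<ge> 0"
  shows "real_distribution (normal_law m v)"
proof (cases "v = 0")
  case True
  interpret prob_space "return borel m" by (rule prob_space_return) simp
  show ?thesis using True by (simp add: normal_law_def real_distribution_def real_distribution_axioms_def prob_space_axioms)
next
  case False
  interpret prob_space "density lborel (\<lambda>x. ennreal (normal_density m (sqrt v) x))"
    by (rule prob_space_normal_density) (use False assms in simp)
  show ?thesis using False by (simp add: normal_law_def real_distribution_def real_distribution_axioms_def prob_space_axioms)
qed

text \<open>Writing the law as that of \<open>sqrt v\<close> times a standard normal variable covers
  the point mass at \<open>v = 0\<close>, so the characteristic function and the moments can be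
  computed without case distinction.\<close>

lemma normal_law_0_eq_distr:
  assumes "v \<ge> 0"
  shows "normal_law 0 v = distr std_normal_distribution borel (\<lambda>x. sqrt v * x)"
proof (cases "v = 0")
  case True
  interpret prob_space std_normal_distribution by (rule prob_space_normal_density) simp
  have "distr std_normal_distribution borel (\<lambda>x. sqrt v * x) = distr std_normal_distribution borel (\<lambda>_. 0)"
    using True by simp
  also have "\<dots> = return borel 0" by (rule distr_const) simp
  finally show ?thesis using True by (simp add: normal_law_def)
next
  case False
  hence v: "v > 0" using assms by simp
  interpret prob_space std_normal_distribution by (rule prob_space_normal_density) simp
  have "distributed std_normal_distribution lborel (\<lambda>x. x) (normal_density 0 1)"
    by (auto simp: distributed_def distr_id2)
  from normal_density_affine[OF this, of "sqrt v" 0] v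
  have "distributed std_normal_distribution lborel (\<lambda>x. sqrt v * x) (normal_density 0 (sqrt v))" by simp
  from distributed_distr_eq_density[OF this]
  have "distr std_normal_distribution lborel (\<lambda>x. sqrt v * x) = density lborel (\<lambda>x. ennreal (normal_density 0 (sqrt v) x))" .
  moreover have "distr std_normal_distribution lborel (\<lambda>x. sqrt v * x) = distr std_normal_distribution borel (\<lambda>x. sqrt v * x)"
    by (rule distr_cong) auto
  ultimately show ?thesis using False by (simp add: normal_law_def)
qed

lemma
  assumes "v \<ge> 0"
  shows char_normal_law: "char (normal_law 0 v) t = exp (- (t\<^sup>2 * v / 2))"
    and normal_law_moment1: "(\<integral>z. z ^ 1 \<partial>normal_law 0 v) = 0"
    and normal_law_moment2: "(\<integral>z. z ^ 2 \<partial>normal_law 0 v) = v"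
proof -
  have "char (normal_law 0 v) t = char std_normal_distribution (t * sqrt v)"
    unfolding normal_law_0_eq_distr[OF assms] char_def by (subst integral_distr) (auto simp: mult.assoc)
  also have "\<dots> = exp (- (t\<^sup>2 * v / 2))"
    using assms by (simp add: char_std_normal_distribution power_mult_distrib)
  finally show "char (normal_law 0 v) t = exp (- (t\<^sup>2 * v / 2))" .
  show "(\<integral>z. z ^ 1 \<partial>normal_law 0 v) = 0"
    unfolding normal_law_0_eq_distr[OF assms] using integral_std_normal_distribution_moment_odd[of 1]
    by (subst integral_distr) auto
  show "(\<integral>z. z ^ 2 \<partial>normal_law 0 v) = v"
    unfolding normal_law_0_eq_distr[OF assms] using std_normal_distribution_even_moments(1)[of 1] assms
    by (subst integral_distr) (auto simp: power_mult_distrib)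
qed

subsection \<open>Stopped U-statistics\<close>

text \<open>Supplies the crossing of the locale \<open>passage\<close>. For \<open>N_minus\<close>
  it is the last one, from the final visit at or below the level; for \<open>N_plus\<close> it is
  the first one. A path may cross several times, so the two values of \<open>K\<close> can
  differ.\<close>

lemma passage_times:
  fixes u :: "nat \<Rightarrow> 'a \<Rightarrow> real"
  assumes u0: "u 0 \<omega> = 0" and lim: "filterlim (\<lambda>n. u n \<omega>) at_top sequentially" and x: "x \<ge> 0"
    and N: "N \<in> {N_minus u, N_plus u}"
  shows "\<exists>n K. N x \<omega> = enat n \<and> K \<ge> 1 \<and> (n = K - 1 \<or> n = K) \<and> u (K - 1) \<omega> \<le> x \<and> x \<le> u K \<omega>"
proof -
  have ev: "\<forall>\<^sub>F n in sequentially. x < u n \<omega>" using lim by (simp add: filterlim_at_top_dense)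
  then obtain n0 where n0: "\<And>n. n \<ge> n0 \<Longrightarrow> x < u n \<omega>" by (auto simp: eventually_sequentially)
  from N consider "N = N_minus u" | "N = N_plus u" by auto
  then show ?thesis
  proof cases
    case 1
    define A where "A = {n. u n \<omega> \<le> x}"
    have fin: "finite A"
      by (rule finite_subset[of _ "{..<n0}"]) (use n0 in \<open>force simp: A_def not_le[symmetric]\<close>)+
    have "0 \<in> A" using u0 x by (simp add: A_def)
    hence ne: "A \<noteq> {}" by blast
    define n where "n = Max A"
    have nA: "n \<in> A" unfolding n_def by (rule Max_in[OF fin ne])
    have le: "k \<le> n" if "k \<in> A" for k unfolding n_def by (rule Max_ge[OF fin that])
    have "N x \<omega> = enat n"
      unfolding 1 N_minus_def
    proof (rule antisym)
      show "Sup {enat n |n. u n \<omega> \<le> x} \<le> enat n"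
        by (rule Sup_least) (use le in \<open>auto simp: A_def\<close>)
      show "enat n \<le> Sup {enat n |n. u n \<omega> \<le> x}"
        by (rule Sup_upper) (use nA in \<open>auto simp: A_def\<close>)
    qed
    moreover have "x \<le> u (Suc n) \<omega>" using le[of "Suc n"] by (force simp: A_def)
    ultimately show ?thesis using nA by (intro exI[of _ n] exI[of _ "Suc n"]) (auto simp: A_def)
  next
    case 2
    define K where "K = (LEAST n. x < u n \<omega>)"
    have K: "x < u K \<omega>" unfolding K_def by (rule LeastI[of _ n0]) (use n0 in auto)
    have least: "K \<le> k" if "x < u k \<omega>" for k unfolding K_def using that by (rule Least_le)
    have K1: "K \<ge> 1" using K u0 x by (cases K) auto
    have "N x \<omega> = enat K"
      unfolding 2 N_plus_def
    proof (rule antisym)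
      show "Inf {enat n |n. u n \<omega> > x} \<le> enat K" by (rule Inf_lower) (use K in auto)
      show "enat K \<le> Inf {enat n |n. u n \<omega> > x}" by (rule Inf_greatest) (use least in auto)
    qed
    moreover have "u (K - 1) \<omega> \<le> x" using least[of "K - 1"] K1 by (force simp: not_le[symmetric])
    ultimately show ?thesis using K K1 by (intro exI[of _ K]) auto
  qed
qed

text \<open>Rewritten as a supremum over all \<open>n\<close>, where times above the level
  contribute \<open>0\<close>, the neutral value of a supremum. For \<open>N_plus\<close> the
  neutral value is infinity.\<close>

lemma N_minus_measurable [measurable]:
  assumes [measurable]: "\<And>n. u n \<in> borel_measurable M"
  shows "N_minus u x \<in> measurable M (count_space UNIV)"
proof -
  have "N_minus u x \<omega> = (SUP n. if u n \<omega> \<le> x then enat n else 0)" for \<omega>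
    unfolding N_minus_def
  proof (rule antisym)
    show "Sup {enat n |n. u n \<omega> \<le> x} \<le> (SUP n. if u n \<omega> \<le> x then enat n else 0)"
    proof (rule Sup_least)
      fix a assume "a \<in> {enat n |n. u n \<omega> \<le> x}"
      then obtain n where n: "a = enat n" "u n \<omega> \<le> x" by blast
      hence "a = (if u n \<omega> \<le> x then enat n else 0)" by simp
      also have "\<dots> \<le> (SUP n. if u n \<omega> \<le> x then enat n else 0)" by (rule SUP_upper) simp
      finally show "a \<le> (SUP n. if u n \<omega> \<le> x then enat n else 0)" .
    qed
    show "(SUP n. if u n \<omega> \<le> x then enat n else 0) \<le> Sup {enat n |n. u n \<omega> \<le> x}"
      by (rule SUP_least) (auto intro: Sup_upper)
  qed
  hence "N_minus u x = (\<lambda>\<omega>. SUP n. if u n \<omega> \<le> x then enat n else 0)" by auto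
  moreover have "(\<lambda>\<omega>. SUP n. if u n \<omega> \<le> x then enat n else 0) \<in> measurable M (count_space UNIV)" by measurable
  ultimately show ?thesis by simp
qed

lemma N_plus_measurable [measurable]:
  assumes [measurable]: "\<And>n. u n \<in> borel_measurable M"
  shows "N_plus u x \<in> measurable M (count_space UNIV)"
proof -
  have "N_plus u x \<omega> = (INF n. if u n \<omega> > x then enat n else \<infinity>)" for \<omega>
    unfolding N_plus_def
  proof (rule antisym)
    show "(INF n. if u n \<omega> > x then enat n else \<infinity>) \<le> Inf {enat n |n. u n \<omega> > x}"
    proof (rule Inf_greatest)
      fix a assume "a \<in> {enat n |n. u n \<omega> > x}"
      then obtain n where n: "a = enat n" "u n \<omega> > x" by blast
      hence "a = (if u n \<omega> > x then enat n else \<infinity>)" by simp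
      moreover have "(INF n. if u n \<omega> > x then enat n else \<infinity>) \<le> (if u n \<omega> > x then enat n else \<infinity>)"
        by (rule INF_lower) simp
      ultimately show "(INF n. if u n \<omega> > x then enat n else \<infinity>) \<le> a" by simp
    qed
    show "Inf {enat n |n. u n \<omega> > x} \<le> (INF n. if u n \<omega> > x then enat n else \<infinity>)"
      by (rule INF_greatest) (auto intro: Inf_lower)
  qed
  hence "N_plus u x = (\<lambda>\<omega>. INF n. if u n \<omega> > x then enat n else \<infinity>)" by auto
  moreover have "(\<lambda>\<omega>. INF n. if u n \<omega> > x then enat n else \<infinity>) \<in> measurable M (count_space UNIV)" by measurable
  ultimately show ?thesis by simp
qed

lemma stopped_measurable:
  assumes u: "\<And>n. u n \<in> borel_measurable M" and T: "T \<in> measurable M (count_space UNIV)"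
  shows "stopped u T \<in> borel_measurable M"
proof -
  have "(\<lambda>\<omega>. (\<lambda>i \<omega>. case i of enat n \<Rightarrow> u n \<omega> | \<infinity> \<Rightarrow> 0) (T \<omega>) \<omega>) \<in> borel_measurable M"
  proof (rule measurable_compose_countable[OF _ T])
    show "(\<lambda>\<omega>. case i of enat n \<Rightarrow> u n \<omega> | \<infinity> \<Rightarrow> 0) \<in> borel_measurable M" for i
      by (cases i) (auto intro: u)
  qed
  thus ?thesis by (simp add: stopped_def[abs_def])
qed

text \<open>Exports the locale with \<open>C\<close> and \<open>E\<close> in front of all other
  quantifiers: they do not depend on the path or on \<open>Q\<close>. The random bound can therefore
  be inserted for each \<open>\<omega>\<close>, and its number of moments chosen after
  \<open>E\<close> is known.\<close>

lemma passage_expansion: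
  fixes \<mu> \<mu>' :: real
  assumes d: "d \<ge> 1" and d': "d' \<ge> 1" and \<mu>: "\<mu> > 0"
  defines "\<kappa> \<equiv> fact (d - 1) * \<mu>' / (fact (d' - 1) * \<mu>)"
  shows "\<exists>C E. C \<ge> 0 \<and> (\<forall>Q y v v' n K. Q \<ge> 1 \<longrightarrow> y \<ge> 1 \<longrightarrow>
    (\<forall>m n. m \<le> n \<longrightarrow> \<bar>v n - v m\<bar> \<le> Q * sqrt (real (n - m)) * real n powr (real d - 15/16)) \<longrightarrow>
    (\<forall>m n. m \<le> n \<longrightarrow> \<bar>v' n - v' m\<bar> \<le> Q * sqrt (real (n - m)) * real n powr (real d' - 15/16)) \<longrightarrow>
    v 0 = 0 \<longrightarrow> v' 0 = 0 \<longrightarrow> K \<ge> 1 \<longrightarrow> n = K - 1 \<or> n = K \<longrightarrow>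
    \<mu> * real ((K - 1) choose d) + v (K - 1) \<le> \<mu> * y ^ d / fact d \<longrightarrow>
    \<mu> * y ^ d / fact d \<le> \<mu> * real (K choose d) + v K \<longrightarrow>
    \<bar>(\<mu>' * real (n choose d') + v' n - \<mu>' * y ^ d' / fact d') / y powr (real d' - 1/2) -
      (v' (nat \<lfloor>y\<rfloor>) / y powr (real d' - 1/2) - \<kappa> * (v (nat \<lfloor>y\<rfloor>) / y powr (real d - 1/2)))\<bar> \<le> C * Q ^ E * y powr (-5/32) \<and>
    \<bar>(\<mu>' * real (n choose d') + v' n - \<mu>' * y ^ d' / fact d') / y powr (real d' - 1/2)\<bar> \<le> C * Q ^ E * y powr (1/16))"
proof -
  \<comment> \<open>One set with every admissible path, scale, bound and crossing; uniformity over
    it is what makes the constants independent of these data.\<close>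
  define Cf :: "(real \<times> real \<times> (nat \<Rightarrow> real) \<times> (nat \<Rightarrow> real) \<times> nat \<times> nat) set" where
    "Cf = {(Q, y, v, v', n, K). Q \<ge> 1 \<and> y \<ge> 1 \<and>
    (\<forall>m n. m \<le> n \<longrightarrow> \<bar>v n - v m\<bar> \<le> Q * sqrt (real (n - m)) * real n powr (real d - 15/16)) \<and>
    (\<forall>m n. m \<le> n \<longrightarrow> \<bar>v' n - v' m\<bar> \<le> Q * sqrt (real (n - m)) * real n powr (real d' - 15/16)) \<and>
    v 0 = 0 \<and> v' 0 = 0 \<and> K \<ge> 1 \<and> (n = K - 1 \<or> n = K) \<and>
    \<mu> * real ((K - 1) choose d) + v (K - 1) \<le> \<mu> * y ^ d / fact d \<and>
    \<mu> * y ^ d / fact d \<le> \<mu> * real (K choose d) + v K}"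
  interpret passage Cf "\<lambda>(Q, y, v, v', n, K). Q" "\<lambda>(Q, y, v, v', n, K). y" d d' \<mu> \<mu>'
    "\<lambda>(Q, y, v, v', n, K). v" "\<lambda>(Q, y, v, v', n, K). v'" "\<lambda>(Q, y, v, v', n, K). n" "\<lambda>(Q, y, v, v', n, K). K"
    by unfold_locales (use d d' \<mu> in \<open>auto simp: Cf_def simp del: of_nat_diff\<close>)
  obtain C E where C: "C \<ge> 0" "\<And>c. c \<in> Cf \<Longrightarrow> \<bar>b c - b0 c\<bar> \<le> C * (case c of (Q, y, v, v', n, K) \<Rightarrow> Q) ^ E * (case c of (Q, y, v, v', n, K) \<Rightarrow> y) powr (-5/32)"
    by (rule pbE[OF pb_b_diff]) blast
  obtain C' E' where C': "C' \<ge> 0" "\<And>c. c \<in> Cf \<Longrightarrow> \<bar>b c\<bar> \<le> C' * (case c of (Q, y, v, v', n, K) \<Rightarrow> Q) ^ E' * (case c of (Q, y, v, v', n, K) \<Rightarrow> y) powr (1/16)"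
    by (rule pbE[OF pb_b]) blast
  have k: "\<kappa> = passage.\<kappa> d d' \<mu> \<mu>'" by (simp add: \<kappa>_def assms(4))
  show ?thesis
  proof (rule exI[of _ "C + C'"], rule exI[of _ "E + E'"], intro conjI allI impI)
    show "C + C' \<ge> 0" using C C' by simp
    fix Q y :: real and v v' :: "nat \<Rightarrow> real" and n K :: nat
    assume a: "Q \<ge> 1" "y \<ge> 1" "\<forall>m n. m \<le> n \<longrightarrow> \<bar>v n - v m\<bar> \<le> Q * sqrt (real (n - m)) * real n powr (real d - 15/16)"
      "\<forall>m n. m \<le> n \<longrightarrow> \<bar>v' n - v' m\<bar> \<le> Q * sqrt (real (n - m)) * real n powr (real d' - 15/16)"
      "v 0 = 0" "v' 0 = 0" "K \<ge> 1" "n = K - 1 \<or> n = K" "\<mu> * real ((K - 1) choose d) + v (K - 1) \<le> \<mu> * y ^ d / fact d"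
      "\<mu> * y ^ d / fact d \<le> \<mu> * real (K choose d) + v K"
    have c: "(Q, y, v, v', n, K) \<in> Cf" unfolding Cf_def using a by blast
    have Q: "Q ^ E \<le> Q ^ (E + E')" "Q ^ E' \<le> Q ^ (E + E')" using a(1) by (auto intro!: power_increasing)
    have "C * Q ^ E \<le> (C + C') * Q ^ (E + E')" using C(1) C'(1) Q a(1) by (intro mult_mono) auto
    hence 1: "C * Q ^ E * z powr e \<le> (C + C') * Q ^ (E + E') * z powr e" for z e by (intro mult_right_mono) auto
    have "C' * Q ^ E' \<le> (C + C') * Q ^ (E + E')" using C(1) C'(1) Q a(1) by (intro mult_mono) auto
    hence 2: "C' * Q ^ E' * z powr e \<le> (C + C') * Q ^ (E + E') * z powr e" for z e by (intro mult_right_mono) auto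
    show "\<bar>(\<mu>' * real (n choose d') + v' n - \<mu>' * y ^ d' / fact d') / y powr (real d' - 1/2) -
      (v' (nat \<lfloor>y\<rfloor>) / y powr (real d' - 1/2) - \<kappa> * (v (nat \<lfloor>y\<rfloor>) / y powr (real d - 1/2)))\<bar> \<le> (C + C') * Q ^ (E + E') * y powr (-5/32)"
      using order_trans[OF C(2)[OF c, unfolded prod.case] 1] unfolding b_def b0_def prod.case k .
    show "\<bar>(\<mu>' * real (n choose d') + v' n - \<mu>' * y ^ d' / fact d') / y powr (real d' - 1/2)\<bar> \<le> (C + C') * Q ^ (E + E') * y powr (1/16)"
      using order_trans[OF C'(2)[OF c, unfolded prod.case] 2] unfolding b_def prod.case .
  qed
qed

lemma powr_real_at_top:
  fixes a :: real
  assumes "a > 0"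
  shows "filterlim (\<lambda>x::real. x powr a) at_top at_top"
proof -
  have "filterlim (\<lambda>x::real. exp (a * ln x)) at_top at_top"
    by (rule filterlim_compose[OF exp_at_top filterlim_tendsto_pos_mult_at_top[OF tendsto_const assms ln_at_top]])
  thus ?thesis
    by (rule filterlim_mono_eventually[OF _ order_refl order_refl])
      (use eventually_gt_at_top[of 0] in \<open>eventually_elim; simp add: powr_def\<close>)
qed

lemma sqrt_mult_powr_real: "sqrt (real n) * real n powr (a - 15/16) = real n powr (a - 7/16)"
  by (cases "n = 0") (auto simp: powr_half_sqrt[symmetric] powr_add[symmetric])

context iid_seq begin

text \<open>The increment from time \<open>0\<close> with \<open>N = n\<close>, the powers of
  \<open>n\<close> divided out: the sharp order \<open>d - 1/2\<close>, free of the loss in the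
  envelope.\<close>

lemma U_moment_le:
  assumes q: "q \<ge> 1" "p = 2 * q" and k: "kern p d h" and mean: "expectation (\<lambda>\<omega>. h (tup d (\<lambda>k. k) \<omega>)) = 0"
    and d: "d \<ge> 1"
  shows "\<exists>C\<ge>0. \<forall>n. expectation (\<lambda>\<omega>. U d h n \<omega> ^ p) \<le> C * (real n powr (real d - 1/2)) ^ p"
proof -
  have p: "even p" "p > 0" using q by auto
  from U_increment_moment[OF q, of d] k mean obtain C where C: "C \<ge> 0" and
    I: "\<And>m n N. m \<le> n \<Longrightarrow> n \<le> N \<Longrightarrow>
      expectation (\<lambda>\<omega>. (U d h n \<omega> - U d h m \<omega>) ^ p) * real N ^ p \<le> C * real (n - m) ^ q * real N ^ (d * p) * kmom p d h"
    by blast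
  have U0: "U d h 0 \<omega> = 0" for \<omega> by (rule U_0_mean_zero(1)[OF k p mean])
  have km: "kmom p d h \<ge> 0" by (rule kmom_nonneg[OF p(1)])
  show ?thesis
  proof (rule exI[of _ "C * kmom p d h"], intro conjI allI)
    show "0 \<le> C * kmom p d h" using C km by simp
    fix n
    show "expectation (\<lambda>\<omega>. U d h n \<omega> ^ p) \<le> C * kmom p d h * (real n powr (real d - 1/2)) ^ p"
    proof (cases "n = 0")
      case True
      then show ?thesis using U0 p by (simp add: power_0_left)
    next
      case False
      hence n: "real n > 0" by simp
      have "(real n powr (real d - 1/2)) ^ p = real n powr (real (d * p) - real q)"
        using n by (simp add: powr_realpow[symmetric] powr_powr q(2) algebra_simps)
      also have "\<dots> = real n ^ (d * p) / real n ^ q" using n by (simp only: powr_diff powr_realpow)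
      finally have e: "(real n powr (real d - 1/2)) ^ p = real n ^ (d * p) / real n ^ q" .
      have "expectation (\<lambda>\<omega>. U d h n \<omega> ^ p) * real n ^ p \<le> C * real n ^ q * real n ^ (d * p) * kmom p d h"
        using I[of 0 n n] U0 by simp
      moreover have "real n ^ p = real n ^ q * real n ^ q" by (simp add: q(2) mult_2 power_add)
      ultimately have "expectation (\<lambda>\<omega>. U d h n \<omega> ^ p) * real n ^ q * real n ^ q \<le> C * real n ^ (d * p) * kmom p d h * real n ^ q"
        by (simp add: mult_ac)
      hence "expectation (\<lambda>\<omega>. U d h n \<omega> ^ p) * real n ^ q \<le> C * real n ^ (d * p) * kmom p d h"
        using n by (simp only: mult_le_cancel_right_pos zero_less_power)
      thus ?thesis unfolding e using n by (simp add: field_simps)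
    qed
  qed
qed

text \<open>Two errors: the normalisation at \<open>y\<close> instead of its integer part,
  controlled by the size of \<open>U\<close>, and the nonlinear remainder of
  \<open>U_linear_approx\<close>. In \<open>B\<close> they are the summands with \<open>C\<close>
  and with \<open>D\<close>.\<close>

lemma linear_approx_L1:
  assumes k: "kern 2 d h" and mean: "expectation (\<lambda>\<omega>. h (tup d (\<lambda>k. k) \<omega>)) = 0" and d: "d \<ge> 1"
  shows "((\<lambda>y. expectation (\<lambda>\<omega>. \<bar>U d h (nat \<lfloor>y\<rfloor>) \<omega> / y powr (real d - 1/2) -
      linpart d h (nat \<lfloor>y\<rfloor>) \<omega> / real (nat \<lfloor>y\<rfloor>) powr (real d - 1/2)\<bar>)) \<longlongrightarrow> 0) at_top"
proof -
  have p: "even (2::nat)" "(2::nat) > 0" by auto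
  let ?a = "real d - 1/2"
  let ?m = "\<lambda>y. real (nat \<lfloor>y\<rfloor>)"
  obtain C where C: "C \<ge> 0" "\<And>n. expectation (\<lambda>\<omega>. U d h n \<omega> ^ 2) \<le> C * (real n powr ?a) ^ 2"
    using U_moment_le[of 1 2 d h] k mean d by auto
  obtain C' where C': "C' \<ge> 0" and
    I: "\<And>n N. n \<le> N \<Longrightarrow> expectation (\<lambda>\<omega>. (U d h n \<omega> - linpart d h n \<omega>) ^ 2) * real N ^ 2 \<le> C' * real N ^ (d * 2) * kmom 2 d h"
    using U_linear_approx[of d] k mean by blast
  define D where "D = C' * kmom 2 d h"
  have D: "D \<ge> 0" using C' kmom_nonneg[OF p(1)] by (simp add: D_def)
  have lin: "expectation (\<lambda>\<omega>. (U d h n \<omega> - linpart d h n \<omega>) ^ 2) \<le> D / real n * (real n powr ?a) ^ 2" if n: "n > 0" for n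
  proof -
    have "(real n powr ?a) ^ 2 = real n powr (real (d * 2) - 1)"
      using n by (simp add: powr_realpow[symmetric] powr_powr algebra_simps)
    also have "\<dots> = real n ^ (d * 2) / real n" using n powr_realpow[of "real n" "d * 2"] by (simp only: powr_diff) simp
    finally have e: "(real n powr ?a) ^ 2 = real n ^ (d * 2) / real n" .
    show ?thesis unfolding e using I[of n n] n by (simp add: D_def field_simps power2_eq_square)
  qed
  define Z where "Z = (\<lambda>y \<omega>. U d h (nat \<lfloor>y\<rfloor>) \<omega> / y powr ?a - linpart d h (nat \<lfloor>y\<rfloor>) \<omega> / ?m y powr ?a)"
  define B where "B = (\<lambda>y. 4 * (C * ((?m y / y) powr ?a - 1) ^ 2 + D / ?m y))"
  have lU: "lp M 2 (U d h n)" and lL: "lp M 2 (linpart d h n)" for n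
    by (rule U_lp[OF k p], rule linpart_lp[OF k p])
  have lZ: "lp M 2 (Z y)" for y
    using lp_diff(1)[OF p(1) lp_cmult[OF lU, of "1 / y powr ?a"] lp_cmult[OF lL, of "1 / ?m y powr ?a"]]
    by (simp add: Z_def)
  have E2: "expectation (\<lambda>\<omega>. (Z y \<omega>)\<^sup>2) \<le> B y" if y: "y \<ge> 1" for y
  proof -
    let ?n = "nat \<lfloor>y\<rfloor>"
    have "of_int 1 \<le> y" using y by simp
    hence "1 \<le> \<lfloor>y\<rfloor>" by (simp only: le_floor_iff)
    hence n: "?n > 0" by linarith
    have "real ?n \<noteq> 0" using n by (simp only: of_nat_eq_0_iff)
    hence np: "real ?n powr ?a > 0" by (rule powr_gt_zero[THEN iffD2])
    have yp: "y powr ?a > 0" using y by simp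
    have r: "(real ?n / y) powr ?a = real ?n powr ?a / y powr ?a" using y by (simp add: powr_divide)
    define w where "w = 1 / y powr ?a - 1 / real ?n powr ?a"
    have wn: "w * real ?n powr ?a = (real ?n / y) powr ?a - 1"
    proof -
      have "(1 / b - 1 / c) * c = c / b - 1" if "c \<noteq> 0" for b c :: real
        using that by (simp add: left_diff_distrib)
      thus ?thesis unfolding w_def r using less_imp_neq[OF np] by metis
    qed
    have e: "Z y \<omega> = w * U d h ?n \<omega> + (1 / real ?n powr ?a) * (U d h ?n \<omega> - linpart d h ?n \<omega>)" for \<omega>
      by (simp add: Z_def w_def algebra_simps)
    have l1: "lp M 2 (\<lambda>\<omega>. w * U d h ?n \<omega>)" by (intro lp_cmult lU)
    have l2: "lp M 2 (\<lambda>\<omega>. (1 / real ?n powr ?a) * (U d h ?n \<omega> - linpart d h ?n \<omega>))"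
      by (intro lp_cmult lp_diff(1) lU lL p)
    have "expectation (\<lambda>\<omega>. (Z y \<omega>)\<^sup>2) \<le> 2 ^ 2 * (expectation (\<lambda>\<omega>. (w * U d h ?n \<omega>)\<^sup>2) +
        expectation (\<lambda>\<omega>. ((1 / real ?n powr ?a) * (U d h ?n \<omega> - linpart d h ?n \<omega>))\<^sup>2))"
      unfolding e by (rule lp_add(2)[OF p(1) l1 l2])
    also have "expectation (\<lambda>\<omega>. (w * U d h ?n \<omega>)\<^sup>2) = w\<^sup>2 * expectation (\<lambda>\<omega>. (U d h ?n \<omega>)\<^sup>2)"
      by (simp add: power_mult_distrib)
    also have "expectation (\<lambda>\<omega>. ((1 / real ?n powr ?a) * (U d h ?n \<omega> - linpart d h ?n \<omega>))\<^sup>2) =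
        (1 / real ?n powr ?a)\<^sup>2 * expectation (\<lambda>\<omega>. (U d h ?n \<omega> - linpart d h ?n \<omega>)\<^sup>2)"
      unfolding power_mult_distrib by simp
    also have "2 ^ 2 * (w\<^sup>2 * expectation (\<lambda>\<omega>. (U d h ?n \<omega>)\<^sup>2) + (1 / real ?n powr ?a)\<^sup>2 * expectation (\<lambda>\<omega>. (U d h ?n \<omega> - linpart d h ?n \<omega>)\<^sup>2)) \<le>
       2 ^ 2 * (w\<^sup>2 * (C * (real ?n powr ?a) ^ 2) + (1 / real ?n powr ?a)\<^sup>2 * (D / real ?n * (real ?n powr ?a) ^ 2))"
      using C(2)[of ?n] lin[OF n] by (intro mult_left_mono add_mono) auto
    also have "w\<^sup>2 * (C * (real ?n powr ?a) ^ 2) = C * ((real ?n / y) powr ?a - 1)\<^sup>2"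
      unfolding wn[symmetric] by (simp add: power_mult_distrib)
    also have "(1 / real ?n powr ?a)\<^sup>2 * (D / real ?n * (real ?n powr ?a) ^ 2) = D / real ?n"
    proof -
      have "(1 / c)\<^sup>2 * (a * c\<^sup>2) = a" if "c \<noteq> 0" for a c :: real
        using that by (simp add: power_divide)
      thus ?thesis using less_imp_neq[OF np] by metis
    qed
    finally show ?thesis by (simp add: B_def)
  qed
  have mlim: "((\<lambda>y. ?m y / y) \<longlongrightarrow> 1) at_top"
  proof (rule tendsto_sandwich[where f="\<lambda>y. 1 - 1 / y" and h="\<lambda>_. 1"])
    show "\<forall>\<^sub>F y::real in at_top. 1 - 1 / y \<le> ?m y / y"
      using eventually_ge_at_top[of 1]
    proof eventually_elim
      case (elim y)
      have "y - 1 \<le> ?m y" using elim by linarith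
      hence "(y - 1) / y \<le> ?m y / y" using elim by (intro divide_right_mono) auto
      thus ?case using elim by (simp add: diff_divide_distrib)
    qed
    show "\<forall>\<^sub>F y::real in at_top. ?m y / y \<le> 1"
      using eventually_ge_at_top[of 1]
    proof eventually_elim
      case (elim y)
      have "?m y \<le> y" using elim by (intro of_nat_floor) auto
      thus ?case using elim by simp
    qed
    have "((\<lambda>y::real. 1 / y) \<longlongrightarrow> 0) at_top"
      by (intro tendsto_divide_0[OF tendsto_const] filterlim_at_top_imp_at_infinity filterlim_ident)
    from tendsto_diff[OF tendsto_const[of 1] this] show "((\<lambda>y::real. 1 - 1 / y) \<longlongrightarrow> 1) at_top" by simp
  qed simp
  have shift: "filterlim (\<lambda>y::real. -1 + y) at_top at_top"
    by (rule filterlim_tendsto_add_at_top[OF tendsto_const filterlim_ident])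
  have minf: "filterlim (\<lambda>y::real. ?m y) at_top at_top"
  proof (rule filterlim_at_top_mono[OF shift])
    show "\<forall>\<^sub>F y in at_top. -1 + y \<le> ?m y"
      using eventually_ge_at_top[of "0::real"] by eventually_elim linarith
  qed
  have "(B \<longlongrightarrow> 4 * (C * (1 powr ?a - 1) ^ 2 + 0)) at_top"
    unfolding B_def
    by (intro tendsto_intros mlim tendsto_divide_0[OF tendsto_const] filterlim_at_top_imp_at_infinity minf) auto
  hence B0: "((\<lambda>y. sqrt (B y)) \<longlongrightarrow> 0) at_top" using tendsto_real_sqrt[of B 0] by simp
  have le: "expectation (\<lambda>\<omega>. \<bar>Z y \<omega>\<bar>) \<le> sqrt (B y)" if "y \<ge> 1" for y
  proof (rule real_le_rsqrt)
    have "lp M 2 (\<lambda>\<omega>. \<bar>Z y \<omega>\<bar>)" using lZ[of y] by (auto simp: lp_def)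
    from expectation_power_le[OF p this] show "(expectation (\<lambda>\<omega>. \<bar>Z y \<omega>\<bar>))\<^sup>2 \<le> B y"
      using E2[OF that] by simp
  qed
  have "((\<lambda>y. expectation (\<lambda>\<omega>. \<bar>Z y \<omega>\<bar>)) \<longlongrightarrow> 0) at_top"
  proof (rule tendsto_sandwich[OF _ _ tendsto_const B0])
    show "\<forall>\<^sub>F y in at_top. expectation (\<lambda>\<omega>. \<bar>Z y \<omega>\<bar>) \<le> sqrt (B y)"
      using eventually_ge_at_top[of 1] by eventually_elim (rule le)
  qed (auto intro!: always_eventually integral_nonneg_AE)
  thus ?thesis by (simp add: Z_def)
qed

end

section \<open>Limits of the coefficients of the linear part\<close>

lemma binomial_scaled_limit:
  fixes k :: "nat \<Rightarrow> nat"
  assumes l: "(\<lambda>m. real (k m) / real m) \<longlonglongrightarrow> s" and k: "\<And>m. k m \<le> m"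
  shows "(\<lambda>m. real (k m choose a) / real m ^ a) \<longlonglongrightarrow> s ^ a / fact a"
proof (cases "a = 0")
  case False
  obtain C where C: "C \<ge> 0" "\<And>n. \<bar>real (n choose a) - real n ^ a / fact a\<bar> \<le> C * real n ^ (a - 1)"
    using binomial_power_bound[of a] False by auto
  have "(\<lambda>m. real (k m choose a) / real m ^ a - (real (k m) / real m) ^ a / fact a) \<longlonglongrightarrow> 0"
  proof (rule Lim_null_comparison)
    show "\<forall>\<^sub>F m in sequentially. norm (real (k m choose a) / real m ^ a - (real (k m) / real m) ^ a / fact a) \<le> C * (1 / real m)"
      using eventually_gt_at_top[of 0]
    proof eventually_elim
      case (elim m)
      have "real (k m choose a) / real m ^ a - (real (k m) / real m) ^ a / fact a = (real (k m choose a) - real (k m) ^ a / fact a) / real m ^ a"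
        by (simp add: power_divide diff_divide_distrib)
      also have "norm \<dots> \<le> C * real (k m) ^ (a - 1) / real m ^ a"
        using C(2)[of "k m"] by (simp add: divide_right_mono)
      also have "\<dots> \<le> C * real m ^ (a - 1) / real m ^ a"
        using k[of m] C(1) by (intro divide_right_mono mult_left_mono power_mono) auto
      also have "\<dots> = C * (1 / real m)" using False power_minus_mult[of a "real m", symmetric] elim by simp
      finally show ?case .
    qed
    show "(\<lambda>m. C * (1 / real m)) \<longlonglongrightarrow> 0" using tendsto_mult[OF tendsto_const lim_1_over_n] by simp
  qed
  moreover have "(\<lambda>m. (real (k m) / real m) ^ a / fact a) \<longlonglongrightarrow> s ^ a / fact a"
    by (intro tendsto_intros l) simp
  ultimately have "(\<lambda>m. (real (k m choose a) / real m ^ a - (real (k m) / real m) ^ a / fact a) + (real (k m) / real m) ^ a / fact a) \<longlonglongrightarrow> 0 + s ^ a / fact a"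
    by (rule tendsto_add)
  thus ?thesis by simp
qed simp

definition lin_coeff :: "nat \<Rightarrow> nat \<Rightarrow> nat \<Rightarrow> nat \<Rightarrow> real" where
  "lin_coeff d j m k = real (k choose (j - 1)) * real ((m - 1 - k) choose (d - j)) / real m powr (real d - 1/2)"

lemma binomial_le_power: "(n choose k) \<le> n ^ k"
  using card_idx_le[of k n] by (simp add: card_idx)

lemma lin_coeff_scaled:
  assumes "j \<in> {1..d}" "m > 0"
  shows "sqrt (real m) * lin_coeff d j m k = (real (k choose (j - 1)) / real m ^ (j - 1)) * (real ((m - 1 - k) choose (d - j)) / real m ^ (d - j))"
proof -
  have "real m powr (real d - 1/2) = real m powr (real (d - 1)) * real m powr (1/2)"
    using assms by (simp add: powr_add[symmetric] of_nat_diff)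
  also have "real m powr (real (d - 1)) = real m ^ (j - 1) * real m ^ (d - j)"
    using assms powr_realpow[of "real m" "d - 1"] power_add[of "real m" "j - 1" "d - j"] by simp
  finally have "real m powr (real d - 1/2) = real m ^ (j - 1) * real m ^ (d - j) * sqrt (real m)"
    using assms(2) by (simp add: powr_half_sqrt)
  thus ?thesis using assms(2) by (simp add: lin_coeff_def)
qed

lemma lin_coeff_bound:
  assumes j: "j \<in> {1..d}" and k: "k < m"
  shows "\<bar>lin_coeff d j m k\<bar> \<le> 1 / sqrt (real m)"
proof -
  have m: "m > 0" using k by simp
  have "real (k choose (j - 1)) \<le> real m ^ (j - 1)"
  proof -
    have "k choose (j - 1) \<le> m ^ (j - 1)"
      by (rule le_trans[OF binomial_le_power power_mono]) (use k in auto)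
    thus ?thesis by (metis of_nat_le_iff of_nat_power)
  qed
  moreover have "real ((m - 1 - k) choose (d - j)) \<le> real m ^ (d - j)"
  proof -
    have "(m - 1 - k) choose (d - j) \<le> m ^ (d - j)"
      by (rule le_trans[OF binomial_le_power power_mono]) auto
    thus ?thesis by (metis of_nat_le_iff of_nat_power)
  qed
  ultimately have "(real (k choose (j - 1)) / real m ^ (j - 1)) * (real ((m - 1 - k) choose (d - j)) / real m ^ (d - j)) \<le> 1 * 1"
    using m by (intro mult_mono) auto
  hence "sqrt (real m) * lin_coeff d j m k \<le> 1" using lin_coeff_scaled[OF j m] by simp
  moreover have "lin_coeff d j m k \<ge> 0" by (simp add: lin_coeff_def)
  ultimately show ?thesis using m by (simp add: field_simps)
qed

text \<open>The origin of \<open>psi\<close>: with \<open>k / m\<close> near \<open>s\<close>, the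
  numbers of indices below and above \<open>k\<close> become powers of \<open>s\<close> and
  \<open>1 - s\<close>, and the factorials are those of the binomial coefficients.\<close>

lemma lin_coeff_limit:
  assumes j: "j \<in> {1..d}" and s: "0 < s" "s < 1"
  shows "(\<lambda>m. sqrt (real m) * lin_coeff d j m (nat \<lfloor>real m * s\<rfloor>)) \<longlonglongrightarrow> psi j d s 1"
proof -
  let ?k = "\<lambda>m. nat \<lfloor>real m * s\<rfloor>"
  have kle: "real (?k m) \<le> real m * s" "real m * s - 1 \<le> real (?k m)" for m
    using s by (auto intro!: of_nat_floor)
  have km: "?k m \<le> m" for m
  proof -
    have "real m * s \<le> real m" using s by (simp add: mult_left_le)
    hence "real (?k m) \<le> real m" using kle(1)[of m] by linarith
    thus ?thesis by simp
  qed
  have km2: "?k m < m" if "m > 0" for m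
  proof -
    have "real m * s < real m" using s that by simp
    hence "real (?k m) < real m" using kle(1)[of m] by linarith
    thus ?thesis by simp
  qed
  have inv: "(\<lambda>m. s - 1 / real m) \<longlonglongrightarrow> s"
    using tendsto_diff[OF tendsto_const[of s] lim_1_over_n] by simp
  have l1: "(\<lambda>m. real (?k m) / real m) \<longlonglongrightarrow> s"
  proof (rule tendsto_sandwich[OF _ _ inv tendsto_const])
    show "\<forall>\<^sub>F m in sequentially. s - 1 / real m \<le> real (?k m) / real m"
      using eventually_gt_at_top[of 0]
    proof eventually_elim
      case (elim m)
      have "(real m * s - 1) / real m \<le> real (?k m) / real m" using kle(2) by (intro divide_right_mono) auto
      thus ?case using elim by (simp add: diff_divide_distrib)
    qed
    show "\<forall>\<^sub>F m in sequentially. real (?k m) / real m \<le> s"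
      using eventually_gt_at_top[of 0]
      by eventually_elim (use kle(1) in \<open>simp add: pos_divide_le_eq mult.commute\<close>)
  qed
  have l2: "(\<lambda>m. real (m - 1 - ?k m) / real m) \<longlonglongrightarrow> 1 - s"
  proof (rule Lim_transform_eventually)
    show "(\<lambda>m. 1 - 1 / real m - real (?k m) / real m) \<longlonglongrightarrow> 1 - s"
      using tendsto_diff[OF tendsto_diff[OF tendsto_const[of 1] lim_1_over_n] l1] by simp
    show "\<forall>\<^sub>F m in sequentially. 1 - 1 / real m - real (?k m) / real m = real (m - 1 - ?k m) / real m"
      using eventually_gt_at_top[of 0]
    proof eventually_elim
      case (elim m)
      have "real (m - 1 - ?k m) = real m - 1 - real (?k m)" using km2[OF elim] by (simp add: of_nat_diff)
      thus ?case using elim by (simp add: diff_divide_distrib)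
    qed
  qed
  have "(\<lambda>m. (real (?k m choose (j - 1)) / real m ^ (j - 1)) * (real ((m - 1 - ?k m) choose (d - j)) / real m ^ (d - j)))
      \<longlonglongrightarrow> (s ^ (j - 1) / fact (j - 1)) * ((1 - s) ^ (d - j) / fact (d - j))"
    by (intro tendsto_mult binomial_scaled_limit l1 l2 km) simp
  moreover have "(s ^ (j - 1) / fact (j - 1)) * ((1 - s) ^ (d - j) / fact (d - j)) = psi j d s 1"
    by (simp add: psi_def)
  ultimately have "(\<lambda>m. (real (?k m choose (j - 1)) / real m ^ (j - 1)) * (real ((m - 1 - ?k m) choose (d - j)) / real m ^ (d - j))) \<longlonglongrightarrow> psi j d s 1" by simp
  thus ?thesis
    by (rule Lim_transform_eventually)
      (use eventually_gt_at_top[of 0] in \<open>eventually_elim; simp add: lin_coeff_scaled[OF j]\<close>)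
qed

section \<open>The stopped statistic: pathwise bounds, moments and limits\<close>

locale two_kernels = iid_seq M S X for M :: "'a measure" and S :: "'s measure" and X :: "nat \<Rightarrow> 'a \<Rightarrow> 's" +
  fixes d d' :: nat and f f' :: "(nat \<Rightarrow> 's) \<Rightarrow> real" and \<mu> \<mu>' :: real
  assumes d: "d \<ge> 1" and d': "d' \<ge> 1" and \<mu>_pos: "\<mu> > 0"
    and kf: "\<And>p. even p \<Longrightarrow> p > 0 \<Longrightarrow> kern p d f"
    and kf': "\<And>p. even p \<Longrightarrow> p > 0 \<Longrightarrow> kern p d' f'"
    and mu: "expectation (\<lambda>\<omega>. f (tup d (\<lambda>k. k) \<omega>)) = \<mu>"
    and mu': "expectation (\<lambda>\<omega>. f' (tup d' (\<lambda>k. k) \<omega>)) = \<mu>'"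
begin

definition fc where "fc w = f w - \<mu>"
definition fc' where "fc' w = f' w - \<mu>'"

lemma kern_const: "kern p e (\<lambda>_. c)"
  by (simp add: kern_def)

lemma kern_fc: "even p \<Longrightarrow> p > 0 \<Longrightarrow> kern p d fc"
  unfolding fc_def[abs_def] by (intro kern_diff(1) kf kern_const)

lemma kern_fc': "even p \<Longrightarrow> p > 0 \<Longrightarrow> kern p d' fc'"
  unfolding fc'_def[abs_def] by (intro kern_diff(1) kf' kern_const)

lemma mean_fc: "expectation (\<lambda>\<omega>. fc (tup d (\<lambda>k. k) \<omega>)) = 0"
  using kern_integrable[OF kf[of 2]] mu by (simp add: fc_def prob_space)

lemma mean_fc': "expectation (\<lambda>\<omega>. fc' (tup d' (\<lambda>k. k) \<omega>)) = 0"
  using kern_integrable[OF kf'[of 2]] mu' by (simp add: fc'_def prob_space)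

abbreviation v where "v n \<omega> \<equiv> U d fc n \<omega>"
abbreviation v' where "v' n \<omega> \<equiv> U d' fc' n \<omega>"

lemma U_eq: "U d f n \<omega> = \<mu> * real (n choose d) + v n \<omega>"
  by (simp add: U_tup fc_def sum_subtractf card_idx)

lemma U_eq': "U d' f' n \<omega> = \<mu>' * real (n choose d') + v' n \<omega>"
  by (simp add: U_tup fc'_def sum_subtractf card_idx)

lemma v_0: "v 0 \<omega> = 0" "v' 0 \<omega> = 0"
  using U_0_mean_zero(1)[OF kern_fc[of 2] _ _ mean_fc] U_0_mean_zero(1)[OF kern_fc'[of 2] _ _ mean_fc'] by auto

lemma U_measurable [measurable]: "U d f n \<in> borel_measurable M" "U d' f' n \<in> borel_measurable M"
  using U_lp(1)[OF kf[of 2], of n] U_lp(1)[OF kf'[of 2], of n] by (auto simp: lp_def)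

text \<open>Here \<open>Q\<close> is a number, so that the condition concerns a single path; the
  random envelope is inserted afterwards.\<close>

definition regular :: "real \<Rightarrow> 'a \<Rightarrow> bool" where
  "regular Q \<omega> \<longleftrightarrow> Q \<ge> 1 \<and>
    (\<forall>m n. m \<le> n \<longrightarrow> \<bar>v n \<omega> - v m \<omega>\<bar> \<le> Q * sqrt (real (n - m)) * real n powr (real d - 15/16)) \<and>
    (\<forall>m n. m \<le> n \<longrightarrow> \<bar>v' n \<omega> - v' m \<omega>\<bar> \<le> Q * sqrt (real (n - m)) * real n powr (real d' - 15/16))"

lemma regular_envelope:
  assumes r: "r \<ge> 3"
  shows "\<exists>Q. Q \<in> borel_measurable M \<and> (\<forall>\<omega>. Q \<omega> \<ge> 1) \<and> integrable M (\<lambda>\<omega>. Q \<omega> ^ (16 * r)) \<and> (AE \<omega> in M. regular (Q \<omega>) \<omega>)"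
proof -
  from U_envelope[OF kern_fc mean_fc d r] obtain Q1 where Q1: "Q1 \<in> borel_measurable M" "\<And>\<omega>. Q1 \<omega> \<ge> 0" "integrable M (\<lambda>\<omega>. Q1 \<omega> ^ (16 * r))"
    "AE \<omega> in M. \<forall>m n. m \<le> n \<longrightarrow> \<bar>v n \<omega> - v m \<omega>\<bar> \<le> Q1 \<omega> * sqrt (real (n - m)) * real n powr (real d - 15/16)" by blast
  from U_envelope[OF kern_fc' mean_fc' d' r] obtain Q2 where Q2: "Q2 \<in> borel_measurable M" "\<And>\<omega>. Q2 \<omega> \<ge> 0" "integrable M (\<lambda>\<omega>. Q2 \<omega> ^ (16 * r))"
    "AE \<omega> in M. \<forall>m n. m \<le> n \<longrightarrow> \<bar>v' n \<omega> - v' m \<omega>\<bar> \<le> Q2 \<omega> * sqrt (real (n - m)) * real n powr (real d' - 15/16)" by blast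
  define Q where "Q = (\<lambda>\<omega>. 1 + (Q1 \<omega> + Q2 \<omega>))"
  have ge: "Q \<omega> \<ge> 1" "Q1 \<omega> \<le> Q \<omega>" "Q2 \<omega> \<le> Q \<omega>" for \<omega> using Q1(2) Q2(2) by (auto simp: Q_def intro: add_increasing2)
  have "lp M (16 * r) Q"
    unfolding Q_def using Q1 Q2 by (intro lp_add(1) lp_const lpI) auto
  hence "Q \<in> borel_measurable M" "integrable M (\<lambda>\<omega>. Q \<omega> ^ (16 * r))" by (auto simp: lp_def)
  moreover have "AE \<omega> in M. regular (Q \<omega>) \<omega>"
    using Q1(4) Q2(4)
  proof eventually_elim
    case (elim \<omega>)
    have "Q1 \<omega> * sqrt (real (n - m)) * real n powr a \<le> Q \<omega> * sqrt (real (n - m)) * real n powr a"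
      "Q2 \<omega> * sqrt (real (n - m)) * real n powr a \<le> Q \<omega> * sqrt (real (n - m)) * real n powr a" for n m :: nat and a
      using ge by (intro mult_right_mono; simp)+
    thus ?case using elim ge(1) unfolding regular_def by (meson order_trans)
  qed
  ultimately show ?thesis using ge(1) by (intro exI[of _ Q]) auto
qed

text \<open>The drift of order \<open>d\<close> beats fluctuations of order \<open>d - 7/16\<close>.
  On such paths both passage times are finite, so the value that \<open>stopped\<close> takes at
  infinity does not enter the pathwise bounds.\<close>

lemma regular_U_at_top:
  assumes R: "regular Q \<omega>"
  shows "filterlim (\<lambda>n. U d f n \<omega>) at_top sequentially"
proof -
  obtain C where C: "C \<ge> 0" "\<And>n. \<bar>real (n choose d) - real n ^ d / fact d\<bar> \<le> C * real n ^ (d - 1)"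
    using binomial_power_bound[OF d] by blast
  have vb: "\<bar>v n \<omega>\<bar> \<le> Q * real n powr (real d - 7/16)" for n
  proof -
    have "\<bar>v n \<omega> - v 0 \<omega>\<bar> \<le> Q * sqrt (real (n - 0)) * real n powr (real d - 15/16)"
      using R unfolding regular_def by blast
    thus ?thesis using sqrt_mult_powr_real[of n "real d"] by (simp add: v_0 mult.assoc)
  qed
  define B where "B = \<mu> * C + Q"
  have low: "U d f n \<omega> \<ge> real n powr (real d - 7/16) * (\<mu> / fact d * real n powr (7/16) - B)" if n: "n \<ge> 1" for n
  proof -
    have "real n ^ (d - 1) = real n powr (real d - 1)"
      using n d powr_realpow[of "real n" "d - 1"] by (simp add: of_nat_diff)
    also have "\<dots> \<le> real n powr (real d - 7/16)" using n by (intro powr_mono) auto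
    finally have 1: "real n ^ (d - 1) \<le> real n powr (real d - 7/16)" .
    have 2: "real n ^ d = real n powr (real d - 7/16) * real n powr (7/16)"
      using n by (simp add: powr_add[symmetric] powr_realpow)
    have "real (n choose d) \<ge> real n ^ d / fact d - C * real n ^ (d - 1)" using C(2)[of n] by (simp add: abs_le_iff)
    hence "real (n choose d) \<ge> real n ^ d / fact d - C * real n powr (real d - 7/16)"
      using mult_left_mono[OF 1 C(1)] by linarith
    hence "\<mu> * real (n choose d) \<ge> \<mu> * (real n ^ d / fact d - C * real n powr (real d - 7/16))"
      using \<mu>_pos by (intro mult_left_mono) auto
    moreover have "v n \<omega> \<ge> - (Q * real n powr (real d - 7/16))" using vb[of n] by (simp add: abs_le_iff)
    moreover have "real n powr (real d - 7/16) * (\<mu> / fact d * real n powr (7/16) - B) =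
        \<mu> * (real n ^ d / fact d - C * real n powr (real d - 7/16)) - Q * real n powr (real d - 7/16)"
      unfolding 2 B_def by (simp add: algebra_simps)
    ultimately show ?thesis unfolding U_eq by linarith
  qed
  have lim1: "filterlim (\<lambda>n. \<mu> / fact d * real n powr (7/16) - B) at_top sequentially"
  proof -
    have "filterlim (\<lambda>n. \<mu> / fact d * real n powr (7/16)) at_top sequentially"
      by (rule filterlim_tendsto_pos_mult_at_top[OF tendsto_const])
        (use \<mu>_pos in \<open>auto intro!: filterlim_compose[OF powr_real_at_top filterlim_real_sequentially]\<close>)
    from filterlim_tendsto_add_at_top[OF tendsto_const[of "- B"] this] show ?thesis by simp
  qed
  have ev: "\<forall>\<^sub>F n in sequentially. 1 \<le> \<mu> / fact d * real n powr (7/16) - B"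
    using filterlim_at_top[THEN iffD1, OF lim1] by blast
  show ?thesis
  proof (rule filterlim_at_top_mono)
    show "filterlim (\<lambda>n. real n powr (9/16)) at_top sequentially"
      by (rule filterlim_compose[OF powr_real_at_top filterlim_real_sequentially]) simp
    show "\<forall>\<^sub>F n in sequentially. real n powr (9/16) \<le> U d f n \<omega>"
      using ev eventually_ge_at_top[of 1]
    proof eventually_elim
      case (elim n)
      have "real n powr (9/16) \<le> real n powr (real d - 7/16)" using elim(2) d by (intro powr_mono) auto
      also have "\<dots> \<le> real n powr (real d - 7/16) * (\<mu> / fact d * real n powr (7/16) - B)"
        using elim(1) by (simp add: mult_le_cancel_left1)
      finally show ?case using low[OF elim(2)] by linarith
    qed
  qed
qed

text \<open>The \<open>y\<close> of the deterministic expansion, as a function of the level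
  \<open>x\<close>.\<close>

definition scale :: "real \<Rightarrow> real" where "scale x = (fact d * x / \<mu>) powr (1 / real d)"

lemma scale_pow: "x > 0 \<Longrightarrow> \<mu> * scale x ^ d / fact d = x"
  using d \<mu>_pos by (simp add: scale_def powr_realpow[symmetric] powr_powr)

lemma scale_pos: "x > 0 \<Longrightarrow> scale x > 0"
  using \<mu>_pos by (simp add: scale_def)

lemma scale_ge_1: "x \<ge> \<mu> / fact d \<Longrightarrow> scale x \<ge> 1"
  using \<mu>_pos by (auto simp: scale_def field_simps intro!: ge_one_powr_ge_zero)

lemma scale_at_top: "filterlim scale at_top at_top"
proof -
  have "filterlim (\<lambda>x. fact d / \<mu> * x) at_top at_top"
    using \<mu>_pos by (intro filterlim_tendsto_pos_mult_at_top[OF tendsto_const]) (auto intro: filterlim_ident)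
  from filterlim_compose[OF powr_real_at_top[of "1 / real d"] this]
  show ?thesis using d by (simp add: scale_def[abs_def])
qed

abbreviation "m x \<equiv> nat \<lfloor>scale x\<rfloor>"

definition \<kappa> where "\<kappa> = fact (d - 1) * \<mu>' / (fact (d' - 1) * \<mu>)"

definition bN :: "(real \<Rightarrow> 'a \<Rightarrow> enat) \<Rightarrow> real \<Rightarrow> 'a \<Rightarrow> real" where
  "bN N x \<omega> = (stopped (U d' f') (N x) \<omega> - \<mu>' * scale x ^ d' / fact d') / scale x powr (real d' - 1/2)"

definition b0 :: "real \<Rightarrow> 'a \<Rightarrow> real" where
  "b0 x \<omega> = v' (m x) \<omega> / scale x powr (real d' - 1/2) - \<kappa> * (v (m x) \<omega> / scale x powr (real d - 1/2))"

abbreviation "passages \<equiv> {N_minus (U d f), N_plus (U d f)}"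

lemma pathwise_bound:
  "\<exists>C E. C \<ge> 0 \<and> (\<forall>N\<in>passages. \<forall>Q \<omega> x. regular Q \<omega> \<longrightarrow> x > 0 \<longrightarrow> x \<ge> \<mu> / fact d \<longrightarrow>
     \<bar>bN N x \<omega> - b0 x \<omega>\<bar> \<le> C * Q ^ E * scale x powr (-5/32) \<and> \<bar>bN N x \<omega>\<bar> \<le> C * Q ^ E * scale x powr (1/16))"
proof -
  from passage_expansion[OF d d' \<mu>_pos, of \<mu>', folded \<kappa>_def]
  obtain C E where C: "C \<ge> 0" and *: "\<And>Q y w w' n K. Q \<ge> 1 \<Longrightarrow> y \<ge> 1 \<Longrightarrow>
    (\<forall>m n. m \<le> n \<longrightarrow> \<bar>w n - w m\<bar> \<le> Q * sqrt (real (n - m)) * real n powr (real d - 15/16)) \<Longrightarrow>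
    (\<forall>m n. m \<le> n \<longrightarrow> \<bar>w' n - w' m\<bar> \<le> Q * sqrt (real (n - m)) * real n powr (real d' - 15/16)) \<Longrightarrow>
    w 0 = 0 \<Longrightarrow> w' 0 = 0 \<Longrightarrow> K \<ge> 1 \<Longrightarrow> n = K - 1 \<or> n = K \<Longrightarrow>
    \<mu> * real ((K - 1) choose d) + w (K - 1) \<le> \<mu> * y ^ d / fact d \<Longrightarrow>
    \<mu> * y ^ d / fact d \<le> \<mu> * real (K choose d) + w K \<Longrightarrow>
    \<bar>(\<mu>' * real (n choose d') + w' n - \<mu>' * y ^ d' / fact d') / y powr (real d' - 1/2) -
      (w' (nat \<lfloor>y\<rfloor>) / y powr (real d' - 1/2) - \<kappa> * (w (nat \<lfloor>y\<rfloor>) / y powr (real d - 1/2)))\<bar> \<le> C * Q ^ E * y powr (-5/32) \<and>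
    \<bar>(\<mu>' * real (n choose d') + w' n - \<mu>' * y ^ d' / fact d') / y powr (real d' - 1/2)\<bar> \<le> C * Q ^ E * y powr (1/16)"
    by metis
  show ?thesis
  proof (rule exI[of _ C], rule exI[of _ E], rule conjI[OF C], intro ballI allI impI)
    fix N Q \<omega> x
    assume N: "N \<in> passages" and R: "regular Q \<omega>" and x: "x > 0" "x \<ge> \<mu> / fact d"
    have U0: "U d f 0 \<omega> = 0" using d by (simp add: U_eq v_0 binomial_eq_0)
    from passage_times[of "U d f" \<omega> x N, OF U0 regular_U_at_top[OF R] _ N] x
    obtain n K where nK: "N x \<omega> = enat n" "K \<ge> 1" "n = K - 1 \<or> n = K" "U d f (K - 1) \<omega> \<le> x" "x \<le> U d f K \<omega>" by auto
    have st: "stopped (U d' f') (N x) \<omega> = \<mu>' * real (n choose d') + v' n \<omega>"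
      by (simp add: stopped_def nK(1) U_eq')
    have R': "Q \<ge> 1" "\<forall>m n. m \<le> n \<longrightarrow> \<bar>v n \<omega> - v m \<omega>\<bar> \<le> Q * sqrt (real (n - m)) * real n powr (real d - 15/16)"
      "\<forall>m n. m \<le> n \<longrightarrow> \<bar>v' n \<omega> - v' m \<omega>\<bar> \<le> Q * sqrt (real (n - m)) * real n powr (real d' - 15/16)"
      using R unfolding regular_def by blast+
    show "\<bar>bN N x \<omega> - b0 x \<omega>\<bar> \<le> C * Q ^ E * scale x powr (-5/32) \<and> \<bar>bN N x \<omega>\<bar> \<le> C * Q ^ E * scale x powr (1/16)"
      unfolding bN_def b0_def st
    proof (rule *[of Q "scale x" "\<lambda>n. v n \<omega>" "\<lambda>n. v' n \<omega>"])
      show "\<mu> * real ((K - 1) choose d) + v (K - 1) \<omega> \<le> \<mu> * scale x ^ d / fact d"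
        "\<mu> * scale x ^ d / fact d \<le> \<mu> * real (K choose d) + v K \<omega>"
        using nK(4,5) unfolding U_eq scale_pow[OF x(1)] .
    qed (use R' nK v_0 scale_ge_1[OF x(2)] in \<open>simp_all only:\<close>)
  qed
qed

lemma bN_measurable: "N \<in> passages \<Longrightarrow> bN N x \<in> borel_measurable M"
proof -
  assume "N \<in> passages"
  hence "N x \<in> measurable M (count_space UNIV)" by auto
  from stopped_measurable[OF U_measurable(2) this] have [measurable]: "stopped (U d' f') (N x) \<in> borel_measurable M" .
  show ?thesis unfolding bN_def[abs_def] by measurable
qed

lemma b0_lp: "even p \<Longrightarrow> p > 0 \<Longrightarrow> lp M p (b0 x)"
  using lp_diff(1)[of p M, OF _ lp_cmult[OF U_lp(1)[OF kern_fc'], of p "1 / scale x powr (real d' - 1/2)" "m x"]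
      lp_cmult[OF lp_cmult[OF U_lp(1)[OF kern_fc], of p "1 / scale x powr (real d - 1/2)" "m x"], of \<kappa>]]
  by (simp add: b0_def[abs_def])

abbreviation "x0 \<equiv> \<mu> / fact d"

lemma x0_pos: "x0 > 0" using \<mu>_pos by simp

text \<open>The pathwise bound by a power of \<open>Q\<close> becomes a moment bound. For each
  \<open>s\<close> a new envelope is taken, with enough moments for the exponent
  \<open>E * s\<close>; this is legitimate because \<open>C\<close> and \<open>E\<close> do not
  depend on the envelope.\<close>

lemma bN_b0_moment:
  assumes s: "even s" "s > 0" and N: "N \<in> passages"
  shows "\<exists>C\<ge>0. \<forall>x\<ge>x0. lp M s (\<lambda>\<omega>. bN N x \<omega> - b0 x \<omega>) \<and>
     expectation (\<lambda>\<omega>. (bN N x \<omega> - b0 x \<omega>) ^ s) \<le> C * (scale x powr (-5/32)) ^ s"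
proof -
  obtain C E where C: "C \<ge> 0" and pb: "\<And>Q \<omega> x. regular Q \<omega> \<Longrightarrow> x > 0 \<Longrightarrow> x \<ge> x0 \<Longrightarrow> \<bar>bN N x \<omega> - b0 x \<omega>\<bar> \<le> C * Q ^ E * scale x powr (-5/32)"
    using pathwise_bound N by blast
  define r where "r = max 3 (E * s)"
  have r: "r \<ge> 3" "E * s \<le> 16 * r" by (auto simp: r_def)
  from regular_envelope[OF r(1)] obtain Q where Q: "Q \<in> borel_measurable M" "\<And>\<omega>. Q \<omega> \<ge> 1" "integrable M (\<lambda>\<omega>. Q \<omega> ^ (16 * r))" "AE \<omega> in M. regular (Q \<omega>) \<omega>" by blast
  define D where "D = C ^ s * expectation (\<lambda>\<omega>. Q \<omega> ^ (16 * r))"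
  have D: "D \<ge> 0" unfolding D_def using C by (intro mult_nonneg_nonneg integral_nonneg_AE) (auto simp: zero_le_even_power)
  show ?thesis
  proof (rule exI[of _ D], intro conjI allI impI D)
    fix x assume x: "x \<ge> x0"
    have xp: "x > 0" using x x0_pos by linarith
    let ?Z = "\<lambda>\<omega>. bN N x \<omega> - b0 x \<omega>"
    have [measurable]: "bN N x \<in> borel_measurable M" "b0 x \<in> borel_measurable M"
      using bN_measurable[OF N] b0_lp[OF s] by (auto simp: lp_def)
    have Zm [measurable]: "?Z \<in> borel_measurable M" by measurable
    have le: "AE \<omega> in M. ?Z \<omega> ^ s \<le> C ^ s * (scale x powr (-5/32)) ^ s * Q \<omega> ^ (16 * r)"
      using Q(4)
    proof eventually_elim
      case (elim \<omega>)
      have "?Z \<omega> ^ s = \<bar>?Z \<omega>\<bar> ^ s" using s by (simp add: power_even_abs)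
      also have "\<dots> \<le> (C * Q \<omega> ^ E * scale x powr (-5/32)) ^ s"
        by (intro power_mono pb elim xp x) auto
      also have "\<dots> = C ^ s * (scale x powr (-5/32)) ^ s * Q \<omega> ^ (E * s)"
        by (simp add: power_mult_distrib power_mult)
      also have "\<dots> \<le> C ^ s * (scale x powr (-5/32)) ^ s * Q \<omega> ^ (16 * r)"
        using C Q(2) r(2) by (intro mult_left_mono power_increasing) auto
      finally show ?case .
    qed
    have i: "integrable M (\<lambda>\<omega>. C ^ s * (scale x powr (-5/32)) ^ s * Q \<omega> ^ (16 * r))"
      using Q(3) by (rule integrable_mult_right)
    have iZ: "integrable M (\<lambda>\<omega>. ?Z \<omega> ^ s)"
    proof (rule Bochner_Integration.integrable_bound[OF i])
      show "AE \<omega> in M. norm (?Z \<omega> ^ s) \<le> norm (C ^ s * (scale x powr (-5/32)) ^ s * Q \<omega> ^ (16 * r))"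
        using le
      proof eventually_elim
        case (elim \<omega>)
        have "norm (?Z \<omega> ^ s) = ?Z \<omega> ^ s" using zero_le_even_power[OF s(1), of "?Z \<omega>"] by simp
        thus ?case using elim by (metis abs_ge_self order_trans real_norm_def)
      qed
    qed measurable
    show "lp M s ?Z" using iZ by (intro lpI) measurable
    have "expectation (\<lambda>\<omega>. ?Z \<omega> ^ s) \<le> expectation (\<lambda>\<omega>. C ^ s * (scale x powr (-5/32)) ^ s * Q \<omega> ^ (16 * r))"
      by (intro integral_mono_AE iZ i le)
    also have "\<dots> = D * (scale x powr (-5/32)) ^ s" by (simp add: D_def)
    finally show "expectation (\<lambda>\<omega>. ?Z \<omega> ^ s) \<le> D * (scale x powr (-5/32)) ^ s" .
  qed
qed

lemma b0_moment:
  assumes s: "even s" "s > 0"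
  shows "\<exists>C. \<forall>x\<ge>x0. expectation (\<lambda>\<omega>. b0 x \<omega> ^ s) \<le> C"
proof -
  obtain q where q: "s = 2 * q" "q \<ge> 1" using s by (elim evenE) auto
  obtain C where C: "C \<ge> 0" "\<And>n. expectation (\<lambda>\<omega>. v n \<omega> ^ s) \<le> C * (real n powr (real d - 1/2)) ^ s"
    using U_moment_le[OF q(2,1) kern_fc[OF s] mean_fc d] by blast
  obtain C' where C': "C' \<ge> 0" "\<And>n. expectation (\<lambda>\<omega>. v' n \<omega> ^ s) \<le> C' * (real n powr (real d' - 1/2)) ^ s"
    using U_moment_le[OF q(2,1) kern_fc'[OF s] mean_fc' d'] by blast
  have one: "expectation (\<lambda>\<omega>. (u (m x) \<omega> / scale x powr a) ^ s) \<le> K"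
    if u: "\<And>n. expectation (\<lambda>\<omega>. u n \<omega> ^ s) \<le> K * (real n powr a) ^ s" and K: "K \<ge> 0" and a: "a \<ge> 0" and x: "x \<ge> x0" for u x a K
  proof -
    have y: "scale x \<ge> 1" by (rule scale_ge_1[OF x])
    have my: "real (m x) \<le> scale x" using y by (intro of_nat_floor) auto
    have "expectation (\<lambda>\<omega>. (u (m x) \<omega> / scale x powr a) ^ s) = expectation (\<lambda>\<omega>. u (m x) \<omega> ^ s) / (scale x powr a) ^ s"
      by (simp add: power_divide)
    also have "\<dots> \<le> K * (real (m x) powr a) ^ s / (scale x powr a) ^ s"
      by (intro divide_right_mono u) auto
    also have "\<dots> \<le> K * (scale x powr a) ^ s / (scale x powr a) ^ s"
      using my K a by (intro divide_right_mono mult_left_mono power_mono powr_mono2) auto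
    also have "\<dots> = K" using y by simp
    finally show ?thesis .
  qed
  have "expectation (\<lambda>\<omega>. b0 x \<omega> ^ s) \<le> 2 ^ s * (C' + \<kappa> ^ s * C)" if x: "x \<ge> x0" for x
  proof -
    have l1: "lp M s (\<lambda>\<omega>. v' (m x) \<omega> / scale x powr (real d' - 1/2))"
      using lp_cmult[OF U_lp(1)[OF kern_fc'[OF s] s], of "1 / scale x powr (real d' - 1/2)" "m x"] by simp
    have l2: "lp M s (\<lambda>\<omega>. \<kappa> * (v (m x) \<omega> / scale x powr (real d - 1/2)))"
      using lp_cmult[OF lp_cmult[OF U_lp(1)[OF kern_fc[OF s] s], of "1 / scale x powr (real d - 1/2)" "m x"], of \<kappa>] by simp
    have "expectation (\<lambda>\<omega>. b0 x \<omega> ^ s) \<le> 2 ^ s * (expectation (\<lambda>\<omega>. (v' (m x) \<omega> / scale x powr (real d' - 1/2)) ^ s) +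
       expectation (\<lambda>\<omega>. (\<kappa> * (v (m x) \<omega> / scale x powr (real d - 1/2))) ^ s))"
      unfolding b0_def by (rule lp_diff(2)[OF s(1) l1 l2])
    also have "expectation (\<lambda>\<omega>. (\<kappa> * (v (m x) \<omega> / scale x powr (real d - 1/2))) ^ s) = \<kappa> ^ s * expectation (\<lambda>\<omega>. (v (m x) \<omega> / scale x powr (real d - 1/2)) ^ s)"
      unfolding power_mult_distrib by simp
    also have "2 ^ s * (expectation (\<lambda>\<omega>. (v' (m x) \<omega> / scale x powr (real d' - 1/2)) ^ s) + \<kappa> ^ s * expectation (\<lambda>\<omega>. (v (m x) \<omega> / scale x powr (real d - 1/2)) ^ s))
        \<le> 2 ^ s * (C' + \<kappa> ^ s * C)"
      using one[of v' C', OF C'(2,1) _ x] one[of v C, OF C(2,1) _ x] d d' s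
      by (intro mult_left_mono add_mono) (auto simp: zero_le_even_power)
    finally show ?thesis .
  qed
  thus ?thesis by blast
qed

text \<open>The pathwise bound on \<open>bN\<close> itself grows like
  \<open>scale x powr (1/16)\<close>, which would not give bounded moments. They come from the sharp
  moments of \<open>b0\<close> at a nonrandom time, plus a vanishing difference.\<close>

lemma bN_moment:
  assumes s: "even s" "s > 0" and N: "N \<in> passages"
  shows "\<exists>C. \<forall>x\<ge>x0. lp M s (bN N x) \<and> expectation (\<lambda>\<omega>. bN N x \<omega> ^ s) \<le> C"
proof -
  obtain C where C: "C \<ge> 0" "\<And>x. x \<ge> x0 \<Longrightarrow> lp M s (\<lambda>\<omega>. bN N x \<omega> - b0 x \<omega>)"
    "\<And>x. x \<ge> x0 \<Longrightarrow> expectation (\<lambda>\<omega>. (bN N x \<omega> - b0 x \<omega>) ^ s) \<le> C * (scale x powr (-5/32)) ^ s"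
    using bN_b0_moment[OF assms] by blast
  obtain C' where C': "\<And>x. x \<ge> x0 \<Longrightarrow> expectation (\<lambda>\<omega>. b0 x \<omega> ^ s) \<le> C'" using b0_moment[OF s] by blast
  have "lp M s (bN N x) \<and> expectation (\<lambda>\<omega>. bN N x \<omega> ^ s) \<le> 2 ^ s * (C + C')" if x: "x \<ge> x0" for x
  proof -
    have y: "scale x \<ge> 1" by (rule scale_ge_1[OF x])
    have "scale x powr (-5/32) \<le> scale x powr 0" using y by (intro powr_mono) auto
    hence "(scale x powr (-5/32)) ^ s \<le> 1" using y by (intro power_le_one) auto
    hence "C * (scale x powr (-5/32)) ^ s \<le> C" using C(1) by (simp add: mult_left_le)
    hence "expectation (\<lambda>\<omega>. (bN N x \<omega> - b0 x \<omega>) ^ s) \<le> C" using C(3)[OF x] by linarith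
    moreover note lp_add[OF s(1) C(2)[OF x] b0_lp[OF s, of x]]
    ultimately have "lp M s (bN N x)" "expectation (\<lambda>\<omega>. bN N x \<omega> ^ s) \<le> 2 ^ s * (expectation (\<lambda>\<omega>. (bN N x \<omega> - b0 x \<omega>) ^ s) + expectation (\<lambda>\<omega>. b0 x \<omega> ^ s))"
      by simp_all
    moreover have "2 ^ s * (expectation (\<lambda>\<omega>. (bN N x \<omega> - b0 x \<omega>) ^ s) + expectation (\<lambda>\<omega>. b0 x \<omega> ^ s)) \<le> 2 ^ s * (C + C')"
      using \<open>expectation (\<lambda>\<omega>. (bN N x \<omega> - b0 x \<omega>) ^ s) \<le> C\<close> C'[OF x] by (intro mult_left_mono add_mono) auto
    ultimately show ?thesis by linarith
  qed
  thus ?thesis by blast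
qed

lemma bN_b0_L1:
  assumes N: "N \<in> passages"
  shows "((\<lambda>x. expectation (\<lambda>\<omega>. \<bar>bN N x \<omega> - b0 x \<omega>\<bar>)) \<longlongrightarrow> 0) at_top"
proof -
  obtain C where C: "C \<ge> 0" "\<And>x. x \<ge> x0 \<Longrightarrow> lp M 2 (\<lambda>\<omega>. bN N x \<omega> - b0 x \<omega>)"
    "\<And>x. x \<ge> x0 \<Longrightarrow> expectation (\<lambda>\<omega>. (bN N x \<omega> - b0 x \<omega>) ^ 2) \<le> C * (scale x powr (-5/32)) ^ 2"
    using bN_b0_moment[of 2 N] N by auto
  have lim: "((\<lambda>x. sqrt C * scale x powr (-5/32)) \<longlongrightarrow> sqrt C * 0) at_top"
    by (intro tendsto_mult tendsto_const tendsto_neg_powr scale_at_top) simp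
  show ?thesis
  proof (rule tendsto_sandwich[OF _ _ tendsto_const lim[unfolded mult_zero_right]])
    show "\<forall>\<^sub>F x in at_top. expectation (\<lambda>\<omega>. \<bar>bN N x \<omega> - b0 x \<omega>\<bar>) \<le> sqrt C * scale x powr (-5/32)"
      using eventually_ge_at_top[of x0]
    proof eventually_elim
      case (elim x)
      have "lp M 2 (\<lambda>\<omega>. \<bar>bN N x \<omega> - b0 x \<omega>\<bar>)" using C(2)[OF elim] by (auto simp: lp_def)
      from expectation_power_le[OF _ _ this]
      have "(expectation (\<lambda>\<omega>. \<bar>bN N x \<omega> - b0 x \<omega>\<bar>))\<^sup>2 \<le> C * (scale x powr (-5/32)) ^ 2"
        using C(3)[OF elim] by simp
      hence "expectation (\<lambda>\<omega>. \<bar>bN N x \<omega> - b0 x \<omega>\<bar>) \<le> sqrt (C * (scale x powr (-5/32)) ^ 2)"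
        by (rule real_le_rsqrt)
      thus ?case by (simp add: real_sqrt_mult)
    qed
  qed (auto intro!: always_eventually integral_nonneg_AE)
qed


text \<open>A disjoint union merges the two families of projections, coefficients and Brownian
  motions into one; the signs and the factor \<open>\<kappa>\<close> of the limit variable sit in
  \<open>\<alpha>\<close>.\<close>

abbreviation "coords \<equiv> {1..d} <+> {1..d'}"

definition \<phi> :: "nat + nat \<Rightarrow> 's \<Rightarrow> real" where "\<phi> = case_sum (proj d fc) (proj d' fc')"
definition \<alpha> :: "nat + nat \<Rightarrow> real" where "\<alpha> = case_sum (\<lambda>_. - \<kappa>) (\<lambda>_. 1)"
definition g :: "nat + nat \<Rightarrow> real \<Rightarrow> real" where "g = case_sum (\<lambda>j s. psi j d s 1) (\<lambda>j s. psi j d' s 1)"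
definition coef :: "nat \<Rightarrow> nat \<Rightarrow> nat + nat \<Rightarrow> real" where
  "coef n k i = \<alpha> i * case_sum (\<lambda>j. lin_coeff d j n k) (\<lambda>j. lin_coeff d' j n k) i"
definition cc where "cc k l = expectation (\<lambda>\<omega>. \<phi> k (X 0 \<omega>) * \<phi> l (X 0 \<omega>))"
text \<open>The meeting point of the two halves: \<open>char_T\<close> finds it as the limiting
  variance of the linear parts, \<open>variance_Z_one\<close> as the variance of the combination of
  Wiener integrals.\<close>

definition \<sigma>2 where
  "\<sigma>2 = (\<Sum>k\<in>coords. \<Sum>l\<in>coords. \<alpha> k * \<alpha> l * cc k l * (\<integral>s. indicator {0..1} s * (g k s * g l s) \<partial>lborel))"

definition T where
  "T n \<omega> = linpart d' fc' n \<omega> / real n powr (real d' - 1/2) - \<kappa> * (linpart d fc n \<omega> / real n powr (real d - 1/2))"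

lemma fc_measurable: "fc \<in> borel_measurable (TS d)" "fc' \<in> borel_measurable (TS d')"
  using kern_measurable[OF kern_fc[of 2]] kern_measurable[OF kern_fc'[of 2]] by auto

lemma fc_integrable: "integrable M (\<lambda>\<omega>. fc (tup d (\<lambda>k. k) \<omega>))" "integrable M (\<lambda>\<omega>. fc' (tup d' (\<lambda>k. k) \<omega>))"
  using kern_integrable[OF kern_fc[of 2]] kern_integrable[OF kern_fc'[of 2]] by auto

lemma g_measurable: "g k \<in> borel_measurable borel"
  by (cases k) (auto simp: g_def psi_def)

lemma T_eq: "T n \<omega> = (\<Sum>k<n. \<Sum>i\<in>coords. coef n k i * \<phi> i (X (Suc k) \<omega>))"
proof -
  have "(\<Sum>i\<in>coords. coef n k i * \<phi> i (X (Suc k) \<omega>)) =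
    (\<Sum>j=1..d'. lin_coeff d' j n k * proj d' fc' j (X (Suc k) \<omega>)) - \<kappa> * (\<Sum>j=1..d. lin_coeff d j n k * proj d fc j (X (Suc k) \<omega>))" for k
    by (simp add: sum.Plus coef_def \<alpha>_def \<phi>_def sum_negf sum_distrib_left mult.assoc)
  moreover have "linpart e h n \<omega> / real n powr (real e - 1/2) = (\<Sum>k<n. \<Sum>j=1..e. lin_coeff e j n k * proj e h j (X (Suc k) \<omega>))" for e h
    by (simp add: linpart_def lin_sum_def lin_coeff_def sum_divide_distrib)
  ultimately show ?thesis by (simp add: T_def sum_subtractf sum_distrib_left)
qed

lemma T_measurable: "T n \<in> borel_measurable M"
proof -
  have [measurable]: "linpart d fc n \<in> borel_measurable M" "linpart d' fc' n \<in> borel_measurable M"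
    using linpart_lp[OF kern_fc[of 2], of n] linpart_lp[OF kern_fc'[of 2], of n] by (auto simp: lp_def)
  show ?thesis unfolding T_def[abs_def] by measurable
qed

lemma \<phi>_props:
  assumes "i \<in> coords"
  shows "\<phi> i \<in> borel_measurable S" "lp M 4 (\<lambda>\<omega>. \<phi> i (X 0 \<omega>))" "expectation (\<lambda>\<omega>. \<phi> i (X 0 \<omega>)) = 0"
  using assms proj_measurable[OF fc_measurable(1) fc_integrable(1)] proj_measurable[OF fc_measurable(2) fc_integrable(2)]
    proj_lp(1)[OF kern_fc[of 4]] proj_lp(1)[OF kern_fc'[of 4]]
    proj_integral[OF fc_measurable(1) fc_integrable(1)] proj_integral[OF fc_measurable(2) fc_integrable(2)] mean_fc mean_fc'
  by (auto simp: \<phi>_def)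

lemma char_T: "(\<lambda>n. char (distr M borel (T n)) t) \<longlonglongrightarrow> exp (- (t\<^sup>2 * \<sigma>2 / 2))"
proof -
  define \<psi> where "\<psi> = (\<lambda>i s. \<alpha> i * g i s)"
  have "(\<lambda>n. char (distr M borel (\<lambda>\<omega>. \<Sum>k<n. \<Sum>i\<in>coords. coef n k i * \<phi> i (X (Suc k) \<omega>))) t) \<longlonglongrightarrow>
    exp (- (t\<^sup>2 * (\<Sum>i\<in>coords. \<Sum>j\<in>coords. expectation (\<lambda>\<omega>. \<phi> i (X 0 \<omega>) * \<phi> j (X 0 \<omega>)) *
      (\<integral>s. indicator {0..<1} s * (\<psi> i s * \<psi> j s) \<partial>lborel)) / 2))"
  proof (rule triangular_clt[where C = "1 + \<bar>\<kappa>\<bar>"])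
    show "\<bar>coef n k i\<bar> \<le> (1 + \<bar>\<kappa>\<bar>) / sqrt (real n)" if "k < n" "i \<in> coords" for n k i
    proof -
      have a: "\<bar>\<alpha> i\<bar> \<le> 1 + \<bar>\<kappa>\<bar>" by (cases i) (auto simp: \<alpha>_def)
      have "\<bar>case_sum (\<lambda>j. lin_coeff d j n k) (\<lambda>j. lin_coeff d' j n k) i\<bar> \<le> 1 / sqrt (real n)"
        using that lin_coeff_bound[of _ d k n] lin_coeff_bound[of _ d' k n] by auto
      hence "\<bar>\<alpha> i\<bar> * \<bar>case_sum (\<lambda>j. lin_coeff d j n k) (\<lambda>j. lin_coeff d' j n k) i\<bar> \<le> (1 + \<bar>\<kappa>\<bar>) * (1 / sqrt (real n))"
        using a by (intro mult_mono) auto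
      thus ?thesis by (simp add: coef_def abs_mult)
    qed
    show "(\<lambda>n. sqrt (real n) * coef n (nat \<lfloor>real n * s\<rfloor>) i) \<longlonglongrightarrow> \<psi> i s" if "0 < s" "s < 1" "i \<in> coords" for s i
    proof -
      have "(\<lambda>n. \<alpha> i * (sqrt (real n) * case_sum (\<lambda>j. lin_coeff d j n (nat \<lfloor>real n * s\<rfloor>)) (\<lambda>j. lin_coeff d' j n (nat \<lfloor>real n * s\<rfloor>)) i)) \<longlonglongrightarrow> \<alpha> i * g i s"
        using that lin_coeff_limit[of _ d s] lin_coeff_limit[of _ d' s]
        by (intro tendsto_mult tendsto_const) (auto simp: g_def)
      thus ?thesis by (simp add: coef_def \<psi>_def mult.left_commute)
    qed
    show "\<psi> i \<in> borel_measurable lborel" for i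
      using g_measurable[of i] by (simp add: \<psi>_def)
  qed (use \<phi>_props in auto)
  moreover have "(\<integral>s. indicator {0..<1} s * (\<psi> i s * \<psi> j s) \<partial>lborel) = \<alpha> i * \<alpha> j * (\<integral>s. indicator {0..1} s * (g i s * g j s) \<partial>lborel)" for i j
  proof -
    note [measurable] = g_measurable[of i] g_measurable[of j]
    have "(\<integral>s. indicator {0..<1} s * (\<psi> i s * \<psi> j s) \<partial>lborel) = (\<integral>s. \<alpha> i * \<alpha> j * (indicator {0..1} s * (g i s * g j s)) \<partial>lborel)"
    proof (rule integral_cong_AE)
      show "AE s in lborel. indicator {0..<1} s * (\<psi> i s * \<psi> j s) = \<alpha> i * \<alpha> j * (indicator {0..1} s * (g i s * g j s))"
        using AE_lborel_singleton[of 1] by eventually_elim (auto simp: \<psi>_def indicator_def)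
    qed (simp_all add: \<psi>_def)
    thus ?thesis by simp
  qed
  ultimately show ?thesis
    unfolding T_eq[abs_def] \<sigma>2_def cc_def by (simp add: mult_ac)
qed

text \<open>The difference splits into the error at the passage time, from \<open>bN_b0_L1\<close>,
  and the two errors of \<open>linear_approx_L1\<close>. Convergence in mean is what
  \<open>char_diff_le\<close> asks for.\<close>

lemma bN_T_L1:
  assumes N: "N \<in> passages"
  shows "((\<lambda>x. expectation (\<lambda>\<omega>. \<bar>bN N x \<omega> - T (m x) \<omega>\<bar>)) \<longlongrightarrow> 0) at_top"
    and "x \<ge> x0 \<Longrightarrow> integrable M (\<lambda>\<omega>. bN N x \<omega> - T (m x) \<omega>)"
proof -
  define D1 where "D1 = (\<lambda>x \<omega>. v (m x) \<omega> / scale x powr (real d - 1/2) - linpart d fc (m x) \<omega> / real (m x) powr (real d - 1/2))"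
  define D2 where "D2 = (\<lambda>x \<omega>. v' (m x) \<omega> / scale x powr (real d' - 1/2) - linpart d' fc' (m x) \<omega> / real (m x) powr (real d' - 1/2))"
  have l1: "((\<lambda>x. expectation (\<lambda>\<omega>. \<bar>D1 x \<omega>\<bar>)) \<longlongrightarrow> 0) at_top"
    unfolding D1_def by (rule filterlim_compose[OF linear_approx_L1[OF kern_fc mean_fc d] scale_at_top]) auto
  have l2: "((\<lambda>x. expectation (\<lambda>\<omega>. \<bar>D2 x \<omega>\<bar>)) \<longlongrightarrow> 0) at_top"
    unfolding D2_def by (rule filterlim_compose[OF linear_approx_L1[OF kern_fc' mean_fc' d'] scale_at_top]) auto
  have i1: "integrable M (D1 x)" for x
  proof (rule lp_integrable[of 2])
    show "lp M 2 (D1 x)"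
    proof -
      have "lp M 2 (\<lambda>\<omega>. 1 / scale x powr (real d - 1/2) * v (m x) \<omega>)"
        by (intro lp_cmult U_lp(1) kern_fc) auto
      moreover have "lp M 2 (\<lambda>\<omega>. 1 / real (m x) powr (real d - 1/2) * linpart d fc (m x) \<omega>)"
        by (intro lp_cmult linpart_lp kern_fc) auto
      ultimately show ?thesis using lp_diff(1)[of 2 M] by (simp add: D1_def)
    qed
  qed auto
  have i2: "integrable M (D2 x)" for x
  proof (rule lp_integrable[of 2])
    show "lp M 2 (D2 x)"
    proof -
      have "lp M 2 (\<lambda>\<omega>. 1 / scale x powr (real d' - 1/2) * v' (m x) \<omega>)"
        by (intro lp_cmult U_lp(1) kern_fc') auto
      moreover have "lp M 2 (\<lambda>\<omega>. 1 / real (m x) powr (real d' - 1/2) * linpart d' fc' (m x) \<omega>)"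
        by (intro lp_cmult linpart_lp kern_fc') auto
      ultimately show ?thesis using lp_diff(1)[of 2 M] by (simp add: D2_def)
    qed
  qed auto
  have i3: "integrable M (\<lambda>\<omega>. bN N x \<omega> - b0 x \<omega>)" if "x \<ge> x0" for x
  proof (rule lp_integrable[of 2])
    show "lp M 2 (\<lambda>\<omega>. bN N x \<omega> - b0 x \<omega>)" using bN_b0_moment[of 2 N] N that by auto
  qed auto
  have e: "bN N x \<omega> - T (m x) \<omega> = (bN N x \<omega> - b0 x \<omega>) + (D2 x \<omega> - \<kappa> * D1 x \<omega>)" for x \<omega>
    by (simp add: T_def b0_def D1_def D2_def algebra_simps)
  show "integrable M (\<lambda>\<omega>. bN N x \<omega> - T (m x) \<omega>)" if "x \<ge> x0" for x
    unfolding e using i1 i2 i3[OF that] by auto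
  have le: "expectation (\<lambda>\<omega>. \<bar>bN N x \<omega> - T (m x) \<omega>\<bar>) \<le>
      expectation (\<lambda>\<omega>. \<bar>bN N x \<omega> - b0 x \<omega>\<bar>) + (expectation (\<lambda>\<omega>. \<bar>D2 x \<omega>\<bar>) + \<bar>\<kappa>\<bar> * expectation (\<lambda>\<omega>. \<bar>D1 x \<omega>\<bar>))"
    if x: "x \<ge> x0" for x
  proof -
    have "expectation (\<lambda>\<omega>. \<bar>bN N x \<omega> - T (m x) \<omega>\<bar>) \<le>
      expectation (\<lambda>\<omega>. \<bar>bN N x \<omega> - b0 x \<omega>\<bar> + (\<bar>D2 x \<omega>\<bar> + \<bar>\<kappa>\<bar> * \<bar>D1 x \<omega>\<bar>))"
    proof (rule integral_mono)
      show "integrable M (\<lambda>\<omega>. \<bar>bN N x \<omega> - T (m x) \<omega>\<bar>)"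
        unfolding e using i1 i2 i3[OF x] by (intro integrable_abs) auto
      show "integrable M (\<lambda>\<omega>. \<bar>bN N x \<omega> - b0 x \<omega>\<bar> + (\<bar>D2 x \<omega>\<bar> + \<bar>\<kappa>\<bar> * \<bar>D1 x \<omega>\<bar>))"
        by (intro Bochner_Integration.integrable_add integrable_mult_right integrable_abs i1 i2 i3[OF x])
      show "\<bar>bN N x \<omega> - T (m x) \<omega>\<bar> \<le> \<bar>bN N x \<omega> - b0 x \<omega>\<bar> + (\<bar>D2 x \<omega>\<bar> + \<bar>\<kappa>\<bar> * \<bar>D1 x \<omega>\<bar>)" for \<omega>
        unfolding e abs_mult[symmetric] by linarith
    qed
    also have "\<dots> = expectation (\<lambda>\<omega>. \<bar>bN N x \<omega> - b0 x \<omega>\<bar>) + (expectation (\<lambda>\<omega>. \<bar>D2 x \<omega>\<bar>) + \<bar>\<kappa>\<bar> * expectation (\<lambda>\<omega>. \<bar>D1 x \<omega>\<bar>))"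
      using i1[of x] i2[of x] i3[OF x] by simp
    finally show ?thesis .
  qed
  have "((\<lambda>x. expectation (\<lambda>\<omega>. \<bar>bN N x \<omega> - b0 x \<omega>\<bar>) + (expectation (\<lambda>\<omega>. \<bar>D2 x \<omega>\<bar>) + \<bar>\<kappa>\<bar> * expectation (\<lambda>\<omega>. \<bar>D1 x \<omega>\<bar>))) \<longlongrightarrow> 0 + (0 + \<bar>\<kappa>\<bar> * 0)) at_top"
    by (intro tendsto_add tendsto_mult tendsto_const l1 l2 bN_b0_L1 N)
  hence lim: "((\<lambda>x. expectation (\<lambda>\<omega>. \<bar>bN N x \<omega> - b0 x \<omega>\<bar>) + (expectation (\<lambda>\<omega>. \<bar>D2 x \<omega>\<bar>) + \<bar>\<kappa>\<bar> * expectation (\<lambda>\<omega>. \<bar>D1 x \<omega>\<bar>))) \<longlongrightarrow> 0) at_top"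
    by simp
  show "((\<lambda>x. expectation (\<lambda>\<omega>. \<bar>bN N x \<omega> - T (m x) \<omega>\<bar>)) \<longlongrightarrow> 0) at_top"
  proof (rule tendsto_sandwich[OF _ _ tendsto_const lim])
    show "\<forall>\<^sub>F x in at_top. expectation (\<lambda>\<omega>. \<bar>bN N x \<omega> - T (m x) \<omega>\<bar>) \<le>
        expectation (\<lambda>\<omega>. \<bar>bN N x \<omega> - b0 x \<omega>\<bar>) + (expectation (\<lambda>\<omega>. \<bar>D2 x \<omega>\<bar>) + \<bar>\<kappa>\<bar> * expectation (\<lambda>\<omega>. \<bar>D1 x \<omega>\<bar>))"
      using eventually_ge_at_top[of x0] by eventually_elim (rule le)
  qed (auto intro!: always_eventually integral_nonneg_AE)
qed

lemma m_at_top: "filterlim m sequentially at_top"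
proof -
  have "filterlim (\<lambda>y::real. nat \<lfloor>y\<rfloor>) sequentially at_top"
    by (intro filterlim_compose[OF filterlim_nat_sequentially filterlim_floor_sequentially])
  from filterlim_compose[OF this scale_at_top] show ?thesis .
qed

lemma char_bN:
  assumes N: "N \<in> passages" and xs: "filterlim xs at_top sequentially"
  shows "(\<lambda>n. char (distr M borel (\<lambda>\<omega>. \<beta> * bN N (xs n) \<omega>)) t) \<longlonglongrightarrow> exp (- (t\<^sup>2 * (\<beta>\<^sup>2 * \<sigma>2) / 2))"
proof -
  have scl: "char (distr M borel (\<lambda>\<omega>. \<beta> * Y \<omega>)) t = char (distr M borel Y) (t * \<beta>)" if "Y \<in> borel_measurable M" for Y
    unfolding char_def using that by (subst (1 2) integral_distr) (auto simp: mult.assoc)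
  have 1: "(\<lambda>n. char (distr M borel (T (m (xs n)))) (t * \<beta>)) \<longlonglongrightarrow> exp (- ((t * \<beta>)\<^sup>2 * \<sigma>2 / 2))"
    by (rule filterlim_compose[OF char_T filterlim_compose[OF m_at_top xs]])
  have 2: "(\<lambda>n. char (distr M borel (\<lambda>\<omega>. \<beta> * bN N (xs n) \<omega>)) t - char (distr M borel (T (m (xs n)))) (t * \<beta>)) \<longlonglongrightarrow> 0"
  proof (rule Lim_null_comparison)
    have "(\<lambda>n. \<bar>t * \<beta>\<bar> * expectation (\<lambda>\<omega>. \<bar>bN N (xs n) \<omega> - T (m (xs n)) \<omega>\<bar>)) \<longlonglongrightarrow> \<bar>t * \<beta>\<bar> * 0"
      by (intro tendsto_mult tendsto_const filterlim_compose[OF bN_T_L1(1)[OF N] xs])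
    thus "(\<lambda>n. \<bar>t * \<beta>\<bar> * expectation (\<lambda>\<omega>. \<bar>bN N (xs n) \<omega> - T (m (xs n)) \<omega>\<bar>)) \<longlonglongrightarrow> 0" by simp
    show "\<forall>\<^sub>F n in sequentially. cmod (char (distr M borel (\<lambda>\<omega>. \<beta> * bN N (xs n) \<omega>)) t - char (distr M borel (T (m (xs n)))) (t * \<beta>))
       \<le> \<bar>t * \<beta>\<bar> * expectation (\<lambda>\<omega>. \<bar>bN N (xs n) \<omega> - T (m (xs n)) \<omega>\<bar>)"
      using filterlim_at_top[THEN iffD1, OF xs, rule_format, of x0]
      by eventually_elim (simp only: scl[OF bN_measurable[OF N]], intro char_diff_le bN_measurable N T_measurable bN_T_L1(2))
  qed
  have "(\<lambda>n. (char (distr M borel (\<lambda>\<omega>. \<beta> * bN N (xs n) \<omega>)) t - char (distr M borel (T (m (xs n)))) (t * \<beta>)) +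
      char (distr M borel (T (m (xs n)))) (t * \<beta>)) \<longlonglongrightarrow> 0 + complex_of_real (exp (- ((t * \<beta>)\<^sup>2 * \<sigma>2 / 2)))"
    by (rule tendsto_add[OF 2 1])
  thus ?thesis by (simp add: power_mult_distrib mult.assoc)
qed

definition limit_const where "limit_const = (fact d / \<mu>) powr (real d' / real d) * (\<mu>' / fact d')"
text \<open>The ratio of the normalisations \<open>scale x powr (real d' - 1/2)\<close> and
  \<open>x powr (real d' / real d - 1 / (2 * real d))\<close>; its square is the leading factor of
  \<open>\<gamma>2\<close>.\<close>

definition \<beta> where "\<beta> = (fact d / \<mu>) powr ((2 * real d' - 1) / (2 * real d))"

lemma stopped_rescaled:
  assumes x: "x > 0"
  shows "(stopped (U d' f') (N x) \<omega> - limit_const * x powr (real d' / real d)) / x powr (real d' / real d - 1 / (2 * real d)) = \<beta> * bN N x \<omega>"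
proof -
  let ?c = "fact d / \<mu>"
  have c: "?c > 0" using \<mu>_pos by simp
  have s: "scale x powr a = ?c powr (a / real d) * x powr (a / real d)" for a
    using c x \<mu>_pos by (simp add: scale_def powr_powr powr_mult powr_divide)
  have 1: "\<mu>' * scale x ^ d' / fact d' = limit_const * x powr (real d' / real d)"
    using s[of "real d'"] scale_pos[OF x] by (simp add: powr_realpow limit_const_def)
  have dd: "(real d' - 1/2) / real d = (2 * real d' - 1) / (2 * real d)" "real d' / real d - 1 / (2 * real d) = (2 * real d' - 1) / (2 * real d)"
    using d by (simp_all add: field_simps)
  have 2: "scale x powr (real d' - 1/2) = \<beta> * x powr (real d' / real d - 1 / (2 * real d))"
    unfolding s dd \<beta>_def ..
  have b: "\<beta> > 0" unfolding \<beta>_def using c \<mu>_pos by simp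
  show ?thesis unfolding bN_def 1 2 using b by simp
qed

text \<open>\<open>A\<close> equals \<open>limit_const\<close> plus \<open>B\<close> times
  \<open>x powr (- (1 / (2 * real d)))\<close>, so everything about \<open>A\<close> is inherited:
  its moments from those of \<open>B\<close>, its almost sure limit from the pathwise bound, whose
  loss \<open>1/16\<close> still leaves the negative exponent
  \<open>- (7 / (16 * real d))\<close>.\<close>

lemma stopped_limits:
  assumes N: "N \<in> passages" and \<sigma>: "\<sigma>2 \<ge> 0"
  defines "A \<equiv> \<lambda>x \<omega>. stopped (U d' f') (N x) \<omega> / x powr (real d' / real d)"
    and "B \<equiv> \<lambda>x \<omega>. (stopped (U d' f') (N x) \<omega> - limit_const * x powr (real d' / real d)) / x powr (real d' / real d - 1 / (2 * real d))"
  shows "AE \<omega> in M. ((\<lambda>x. A x \<omega>) \<longlongrightarrow> limit_const) at_top"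
    and "moments_converge M A at_top (return borel limit_const)"
    and "conv_in_distr M B at_top (normal_law 0 (\<beta>\<^sup>2 * \<sigma>2))"
    and "moments_converge M B at_top (normal_law 0 (\<beta>\<^sup>2 * \<sigma>2))"
proof -
  have sm [measurable]: "stopped (U d' f') (N x) \<in> borel_measurable M" for x
  proof -
    have "N x \<in> measurable M (count_space UNIV)" using N by auto
    from stopped_measurable[OF U_measurable(2) this] show ?thesis .
  qed
  have Am: "A x \<in> borel_measurable M" and Bm: "B x \<in> borel_measurable M" for x
    unfolding A_def B_def by measurable
  have B_eq: "B x = (\<lambda>\<omega>. \<beta> * bN N x \<omega>)" if "x > 0" for x
    unfolding B_def by (intro ext stopped_rescaled that)
  have dpos: "real d > 0" using d by simp
  have A_eq: "A x \<omega> = limit_const + B x \<omega> * x powr (- (1 / (2 * real d)))" if x: "x > 0" for x \<omega>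
  proof -
    have "x powr (real d' / real d - 1 / (2 * real d)) * x powr (1 / (2 * real d)) = x powr (real d' / real d)"
      by (simp add: powr_add[symmetric])
    moreover have "x powr (real d' / real d) > 0" "x powr (1 / (2 * real d)) > 0" using x by auto
    ultimately have "B x \<omega> * x powr (- (1 / (2 * real d))) = (stopped (U d' f') (N x) \<omega> - limit_const * x powr (real d' / real d)) / x powr (real d' / real d)"
      by (simp add: B_def powr_minus_divide)
    thus ?thesis using x by (simp add: A_def diff_divide_distrib)
  qed
  have Bmom: "\<exists>C. \<forall>x\<ge>x0. lp M s (B x) \<and> expectation (\<lambda>\<omega>. B x \<omega> ^ s) \<le> C" if s: "even s" "s > 0" for s
  proof -
    obtain C where C: "\<And>x. x \<ge> x0 \<Longrightarrow> lp M s (bN N x)" "\<And>x. x \<ge> x0 \<Longrightarrow> expectation (\<lambda>\<omega>. bN N x \<omega> ^ s) \<le> C"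
      using bN_moment[OF s N] by blast
    show ?thesis
    proof (rule exI[of _ "\<beta> ^ s * C"], intro allI impI)
      fix x assume x: "x \<ge> x0"
      hence xp: "x > 0" using x0_pos by linarith
      have "expectation (\<lambda>\<omega>. (\<beta> * bN N x \<omega>) ^ s) = \<beta> ^ s * expectation (\<lambda>\<omega>. bN N x \<omega> ^ s)"
        by (simp add: power_mult_distrib)
      also have "\<dots> \<le> \<beta> ^ s * C" using C(2)[OF x] s by (intro mult_left_mono) (auto simp: zero_le_even_power)
      finally show "lp M s (B x) \<and> expectation (\<lambda>\<omega>. B x \<omega> ^ s) \<le> \<beta> ^ s * C"
        unfolding B_eq[OF xp] using lp_cmult[OF C(1)[OF x]] by simp
    qed
  qed
  have Bchar: "(\<lambda>n. char (distr M borel (B (xs n))) t) \<longlonglongrightarrow> char (normal_law 0 (\<beta>\<^sup>2 * \<sigma>2)) t"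
    if xs: "filterlim xs at_top sequentially" for xs t
  proof -
    have "(\<lambda>n. char (distr M borel (\<lambda>\<omega>. \<beta> * bN N (xs n) \<omega>)) t) \<longlonglongrightarrow> char (normal_law 0 (\<beta>\<^sup>2 * \<sigma>2)) t"
      using char_bN[OF N xs, of \<beta> t] \<sigma> by (simp add: char_normal_law)
    moreover have "\<forall>\<^sub>F n in sequentially. char (distr M borel (\<lambda>\<omega>. \<beta> * bN N (xs n) \<omega>)) t = char (distr M borel (B (xs n))) t"
      using filterlim_at_top_dense[THEN iffD1, OF xs, rule_format, of 0] by eventually_elim (simp only: B_eq)
    ultimately show ?thesis by (rule Lim_transform_eventually)
  qed
  have rn: "real_distribution (normal_law 0 (\<beta>\<^sup>2 * \<sigma>2))" by (rule real_distribution_normal_law) (use \<sigma> in simp)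
  show "conv_in_distr M B at_top (normal_law 0 (\<beta>\<^sup>2 * \<sigma>2))" "moments_converge M B at_top (normal_law 0 (\<beta>\<^sup>2 * \<sigma>2))"
    by (rule conv_from_char_and_moments[OF rn Bm Bchar Bmom]; assumption)+
  have pw: "((\<lambda>x::real. x powr (- (1 / (2 * real d)))) \<longlongrightarrow> 0) at_top"
    using d by (intro tendsto_neg_powr filterlim_ident) auto
  show "moments_converge M A at_top (return borel limit_const)"
  proof (rule conv_from_char_and_moments(2))
    interpret R: prob_space "return borel limit_const" by (rule prob_space_return) simp
    show "real_distribution (return borel limit_const)"
      by (simp add: real_distribution_def real_distribution_axioms_def R.prob_space_axioms)
    show "A x \<in> borel_measurable M" for x by (rule Am)
    \<comment> \<open>From \<open>x = 1\<close> on the factor in front of \<open>B\<close> is at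
      most \<open>1\<close>.\<close>
    show "\<exists>C. \<forall>x\<ge>max x0 1. lp M s (A x) \<and> expectation (\<lambda>\<omega>. A x \<omega> ^ s) \<le> C" if s: "even s" "s > 0" for s
    proof -
      obtain C where C: "\<And>x. x \<ge> x0 \<Longrightarrow> lp M s (B x)" "\<And>x. x \<ge> x0 \<Longrightarrow> expectation (\<lambda>\<omega>. B x \<omega> ^ s) \<le> C"
        using Bmom[OF s] by blast
      show ?thesis
      proof (rule exI[of _ "2 ^ s * (limit_const ^ s + C)"], intro allI impI)
        fix x assume x: "x \<ge> max x0 1"
        let ?p = "x powr (- (1 / (2 * real d)))"
        have p1: "?p \<le> 1" using x dpos powr_mono[of "- (1 / (2 * real d))" 0 x] by simp
        have e: "A x = (\<lambda>\<omega>. limit_const + ?p * B x \<omega>)" using A_eq[of x] x by (auto simp: mult.commute)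
        have l: "lp M s (\<lambda>\<omega>. ?p * B x \<omega>)" using x by (intro lp_cmult C(1)) auto
        have "expectation (\<lambda>\<omega>. (?p * B x \<omega>) ^ s) = ?p ^ s * expectation (\<lambda>\<omega>. B x \<omega> ^ s)"
          by (simp add: power_mult_distrib)
        also have "\<dots> \<le> 1 * expectation (\<lambda>\<omega>. B x \<omega> ^ s)"
          using p1 s by (intro mult_right_mono power_le_one integral_nonneg_AE) (auto simp: zero_le_even_power)
        also have "\<dots> \<le> C" using C(2)[of x] x by simp
        finally have "expectation (\<lambda>\<omega>. (?p * B x \<omega>) ^ s) \<le> C" .
        hence "2 ^ s * (expectation (\<lambda>\<omega>. limit_const ^ s) + expectation (\<lambda>\<omega>. (?p * B x \<omega>) ^ s)) \<le> 2 ^ s * (limit_const ^ s + C)"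
          by (intro mult_left_mono add_mono) (auto simp: prob_space)
        thus "lp M s (A x) \<and> expectation (\<lambda>\<omega>. A x \<omega> ^ s) \<le> 2 ^ s * (limit_const ^ s + C)"
          unfolding e using lp_add[OF s(1) lp_const[of s limit_const] l] by linarith
      qed
    qed
    show "(\<lambda>n. char (distr M borel (A (xs n))) t) \<longlonglongrightarrow> char (return borel limit_const) t"
      if xs: "filterlim xs at_top sequentially" for xs t
    proof -
      obtain C where C: "\<And>x. x \<ge> x0 \<Longrightarrow> lp M 2 (B x)" "\<And>x. x \<ge> x0 \<Longrightarrow> expectation (\<lambda>\<omega>. B x \<omega> ^ 2) \<le> C"
        using Bmom[of 2] by auto
      have le: "cmod (char (distr M borel (A x)) t - char (return borel limit_const) t) \<le> \<bar>t\<bar> * ((1 + C) * x powr (- (1 / (2 * real d))))"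
        if x: "x \<ge> x0" for x
      proof -
        have xp: "x > 0" using x x0_pos by linarith
        let ?p = "x powr (- (1 / (2 * real d)))"
        have Bi: "integrable M (B x)" "integrable M (\<lambda>\<omega>. (B x \<omega>)\<^sup>2)"
          using lp_integrable[OF _ _ C(1)[OF x]] C(1)[OF x] by (auto simp: lp_def)
        have ret: "return borel limit_const = distr M borel (\<lambda>_. limit_const)" by (rule distr_const[symmetric]) simp
        have d: "A x \<omega> - limit_const = B x \<omega> * ?p" for \<omega> using A_eq[OF xp] by simp
        have "cmod (char (distr M borel (A x)) t - char (distr M borel (\<lambda>_. limit_const)) t) \<le> \<bar>t\<bar> * expectation (\<lambda>\<omega>. \<bar>A x \<omega> - limit_const\<bar>)"
          using Bi by (intro char_diff_le Am) (auto simp: d)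
        also have "expectation (\<lambda>\<omega>. \<bar>A x \<omega> - limit_const\<bar>) = expectation (\<lambda>\<omega>. \<bar>B x \<omega>\<bar>) * ?p"
          unfolding d by (simp add: abs_mult)
        also have "expectation (\<lambda>\<omega>. \<bar>B x \<omega>\<bar>) \<le> expectation (\<lambda>\<omega>. 1 + (B x \<omega>)\<^sup>2)"
        proof (rule integral_mono)
          show "\<bar>B x \<omega>\<bar> \<le> 1 + (B x \<omega>)\<^sup>2" for \<omega>
            using zero_le_power2[of "\<bar>B x \<omega>\<bar> - 1"] zero_le_power2[of "B x \<omega>"] by (simp add: power2_diff)
        qed (use Bi in auto)
        also have "\<dots> \<le> 1 + C" using C(2)[OF x] Bi by (simp add: prob_space)
        finally show ?thesis unfolding ret by (simp add: mult_left_mono mult_right_mono)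
      qed
      have "(\<lambda>n. char (distr M borel (A (xs n))) t - char (return borel limit_const) t) \<longlonglongrightarrow> 0"
      proof (rule Lim_null_comparison)
        show "\<forall>\<^sub>F n in sequentially. cmod (char (distr M borel (A (xs n))) t - char (return borel limit_const) t) \<le> \<bar>t\<bar> * ((1 + C) * xs n powr (- (1 / (2 * real d))))"
          using filterlim_at_top[THEN iffD1, OF xs, rule_format, of x0] by eventually_elim (rule le)
        have "(\<lambda>n. \<bar>t\<bar> * ((1 + C) * xs n powr (- (1 / (2 * real d))))) \<longlonglongrightarrow> \<bar>t\<bar> * ((1 + C) * 0)"
          by (intro tendsto_mult tendsto_const filterlim_compose[OF pw xs])
        thus "(\<lambda>n. \<bar>t\<bar> * ((1 + C) * xs n powr (- (1 / (2 * real d))))) \<longlonglongrightarrow> 0" by simp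
      qed
      thus ?thesis by (simp add: LIM_zero_iff)
    qed
  qed
  obtain C E where C: "C \<ge> 0" and pb: "\<And>Q \<omega> x. regular Q \<omega> \<Longrightarrow> x > 0 \<Longrightarrow> x \<ge> x0 \<Longrightarrow> \<bar>bN N x \<omega>\<bar> \<le> C * Q ^ E * scale x powr (1/16)"
    using pathwise_bound N by blast
  from regular_envelope[of 3] obtain Q where Q: "AE \<omega> in M. regular (Q \<omega>) \<omega>" by auto
  show "AE \<omega> in M. ((\<lambda>x. A x \<omega>) \<longlongrightarrow> limit_const) at_top"
    using Q
  proof eventually_elim
    case (elim \<omega>)
    define D where "D = \<bar>\<beta>\<bar> * (C * Q \<omega> ^ E * (fact d / \<mu>) powr (1 / (16 * real d)))"
    have "((\<lambda>x. A x \<omega> - limit_const) \<longlongrightarrow> 0) at_top"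
    proof (rule Lim_null_comparison)
      show "\<forall>\<^sub>F x in at_top. norm (A x \<omega> - limit_const) \<le> D * x powr (- (7 / (16 * real d)))"
        using eventually_ge_at_top[of x0]
      proof eventually_elim
        case (elim x)
        hence xp: "x > 0" using x0_pos by linarith
        have "scale x powr (1/16) = (fact d / \<mu>) powr (1 / (16 * real d)) * x powr (1 / (16 * real d))"
          using xp \<mu>_pos by (simp add: scale_def powr_powr powr_mult powr_divide mult.commute)
        hence "\<bar>bN N x \<omega>\<bar> \<le> C * Q \<omega> ^ E * ((fact d / \<mu>) powr (1 / (16 * real d)) * x powr (1 / (16 * real d)))"
          using pb[OF \<open>regular (Q \<omega>) \<omega>\<close> xp elim] by simp
        hence "\<bar>\<beta>\<bar> * \<bar>bN N x \<omega>\<bar> \<le> D * x powr (1 / (16 * real d))"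
          unfolding D_def mult.assoc by (intro mult_left_mono) (auto simp: mult.assoc)
        hence "\<bar>B x \<omega>\<bar> * x powr (- (1 / (2 * real d))) \<le> D * x powr (1 / (16 * real d)) * x powr (- (1 / (2 * real d)))"
          unfolding B_eq[OF xp] abs_mult by (rule mult_right_mono) simp
        also have "\<dots> = D * x powr (- (7 / (16 * real d)))"
        proof -
          have "1 / (16 * real d) + - (1 / (2 * real d)) = - (7 / (16 * real d))" using dpos by (simp add: field_simps)
          thus ?thesis by (simp add: mult.assoc powr_add[symmetric])
        qed
        finally show ?case using A_eq[OF xp, of \<omega>] by (simp add: abs_mult)
      qed
      have "((\<lambda>x. D * x powr (- (7 / (16 * real d)))) \<longlongrightarrow> D * 0) at_top"
        using d by (intro tendsto_mult tendsto_const tendsto_neg_powr filterlim_ident) auto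
      thus "((\<lambda>x. D * x powr (- (7 / (16 * real d)))) \<longlongrightarrow> 0) at_top" by simp
    qed
    thus ?case by (simp add: LIM_zero_iff)
  qed
qed

end

section \<open>Identification of the limiting variance\<close>

lemma square_integrable_normal_law:
  assumes "v \<ge> 0"
  shows "integrable (normal_law m v) (\<lambda>z. z\<^sup>2)"
proof (cases "v = 0")
  case True
  thus ?thesis by (simp add: normal_law_def integrable_iff_bounded nn_integral_return)
next
  case False
  hence s: "sqrt v > 0" using assms by simp
  have "integrable lborel (\<lambda>z. normal_density m (sqrt v) z * (z - m) ^ 2 + (2 * m * (normal_density m (sqrt v) z * (z - m) ^ 1) +
      m\<^sup>2 * (normal_density m (sqrt v) z * (z - m) ^ 0)))"
    by (intro Bochner_Integration.integrable_add integrable_mult_right integrable_normal_moment s)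
  also have "(\<lambda>z. normal_density m (sqrt v) z * (z - m) ^ 2 + (2 * m * (normal_density m (sqrt v) z * (z - m) ^ 1) +
      m\<^sup>2 * (normal_density m (sqrt v) z * (z - m) ^ 0))) = (\<lambda>z. normal_density m (sqrt v) z * z\<^sup>2)"
    by (simp add: fun_eq_iff power2_eq_square algebra_simps)
  finally show ?thesis using False by (simp add: normal_law_def integrable_density)
qed

text \<open>A covariance formula alone carries no integrability, since the integral of a
  non-integrable function is \<open>0\<close>; the normal law of a one-term combination supplies
  it.\<close>

lemma gaussian_family_lp:
  assumes g: "gaussian_family P I Y" and i: "i \<in> I"
  shows "lp P 2 (Y i)"
proof -
  have m [measurable]: "Y i \<in> borel_measurable P" using assms by (auto simp: gaussian_family_def)
  have "\<forall>J (c :: _ \<Rightarrow> real). finite J \<and> J \<subseteq> I \<longrightarrow>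
      (\<exists>m v. v \<ge> 0 \<and> distr P borel (\<lambda>\<omega>. \<Sum>i\<in>J. c i * Y i \<omega>) = normal_law m v)"
    using g unfolding gaussian_family_def by (rule conjunct2)
  from this[THEN spec[where x="{i}"], THEN spec[where x="\<lambda>_. 1"]] i
  obtain m v where v: "v \<ge> 0" "distr P borel (Y i) = normal_law m v" by auto
  have "integrable (distr P borel (Y i)) (\<lambda>z. z\<^sup>2)"
    unfolding v(2) by (rule square_integrable_normal_law[OF v(1)])
  thus ?thesis by (simp add: lp_def integrable_distr_eq)
qed

text \<open>Centring outside the integral and centring the kernel agree where the section is
  integrable, hence almost surely. At an exceptional \<open>x\<close> both integrals default to
  \<open>0\<close>, and only one side still subtracts the mean.\<close>

lemma (in iid_seq) kernel_proj_X:
  assumes f: "f \<in> borel_measurable (TS d)" and i: "integrable M (\<lambda>\<omega>. f (tup d (\<lambda>k. k) \<omega>))" and j: "j \<in> {1..d}"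
  shows "(\<lambda>\<omega>. kernel_proj M X d f j (X 0 \<omega>)) \<in> borel_measurable M"
    and "AE \<omega> in M. kernel_proj M X d f j (X 0 \<omega>) = proj d (\<lambda>y. f y - kernel_mean M X d f) j (X 0 \<omega>)"
proof -
  note [measurable] = proj_measurable[OF f i j]
  have e: "kernel_proj M X d f j x = proj d f j x - kernel_mean M X d f" for x
    by (simp add: kernel_proj_def proj_def)
  show "(\<lambda>\<omega>. kernel_proj M X d f j (X 0 \<omega>)) \<in> borel_measurable M" unfolding e by measurable
  show "AE \<omega> in M. kernel_proj M X d f j (X 0 \<omega>) = proj d (\<lambda>y. f y - kernel_mean M X d f) j (X 0 \<omega>)"
    using proj_AE_integrable[OF f i j]
  proof eventually_elim
    case (elim \<omega>)
    show ?case
      unfolding e proj_upd[OF j] Bochner_Integration.integral_diff[OF elim integrable_const] by (simp add: prob_space)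
  qed
qed

context two_kernels
begin

lemma cov_kernel_proj:
  assumes k: "k \<in> coords" and l: "l \<in> coords"
  defines "Y \<equiv> \<lambda>i \<omega>. case_sum (kernel_proj M X d f) (kernel_proj M X d' f') i (X 0 \<omega>)"
  shows "cov M (Y k) (Y l) = cc k l"
proof -
  have km: "kernel_mean M X d f = \<mu>" "kernel_mean M X d' f' = \<mu>'"
    using mu mu' by (simp_all add: kernel_mean_def tup_def)
  have Ym: "Y i \<in> borel_measurable M" and Y\<phi>: "AE \<omega> in M. Y i \<omega> = \<phi> i (X 0 \<omega>)" if i: "i \<in> coords" for i
    using i kernel_proj_X[OF kern_measurable[OF kf[of 2]] kern_integrable[OF kf[of 2]]]
      kernel_proj_X[OF kern_measurable[OF kf'[of 2]] kern_integrable[OF kf'[of 2]]]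
    by (auto simp: Y_def[abs_def] \<phi>_def km fc_def[abs_def] fc'_def[abs_def])
  have \<phi>m [measurable]: "(\<lambda>\<omega>. \<phi> i (X 0 \<omega>)) \<in> borel_measurable M" if "i \<in> coords" for i
    using measurable_compose[OF X_measurable \<phi>_props(1)[OF that]] .
  note [measurable] = Ym[OF k] Ym[OF l] \<phi>m[OF k] \<phi>m[OF l]
  have 0: "expectation (Y i) = 0" if i: "i \<in> coords" for i
    using integral_cong_AE[OF Ym[OF i] \<phi>m[OF i] Y\<phi>[OF i]] \<phi>_props(3)[OF i] by simp
  have "expectation (\<lambda>\<omega>. Y k \<omega> * Y l \<omega>) = cc k l"
    unfolding cc_def using Y\<phi>[OF k] Y\<phi>[OF l] by (intro integral_cong_AE) (measurable, auto)
  thus ?thesis using 0[OF k] 0[OF l] by (simp add: cov_def)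
qed

text \<open>The Gaussian hypothesis supplies square integrability and centring; the three covariance
  hypotheses, with symmetry for the mixed pairs in reverse order, supply the rest of
  \<open>brownian_covariance\<close>.\<close>

lemma variance_Z_one:
  fixes P :: "'b measure" and W W' :: "nat \<Rightarrow> real \<Rightarrow> 'b \<Rightarrow> real"
  assumes P: "prob_space P"
    and gaussian: "centered_gaussian_process P coords (case_sum W W')"
    and cov_WW: "\<And>i j s t. i \<in> {1..d} \<Longrightarrow> j \<in> {1..d} \<Longrightarrow> s \<ge> 0 \<Longrightarrow> t \<ge> 0 \<Longrightarrow>
        cov P (W i s) (W j t) =
        cov M (\<lambda>\<omega>. kernel_proj M X d f i (X 0 \<omega>)) (\<lambda>\<omega>. kernel_proj M X d f j (X 0 \<omega>)) * min s t"
    and cov_W'W': "\<And>i j s t. i \<in> {1..d'} \<Longrightarrow> j \<in> {1..d'} \<Longrightarrow> s \<ge> 0 \<Longrightarrow> t \<ge> 0 \<Longrightarrow>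
        cov P (W' i s) (W' j t) =
        cov M (\<lambda>\<omega>. kernel_proj M X d' f' i (X 0 \<omega>)) (\<lambda>\<omega>. kernel_proj M X d' f' j (X 0 \<omega>)) * min s t"
    and cov_WW': "\<And>i j s t. i \<in> {1..d} \<Longrightarrow> j \<in> {1..d'} \<Longrightarrow> s \<ge> 0 \<Longrightarrow> t \<ge> 0 \<Longrightarrow>
        cov P (W i s) (W' j t) =
        cov M (\<lambda>\<omega>. kernel_proj M X d f i (X 0 \<omega>)) (\<lambda>\<omega>. kernel_proj M X d' f' j (X 0 \<omega>)) * min s t"
  shows "prob_space.variance P (\<lambda>\<omega>. Z_one P d' W' \<omega> - \<kappa> * Z_one P d W \<omega>) = \<sigma>2"
proof -
  interpret P: prob_space P by (rule P)
  let ?V = "case_sum W W'"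
  have V_lp: "lp P 2 (?V k t)" and V_mean: "P.expectation (?V k t) = 0" if "k \<in> coords" "t \<ge> 0" for k t
    using that gaussian gaussian_family_lp[of P "coords \<times> {0..}" "\<lambda>(k, t). ?V k t" "(k, t)"]
    by (auto simp: centered_gaussian_process_def)
  have swap: "cov Q Y Z = cov Q Z Y" for Q :: "'q measure" and Y Z by (simp add: cov_def mult.commute)
  have V_cov: "P.expectation (\<lambda>\<omega>. ?V k s \<omega> * ?V l t \<omega>) = cc k l * min s t"
    if k: "k \<in> coords" and l: "l \<in> coords" and s: "s \<ge> 0" and t: "t \<ge> 0" for k l s t
  proof -
    have "P.expectation (\<lambda>\<omega>. ?V k s \<omega> * ?V l t \<omega>) = cov P (?V k s) (?V l t)"
      using V_mean[OF k s] V_mean[OF l t] by (simp add: cov_def)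
    also have "\<dots> = cov M (\<lambda>\<omega>. case_sum (kernel_proj M X d f) (kernel_proj M X d' f') k (X 0 \<omega>))
        (\<lambda>\<omega>. case_sum (kernel_proj M X d f) (kernel_proj M X d' f') l (X 0 \<omega>)) * min s t"
    proof (cases k)
      case (Inl i)
      thus ?thesis using k l s t cov_WW cov_WW' by (cases l) auto
    next
      case (Inr i)
      thus ?thesis using k l s t cov_W'W' cov_WW'[of _ i t s]
        by (cases l) (auto simp: swap[of P "W' i s"] swap[of M "\<lambda>\<omega>. kernel_proj M X d' f' i (X 0 \<omega>)"] min.commute)
    qed
    finally show ?thesis unfolding cov_kernel_proj[OF k l] .
  qed
  interpret B: brownian_covariance P coords ?V cc
    by unfold_locales (fact V_lp V_mean V_cov)+
  have wi: "has_wiener_integral P (?V k) 0 1 (g k) (wiener_integral P (?V k) 0 1 (g k))" if k: "k \<in> coords" for k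
  proof -
    have "\<exists>L. \<forall>s t. 0 \<le> s \<longrightarrow> s \<le> 1 \<longrightarrow> 0 \<le> t \<longrightarrow> t \<le> 1 \<longrightarrow> \<bar>g k s - g k t\<bar> \<le> L * \<bar>s - t\<bar>"
      using psi_lipschitz by (cases k) (auto simp: g_def, blast+)
    then obtain L where "\<And>s t. 0 \<le> s \<Longrightarrow> s \<le> 1 \<Longrightarrow> 0 \<le> t \<Longrightarrow> t \<le> 1 \<Longrightarrow> \<bar>g k s - g k t\<bar> \<le> L * \<bar>s - t\<bar>" by blast
    from B.has_wiener_integral_wiener_integral[OF k this] show ?thesis .
  qed
  have "Z_one P d' W' \<omega> - \<kappa> * Z_one P d W \<omega> = (\<Sum>k\<in>coords. \<alpha> k * wiener_integral P (?V k) 0 1 (g k) \<omega>)" for \<omega>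
    by (simp add: Z_one_def sum.Plus \<alpha>_def g_def sum_distrib_left sum_negf)
  thus ?thesis using B.wiener_combination[OF _ wi g_measurable, of \<alpha>] by (simp add: \<sigma>2_def)
qed

text \<open>The mean is the first moment of \<open>A\<close>. The variance ignores the centring in
  \<open>B\<close>, so it is the squared normalisation times the second moment of \<open>B\<close>
  minus its squared first moment, and these tend to the moments of the centered normal law.\<close>

lemma mean_and_variance_limits:
  assumes N: "N \<in> passages" and \<sigma>: "\<sigma>2 \<ge> 0"
  shows "((\<lambda>x. expectation (stopped (U d' f') (N x)) / x powr (real d' / real d)) \<longlongrightarrow> limit_const) at_top"
    and "((\<lambda>x. variance (stopped (U d' f') (N x)) / x powr ((2 * real d' - 1) / real d)) \<longlongrightarrow> \<beta>\<^sup>2 * \<sigma>2) at_top"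
proof -
  define Y where "Y = (\<lambda>x. stopped (U d' f') (N x))"
  define p where "p = (\<lambda>x::real. x powr (real d' / real d - 1 / (2 * real d)))"
  define c where "c = (\<lambda>x::real. limit_const * x powr (real d' / real d))"
  have v0: "0 \<le> \<beta>\<^sup>2 * \<sigma>2" using \<sigma> by simp
  have A: "((\<lambda>x. \<integral>\<omega>. (Y x \<omega> / x powr (real d' / real d)) ^ 1 \<partial>M) \<longlongrightarrow> (\<integral>z. z ^ 1 \<partial>return borel limit_const)) at_top"
    using stopped_limits(2)[OF N \<sigma>] unfolding moments_converge_def Y_def by blast
  have "(\<integral>z. z ^ 1 \<partial>return borel limit_const) = limit_const" by (simp add: integral_return)
  with A show "((\<lambda>x. expectation (stopped (U d' f') (N x)) / x powr (real d' / real d)) \<longlongrightarrow> limit_const) at_top"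
    by (simp add: Y_def)
  let ?B = "\<lambda>x \<omega>. (Y x \<omega> - c x) / p x"
  have mc: "moments_converge M ?B at_top (normal_law 0 (\<beta>\<^sup>2 * \<sigma>2))"
    using stopped_limits(4)[OF N \<sigma>] unfolding Y_def c_def p_def .
  have B: "\<forall>\<^sub>F x in at_top. integrable M (\<lambda>\<omega>. ?B x \<omega> ^ k)"
    "((\<lambda>x. \<integral>\<omega>. ?B x \<omega> ^ k \<partial>M) \<longlongrightarrow> (\<integral>z. z ^ k \<partial>normal_law 0 (\<beta>\<^sup>2 * \<sigma>2))) at_top" if "k \<ge> 1" for k
    using mc that unfolding moments_converge_def by blast+
  have "((\<lambda>x. (\<integral>\<omega>. ?B x \<omega> ^ 2 \<partial>M) - (\<integral>\<omega>. ?B x \<omega> ^ 1 \<partial>M)\<^sup>2) \<longlongrightarrow> \<beta>\<^sup>2 * \<sigma>2 - 0\<^sup>2) at_top"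
    using B(2)[of 1] B(2)[of 2] unfolding normal_law_moment1[OF v0] normal_law_moment2[OF v0]
    by (intro tendsto_diff tendsto_power) auto
  moreover have "\<forall>\<^sub>F x in at_top. (\<integral>\<omega>. ?B x \<omega> ^ 2 \<partial>M) - (\<integral>\<omega>. ?B x \<omega> ^ 1 \<partial>M)\<^sup>2 =
      variance (Y x) / x powr ((2 * real d' - 1) / real d)"
    using B(1)[of 1, simplified] B(1)[of 2, simplified] eventually_gt_at_top[of 0]
  proof eventually_elim
    case (elim x)
    have p0: "p x > 0" using elim(3) by (simp add: p_def)
    have p2: "(p x)\<^sup>2 = x powr ((2 * real d' - 1) / real d)"
    proof -
      have "real d' / real d - 1 / (2 * real d) + (real d' / real d - 1 / (2 * real d)) = (2 * real d' - 1) / real d"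
        using d by (simp add: field_simps)
      thus ?thesis by (simp add: p_def power2_eq_square powr_add[symmetric])
    qed
    have Y: "Y x = (\<lambda>\<omega>. p x * ?B x \<omega> + c x)" using p0 by auto
    have EY: "expectation (Y x) = p x * expectation (?B x) + c x"
    proof -
      have "expectation (\<lambda>\<omega>. a * h \<omega> + b) = a * expectation h + b" if "integrable M h" for a b :: real and h
        using that by (simp add: prob_space)
      from this[OF elim(1), of "p x" "c x"] show ?thesis unfolding Y[symmetric] .
    qed
    have "variance (Y x) = expectation (\<lambda>\<omega>. (p x)\<^sup>2 * (?B x \<omega> - expectation (?B x))\<^sup>2)"
    proof (rule Bochner_Integration.integral_cong[OF refl])
      fix \<omega>
      have "Y x \<omega> = p x * ?B x \<omega> + c x" by (rule fun_cong[OF Y])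
      hence "Y x \<omega> - expectation (Y x) = p x * (?B x \<omega> - expectation (?B x))"
        unfolding EY by (simp add: right_diff_distrib)
      thus "(Y x \<omega> - expectation (Y x))\<^sup>2 = (p x)\<^sup>2 * (?B x \<omega> - expectation (?B x))\<^sup>2"
        by (simp only: power_mult_distrib)
    qed
    also have "\<dots> = (p x)\<^sup>2 * variance (?B x)" by simp
    also have "variance (?B x) = expectation (\<lambda>\<omega>. (?B x \<omega>)\<^sup>2) - (expectation (?B x))\<^sup>2"
      using elim(1,2) by (intro variance_eq) auto
    finally show ?case using p0 unfolding p2[symmetric] by simp
  qed
  ultimately show "((\<lambda>x. variance (stopped (U d' f') (N x)) / x powr ((2 * real d' - 1) / real d)) \<longlongrightarrow> \<beta>\<^sup>2 * \<sigma>2) at_top"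
    unfolding Y_def by (simp only: Lim_transform_eventually zero_power2 diff_zero)
qed

end

theorem theorem3p17:
  fixes M :: "'a measure" and S :: "'s measure" and P :: "'b measure"
    and X :: "nat \<Rightarrow> 'a \<Rightarrow> 's"
    and d d' :: nat
    and f f' :: "(nat \<Rightarrow> 's) \<Rightarrow> real"
    and \<mu> \<mu>' \<gamma>2 :: real
    and W W' :: "nat \<Rightarrow> real \<Rightarrow> 'b \<Rightarrow> real"
  assumes "prob_space M"
    and "d \<ge> 1" and "d' \<ge> 1"
    and "f \<in> borel_measurable (PiM {1..d} (\<lambda>_. S))"
    and "f' \<in> borel_measurable (PiM {1..d'} (\<lambda>_. S))"
    and indep: "prob_space.indep_vars M (\<lambda>_. S) X UNIV"
    and ident: "\<And>i. distr M S (X i) = distr M S (X 0)"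
    and Lp: "\<And>p::real. p > 0 \<Longrightarrow> integrable M (\<lambda>\<omega>. \<bar>f (\<lambda>k\<in>{1..d}. X k \<omega>)\<bar> powr p)"
    and Lp': "\<And>p::real. p > 0 \<Longrightarrow> integrable M (\<lambda>\<omega>. \<bar>f' (\<lambda>k\<in>{1..d'}. X k \<omega>)\<bar> powr p)"
    and mu: "\<mu> = kernel_mean M X d f"
    and mu': "\<mu>' = kernel_mean M X d' f'"
    and "\<mu> > 0"
    and "prob_space P"
    and gaussian: "centered_gaussian_process P ({1..d} <+> {1..d'}) (case_sum W W')"
    and "continuous_paths_from_0 P ({1..d} <+> {1..d'}) (case_sum W W')"
    and "independent_increments P ({1..d} <+> {1..d'}) (case_sum W W')"
    and "stationary_increments P ({1..d} <+> {1..d'}) (case_sum W W')"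
    and cov_WW: "\<And>i j s t. i \<in> {1..d} \<Longrightarrow> j \<in> {1..d} \<Longrightarrow> s \<ge> 0 \<Longrightarrow> t \<ge> 0 \<Longrightarrow>
        cov P (W i s) (W j t) =
        cov M (\<lambda>\<omega>. kernel_proj M X d f i (X 0 \<omega>)) (\<lambda>\<omega>. kernel_proj M X d f j (X 0 \<omega>)) * min s t"
    and cov_W'W': "\<And>i j s t. i \<in> {1..d'} \<Longrightarrow> j \<in> {1..d'} \<Longrightarrow> s \<ge> 0 \<Longrightarrow> t \<ge> 0 \<Longrightarrow>
        cov P (W' i s) (W' j t) =
        cov M (\<lambda>\<omega>. kernel_proj M X d' f' i (X 0 \<omega>)) (\<lambda>\<omega>. kernel_proj M X d' f' j (X 0 \<omega>)) * min s t"
    and cov_WW': "\<And>i j s t. i \<in> {1..d} \<Longrightarrow> j \<in> {1..d'} \<Longrightarrow> s \<ge> 0 \<Longrightarrow> t \<ge> 0 \<Longrightarrow>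
        cov P (W i s) (W' j t) =
        cov M (\<lambda>\<omega>. kernel_proj M X d f i (X 0 \<omega>)) (\<lambda>\<omega>. kernel_proj M X d' f' j (X 0 \<omega>)) * min s t"
    and gamma2: "\<gamma>2 = (fact d / \<mu>) powr ((2 * real d' - 1) / real d) *
        prob_space.variance P
          (\<lambda>\<omega>. Z_one P d' W' \<omega> - fact (d - 1) * \<mu>' / (fact (d' - 1) * \<mu>) * Z_one P d W \<omega>)"
  shows "\<forall>N \<in> {N_minus (U_stat d f X), N_plus (U_stat d f X)}.
     (let Ustop = (\<lambda>x. stopped (U_stat d' f' X) (N x));
          c = (fact d / \<mu>) powr (real d' / real d) * (\<mu>' / fact d');
          A = (\<lambda>x \<omega>. Ustop x \<omega> / x powr (real d' / real d));
          B = (\<lambda>x \<omega>. (Ustop x \<omega> - c * x powr (real d' / real d)) /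
                      x powr (real d' / real d - 1 / (2 * real d)))
      in (AE \<omega> in M. ((\<lambda>x. A x \<omega>) \<longlongrightarrow> c) at_top) \<and>
         moments_converge M A at_top (return borel c) \<and>
         conv_in_distr M B at_top (normal_law 0 \<gamma>2) \<and>
         moments_converge M B at_top (normal_law 0 \<gamma>2) \<and>
         ((\<lambda>x. prob_space.expectation M (Ustop x) / x powr (real d' / real d)) \<longlongrightarrow> c) at_top \<and>
         ((\<lambda>x. prob_space.variance M (Ustop x) / x powr ((2 * real d' - 1) / real d)) \<longlongrightarrow> \<gamma>2) at_top)"
  proof -
  interpret prob_space M by fact
  interpret iid_seq M S X by unfold_locales (fact indep, fact ident)
  \<comment> \<open>The hypotheses concern real powers of absolute values, the development even
    natural powers. At \<open>z = 0\<close> the two agree because \<open>p > 0\<close>.\<close>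
  have even_abs: "\<bar>z\<bar> powr real p = z ^ p" if "even p" "p > 0" for z :: real and p
    using that by (cases "z = 0") (auto simp: powr_realpow power_even_abs)
  interpret two_kernels M S X d d' f f' \<mu> \<mu>'
  proof unfold_locales
    show "kern p d f" if "even p" "p > 0" for p
      using Lp[of "real p"] that assms(4) by (simp add: kern_def tup_def even_abs)
    show "kern p d' f'" if "even p" "p > 0" for p
      using Lp'[of "real p"] that assms(5) by (simp add: kern_def tup_def even_abs)
    show "expectation (\<lambda>\<omega>. f (tup d (\<lambda>k. k) \<omega>)) = \<mu>" "expectation (\<lambda>\<omega>. f' (tup d' (\<lambda>k. k) \<omega>)) = \<mu>'"
      by (simp_all add: mu mu' kernel_mean_def tup_def)
  qed fact+
  have var: "prob_space.variance P (\<lambda>\<omega>. Z_one P d' W' \<omega> - \<kappa> * Z_one P d W \<omega>) = \<sigma>2"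
    by (rule variance_Z_one[OF \<open>prob_space P\<close> gaussian cov_WW cov_W'W' cov_WW'])
  \<comment> \<open>Nonnegativity is read off from the identification as a variance rather than from
    the double sum.\<close>
  have \<sigma>: "\<sigma>2 \<ge> 0" unfolding var[symmetric] by (intro integral_nonneg_AE) auto
  have "\<beta>\<^sup>2 = (fact d / \<mu>) powr ((2 * real d' - 1) / real d)"
  proof -
    have "(2 * real d' - 1) / (2 * real d) + (2 * real d' - 1) / (2 * real d) = (2 * real d' - 1) / real d"
      using d by (simp add: field_simps)
    thus ?thesis by (simp add: \<beta>_def power2_eq_square powr_add[symmetric])
  qed
  hence \<gamma>: "\<gamma>2 = \<beta>\<^sup>2 * \<sigma>2" using gamma2 var by (simp add: \<kappa>_def)
  show ?thesis
    unfolding Let_def \<gamma> limit_const_def[symmetric]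
    using stopped_limits[OF _ \<sigma>] mean_and_variance_limits[OF _ \<sigma>] by blast
qed

end
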